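(* Let $Q$ be a Dynkin quiver of type $\mathbb{A}_{n+2}$, let $\mathcal{C}_{P(Q)}$ be the category of line segments of the polygon $P(Q)$, and let $F\colon\mathcal{C}_{P(Q)}\to\mathrm{ind}\,Q$ be the functor given on objects by $F(\gamma(i,j))=M(i+1,j)$ and on pivots by the irreducible morphisms that add a hook or remove a cohook (see context). The functor $F$ is an equivalence of categories $$F\colon\mathcal{C}_{P(Q)}\to\mathrm{ind}\,Q.$$ In particular: (1) $F$ induces an isomorphism of translation quivers $(\Gamma_{P(Q)},R)\to(\Gamma_{\mathrm{rep}\,Q},\tau)$; (2) $F$ induces bijections $\{\text{line segments in }P(Q)\}\to\mathrm{ind}\,Q$ and $\{\text{pivots in }P(Q)\}\to\{\text{irreducible morphisms in }Q\}$; (3) the rotation $R$ corresponds to the Auslander–Reiten translation $\tau$ in the following sense: $F\circ R=\tau\circ F$; (4) $F$ is an exact functor with respect to the induced abelian structure on $\mathcal{C}_{P(Q)}$.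
   Context: $\Bbbk$ is an algebraically closed field. A Dynkin quiver $Q$ of type $\mathbb{A}_{n+2}$ has vertices $1,\dots,n+2$ and, for each $1\le i\le n+1$, exactly one arrow between $i$ and $i+1$, in either direction. $\mathrm{rep}\,Q$ is the category of finite-dimensional representations of $Q$ over $\Bbbk$; $\mathrm{ind}\,Q$ is a full subcategory whose objects are one representative of each isomorphism class of indecomposable representations. For $1\le i\le j\le n+2$, $M(i,j)$ is the indecomposable representation with $\Bbbk$ at the vertices $i,\dots,j$ and $0$ elsewhere, with identity maps between nonzero spaces; these are all the indecomposables up to isomorphism. $\Gamma_{\mathrm{rep}\,Q}$ is the Auslander–Reiten quiver of $\mathrm{rep}\,Q$, with the isomorphism classes of indecomposable representations as vertices and irreducible morphisms as arrows, and $\tau$ is the Auslander–Reiten translation. "Irreducible morphisms in $Q$" means irreducible morphisms between indecomposable representations of $Q$, i.e. the arrows of $\Gamma_{\mathrm{rep}\,Q}$. Polygon $P(Q)$: let $[n+1]=\{1,\dots,n+1\}$, $\overline{[n+1]}=\{i : i\to(i+1)\text{ is in }Q\}$ and $\underline{[n+1]}=\{i : i\leftarrow(i+1)\text{ is in }Q\}$. $P(Q)$ is an $(n+3)$-gon with vertices $0,1,\dots,n+2$ drawn in this order from left to right, with $0$ and $n+2$ on the same horizontal line $L$, the vertices in $\overline{[n+1]}$ above $L$ and those in $\underline{[n+1]}$ below $L$; the upper boundary runs from $0$ to $n+2$ through the vertices of $\overline{[n+1]}$ in numerical order, the lower boundary through those of $\underline{[n+1]}$. For a vertex $\ell$ of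 $P(Q)$, $R(\ell)$ and $R^{-1}(\ell)$ are its clockwise and counterclockwise neighbors on the boundary. Line segments and pivots: $\mathcal{E}=\{\gamma(i,j)\mid 0\le i<j\le n+2\}$, where $\gamma(i,j)$ is the line segment between the vertices $i$ and $j$ (diagonals and boundary edges). The segment $\gamma(i,R^{-1}(j))$ is a pivot of $\gamma(i,j)$ if $i<R^{-1}(j)$, and $\gamma(R^{-1}(i),j)$ is a pivot of $\gamma(i,j)$ if $R^{-1}(i)<j$. The translation quiver $(\Gamma_{P(Q)},R)$ has vertex set $\mathcal{E}$, an arrow $\gamma\to\gamma'$ if and only if $\gamma'$ is a pivot of $\gamma$, and translation $R(\gamma(i,j))=\gamma(R(i),R(j))$ if $R(i)<R(j)$, and $0$ otherwise. Mesh category: for a translation quiver $(\Gamma,\tau)$ without multiple arrows, with $\tau$ defined on a subset $\Gamma_0'$ of the vertices, it is the $\Bbbk$-linear path category of $\Gamma$ modulo the ideal generated by $m_x=\sum_{\alpha\colon y\to x}\sigma(\alpha)\alpha$, $x\in\Gamma_0'$, where $\sigma(\alpha)$ is the unique arrow $\tau x\to y$. $\mathcal{C}_{P(Q)}$ is the mesh category of $(\Gamma_{P(Q)},R)$. Hooks and cohooks: the hook of an arrow $\alpha$ of $Q$ is the maximal path (possibly a single vertex) starting at the source of $\alpha$ and not using $\alpha$; the cohook of $\alpha$ is the maximal path (possibly a single vertex) ending at the target of $\alpha$ and not using $\alpha$. The hook or cohook corresponding to a boundary edge $\gamma(a,b)$, $a<b$, of $P(Q)$ is the one supported on the vertices $a+1,\dots,b$.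 Adding a hook enlarges the support of an indecomposable by the (disjoint) support of the hook; removing a cohook deletes the support of the cohook from the support. Definition of $F$ on pivots: $F(\gamma(i,j)\to\gamma(R^{-1}(i),j))$ is the irreducible morphism $M(i+1,j)\to M(R^{-1}(i)+1,j)$ given by (a) adding the hook corresponding to the boundary edge $\gamma(R^{-1}(i),i)$ if $R^{-1}(i)<i$; (b) removing the cohook corresponding to the boundary edge $\gamma(i,R^{-1}(i))$ if $i<R^{-1}(i)$. Similarly $F(\gamma(i,j)\to\gamma(i,R^{-1}(j)))$ is the irreducible morphism $M(i+1,j)\to M(i+1,R^{-1}(j))$ given by (a) adding the hook corresponding to the boundary edge $\gamma(j,R^{-1}(j))$ if $j<R^{-1}(j)$; (b) removing the cohook corresponding to the boundary edge $\gamma(R^{-1}(j),j)$ if $R^{-1}(j)<j$. The induced abelian structure on $\mathcal{C}_{P(Q)}$ is the one induced by the equivalence $F$.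
   Formalization: F on pivots is the hook/cohook morphism up to a nonzero scalar (signs ±1 suffice; unscaled morphisms violate the mesh relations outside characteristic 2), and (4) is stated for every linear extension of F from the additive hull of C_{P(Q)} to rep Q, as ind Q is not abelian. *)

theory Defs
  imports
    "HOL-Computational_Algebra.Polynomial"
    "HOL-Library.Poly_Mapping"
    "HOL-Library.Function_Algebras"
begin

section \<open>Linear categories\<close>

text \<open>
  The operations take the objects involved as arguments, so hom-sets need not be disjoint.
  \<open>Comp C x y z g f\<close> is the composite of \<open>f : x \<rightarrow> y\<close> followed by \<open>g : y \<rightarrow> z\<close>.
\<close>

record ('k, 'o, 'm) lcat =
  Obj :: "'o set"
  Hom :: "'o \<Rightarrow> 'o \<Rightarrow> 'm set"
  Ide :: "'o \<Rightarrow> 'm"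
  Comp :: "'o \<Rightarrow> 'o \<Rightarrow> 'o \<Rightarrow> 'm \<Rightarrow> 'm \<Rightarrow> 'm"
  Add :: "'o \<Rightarrow> 'o \<Rightarrow> 'm \<Rightarrow> 'm \<Rightarrow> 'm"
  Zero :: "'o \<Rightarrow> 'o \<Rightarrow> 'm"
  Scl :: "'o \<Rightarrow> 'o \<Rightarrow> 'k \<Rightarrow> 'm \<Rightarrow> 'm"

definition category :: "('k, 'o, 'm) lcat \<Rightarrow> bool" where
  "category C \<longleftrightarrow>
     (\<forall>x\<in>Obj C. Ide C x \<in> Hom C x x) \<and>
     (\<forall>x\<in>Obj C. \<forall>y\<in>Obj C. \<forall>z\<in>Obj C. \<forall>f\<in>Hom C x y. \<forall>g\<in>Hom C y z.
        Comp C x y z g f \<in> Hom C x z) \<and>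
     (\<forall>x\<in>Obj C. \<forall>y\<in>Obj C. \<forall>f\<in>Hom C x y.
        Comp C x y y (Ide C y) f = f \<and> Comp C x x y f (Ide C x) = f) \<and>
     (\<forall>w\<in>Obj C. \<forall>x\<in>Obj C. \<forall>y\<in>Obj C. \<forall>z\<in>Obj C.
        \<forall>f\<in>Hom C w x. \<forall>g\<in>Hom C x y. \<forall>h\<in>Hom C y z.
        Comp C w x z (Comp C x y z h g) f = Comp C w y z h (Comp C w x y g f))"

definition hom_vector_space :: "('k::field, 'o, 'm) lcat \<Rightarrow> 'o \<Rightarrow> 'o \<Rightarrow> bool" where
  "hom_vector_space C x y \<longleftrightarrow>
     Zero C x y \<in> Hom C x y \<and>
     (\<forall>f\<in>Hom C x y. \<forall>g\<in>Hom C x y. Add C x y f g \<in> Hom C x y \<and> Add C x y f g = Add C x y g f) \<and>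
     (\<forall>a. \<forall>f\<in>Hom C x y. Scl C x y a f \<in> Hom C x y) \<and>
     (\<forall>f\<in>Hom C x y. \<forall>g\<in>Hom C x y. \<forall>h\<in>Hom C x y.
        Add C x y (Add C x y f g) h = Add C x y f (Add C x y g h)) \<and>
     (\<forall>f\<in>Hom C x y. Add C x y (Zero C x y) f = f \<and>
        (\<exists>g\<in>Hom C x y. Add C x y f g = Zero C x y) \<and> Scl C x y 1 f = f) \<and>
     (\<forall>a b. \<forall>f\<in>Hom C x y. Scl C x y a (Scl C x y b f) = Scl C x y (a * b) f \<and>
        Scl C x y (a + b) f = Add C x y (Scl C x y a f) (Scl C x y b f)) \<and>
     (\<forall>a. \<forall>f\<in>Hom C x y. \<forall>g\<in>Hom C x y.
        Scl C x y a (Add C x y f g) = Add C x y (Scl C x y a f) (Scl C x y a g))"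

definition linear_category :: "('k::field, 'o, 'm) lcat \<Rightarrow> bool" where
  "linear_category C \<longleftrightarrow> category C \<and>
     (\<forall>x\<in>Obj C. \<forall>y\<in>Obj C. hom_vector_space C x y) \<and>
     (\<forall>x\<in>Obj C. \<forall>y\<in>Obj C. \<forall>z\<in>Obj C. \<forall>f\<in>Hom C x y. \<forall>f'\<in>Hom C x y. \<forall>g\<in>Hom C y z. \<forall>g'\<in>Hom C y z.
        Comp C x y z g (Add C x y f f') = Add C x z (Comp C x y z g f) (Comp C x y z g f') \<and>
        Comp C x y z (Add C y z g g') f = Add C x z (Comp C x y z g f) (Comp C x y z g' f)) \<and>
     (\<forall>x\<in>Obj C. \<forall>y\<in>Obj C. \<forall>z\<in>Obj C. \<forall>a. \<forall>f\<in>Hom C x y. \<forall>g\<in>Hom C y z.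
        Comp C x y z g (Scl C x y a f) = Scl C x z a (Comp C x y z g f) \<and>
        Comp C x y z (Scl C y z a g) f = Scl C x z a (Comp C x y z g f))"

definition full_subcategory :: "('k, 'o, 'm) lcat \<Rightarrow> 'o set \<Rightarrow> ('k, 'o, 'm) lcat" where
  "full_subcategory C S = C\<lparr>Obj := S\<rparr>"

subsection \<open>Functors and equivalences\<close>

definition is_functor ::
  "('k, 'o, 'm) lcat \<Rightarrow> ('k, 'p, 'n) lcat \<Rightarrow> ('o \<Rightarrow> 'p) \<Rightarrow> ('o \<Rightarrow> 'o \<Rightarrow> 'm \<Rightarrow> 'n) \<Rightarrow> bool" where
  "is_functor C D Fo Fm \<longleftrightarrow> category C \<and> category D \<and>
     (\<forall>x\<in>Obj C. Fo x \<in> Obj D \<and> Fm x x (Ide C x) = Ide D (Fo x)) \<and>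
     (\<forall>x\<in>Obj C. \<forall>y\<in>Obj C. \<forall>f\<in>Hom C x y. Fm x y f \<in> Hom D (Fo x) (Fo y)) \<and>
     (\<forall>x\<in>Obj C. \<forall>y\<in>Obj C. \<forall>z\<in>Obj C. \<forall>f\<in>Hom C x y. \<forall>g\<in>Hom C y z.
        Fm x z (Comp C x y z g f) = Comp D (Fo x) (Fo y) (Fo z) (Fm y z g) (Fm x y f))"

definition linear_functor ::
  "('k::field, 'o, 'm) lcat \<Rightarrow> ('k, 'p, 'n) lcat \<Rightarrow> ('o \<Rightarrow> 'p) \<Rightarrow> ('o \<Rightarrow> 'o \<Rightarrow> 'm \<Rightarrow> 'n) \<Rightarrow> bool" where
  "linear_functor C D Fo Fm \<longleftrightarrow>
     linear_category C \<and> linear_category D \<and> is_functor C D Fo Fm \<and>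
     (\<forall>x\<in>Obj C. \<forall>y\<in>Obj C. \<forall>f\<in>Hom C x y. \<forall>g\<in>Hom C x y.
        Fm x y (Add C x y f g) = Add D (Fo x) (Fo y) (Fm x y f) (Fm x y g)) \<and>
     (\<forall>x\<in>Obj C. \<forall>y\<in>Obj C. \<forall>a. \<forall>f\<in>Hom C x y.
        Fm x y (Scl C x y a f) = Scl D (Fo x) (Fo y) a (Fm x y f))"

definition split_mono :: "('k, 'o, 'm) lcat \<Rightarrow> 'o \<Rightarrow> 'o \<Rightarrow> 'm \<Rightarrow> bool" where
  "split_mono C x y f \<longleftrightarrow> (\<exists>g\<in>Hom C y x. Comp C x y x g f = Ide C x)"

definition split_epi :: "('k, 'o, 'm) lcat \<Rightarrow> 'o \<Rightarrow> 'o \<Rightarrow> 'm \<Rightarrow> bool" where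
  "split_epi C x y f \<longleftrightarrow> (\<exists>g\<in>Hom C y x. Comp C y x y f g = Ide C y)"

definition is_iso :: "('k, 'o, 'm) lcat \<Rightarrow> 'o \<Rightarrow> 'o \<Rightarrow> 'm \<Rightarrow> bool" where
  "is_iso C x y f \<longleftrightarrow> f \<in> Hom C x y \<and>
     (\<exists>g\<in>Hom C y x. Comp C x y x g f = Ide C x \<and> Comp C y x y f g = Ide C y)"

definition isomorphic_in :: "('k, 'o, 'm) lcat \<Rightarrow> 'o \<Rightarrow> 'o \<Rightarrow> bool" where
  "isomorphic_in C x y \<longleftrightarrow> (\<exists>f. is_iso C x y f)"

definition natural_iso_from_identity ::
  "('k, 'o, 'm) lcat \<Rightarrow> ('o \<Rightarrow> 'o) \<Rightarrow> ('o \<Rightarrow> 'o \<Rightarrow> 'm \<Rightarrow> 'm) \<Rightarrow> ('o \<Rightarrow> 'm) \<Rightarrow> bool" where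
  "natural_iso_from_identity C To Tm \<eta> \<longleftrightarrow>
     (\<forall>x\<in>Obj C. is_iso C x (To x) (\<eta> x)) \<and>
     (\<forall>x\<in>Obj C. \<forall>y\<in>Obj C. \<forall>f\<in>Hom C x y.
        Comp C x y (To y) (\<eta> y) f = Comp C x (To x) (To y) (Tm x y f) (\<eta> x))"

definition equivalence_of_categories ::
  "('k, 'o, 'm) lcat \<Rightarrow> ('k, 'p, 'n) lcat \<Rightarrow> ('o \<Rightarrow> 'p) \<Rightarrow> ('o \<Rightarrow> 'o \<Rightarrow> 'm \<Rightarrow> 'n) \<Rightarrow> bool" where
  "equivalence_of_categories C D Fo Fm \<longleftrightarrow> is_functor C D Fo Fm \<and>
     (\<exists>Go Gm \<eta> \<epsilon>. is_functor D C Go Gm \<and>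
        natural_iso_from_identity C (\<lambda>x. Go (Fo x)) (\<lambda>x y f. Gm (Fo x) (Fo y) (Fm x y f)) \<eta> \<and>
        natural_iso_from_identity D (\<lambda>x. Fo (Go x)) (\<lambda>x y f. Fm (Go x) (Go y) (Gm x y f)) \<epsilon>)"

subsection \<open>Abelian categories and exact functors\<close>

definition is_mono :: "('k, 'o, 'm) lcat \<Rightarrow> 'o \<Rightarrow> 'o \<Rightarrow> 'm \<Rightarrow> bool" where
  "is_mono C x y f \<longleftrightarrow> f \<in> Hom C x y \<and>
     (\<forall>w\<in>Obj C. \<forall>g\<in>Hom C w x. \<forall>h\<in>Hom C w x. Comp C w x y f g = Comp C w x y f h \<longrightarrow> g = h)"

definition is_epi :: "('k, 'o, 'm) lcat \<Rightarrow> 'o \<Rightarrow> 'o \<Rightarrow> 'm \<Rightarrow> bool" where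
  "is_epi C x y f \<longleftrightarrow> f \<in> Hom C x y \<and>
     (\<forall>z\<in>Obj C. \<forall>g\<in>Hom C y z. \<forall>h\<in>Hom C y z. Comp C x y z g f = Comp C x y z h f \<longrightarrow> g = h)"

definition is_zero_object :: "('k, 'o, 'm) lcat \<Rightarrow> 'o \<Rightarrow> bool" where
  "is_zero_object C z \<longleftrightarrow> z \<in> Obj C \<and>
     (\<forall>x\<in>Obj C. (\<exists>!f. f \<in> Hom C x z) \<and> (\<exists>!f. f \<in> Hom C z x))"

definition is_biproduct ::
  "('k, 'o, 'm) lcat \<Rightarrow> 'o \<Rightarrow> 'o \<Rightarrow> 'o \<Rightarrow> 'm \<Rightarrow> 'm \<Rightarrow> 'm \<Rightarrow> 'm \<Rightarrow> bool" where
  "is_biproduct C x y b i1 i2 p1 p2 \<longleftrightarrow>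
     i1 \<in> Hom C x b \<and> i2 \<in> Hom C y b \<and> p1 \<in> Hom C b x \<and> p2 \<in> Hom C b y \<and>
     Comp C x b x p1 i1 = Ide C x \<and> Comp C y b y p2 i2 = Ide C y \<and>
     Comp C x b y p2 i1 = Zero C x y \<and> Comp C y b x p1 i2 = Zero C y x \<and>
     Add C b b (Comp C b x b i1 p1) (Comp C b y b i2 p2) = Ide C b"

definition is_kernel :: "('k, 'o, 'm) lcat \<Rightarrow> 'o \<Rightarrow> 'o \<Rightarrow> 'o \<Rightarrow> 'm \<Rightarrow> 'm \<Rightarrow> bool" where
  "is_kernel C k x y i f \<longleftrightarrow>  \<comment> \<open>\<open>i : k \<rightarrow> x\<close> is a kernel of \<open>f : x \<rightarrow> y\<close>\<close>
     i \<in> Hom C k x \<and> f \<in> Hom C x y \<and> Comp C k x y f i = Zero C k y \<and>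
     (\<forall>w\<in>Obj C. \<forall>h\<in>Hom C w x. Comp C w x y f h = Zero C w y \<longrightarrow>
        (\<exists>!u. u \<in> Hom C w k \<and> Comp C w k x i u = h))"

definition is_cokernel :: "('k, 'o, 'm) lcat \<Rightarrow> 'o \<Rightarrow> 'o \<Rightarrow> 'o \<Rightarrow> 'm \<Rightarrow> 'm \<Rightarrow> bool" where
  "is_cokernel C x y q f p \<longleftrightarrow>  \<comment> \<open>\<open>p : y \<rightarrow> q\<close> is a cokernel of \<open>f : x \<rightarrow> y\<close>\<close>
     f \<in> Hom C x y \<and> p \<in> Hom C y q \<and> Comp C x y q p f = Zero C x q \<and>
     (\<forall>w\<in>Obj C. \<forall>h\<in>Hom C y w. Comp C x y w h f = Zero C x w \<longrightarrow>
        (\<exists>!u. u \<in> Hom C q w \<and> Comp C y q w u p = h))"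

definition abelian_category :: "('k::field, 'o, 'm) lcat \<Rightarrow> bool" where
  "abelian_category C \<longleftrightarrow> linear_category C \<and>
     (\<exists>z. is_zero_object C z) \<and>
     (\<forall>x\<in>Obj C. \<forall>y\<in>Obj C. \<exists>b\<in>Obj C. \<exists>i1 i2 p1 p2. is_biproduct C x y b i1 i2 p1 p2) \<and>
     (\<forall>x\<in>Obj C. \<forall>y\<in>Obj C. \<forall>f\<in>Hom C x y.
        (\<exists>k\<in>Obj C. \<exists>i. is_kernel C k x y i f) \<and> (\<exists>q\<in>Obj C. \<exists>p. is_cokernel C x y q f p)) \<and>
     (\<forall>x\<in>Obj C. \<forall>y\<in>Obj C. \<forall>f. is_mono C x y f \<longrightarrow> (\<exists>z\<in>Obj C. \<exists>g. is_kernel C x y z f g)) \<and>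
     (\<forall>x\<in>Obj C. \<forall>y\<in>Obj C. \<forall>f. is_epi C x y f \<longrightarrow> (\<exists>w\<in>Obj C. \<exists>g. is_cokernel C w x y g f))"

definition short_exact :: "('k, 'o, 'm) lcat \<Rightarrow> 'o \<Rightarrow> 'o \<Rightarrow> 'o \<Rightarrow> 'm \<Rightarrow> 'm \<Rightarrow> bool" where
  "short_exact C x y z f g \<longleftrightarrow> is_kernel C x y z f g \<and> is_cokernel C x y z f g"

definition exact_functor ::
  "('k::field, 'o, 'm) lcat \<Rightarrow> ('k, 'p, 'n) lcat \<Rightarrow> ('o \<Rightarrow> 'p) \<Rightarrow> ('o \<Rightarrow> 'o \<Rightarrow> 'm \<Rightarrow> 'n) \<Rightarrow> bool" where
  "exact_functor C D Fo Fm \<longleftrightarrow>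
     abelian_category C \<and> abelian_category D \<and> linear_functor C D Fo Fm \<and>
     (\<forall>x\<in>Obj C. \<forall>y\<in>Obj C. \<forall>z\<in>Obj C. \<forall>f g. short_exact C x y z f g \<longrightarrow>
        short_exact D (Fo x) (Fo y) (Fo z) (Fm x y f) (Fm y z g))"

subsection \<open>Additive hull\<close>

text \<open>
  Objects are finite formal direct sums, given as lists; a morphism from \<open>xs\<close> to \<open>ys\<close> is a matrix
  whose entry at row \<open>i\<close> and column \<open>j\<close> is a morphism from \<open>xs ! j\<close> to \<open>ys ! i\<close>.
\<close>

definition hom_sum :: "('k, 'o, 'm) lcat \<Rightarrow> 'o \<Rightarrow> 'o \<Rightarrow> 'm list \<Rightarrow> 'm" where
  "hom_sum C x y fs = foldr (Add C x y) fs (Zero C x y)"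

definition hom_matrix :: "nat \<Rightarrow> nat \<Rightarrow> (nat \<Rightarrow> nat \<Rightarrow> 'm) \<Rightarrow> nat \<Rightarrow> nat \<Rightarrow> 'm" where
  "hom_matrix r c A = (\<lambda>i j. if i < r \<and> j < c then A i j else undefined)"

definition additive_hull :: "('k, 'o, 'm) lcat \<Rightarrow> ('k, 'o list, nat \<Rightarrow> nat \<Rightarrow> 'm) lcat" where
  "additive_hull C = \<lparr>
     Obj = lists (Obj C),
     Hom = (\<lambda>xs ys. {hom_matrix (length ys) (length xs) A | A.
              \<forall>i<length ys. \<forall>j<length xs. A i j \<in> Hom C (xs ! j) (ys ! i)}),
     Ide = (\<lambda>xs. hom_matrix (length xs) (length xs)
              (\<lambda>i j. if i = j then Ide C (xs ! i) else Zero C (xs ! j) (xs ! i))),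
     Comp = (\<lambda>xs ys zs B A. hom_matrix (length zs) (length xs)
              (\<lambda>i j. hom_sum C (xs ! j) (zs ! i)
                 (map (\<lambda>l. Comp C (xs ! j) (ys ! l) (zs ! i) (B i l) (A l j)) [0..<length ys]))),
     Add = (\<lambda>xs ys A B. hom_matrix (length ys) (length xs)
              (\<lambda>i j. Add C (xs ! j) (ys ! i) (A i j) (B i j))),
     Zero = (\<lambda>xs ys. hom_matrix (length ys) (length xs) (\<lambda>i j. Zero C (xs ! j) (ys ! i))),
     Scl = (\<lambda>xs ys a A. hom_matrix (length ys) (length xs)
              (\<lambda>i j. Scl C (xs ! j) (ys ! i) a (A i j)))\<rparr>"

definition extends_to_hull ::
  "('k::field, 'o, 'm) lcat \<Rightarrow> ('k, 'p, 'n) lcat \<Rightarrow> ('o \<Rightarrow> 'p) \<Rightarrow> ('o \<Rightarrow> 'o \<Rightarrow> 'm \<Rightarrow> 'n) \<Rightarrow>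
   ('o list \<Rightarrow> 'p) \<Rightarrow> ('o list \<Rightarrow> 'o list \<Rightarrow> (nat \<Rightarrow> nat \<Rightarrow> 'm) \<Rightarrow> 'n) \<Rightarrow> bool" where
  "extends_to_hull C D Fo Fm Go Gm \<longleftrightarrow>
     linear_functor (additive_hull C) D Go Gm \<and>
     (\<forall>x\<in>Obj C. Go [x] = Fo x) \<and>
     (\<forall>x\<in>Obj C. \<forall>y\<in>Obj C. \<forall>f\<in>Hom C x y. Gm [x] [y] (hom_matrix 1 1 (\<lambda>i j. f)) = Fm x y f)"

subsection \<open>Quotient by the ideal generated by a family of morphisms\<close>

inductive generated_ideal ::
  "('k, 'o, 'm) lcat \<Rightarrow> ('o \<Rightarrow> 'o \<Rightarrow> 'm set) \<Rightarrow> 'o \<Rightarrow> 'o \<Rightarrow> 'm \<Rightarrow> bool"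
  for C :: "('k, 'o, 'm) lcat" and G :: "'o \<Rightarrow> 'o \<Rightarrow> 'm set" where
  gen: "x \<in> Obj C \<Longrightarrow> y \<in> Obj C \<Longrightarrow> f \<in> G x y \<Longrightarrow> f \<in> Hom C x y \<Longrightarrow> generated_ideal C G x y f"
| zero: "x \<in> Obj C \<Longrightarrow> y \<in> Obj C \<Longrightarrow> generated_ideal C G x y (Zero C x y)"
| add: "generated_ideal C G x y f \<Longrightarrow> generated_ideal C G x y g \<Longrightarrow>
          generated_ideal C G x y (Add C x y f g)"
| scl: "generated_ideal C G x y f \<Longrightarrow> generated_ideal C G x y (Scl C x y a f)"
| comp_left: "generated_ideal C G x y f \<Longrightarrow> z \<in> Obj C \<Longrightarrow> g \<in> Hom C y z \<Longrightarrow>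
          generated_ideal C G x z (Comp C x y z g f)"
| comp_right: "generated_ideal C G y z g \<Longrightarrow> x \<in> Obj C \<Longrightarrow> f \<in> Hom C x y \<Longrightarrow>
          generated_ideal C G x z (Comp C x y z g f)"

definition ideal_coset ::
  "('k, 'o, 'm) lcat \<Rightarrow> ('o \<Rightarrow> 'o \<Rightarrow> 'm \<Rightarrow> bool) \<Rightarrow> 'o \<Rightarrow> 'o \<Rightarrow> 'm \<Rightarrow> 'm set" where
  "ideal_coset C I x y f = {Add C x y f i | i. I x y i}"

definition quotient_category ::
  "('k, 'o, 'm) lcat \<Rightarrow> ('o \<Rightarrow> 'o \<Rightarrow> 'm \<Rightarrow> bool) \<Rightarrow> ('k, 'o, 'm set) lcat" where
  "quotient_category C I = \<lparr>
     Obj = Obj C,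
     Hom = (\<lambda>x y. ideal_coset C I x y ` Hom C x y),
     Ide = (\<lambda>x. ideal_coset C I x x (Ide C x)),
     Comp = (\<lambda>x y z B A. \<Union>g\<in>B. \<Union>f\<in>A. ideal_coset C I x z (Comp C x y z g f)),
     Add = (\<lambda>x y A B. \<Union>f\<in>A. \<Union>g\<in>B. ideal_coset C I x y (Add C x y f g)),
     Zero = (\<lambda>x y. ideal_coset C I x y (Zero C x y)),
     Scl = (\<lambda>x y a A. \<Union>f\<in>A. ideal_coset C I x y (Scl C x y a f))\<rparr>"

section \<open>Quivers, translation quivers and mesh categories\<close>

text \<open>All quivers here have no multiple arrows, so an arrow is a pair (source, target).\<close>

record 'v quiver =
  verts :: "'v set"
  arrs :: "('v \<times> 'v) set"

text \<open>\<open>transl x = None\<close> means that the translation is not defined at (or is zero on) \<open>x\<close>.\<close>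

record 'v tquiver = "'v quiver" +
  transl :: "'v \<Rightarrow> 'v option"

definition translation_quiver :: "'v tquiver \<Rightarrow> bool" where
  "translation_quiver \<Gamma> \<longleftrightarrow>
     arrs \<Gamma> \<subseteq> verts \<Gamma> \<times> verts \<Gamma> \<and> (\<forall>x. (x, x) \<notin> arrs \<Gamma>) \<and>
     (\<forall>x\<in>verts \<Gamma>. finite {y. (x, y) \<in> arrs \<Gamma>} \<and> finite {y. (y, x) \<in> arrs \<Gamma>}) \<and>
     (\<forall>x\<in>verts \<Gamma>. \<forall>t. transl \<Gamma> x = Some t \<longrightarrow>
        t \<in> verts \<Gamma> \<and> (\<forall>y. (y, x) \<in> arrs \<Gamma> \<longleftrightarrow> (t, y) \<in> arrs \<Gamma>)) \<and>
     (\<forall>x\<in>verts \<Gamma>. \<forall>y\<in>verts \<Gamma>. transl \<Gamma> x \<noteq> None \<and> transl \<Gamma> x = transl \<Gamma> y \<longrightarrow> x = y)"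

definition translation_quiver_iso :: "'v tquiver \<Rightarrow> 'w tquiver \<Rightarrow> ('v \<Rightarrow> 'w) \<Rightarrow> bool" where
  "translation_quiver_iso \<Gamma> \<Delta> h \<longleftrightarrow> translation_quiver \<Gamma> \<and> translation_quiver \<Delta> \<and>
     bij_betw h (verts \<Gamma>) (verts \<Delta>) \<and>
     (\<forall>x\<in>verts \<Gamma>. \<forall>y\<in>verts \<Gamma>. (x, y) \<in> arrs \<Gamma> \<longleftrightarrow> (h x, h y) \<in> arrs \<Delta>) \<and>
     (\<forall>x\<in>verts \<Gamma>. transl \<Delta> (h x) = map_option h (transl \<Gamma> x))"

text \<open>A path is the list of the vertices it visits; \<open>[x]\<close> is the trivial path at \<open>x\<close>.\<close>

definition quiver_path :: "('v, 'z) quiver_scheme \<Rightarrow> 'v list \<Rightarrow> bool" where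
  "quiver_path \<Gamma> p \<longleftrightarrow> p \<noteq> [] \<and> set p \<subseteq> verts \<Gamma> \<and> successively (\<lambda>x y. (x, y) \<in> arrs \<Gamma>) p"

definition uses_arrow :: "'v list \<Rightarrow> 'v \<times> 'v \<Rightarrow> bool" where
  "uses_arrow p \<alpha> \<longleftrightarrow> (\<exists>k. Suc k < length p \<and> (p ! k, p ! Suc k) = \<alpha>)"

definition path_category ::
  "('v, 'z) quiver_scheme \<Rightarrow> ('k::field, 'v, 'v list \<Rightarrow>\<^sub>0 'k) lcat" where
  "path_category \<Gamma> = \<lparr>
     Obj = verts \<Gamma>,
     Hom = (\<lambda>x y. {f. Poly_Mapping.keys f \<subseteq> {p. quiver_path \<Gamma> p \<and> hd p = x \<and> last p = y}}),
     Ide = (\<lambda>x. Poly_Mapping.single [x] 1),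
     Comp = (\<lambda>x y z g f. \<Sum>p\<in>Poly_Mapping.keys f. \<Sum>q\<in>Poly_Mapping.keys g.
               Poly_Mapping.single (p @ tl q) (Poly_Mapping.lookup g q * Poly_Mapping.lookup f p)),
     Add = (\<lambda>x y f g. f + g),
     Zero = (\<lambda>x y. 0),
     Scl = (\<lambda>x y a. Poly_Mapping.map ((*) a))\<rparr>"

definition mesh_relation :: "'v tquiver \<Rightarrow> 'v \<Rightarrow> 'v \<Rightarrow> 'v list \<Rightarrow>\<^sub>0 'k::field" where
  "mesh_relation \<Gamma> t x = (\<Sum>y | (y, x) \<in> arrs \<Gamma>. Poly_Mapping.single [t, y, x] 1)"

definition mesh_ideal :: "'v tquiver \<Rightarrow> 'v \<Rightarrow> 'v \<Rightarrow> ('v list \<Rightarrow>\<^sub>0 'k::field) \<Rightarrow> bool" where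
  "mesh_ideal \<Gamma> = generated_ideal (path_category \<Gamma>)
     (\<lambda>t x. if transl \<Gamma> x = Some t then {mesh_relation \<Gamma> t x} else {})"

definition mesh_category :: "'v tquiver \<Rightarrow> ('k::field, 'v, ('v list \<Rightarrow>\<^sub>0 'k) set) lcat" where
  "mesh_category \<Gamma> = quotient_category (path_category \<Gamma>) (mesh_ideal \<Gamma>)"

definition mesh_arrow :: "'v tquiver \<Rightarrow> 'v \<Rightarrow> 'v \<Rightarrow> ('v list \<Rightarrow>\<^sub>0 'k::field) set" where
  "mesh_arrow \<Gamma> x y = ideal_coset (path_category \<Gamma>) (mesh_ideal \<Gamma>) x y (Poly_Mapping.single [x, y] 1)"

section \<open>Auslander--Reiten theory\<close>

definition indecomposable_object :: "('k, 'o, 'm) lcat \<Rightarrow> 'o \<Rightarrow> bool" where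
  "indecomposable_object C x \<longleftrightarrow> x \<in> Obj C \<and> \<not> is_zero_object C x \<and>
     (\<forall>y\<in>Obj C. \<forall>z\<in>Obj C. \<forall>i1 i2 p1 p2. is_biproduct C y z x i1 i2 p1 p2 \<longrightarrow>
        is_zero_object C y \<or> is_zero_object C z)"

definition indecomposable_representatives :: "('k, 'o, 'm) lcat \<Rightarrow> 'o set \<Rightarrow> bool" where
  "indecomposable_representatives C S \<longleftrightarrow>
     (\<forall>x\<in>S. indecomposable_object C x) \<and>
     (\<forall>x. indecomposable_object C x \<longrightarrow> (\<exists>!s. s \<in> S \<and> isomorphic_in C x s))"

definition projective_object :: "('k, 'o, 'm) lcat \<Rightarrow> 'o \<Rightarrow> bool" where
  "projective_object C p \<longleftrightarrow> p \<in> Obj C \<and>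
     (\<forall>x\<in>Obj C. \<forall>y\<in>Obj C. \<forall>e. is_epi C x y e \<longrightarrow>
        (\<forall>h\<in>Hom C p y. \<exists>l\<in>Hom C p x. Comp C p x y e l = h))"

definition irreducible_morphism :: "('k, 'o, 'm) lcat \<Rightarrow> 'o \<Rightarrow> 'o \<Rightarrow> 'm \<Rightarrow> bool" where
  "irreducible_morphism C x y f \<longleftrightarrow> f \<in> Hom C x y \<and>
     \<not> split_mono C x y f \<and> \<not> split_epi C x y f \<and>
     (\<forall>z\<in>Obj C. \<forall>g\<in>Hom C x z. \<forall>h\<in>Hom C z y. Comp C x z y h g = f \<longrightarrow>
        split_mono C x z g \<or> split_epi C z y h)"

definition almost_split_sequence ::
  "('k, 'o, 'm) lcat \<Rightarrow> 'o \<Rightarrow> 'o \<Rightarrow> 'o \<Rightarrow> 'm \<Rightarrow> 'm \<Rightarrow> bool" where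
  "almost_split_sequence C x e z f g \<longleftrightarrow> short_exact C x e z f g \<and>
     \<not> split_mono C x e f \<and>
     (\<forall>w\<in>Obj C. \<forall>h\<in>Hom C x w. \<not> split_mono C x w h \<longrightarrow>
        (\<exists>u\<in>Hom C e w. Comp C x e w u f = h)) \<and>
     \<not> split_epi C e z g \<and>
     (\<forall>w\<in>Obj C. \<forall>h\<in>Hom C w z. \<not> split_epi C w z h \<longrightarrow>
        (\<exists>u\<in>Hom C w e. Comp C w e z g u = h))"

text \<open>
  \<open>S\<close> is a set of representatives of the indecomposable objects of \<open>C\<close>. The translate of a
  non-projective \<open>z\<close> is the left-hand term of the almost split sequence ending at \<open>z\<close>.
\<close>

definition AR_translate :: "('k, 'o, 'm) lcat \<Rightarrow> 'o set \<Rightarrow> 'o \<Rightarrow> 'o option" where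
  "AR_translate C S z = (if projective_object C z then None
     else Some (THE x. x \<in> S \<and> (\<exists>e\<in>Obj C. \<exists>f g. almost_split_sequence C x e z f g)))"

definition AR_quiver :: "('k, 'o, 'm) lcat \<Rightarrow> 'o set \<Rightarrow> 'o tquiver" where
  "AR_quiver C S = \<lparr>
     verts = S,
     arrs = {(x, y). x \<in> S \<and> y \<in> S \<and> (\<exists>f. irreducible_morphism C x y f)},
     transl = AR_translate C S\<rparr>"

definition scalar_class :: "('k::field, 'o, 'm) lcat \<Rightarrow> 'o \<Rightarrow> 'o \<Rightarrow> 'm \<Rightarrow> 'm set" where
  "scalar_class C x y f = {Scl C x y a f | a. a \<noteq> 0}"

text \<open>
  Irreducible morphisms between the objects in \<open>S\<close>, up to nonzero scalars. The relation \<open>arrs\<close> of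
  \<open>AR_quiver\<close> does not record the multiplicity of an arrow; this set does, since a multiplicity
  above one produces several classes between the same two objects.
\<close>

definition irreducible_classes :: "('k::field, 'o, 'm) lcat \<Rightarrow> 'o set \<Rightarrow> ('o \<times> 'o \<times> 'm set) set" where
  "irreducible_classes C S =
     {(x, y, scalar_class C x y f) | x y f. x \<in> S \<and> y \<in> S \<and> irreducible_morphism C x y f}"

section \<open>Finite-dimensional quiver representations\<close>

text \<open>
  All vector spaces are finite-dimensional subspaces of the space of sequences over the field.
  Every finite-dimensional space is isomorphic to one of these. To make maps on a subspace
  determined by their values there, they are set to zero outside of it.
\<close>

definition vscale :: "'k::field \<Rightarrow> (nat \<Rightarrow> 'k) \<Rightarrow> nat \<Rightarrow> 'k" where
  "vscale a x = (\<lambda>m. a * x m)"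

global_interpretation seq: vector_space vscale
  by standard (auto simp: vscale_def fun_eq_iff algebra_simps)

definition linear_maps :: "(nat \<Rightarrow> 'k::field) set \<Rightarrow> (nat \<Rightarrow> 'k) set \<Rightarrow> ((nat \<Rightarrow> 'k) \<Rightarrow> nat \<Rightarrow> 'k) set" where
  "linear_maps V W = {f. (\<forall>x\<in>V. f x \<in> W) \<and> (\<forall>x\<in>V. \<forall>y\<in>V. f (x + y) = f x + f y) \<and>
     (\<forall>a. \<forall>x\<in>V. f (vscale a x) = vscale a (f x)) \<and> (\<forall>x. x \<notin> V \<longrightarrow> f x = 0)}"

record ('v, 'k) rep =
  space_at :: "'v \<Rightarrow> (nat \<Rightarrow> 'k) set"
  map_at :: "'v \<times> 'v \<Rightarrow> (nat \<Rightarrow> 'k) \<Rightarrow> nat \<Rightarrow> 'k"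

type_synonym ('v, 'k) rep_mor = "'v \<Rightarrow> (nat \<Rightarrow> 'k) \<Rightarrow> nat \<Rightarrow> 'k"

definition representation :: "'v quiver \<Rightarrow> ('v, 'k::field) rep \<Rightarrow> bool" where
  "representation Q X \<longleftrightarrow>
     (\<forall>v\<in>verts Q. \<exists>B. finite B \<and> space_at X v = seq.span B) \<and>
     (\<forall>(a, b)\<in>arrs Q. map_at X (a, b) \<in> linear_maps (space_at X a) (space_at X b))"

definition rep_category :: "'v quiver \<Rightarrow> ('k::field, ('v, 'k) rep, ('v, 'k) rep_mor) lcat" where
  "rep_category Q = \<lparr>
     Obj = {X. representation Q X},
     Hom = (\<lambda>X Y. {\<phi>. (\<forall>v\<in>verts Q. \<phi> v \<in> linear_maps (space_at X v) (space_at Y v)) \<and>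
              (\<forall>v. v \<notin> verts Q \<longrightarrow> \<phi> v = 0) \<and>
              (\<forall>(a, b)\<in>arrs Q. \<forall>x\<in>space_at X a. \<phi> b (map_at X (a, b) x) = map_at Y (a, b) (\<phi> a x))}),
     Ide = (\<lambda>X v x. if v \<in> verts Q \<and> x \<in> space_at X v then x else 0),
     Comp = (\<lambda>X Y Z \<psi> \<phi> v. \<psi> v \<circ> \<phi> v),
     Add = (\<lambda>X Y \<phi> \<psi>. \<phi> + \<psi>),
     Zero = (\<lambda>X Y. 0),
     Scl = (\<lambda>X Y a \<phi> v x. vscale a (\<phi> v x))\<rparr>"

section \<open>Dynkin quivers of type A and their polygons\<close>

definition dynkin_A :: "nat \<Rightarrow> nat quiver \<Rightarrow> bool" where
  "dynkin_A N Q \<longleftrightarrow> verts Q = {1..N} \<and>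
     arrs Q \<subseteq> {(i, i + 1) | i. 1 \<le> i \<and> i < N} \<union> {(i + 1, i) | i. 1 \<le> i \<and> i < N} \<and>
     (\<forall>i. 1 \<le> i \<and> i < N \<longrightarrow> ((i, i + 1) \<in> arrs Q) \<noteq> ((i + 1, i) \<in> arrs Q))"

text \<open>The one-dimensional space of sequences concentrated at 0 serves as the copy of the field.\<close>

definition line :: "(nat \<Rightarrow> 'k::field) set" where
  "line = {x. \<forall>m>0. x m = 0}"

definition identity_on :: "nat set \<Rightarrow> (nat, 'k::field) rep_mor" where
  "identity_on S = (\<lambda>v x. if v \<in> S \<and> x \<in> line then x else 0)"

definition M :: "nat \<Rightarrow> nat \<Rightarrow> (nat, 'k::field) rep" where
  "M i j = \<lparr>
     space_at = (\<lambda>v. if v \<in> {i..j} then line else {0}),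
     map_at = (\<lambda>(a, b) x. if a \<in> {i..j} \<and> b \<in> {i..j} \<and> x \<in> line then x else 0)\<rparr>"

definition ind_objects :: "nat \<Rightarrow> (nat, 'k::field) rep set" where
  "ind_objects n = {M i j | i j. 1 \<le> i \<and> i \<le> j \<and> j \<le> n + 2}"

definition ind_category :: "nat \<Rightarrow> nat quiver \<Rightarrow> ('k::field, (nat, 'k) rep, (nat, 'k) rep_mor) lcat" where
  "ind_category n Q = full_subcategory (rep_category Q) (ind_objects n)"

definition upper :: "nat \<Rightarrow> nat quiver \<Rightarrow> nat set" where
  "upper n Q = {i \<in> {1..n + 1}. (i, i + 1) \<in> arrs Q}"

definition lower :: "nat \<Rightarrow> nat quiver \<Rightarrow> nat set" where
  "lower n Q = {i \<in> {1..n + 1}. (i + 1, i) \<in> arrs Q}"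

text \<open>
  Clockwise, the boundary runs from 0 to \<open>n + 2\<close> along the upper vertices in increasing order and
  back to 0 along the lower vertices in decreasing order.
\<close>

definition R_vertex :: "nat \<Rightarrow> nat quiver \<Rightarrow> nat \<Rightarrow> nat" where
  "R_vertex n Q l = (if l = 0 \<or> l \<in> upper n Q then Min {m \<in> insert (n + 2) (upper n Q). l < m}
     else Max {m \<in> insert 0 (lower n Q). m < l})"

definition R_inv :: "nat \<Rightarrow> nat quiver \<Rightarrow> nat \<Rightarrow> nat" where
  "R_inv n Q l = (if l = 0 \<or> l \<in> lower n Q then Min {m \<in> insert (n + 2) (lower n Q). l < m}
     else Max {m \<in> insert 0 (upper n Q). m < l})"

text \<open>The line segment between the vertices \<open>i < j\<close> is the pair \<open>(i, j)\<close>.\<close>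

definition segments :: "nat \<Rightarrow> (nat \<times> nat) set" where
  "segments n = {(i, j). i < j \<and> j \<le> n + 2}"

definition pivots :: "nat \<Rightarrow> nat quiver \<Rightarrow> ((nat \<times> nat) \<times> (nat \<times> nat)) set" where
  "pivots n Q =
     {((i, j), (i, R_inv n Q j)) | i j. (i, j) \<in> segments n \<and> i < R_inv n Q j} \<union>
     {((i, j), (R_inv n Q i, j)) | i j. (i, j) \<in> segments n \<and> R_inv n Q i < j}"

definition R_segment :: "nat \<Rightarrow> nat quiver \<Rightarrow> nat \<times> nat \<Rightarrow> (nat \<times> nat) option" where
  "R_segment n Q = (\<lambda>(i, j). if R_vertex n Q i < R_vertex n Q j
     then Some (R_vertex n Q i, R_vertex n Q j) else None)"

definition polygon_quiver :: "nat \<Rightarrow> nat quiver \<Rightarrow> (nat \<times> nat) tquiver" where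
  "polygon_quiver n Q = \<lparr>verts = segments n, arrs = pivots n Q, transl = R_segment n Q\<rparr>"

definition polygon_category ::
  "nat \<Rightarrow> nat quiver \<Rightarrow> ('k::field, nat \<times> nat, ((nat \<times> nat) list \<Rightarrow>\<^sub>0 'k) set) lcat" where
  "polygon_category n Q = mesh_category (polygon_quiver n Q)"

section \<open>Hooks, cohooks and the functor\<close>

definition is_hook :: "'v quiver \<Rightarrow> 'v \<times> 'v \<Rightarrow> 'v list \<Rightarrow> bool" where
  "is_hook Q \<alpha> h \<longleftrightarrow> (let P = {p. quiver_path Q p \<and> hd p = fst \<alpha> \<and> \<not> uses_arrow p \<alpha>}
     in h \<in> P \<and> (\<forall>q. h @ q \<in> P \<longrightarrow> q = []))"

definition is_cohook :: "'v quiver \<Rightarrow> 'v \<times> 'v \<Rightarrow> 'v list \<Rightarrow> bool" where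
  "is_cohook Q \<alpha> h \<longleftrightarrow> (let P = {p. quiver_path Q p \<and> last p = snd \<alpha> \<and> \<not> uses_arrow p \<alpha>}
     in h \<in> P \<and> (\<forall>q. q @ h \<in> P \<longrightarrow> q = []))"

definition adds_hook ::
  "nat quiver \<Rightarrow> nat \<Rightarrow> nat \<Rightarrow> nat set \<Rightarrow> nat set \<Rightarrow> (nat, 'k::field) rep_mor \<Rightarrow> bool" where
  "adds_hook Q a b S T \<phi> \<longleftrightarrow> (\<exists>\<alpha>\<in>arrs Q. \<exists>h. is_hook Q \<alpha> h \<and> set h = {a + 1..b} \<and>
     S \<inter> set h = {} \<and> T = S \<union> set h \<and> \<phi> = identity_on S)"

definition removes_cohook ::
  "nat quiver \<Rightarrow> nat \<Rightarrow> nat \<Rightarrow> nat set \<Rightarrow> nat set \<Rightarrow> (nat, 'k::field) rep_mor \<Rightarrow> bool" where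
  "removes_cohook Q a b S T \<phi> \<longleftrightarrow> (\<exists>\<alpha>\<in>arrs Q. \<exists>h. is_cohook Q \<alpha> h \<and> set h = {a + 1..b} \<and>
     set h \<subseteq> S \<and> T = S - set h \<and> \<phi> = identity_on T)"

text \<open>
  \<open>pivot_morphism n Q x y \<phi>\<close>: \<open>\<phi>\<close> is the morphism attached to the pivot from \<open>x\<close> to \<open>y\<close>. The two
  disjuncts are the pivots moving the left and the right endpoint.
\<close>

definition pivot_morphism ::
  "nat \<Rightarrow> nat quiver \<Rightarrow> nat \<times> nat \<Rightarrow> nat \<times> nat \<Rightarrow> (nat, 'k::field) rep_mor \<Rightarrow> bool" where
  "pivot_morphism n Q = (\<lambda>(i, j) (k, l) \<phi>.
     (k = R_inv n Q i \<and> l = j \<and>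
        (if k < i then adds_hook Q k i {i + 1..j} {k + 1..l} \<phi>
         else removes_cohook Q i k {i + 1..j} {k + 1..l} \<phi>)) \<or>
     (k = i \<and> l = R_inv n Q j \<and>
        (if j < l then adds_hook Q j l {i + 1..j} {k + 1..l} \<phi>
         else removes_cohook Q l j {i + 1..j} {k + 1..l} \<phi>)))"

definition F_obj :: "nat \<times> nat \<Rightarrow> (nat, 'k::field) rep" where
  "F_obj = (\<lambda>(i, j). M (i + 1) j)"

text \<open>
  \<open>Fm\<close> is the morphism part of a linear functor with object part \<open>F_obj\<close> that sends each pivot
  to its hook or cohook morphism, up to the nonzero scalars \<open>c\<close>. The scalars cannot all be 1
  unless the characteristic is 2: the two composites of hook and cohook morphisms around a mesh
  with two middle terms are equal, while the mesh relation is the sum of the two paths.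
\<close>

definition hook_functor ::
  "nat \<Rightarrow> nat quiver \<Rightarrow> (nat \<times> nat \<Rightarrow> nat \<times> nat \<Rightarrow> 'k::field) \<Rightarrow>
   (nat \<times> nat \<Rightarrow> nat \<times> nat \<Rightarrow> ((nat \<times> nat) list \<Rightarrow>\<^sub>0 'k) set \<Rightarrow> (nat, 'k) rep_mor) \<Rightarrow> bool" where
  "hook_functor n Q c Fm \<longleftrightarrow>
     linear_functor (polygon_category n Q) (ind_category n Q) F_obj Fm \<and>
     (\<forall>(x, y)\<in>pivots n Q. c x y \<noteq> 0 \<and> (\<exists>\<phi>. pivot_morphism n Q x y \<phi> \<and>
        Fm x y (mesh_arrow (polygon_quiver n Q) x y) =
          Scl (ind_category n Q) (F_obj x) (F_obj y) (c x y) \<phi>))"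

end

theory Submission
  imports Defs
begin

text \<open>
  Cut open at \<open>n + 2\<close> and at 0, the boundary of the polygon is linearly ordered counterclockwise, and
  pivots increase one endpoint of a segment to its successor. Two segments are linked if the second
  one dominates the first in both orders and the two intervals meet. Exactly then there is a nonzero
  morphism between the interval representations, unique up to a scalar and equal to the identity on
  the common support. On the side of the mesh category, the paths between linked segments agree up to
  a nonzero scalar, because any two of them differ by meshes with two middle terms; every path
  between segments that are not linked vanishes, because it can be rerouted through a mesh with a
  single middle term. Hence \<open>F\<close> is fully faithful. The signs that turn commuting squares
  into mesh relations come from the position of the right endpoint.

  That the intervals exhaust the indecomposables is seen by splitting off one summand: at the first
  vertex \<open>j\<close> where the arrow to \<open>j + 1\<close> is not injective or the one from \<open>j + 1\<close> is not
  surjective, choose a vector that extends as little as possible to the left, and a functional not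
  vanishing on it that can be propagated to the left.

  The sequence \<open>0 \<rightarrow> F(i, j) \<rightarrow> F(R\<^sup>-i, j) \<oplus> F(i, R\<^sup>-j) \<rightarrow> F(R\<^sup>-i, R\<^sup>-j) \<rightarrow> 0\<close>
  is almost split, since every nonzero morphism out of an interval that is not a multiple of the
  identity factors through a pivot. A segment without translate belongs to the indecomposable
  projective at the vertex from which all arrows within its interval point away.
\<close>

section \<open>Linear categories\<close>

text \<open>The mesh category has no direct sums, so exactness can only be stated on its additive
  hull. An extension of \<open>F\<close> to lists of segments depends on chosen direct sums; the
  result is therefore shown for every extension, and one is exhibited. These statements are reduced
  to matrix entries, that is, to hom-spaces between intervals. Such a space is at most
  one-dimensional, with the identity on the common support as canonical generator, and generators
  along a chain in the two orders compose to the generator. The last fact rests on the shape of the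
  orders: along the left one the vertex numbers fall and then rise, along the right one they rise
  and then fall. Since only the nonvanishing of the scalars enters, the argument covers every
  functor satisfying \<open>hook_functor\<close>, whatever its \<open>c\<close>. Different intervals
  are told apart by antisymmetry of the orders, because an isomorphism gives nonzero maps both
  ways.\<close>

lemma mem_uptD: "l \<in> set [0..<n] \<Longrightarrow> l < n"
  by simp

lemma hom_sum_cong:
  "(\<And>l. l \<in> set ls \<Longrightarrow> f l = g l) \<Longrightarrow> hom_sum C x y (map f ls) = hom_sum C x y (map g ls)"
  by (simp cong: map_cong)

locale lincat =
  fixes C :: "('k::field, 'o, 'm) lcat"
  assumes linear: "linear_category C"
begin

lemma hvs: "x \<in> Obj C \<Longrightarrow> y \<in> Obj C \<Longrightarrow> hom_vector_space C x y"
  and cat: "category C"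
  using linear unfolding linear_category_def by auto

lemma ide_in [simp]: "x \<in> Obj C \<Longrightarrow> Ide C x \<in> Hom C x x"
  using cat unfolding category_def by blast

lemma comp_in [simp]: "\<lbrakk>x \<in> Obj C; y \<in> Obj C; z \<in> Obj C; f \<in> Hom C x y; g \<in> Hom C y z\<rbrakk>
    \<Longrightarrow> Comp C x y z g f \<in> Hom C x z"
  using cat unfolding category_def by blast

lemma comp_ide_left [simp]: "\<lbrakk>x \<in> Obj C; y \<in> Obj C; f \<in> Hom C x y\<rbrakk> \<Longrightarrow> Comp C x y y (Ide C y) f = f"
  and comp_ide_right [simp]: "\<lbrakk>x \<in> Obj C; y \<in> Obj C; f \<in> Hom C x y\<rbrakk> \<Longrightarrow> Comp C x x y f (Ide C x) = f"
  using cat unfolding category_def by blast+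

lemma comp_assoc: "\<lbrakk>w \<in> Obj C; x \<in> Obj C; y \<in> Obj C; z \<in> Obj C;
    f \<in> Hom C w x; g \<in> Hom C x y; h \<in> Hom C y z\<rbrakk>
    \<Longrightarrow> Comp C w x z (Comp C x y z h g) f = Comp C w y z h (Comp C w x y g f)"
  using cat unfolding category_def by blast

context
  fixes x y assumes xy: "x \<in> Obj C" "y \<in> Obj C"
begin

lemma zero_in [simp]: "Zero C x y \<in> Hom C x y"
  and add_in [simp]: "f \<in> Hom C x y \<Longrightarrow> g \<in> Hom C x y \<Longrightarrow> Add C x y f g \<in> Hom C x y"
  and add_comm: "f \<in> Hom C x y \<Longrightarrow> g \<in> Hom C x y \<Longrightarrow> Add C x y f g = Add C x y g f"
  and scl_in [simp]: "f \<in> Hom C x y \<Longrightarrow> Scl C x y a f \<in> Hom C x y"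
  and add_assoc: "f \<in> Hom C x y \<Longrightarrow> g \<in> Hom C x y \<Longrightarrow> h \<in> Hom C x y \<Longrightarrow>
      Add C x y (Add C x y f g) h = Add C x y f (Add C x y g h)"
  and add_zero_left [simp]: "f \<in> Hom C x y \<Longrightarrow> Add C x y (Zero C x y) f = f"
  and scl_one [simp]: "f \<in> Hom C x y \<Longrightarrow> Scl C x y 1 f = f"
  and scl_scl [simp]: "f \<in> Hom C x y \<Longrightarrow> Scl C x y a (Scl C x y b f) = Scl C x y (a * b) f"
  and scl_add_scalar: "f \<in> Hom C x y \<Longrightarrow>
      Scl C x y (a + b) f = Add C x y (Scl C x y a f) (Scl C x y b f)"
  and scl_add: "f \<in> Hom C x y \<Longrightarrow> g \<in> Hom C x y \<Longrightarrow>
      Scl C x y a (Add C x y f g) = Add C x y (Scl C x y a f) (Scl C x y a g)"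
  and ex_neg: "f \<in> Hom C x y \<Longrightarrow> \<exists>g\<in>Hom C x y. Add C x y f g = Zero C x y"
  using hvs[OF xy] unfolding hom_vector_space_def by blast+

lemma add_zero_right [simp]: "f \<in> Hom C x y \<Longrightarrow> Add C x y f (Zero C x y) = f"
  using add_comm add_zero_left zero_in by metis

lemma add_cancel:
  assumes "f \<in> Hom C x y" "g \<in> Hom C x y" "h \<in> Hom C x y" "Add C x y f g = Add C x y f h"
  shows "g = h"
proof -
  obtain e where e: "e \<in> Hom C x y" "Add C x y f e = Zero C x y" using ex_neg assms by blast
  have "g = Add C x y (Add C x y e f) g" using e assms add_comm by simp
  also have "\<dots> = Add C x y (Add C x y e f) h" using e assms add_assoc by simp
  also have "\<dots> = h" using e assms add_comm by simp
  finally show ?thesis .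
qed

lemma scl_zero_scalar [simp]: "f \<in> Hom C x y \<Longrightarrow> Scl C x y 0 f = Zero C x y"
  using scl_add_scalar[of f 0 0] add_cancel[of "Scl C x y 0 f" "Zero C x y" "Scl C x y 0 f"] by simp

lemma scl_zero [simp]: "Scl C x y a (Zero C x y) = Zero C x y"
  using scl_zero_scalar[of "Zero C x y"] scl_scl[of "Zero C x y" a 0] by simp

lemma add_neg [simp]: "f \<in> Hom C x y \<Longrightarrow> Add C x y f (Scl C x y (- 1) f) = Zero C x y"
  using scl_add_scalar[of f 1 "- 1"] by simp

lemma add_left_comm: "f \<in> Hom C x y \<Longrightarrow> g \<in> Hom C x y \<Longrightarrow> h \<in> Hom C x y \<Longrightarrow>
    Add C x y f (Add C x y g h) = Add C x y g (Add C x y f h)"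
  by (metis add_assoc add_comm)

lemma hom_sum_simps [simp]: "hom_sum C x y [] = Zero C x y"
    "hom_sum C x y (f # fs) = Add C x y f (hom_sum C x y fs)"
  by (simp_all add: hom_sum_def)

lemma hom_sum_in [simp]: "(\<And>f. f \<in> set fs \<Longrightarrow> f \<in> Hom C x y) \<Longrightarrow> hom_sum C x y fs \<in> Hom C x y"
  by (induction fs) auto

lemma hom_sum_map_in [simp]: "(\<And>l. l \<in> set ls \<Longrightarrow> f l \<in> Hom C x y) \<Longrightarrow> hom_sum C x y (map f ls) \<in> Hom C x y"
  by (rule hom_sum_in) auto

lemma hom_sum_zero: "(\<And>l. l \<in> set ls \<Longrightarrow> f l = Zero C x y) \<Longrightarrow> hom_sum C x y (map f ls) = Zero C x y"
  by (induction ls) auto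

lemma hom_sum_add:
  assumes "\<And>l. l \<in> set ls \<Longrightarrow> f l \<in> Hom C x y" "\<And>l. l \<in> set ls \<Longrightarrow> g l \<in> Hom C x y"
  shows "hom_sum C x y (map (\<lambda>l. Add C x y (f l) (g l)) ls)
       = Add C x y (hom_sum C x y (map f ls)) (hom_sum C x y (map g ls))"
  using assms
proof (induction ls)
  case (Cons l ls)
  have in': "hom_sum C x y (map f ls) \<in> Hom C x y" "hom_sum C x y (map g ls) \<in> Hom C x y"
    using Cons by (auto intro!: hom_sum_in)
  have "f l \<in> Hom C x y" "g l \<in> Hom C x y" using Cons by auto
  then show ?case using Cons in' by (simp add: add_assoc add_left_comm)
qed simp

lemma hom_sum_scl:
  assumes "\<And>l. l \<in> set ls \<Longrightarrow> f l \<in> Hom C x y"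
  shows "Scl C x y a (hom_sum C x y (map f ls)) = hom_sum C x y (map (\<lambda>l. Scl C x y a (f l)) ls)"
  using assms
proof (induction ls)
  case (Cons l ls)
  have "hom_sum C x y (map f ls) \<in> Hom C x y" using Cons by (auto intro!: hom_sum_in)
  then show ?case using Cons by (simp add: scl_add)
qed simp

lemma hom_sum_swap:
  assumes "\<And>k l. k \<in> set ks \<Longrightarrow> l \<in> set ls \<Longrightarrow> f k l \<in> Hom C x y"
  shows "hom_sum C x y (map (\<lambda>k. hom_sum C x y (map (f k) ls)) ks)
       = hom_sum C x y (map (\<lambda>l. hom_sum C x y (map (\<lambda>k. f k l) ks)) ls)"
  using assms
proof (induction ks)
  case Nil
  then show ?case by (simp add: hom_sum_zero)
next
  case (Cons k ks)
  then show ?case using hom_sum_add[of ls "f k" "\<lambda>l. hom_sum C x y (map (\<lambda>k. f k l) ks)"]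
    by (force intro!: hom_sum_in)
qed

lemma hom_sum_delta:
  assumes "distinct ls" "k \<in> set ls" "f k \<in> Hom C x y"
    "\<And>l. l \<in> set ls \<Longrightarrow> l \<noteq> k \<Longrightarrow> f l = Zero C x y"
  shows "hom_sum C x y (map f ls) = f k"
  using assms
proof (induction ls)
  case (Cons l ls)
  show ?case
  proof (cases "l = k")
    case True
    then have "hom_sum C x y (map f ls) = Zero C x y" using Cons by (intro hom_sum_zero) auto
    then show ?thesis using True Cons by simp
  next
    case False
    then show ?thesis using Cons by auto
  qed
qed simp

end

context
  fixes x y z assumes xyz: "x \<in> Obj C" "y \<in> Obj C" "z \<in> Obj C"
begin

lemma comp_add_right: "\<lbrakk>f \<in> Hom C x y; f' \<in> Hom C x y; g \<in> Hom C y z\<rbrakk> \<Longrightarrow>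
    Comp C x y z g (Add C x y f f') = Add C x z (Comp C x y z g f) (Comp C x y z g f')"
  using linear xyz unfolding linear_category_def by meson

lemma comp_add_left: "\<lbrakk>f \<in> Hom C x y; g \<in> Hom C y z; g' \<in> Hom C y z\<rbrakk> \<Longrightarrow>
    Comp C x y z (Add C y z g g') f = Add C x z (Comp C x y z g f) (Comp C x y z g' f)"
  using linear xyz unfolding linear_category_def by meson

lemma comp_scl_right [simp]: "\<lbrakk>f \<in> Hom C x y; g \<in> Hom C y z\<rbrakk> \<Longrightarrow>
    Comp C x y z g (Scl C x y a f) = Scl C x z a (Comp C x y z g f)"
  and comp_scl_left [simp]: "\<lbrakk>f \<in> Hom C x y; g \<in> Hom C y z\<rbrakk> \<Longrightarrow>
    Comp C x y z (Scl C y z a g) f = Scl C x z a (Comp C x y z g f)"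
  using linear xyz unfolding linear_category_def by meson+

lemma comp_zero_right [simp]: "g \<in> Hom C y z \<Longrightarrow> Comp C x y z g (Zero C x y) = Zero C x z"
  using comp_scl_right[of "Zero C x y" g 0] xyz by simp

lemma comp_zero_left [simp]: "f \<in> Hom C x y \<Longrightarrow> Comp C x y z (Zero C y z) f = Zero C x z"
  using comp_scl_left[of f "Zero C y z" 0] xyz by simp

lemma comp_hom_sum_right:
  assumes "\<And>l. l \<in> set ls \<Longrightarrow> f l \<in> Hom C x y" "g \<in> Hom C y z"
  shows "Comp C x y z g (hom_sum C x y (map f ls)) = hom_sum C x z (map (\<lambda>l. Comp C x y z g (f l)) ls)"
  using assms
proof (induction ls)
  case (Cons l ls)
  have "hom_sum C x y (map f ls) \<in> Hom C x y" using Cons xyz by (auto intro!: hom_sum_in)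
  then show ?case using Cons xyz by (simp add: comp_add_right)
qed (use xyz in simp)

lemma comp_hom_sum_left:
  assumes "\<And>l. l \<in> set ls \<Longrightarrow> g l \<in> Hom C y z" "f \<in> Hom C x y"
  shows "Comp C x y z (hom_sum C y z (map g ls)) f = hom_sum C x z (map (\<lambda>l. Comp C x y z (g l) f) ls)"
  using assms
proof (induction ls)
  case (Cons l ls)
  have "hom_sum C y z (map g ls) \<in> Hom C y z" using Cons xyz by (auto intro!: hom_sum_in)
  then show ?case using Cons xyz by (simp add: comp_add_left)
qed (use xyz in simp)

end

section \<open>Zero objects, isomorphisms and split summands in a linear category\<close>

lemma zero_object_iff: "z \<in> Obj C \<Longrightarrow> is_zero_object C z \<longleftrightarrow> Ide C z = Zero C z z"
proof
  assume z: "z \<in> Obj C" and "is_zero_object C z"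
  then show "Ide C z = Zero C z z"
    unfolding is_zero_object_def using ide_in zero_in by metis
next
  assume z: "z \<in> Obj C" and e: "Ide C z = Zero C z z"
  have "f = Zero C x z" if "x \<in> Obj C" "f \<in> Hom C x z" for x f
    using comp_ide_left[OF that(1) z that(2)] e that z by simp
  moreover have "f = Zero C z x" if "x \<in> Obj C" "f \<in> Hom C z x" for x f
    using comp_ide_right[OF z that(1) that(2)] e that z by simp
  ultimately show "is_zero_object C z"
    unfolding is_zero_object_def using z zero_in by blast
qed

lemma isomorphic_trans:
  assumes "x \<in> Obj C" "y \<in> Obj C" "z \<in> Obj C" "is_iso C x y f" "is_iso C y z g"
  shows "is_iso C x z (Comp C x y z g f)"
proof -
  obtain f' where f: "f \<in> Hom C x y" "f' \<in> Hom C y x" "Comp C x y x f' f = Ide C x" "Comp C y x y f f' = Ide C y"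
    using assms unfolding is_iso_def by auto
  obtain g' where g: "g \<in> Hom C y z" "g' \<in> Hom C z y" "Comp C y z y g' g = Ide C y" "Comp C z y z g g' = Ide C z"
    using assms unfolding is_iso_def by auto
  have "Comp C x z x (Comp C z y x f' g') (Comp C x y z g f) = Comp C x y x f' (Comp C x z y g' (Comp C x y z g f))"
    using assms f g by (simp add: comp_assoc)
  also have "Comp C x z y g' (Comp C x y z g f) = f"
    using comp_assoc[of x y z y f g g'] assms f g by simp
  finally have 1: "Comp C x z x (Comp C z y x f' g') (Comp C x y z g f) = Ide C x" using f by simp
  have "Comp C z x z (Comp C x y z g f) (Comp C z y x f' g') = Comp C z y z g (Comp C z x y f (Comp C z y x f' g'))"
    using assms f g by (simp add: comp_assoc)
  also have "Comp C z x y f (Comp C z y x f' g') = g'"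
    using comp_assoc[of z y x y g' f' f] assms f g by simp
  finally have 2: "Comp C z x z (Comp C x y z g f) (Comp C z y x f' g') = Ide C z" using g by simp
  show ?thesis unfolding is_iso_def using 1 2 assms f g by (intro conjI bexI) auto
qed

text \<open>A retraction \<open>g\<close> of \<open>f\<close> makes \<open>1 - f g\<close> an
  endomorphism killed by \<open>g\<close>, so it factors through the kernel of \<open>g\<close> and
  supplies the missing projection. This is how an interval summand is split off.\<close>

lemma split_mono_biproduct:
  assumes m: "m \<in> Obj C" and x: "x \<in> Obj C" and f: "f \<in> Hom C m x" and g: "g \<in> Hom C x m"
    and gf: "Comp C m x m g f = Ide C m" and K: "K \<in> Obj C" and k: "is_kernel C K x m k g"
  obtains q where "is_biproduct C m K x f k g q"
proof -
  note [simp] = m x f g K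
  have kin [simp]: "k \<in> Hom C K x" and gk: "Comp C K x m g k = Zero C K m"
    using k unfolding is_kernel_def by auto
  have uni: "\<exists>!u. u \<in> Hom C w K \<and> Comp C w K x k u = h"
    if "w \<in> Obj C" "h \<in> Hom C w x" "Comp C w x m g h = Zero C w m" for w h
    using k that unfolding is_kernel_def by blast
  \<comment> \<open>Uniqueness of factorizations through a kernel makes \<open>k\<close>
    cancellable; the equations for \<open>q\<close> are checked after composing with
    \<open>k\<close>.\<close>
  have mono: "u = v" if "w \<in> Obj C" "u \<in> Hom C w K" "v \<in> Hom C w K"
      "Comp C w K x k u = Comp C w K x k v" for u v w
  proof -
    have "Comp C w x m g (Comp C w K x k u) = Zero C w m"
      using comp_assoc[of w K x m u k g] that gk by simp
    then show ?thesis using uni[of w "Comp C w K x k u"] that by auto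
  qed
  define e where "e = Add C x x (Ide C x) (Scl C x x (- 1) (Comp C x m x f g))"
  have ein [simp]: "e \<in> Hom C x x" by (simp add: e_def)
  have ge: "Comp C x x m g e = Zero C x m"
    unfolding e_def using comp_assoc[of x m x m g f g] gf by (simp add: comp_add_right)
  obtain q where q [simp]: "q \<in> Hom C x K" and kq: "Comp C x K x k q = e"
    using uni[of x e] ge by auto
  have ek: "Comp C K x x e k = k"
    unfolding e_def by (simp add: comp_add_left comp_assoc gk)
  have ef: "Comp C m x x e f = Zero C m x"
    unfolding e_def by (simp add: comp_add_left comp_assoc gf)
  have qk: "Comp C K x K q k = Ide C K"
    by (rule mono[of K]) (use comp_assoc[of K x K x k q k] kq ek in simp_all)
  have qf: "Comp C m x K q f = Zero C m K"
    by (rule mono[of m]) (use comp_assoc[of m x K x f q k] kq ef in simp_all)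
  have "Add C x x (Comp C x m x f g) (Comp C x K x k q) = Ide C x"
    unfolding kq e_def by (subst add_left_comm) auto
  then have "is_biproduct C m K x f k g q"
    unfolding is_biproduct_def using qk qf gk gf by simp
  then show ?thesis by (rule that)
qed

text \<open>The idempotent \<open>i1 p1\<close> is a scalar \<open>a\<close>. If
  \<open>a = 0\<close>, then \<open>i1\<close> vanishes and with it the identity of
  \<open>y\<close>; otherwise \<open>p2 i1 = 0\<close> forces \<open>p2 = 0\<close>, and the
  identity of \<open>z\<close> vanishes.\<close>

lemma biproduct_of_scalar_endomorphisms_trivial:
  assumes x: "x \<in> Obj C" "y \<in> Obj C" "z \<in> Obj C"
    and scal: "\<And>e. e \<in> Hom C x x \<Longrightarrow> \<exists>a. e = Scl C x x a (Ide C x)"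
    and nz: "Ide C x \<noteq> Zero C x x"
    and b: "is_biproduct C y z x i1 i2 p1 p2"
  shows "is_zero_object C y \<or> is_zero_object C z"
proof -
  note [simp] = x
  have [simp]: "i1 \<in> Hom C y x" "i2 \<in> Hom C z x" "p1 \<in> Hom C x y" "p2 \<in> Hom C x z"
    and e1: "Comp C y x y p1 i1 = Ide C y" and e2: "Comp C z x z p2 i2 = Ide C z"
    and o1: "Comp C y x z p2 i1 = Zero C y z"
    using b unfolding is_biproduct_def by auto
  obtain a where a: "Comp C x y x i1 p1 = Scl C x x a (Ide C x)" using scal[of "Comp C x y x i1 p1"] by auto
  have "Comp C y x x (Comp C x y x i1 p1) i1 = i1"
    by (simp add: comp_assoc e1)
  then have s: "Scl C y x a i1 = i1" using a by simp
  show ?thesis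
  proof (cases "a = 0")
    case True
    then have "i1 = Zero C y x" using s by (simp add: True)
    then have "Ide C y = Zero C y y" using e1 by simp
    then show ?thesis using zero_object_iff by simp
  next
    case False
    have "Comp C x x z p2 (Comp C x y x i1 p1) = Zero C x z"
      using comp_assoc[of x y x z p1 i1 p2] o1 by simp
    then have "Scl C x z a p2 = Zero C x z" using a by simp
    then have "Scl C x z (inverse a) (Scl C x z a p2) = Zero C x z" by simp
    then have "p2 = Zero C x z" using False by simp
    then have "Ide C z = Zero C z z" using e2 by simp
    then show ?thesis using zero_object_iff by simp
  qed
qed

text \<open>With \<open>K\<close> zero the second projection vanishes, and the resolution of the
  identity leaves \<open>i1 p1 = 1\<close>.\<close>

lemma biproduct_with_zero_iso:
  assumes x: "m \<in> Obj C" "K \<in> Obj C" "x \<in> Obj C" and b: "is_biproduct C m K x i1 i2 p1 p2"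
    and z: "is_zero_object C K"
  shows "is_iso C x m p1"
proof -
  note [simp] = x
  have [simp]: "i1 \<in> Hom C m x" "i2 \<in> Hom C K x" "p1 \<in> Hom C x m" "p2 \<in> Hom C x K"
    and e1: "Comp C m x m p1 i1 = Ide C m"
    and s: "Add C x x (Comp C x m x i1 p1) (Comp C x K x i2 p2) = Ide C x"
    using b unfolding is_biproduct_def by auto
  have "p2 = Zero C x K" using z unfolding is_zero_object_def by (metis \<open>p2 \<in> Hom C x K\<close> x zero_in)
  then have "Comp C x m x i1 p1 = Ide C x" using s by simp
  then show ?thesis unfolding is_iso_def using e1 by (intro conjI bexI) auto
qed

end

subsection \<open>Opposite categories\<close>

text \<open>Statements on kernels and monomorphisms of the opposite category are statements on
  cokernels and epimorphisms, so each of them is proved once.\<close>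

definition op_cat :: "('k, 'o, 'm) lcat \<Rightarrow> ('k, 'o, 'm) lcat" where
  "op_cat C = \<lparr>Obj = Obj C, Hom = (\<lambda>x y. Hom C y x), Ide = Ide C,
     Comp = (\<lambda>x y z g f. Comp C z y x f g), Add = (\<lambda>x y. Add C y x), Zero = (\<lambda>x y. Zero C y x),
     Scl = (\<lambda>x y. Scl C y x)\<rparr>"

lemma op_cat_simps [simp]:
  "Obj (op_cat C) = Obj C" "Hom (op_cat C) x y = Hom C y x" "Ide (op_cat C) = Ide C"
  "Comp (op_cat C) x y z g f = Comp C z y x f g" "Add (op_cat C) x y = Add C y x"
  "Zero (op_cat C) x y = Zero C y x" "Scl (op_cat C) x y = Scl C y x"
  by (simp_all add: op_cat_def)

lemma linear_op [simp]: "linear_category C \<Longrightarrow> linear_category (op_cat C)"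
proof -
  assume "linear_category C"
  then interpret lincat C by (rule lincat.intro)
  have "category (op_cat C)" unfolding category_def by (simp add: comp_assoc)
  moreover have "hom_vector_space (op_cat C) x y \<longleftrightarrow> hom_vector_space C y x" for x y
    unfolding hom_vector_space_def op_cat_simps ..
  ultimately show ?thesis unfolding linear_category_def by (simp add: comp_add_left comp_add_right hvs)
qed

lemma is_kernel_op: "is_kernel (op_cat C) q y x p f \<longleftrightarrow> is_cokernel C x y q f p"
  unfolding is_kernel_def is_cokernel_def by auto

lemma is_mono_op: "is_mono (op_cat C) y x f \<longleftrightarrow> is_epi C x y f"
  unfolding is_mono_def is_epi_def by auto

subsection \<open>Equivalences\<close>

definition fully_faithful where
  "fully_faithful C D Fo Fm \<longleftrightarrow>
     (\<forall>x\<in>Obj C. \<forall>y\<in>Obj C. bij_betw (Fm x y) (Hom C x y) (Hom D (Fo x) (Fo y)))"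

definition essentially_surjective where
  "essentially_surjective C D Fo \<longleftrightarrow> (\<forall>d\<in>Obj D. \<exists>c\<in>Obj C. isomorphic_in D d (Fo c))"

locale linfun =
  fixes C :: "('k::field, 'o, 'm) lcat" and D :: "('k, 'p, 'n) lcat" and Fo Fm
  assumes lin_functor: "linear_functor C D Fo Fm"
begin

sublocale C: lincat C using lin_functor unfolding linear_functor_def by unfold_locales auto
sublocale D: lincat D using lin_functor unfolding linear_functor_def by unfold_locales auto

lemma is_fun: "is_functor C D Fo Fm" using lin_functor unfolding linear_functor_def by auto

lemma Fo_in [simp]: "x \<in> Obj C \<Longrightarrow> Fo x \<in> Obj D"
  and Fm_ide [simp]: "x \<in> Obj C \<Longrightarrow> Fm x x (Ide C x) = Ide D (Fo x)"
  and Fm_in [simp]: "\<lbrakk>x \<in> Obj C; y \<in> Obj C; f \<in> Hom C x y\<rbrakk> \<Longrightarrow> Fm x y f \<in> Hom D (Fo x) (Fo y)"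
  and Fm_comp: "\<lbrakk>x \<in> Obj C; y \<in> Obj C; z \<in> Obj C; f \<in> Hom C x y; g \<in> Hom C y z\<rbrakk> \<Longrightarrow>
     Fm x z (Comp C x y z g f) = Comp D (Fo x) (Fo y) (Fo z) (Fm y z g) (Fm x y f)"
  using is_fun unfolding is_functor_def by blast+

lemma Fm_add: "\<lbrakk>x \<in> Obj C; y \<in> Obj C; f \<in> Hom C x y; g \<in> Hom C x y\<rbrakk> \<Longrightarrow>
     Fm x y (Add C x y f g) = Add D (Fo x) (Fo y) (Fm x y f) (Fm x y g)"
  and Fm_scl: "\<lbrakk>x \<in> Obj C; y \<in> Obj C; f \<in> Hom C x y\<rbrakk> \<Longrightarrow>
     Fm x y (Scl C x y a f) = Scl D (Fo x) (Fo y) a (Fm x y f)"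
  using lin_functor unfolding linear_functor_def by blast+

lemma Fm_zero [simp]: "\<lbrakk>x \<in> Obj C; y \<in> Obj C\<rbrakk> \<Longrightarrow> Fm x y (Zero C x y) = Zero D (Fo x) (Fo y)"
  using Fm_scl[of x y "Zero C x y" 0] by simp

lemma Fm_hom_sum:
  assumes "x \<in> Obj C" "y \<in> Obj C" "\<And>l. l \<in> set ls \<Longrightarrow> f l \<in> Hom C x y"
  shows "Fm x y (hom_sum C x y (map f ls)) = hom_sum D (Fo x) (Fo y) (map (\<lambda>l. Fm x y (f l)) ls)"
  using assms(3)
proof (induction ls)
  case (Cons l ls)
  have "hom_sum C x y (map f ls) \<in> Hom C x y" using Cons assms by (auto intro!: C.hom_sum_in)
  then show ?case using Cons assms by (simp add: Fm_add)
qed (use assms in simp)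

lemma op: "linfun (op_cat C) (op_cat D) Fo (\<lambda>x y. Fm y x)"
proof (unfold_locales)
  have 1: "is_functor (op_cat C) (op_cat D) Fo (\<lambda>x y. Fm y x)"
    unfolding is_functor_def
    using linear_op[OF C.linear] linear_op[OF D.linear] unfolding linear_category_def
    by (auto simp: Fm_comp)
  show "linear_functor (op_cat C) (op_cat D) Fo (\<lambda>x y. Fm y x)"
    unfolding linear_functor_def using 1 linear_op[OF C.linear] linear_op[OF D.linear]
    by (auto simp: Fm_add Fm_scl)
qed

end

locale linequiv = linfun +
  assumes ff: "fully_faithful C D Fo Fm" and es: "essentially_surjective C D Fo"
begin

lemma Fm_inj: "\<lbrakk>x \<in> Obj C; y \<in> Obj C; f \<in> Hom C x y; g \<in> Hom C x y; Fm x y f = Fm x y g\<rbrakk> \<Longrightarrow> f = g"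
  using ff unfolding fully_faithful_def bij_betw_def by (meson inj_onD)

lemma Fm_surj: 
  assumes "x \<in> Obj C" "y \<in> Obj C" "h \<in> Hom D (Fo x) (Fo y)"
  obtains f where "f \<in> Hom C x y" "Fm x y f = h"
proof -
  have "Fm x y ` Hom C x y = Hom D (Fo x) (Fo y)"
    using ff assms unfolding fully_faithful_def bij_betw_def by blast
  then show ?thesis using assms(3) that by (metis imageE)
qed

lemma obtain_iso:
  assumes "d \<in> Obj D"
  obtains c e e' where "c \<in> Obj C" "e \<in> Hom D d (Fo c)" "e' \<in> Hom D (Fo c) d"
    "Comp D d (Fo c) d e' e = Ide D d" "Comp D (Fo c) d (Fo c) e e' = Ide D (Fo c)"
  using es assms unfolding essentially_surjective_def isomorphic_in_def is_iso_def by blast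

lemma op_equiv: "linequiv (op_cat C) (op_cat D) Fo (\<lambda>x y. Fm y x)"
proof -
  interpret o: linfun "op_cat C" "op_cat D" Fo "\<lambda>x y. Fm y x" by (rule op)
  show ?thesis
  proof
    show "fully_faithful (op_cat C) (op_cat D) Fo (\<lambda>x y. Fm y x)"
      using ff unfolding fully_faithful_def by auto
    show "essentially_surjective (op_cat C) (op_cat D) Fo"
      unfolding essentially_surjective_def
    proof
      fix d assume d: "d \<in> Obj (op_cat D)"
      then obtain c e e' where "c \<in> Obj C" "e \<in> Hom D d (Fo c)" "e' \<in> Hom D (Fo c) d"
        "Comp D d (Fo c) d e' e = Ide D d" "Comp D (Fo c) d (Fo c) e e' = Ide D (Fo c)"
        using obtain_iso[of d] by auto
      then show "\<exists>c\<in>Obj (op_cat C). isomorphic_in (op_cat D) d (Fo c)"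
        unfolding isomorphic_in_def is_iso_def by auto
    qed
  qed
qed

text \<open>Each object of \<open>D\<close> gets a chosen isomorphism to some \<open>Fo c\<close>;
  morphisms are conjugated by these and pulled back through the bijections on hom-sets. Faithfulness
  turns every identity in \<open>C\<close> into one in \<open>D\<close>, where the chosen
  isomorphisms cancel.\<close>

lemma equivalence: "equivalence_of_categories C D Fo Fm"
proof -
  define P where "P d = (\<lambda>(c, e, e'). c \<in> Obj C \<and> e \<in> Hom D d (Fo c) \<and> e' \<in> Hom D (Fo c) d \<and>
    Comp D d (Fo c) d e' e = Ide D d \<and> Comp D (Fo c) d (Fo c) e e' = Ide D (Fo c))" for d
  define S where "S d = (SOME t. P d t)" for d
  have PS: "P d (S d)" if d: "d \<in> Obj D" for d
  proof -
    obtain c e e' where "c \<in> Obj C" "e \<in> Hom D d (Fo c)" "e' \<in> Hom D (Fo c) d"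
    "Comp D d (Fo c) d e' e = Ide D d" "Comp D (Fo c) d (Fo c) e e' = Ide D (Fo c)"
      using obtain_iso[OF d] .
    then have "P d (c, e, e')" unfolding P_def by simp
    then show ?thesis unfolding S_def by (rule someI)
  qed
  define Go where "Go d = fst (S d)" for d
  define e where "e d = fst (snd (S d))" for d
  define e' where "e' d = snd (snd (S d))" for d
  have G [simp]: "d \<in> Obj D \<Longrightarrow> Go d \<in> Obj C" "d \<in> Obj D \<Longrightarrow> e d \<in> Hom D d (Fo (Go d))"
    "d \<in> Obj D \<Longrightarrow> e' d \<in> Hom D (Fo (Go d)) d"
    "d \<in> Obj D \<Longrightarrow> Comp D d (Fo (Go d)) d (e' d) (e d) = Ide D d"
    "d \<in> Obj D \<Longrightarrow> Comp D (Fo (Go d)) d (Fo (Go d)) (e d) (e' d) = Ide D (Fo (Go d))" for d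
    using PS[of d] unfolding P_def Go_def e_def e'_def by (auto simp: case_prod_beta)
  define J where "J x y h = inv_into (Hom C x y) (Fm x y) h" for x y h
  have J [simp]: "J x y h \<in> Hom C x y" "Fm x y (J x y h) = h"
    if "x \<in> Obj C" "y \<in> Obj C" "h \<in> Hom D (Fo x) (Fo y)" for x y h
    using that ff unfolding fully_faithful_def bij_betw_def J_def
    by (auto intro: inv_into_into f_inv_into_f)
  \<comment> \<open>\<open>T\<close> conjugates \<open>f\<close> by the chosen isomorphisms, giving
    a morphism between objects in the image of \<open>Fo\<close>, which \<open>J\<close> can
    lift.\<close>
  define T where "T d d' f = Comp D (Fo (Go d)) d' (Fo (Go d')) (e d') (Comp D (Fo (Go d)) d d' f (e' d))" for d d' f
  have T [simp]: "T d d' f \<in> Hom D (Fo (Go d)) (Fo (Go d'))"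
    if "d \<in> Obj D" "d' \<in> Obj D" "f \<in> Hom D d d'" for d d' f
    using that by (simp add: T_def)
  define Gm where "Gm d d' f = J (Go d) (Go d') (T d d' f)" for d d' f
  have Gm [simp]: "Gm d d' f \<in> Hom C (Go d) (Go d')" "Fm (Go d) (Go d') (Gm d d' f) = T d d' f"
    if "d \<in> Obj D" "d' \<in> Obj D" "f \<in> Hom D d d'" for d d' f
    using that by (simp_all add: Gm_def)
  have Tcomp: "T d d'' (Comp D d d' d'' g f) = Comp D (Fo (Go d)) (Fo (Go d')) (Fo (Go d'')) (T d' d'' g) (T d d' f)"
    if [simp]: "d \<in> Obj D" "d' \<in> Obj D" "d'' \<in> Obj D" "f \<in> Hom D d d'" "g \<in> Hom D d' d''" for d d' d'' f g
  proof -
    let ?F = "\<lambda>d. Fo (Go d)"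
    have "Comp D (?F d) (?F d') d' (e' d') (Comp D (?F d) d' (?F d') (e d') (Comp D (?F d) d d' f (e' d)))
      = Comp D (?F d) d d' f (e' d)"
      using D.comp_assoc[of "?F d" d' "?F d'" d' "Comp D (?F d) d d' f (e' d)" "e d'" "e' d'"] by simp
    then show ?thesis unfolding T_def by (simp add: D.comp_assoc)
  qed
  have Gfun: "is_functor D C Go Gm"
    unfolding is_functor_def
  proof (intro conjI ballI)
    show "category D" "category C" by (rule D.cat, rule C.cat)
    fix d assume d [simp]: "d \<in> Obj D"
    show "Go d \<in> Obj C" by simp
    show "Gm d d (Ide D d) = Ide C (Go d)"
      by (rule Fm_inj[of "Go d" "Go d"]) (simp_all add: T_def)
    fix d' f assume d' [simp]: "d' \<in> Obj D"
    { assume "f \<in> Hom D d d'" then show "Gm d d' f \<in> Hom C (Go d) (Go d')" by simp }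
    fix d'' f g assume [simp]: "d'' \<in> Obj D" "f \<in> Hom D d d'" "g \<in> Hom D d' d''"
    show "Gm d d'' (Comp D d d' d'' g f) = Comp C (Go d) (Go d') (Go d'') (Gm d' d'' g) (Gm d d' f)"
      by (rule Fm_inj[of "Go d" "Go d''"]) (simp_all add: Fm_comp Tcomp)
  qed
  have n1: "natural_iso_from_identity D (\<lambda>x. Fo (Go x)) (\<lambda>x y f. Fm (Go x) (Go y) (Gm x y f)) e"
    unfolding natural_iso_from_identity_def
  proof (intro conjI ballI)
    fix d assume d [simp]: "d \<in> Obj D"
    show "is_iso D d (Fo (Go d)) (e d)" unfolding is_iso_def by (intro conjI bexI[of _ "e' d"]) auto
    fix d' f assume [simp]: "d' \<in> Obj D" "f \<in> Hom D d d'"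
    show "Comp D d d' (Fo (Go d')) (e d') f =
       Comp D d (Fo (Go d)) (Fo (Go d')) (Fm (Go d) (Go d') (Gm d d' f)) (e d)"
      by (simp add: T_def D.comp_assoc)
  qed
  \<comment> \<open>The unit lifts the chosen isomorphism at \<open>Fo x\<close>.\<close>
  define t where "t x = J x (Go (Fo x)) (e (Fo x))" for x
  have t [simp]: "t x \<in> Hom C x (Go (Fo x))" "Fm x (Go (Fo x)) (t x) = e (Fo x)" if "x \<in> Obj C" for x
    using that by (simp_all add: t_def)
  have n2: "natural_iso_from_identity C (\<lambda>x. Go (Fo x)) (\<lambda>x y f. Gm (Fo x) (Fo y) (Fm x y f)) t"
    unfolding natural_iso_from_identity_def
  proof (intro conjI ballI)
    fix x assume [simp]: "x \<in> Obj C"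
    have "Comp C x (Go (Fo x)) x (J (Go (Fo x)) x (e' (Fo x))) (t x) = Ide C x"
      by (rule Fm_inj[of x x]) (simp_all add: Fm_comp)
    moreover have "Comp C (Go (Fo x)) x (Go (Fo x)) (t x) (J (Go (Fo x)) x (e' (Fo x))) = Ide C (Go (Fo x))"
      by (rule Fm_inj[of "Go (Fo x)" "Go (Fo x)"]) (simp_all add: Fm_comp)
    ultimately show "is_iso C x (Go (Fo x)) (t x)"
      unfolding is_iso_def by (intro conjI bexI[of _ "J (Go (Fo x)) x (e' (Fo x))"]) auto
    fix y f assume [simp]: "y \<in> Obj C" "f \<in> Hom C x y"
    show "Comp C x y (Go (Fo y)) (t y) f
      = Comp C x (Go (Fo x)) (Go (Fo y)) (Gm (Fo x) (Fo y) (Fm x y f)) (t x)"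
      by (rule Fm_inj[of x "Go (Fo y)"]) (simp_all add: Fm_comp T_def D.comp_assoc)
  qed
  show ?thesis unfolding equivalence_of_categories_def using is_fun Gfun n1 n2 by blast
qed

section \<open>Kernels, monomorphisms and the abelian property along an equivalence\<close>

lemma reflect_kernel:
  assumes [simp]: "k \<in> Obj C" "x \<in> Obj C" "y \<in> Obj C" "i \<in> Hom C k x" "f \<in> Hom C x y"
    and K: "is_kernel D (Fo k) (Fo x) (Fo y) (Fm k x i) (Fm x y f)"
  shows "is_kernel C k x y i f"
  unfolding is_kernel_def
proof (intro conjI ballI impI)
  show "Comp C k x y f i = Zero C k y"
    by (rule Fm_inj[of k y]) (use K in \<open>simp_all add: Fm_comp is_kernel_def\<close>)
  fix w h assume [simp]: "w \<in> Obj C" "h \<in> Hom C w x" and e: "Comp C w x y f h = Zero C w y"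
  have "Comp D (Fo w) (Fo x) (Fo y) (Fm x y f) (Fm w x h) = Zero D (Fo w) (Fo y)"
    using e Fm_comp[of w x y h f] by simp
  then have ex: "\<exists>!u. u \<in> Hom D (Fo w) (Fo k) \<and> Comp D (Fo w) (Fo k) (Fo x) (Fm k x i) u = Fm w x h"
    using K unfolding is_kernel_def by simp
  then obtain u where u: "u \<in> Hom D (Fo w) (Fo k)" "Comp D (Fo w) (Fo k) (Fo x) (Fm k x i) u = Fm w x h" by blast
  then obtain v where v [simp]: "v \<in> Hom C w k" "Fm w k v = u" using Fm_surj[of w k u] by auto
  show "\<exists>!u. u \<in> Hom C w k \<and> Comp C w k x i u = h"
  proof (rule ex1I[of _ v], intro conjI)
    show "Comp C w k x i v = h" by (rule Fm_inj[of w x]) (simp_all add: Fm_comp u)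
    fix v' assume v': "v' \<in> Hom C w k \<and> Comp C w k x i v' = h"
    then have "Fm w k v' \<in> Hom D (Fo w) (Fo k) \<and> Comp D (Fo w) (Fo k) (Fo x) (Fm k x i) (Fm w k v') = Fm w x h"
      using Fm_comp[of w k x v' i] by simp
    then have "Fm w k v' = u" using ex u by blast
    then show "v' = v" using Fm_inj[of w k v' v] v' by simp
  qed simp
qed (use assms in auto)

text \<open>A test object \<open>d\<close> of \<open>D\<close> need not lie in the image, so it is
  replaced by an isomorphic \<open>Fo c\<close>; the factorization found in \<open>C\<close> is
  carried back along the isomorphism.\<close>

lemma preserve_kernel:
  assumes [simp]: "k \<in> Obj C" "x \<in> Obj C" "y \<in> Obj C" and K: "is_kernel C k x y i f"
  shows "is_kernel D (Fo k) (Fo x) (Fo y) (Fm k x i) (Fm x y f)"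
proof -
  have [simp]: "i \<in> Hom C k x" "f \<in> Hom C x y" and z: "Comp C k x y f i = Zero C k y"
    using K unfolding is_kernel_def by auto
  show ?thesis unfolding is_kernel_def
  proof (intro conjI ballI impI)
    show "Comp D (Fo k) (Fo x) (Fo y) (Fm x y f) (Fm k x i) = Zero D (Fo k) (Fo y)"
      using Fm_comp[of k x y i f] z by simp
    fix d h assume d [simp]: "d \<in> Obj D" and h [simp]: "h \<in> Hom D d (Fo x)"
      and e0: "Comp D d (Fo x) (Fo y) (Fm x y f) h = Zero D d (Fo y)"
    obtain c e e' where c [simp]: "c \<in> Obj C" "e \<in> Hom D d (Fo c)" "e' \<in> Hom D (Fo c) d"
      "Comp D d (Fo c) d e' e = Ide D d" "Comp D (Fo c) d (Fo c) e e' = Ide D (Fo c)"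
      using obtain_iso[OF d] .
    obtain h' where h' [simp]: "h' \<in> Hom C c x" "Fm c x h' = Comp D (Fo c) d (Fo x) h e'"
      using Fm_surj[of c x "Comp D (Fo c) d (Fo x) h e'"] by auto
    have "Comp C c x y f h' = Zero C c y"
    proof (rule Fm_inj[of c y])
      have "Comp D (Fo c) (Fo x) (Fo y) (Fm x y f) (Comp D (Fo c) d (Fo x) h e')
        = Comp D (Fo c) d (Fo y) (Comp D d (Fo x) (Fo y) (Fm x y f) h) e'" by (simp add: D.comp_assoc)
      then show "Fm c y (Comp C c x y f h') = Fm c y (Zero C c y)" by (simp add: Fm_comp e0)
    qed simp_all
    then have ex: "\<exists>!u. u \<in> Hom C c k \<and> Comp C c k x i u = h'"
      using K unfolding is_kernel_def by simp
    then obtain u where u [simp]: "u \<in> Hom C c k" "Comp C c k x i u = h'" by blast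
    show "\<exists>!u. u \<in> Hom D d (Fo k) \<and> Comp D d (Fo k) (Fo x) (Fm k x i) u = h"
    proof (rule ex1I[of _ "Comp D d (Fo c) (Fo k) (Fm c k u) e"], intro conjI)
      have "Comp D d (Fo k) (Fo x) (Fm k x i) (Comp D d (Fo c) (Fo k) (Fm c k u) e)
        = Comp D d (Fo c) (Fo x) (Fm c x (Comp C c k x i u)) e"
        by (simp add: Fm_comp D.comp_assoc del: u(2))
      also have "\<dots> = h" by (simp add: D.comp_assoc)
      finally show "Comp D d (Fo k) (Fo x) (Fm k x i) (Comp D d (Fo c) (Fo k) (Fm c k u) e) = h" .
      fix v assume "v \<in> Hom D d (Fo k) \<and> Comp D d (Fo k) (Fo x) (Fm k x i) v = h"
      then have v [simp]: "v \<in> Hom D d (Fo k)" and vh: "Comp D d (Fo k) (Fo x) (Fm k x i) v = h" by auto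
      obtain v' where v' [simp]: "v' \<in> Hom C c k" "Fm c k v' = Comp D (Fo c) d (Fo k) v e'"
        using Fm_surj[of c k "Comp D (Fo c) d (Fo k) v e'"] by auto
      have "Comp C c k x i v' = h'"
        by (rule Fm_inj[of c x])
          (simp_all add: Fm_comp vh D.comp_assoc[of "Fo c" d "Fo k" "Fo x" e' v "Fm k x i", symmetric])
      then have "v' = u" using ex u v'(1) by blast
      then have "Comp D d (Fo c) (Fo k) (Fm c k u) e = Comp D d (Fo c) (Fo k) (Comp D (Fo c) d (Fo k) v e') e"
        using v' by simp
      also have "\<dots> = v" by (simp add: D.comp_assoc)
      finally show "v = Comp D d (Fo c) (Fo k) (Fm c k u) e" by simp
    qed simp
  qed simp_all
qed

text \<open>The kernel in \<open>D\<close> is moved along an isomorphism to an object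
  \<open>Fo c\<close>, so that its inclusion lifts to \<open>C\<close>, and is then
  reflected.\<close>

lemma kernel_exists:
  assumes D: "\<And>x y f. \<lbrakk>x \<in> Obj D; y \<in> Obj D; f \<in> Hom D x y\<rbrakk> \<Longrightarrow> \<exists>k\<in>Obj D. \<exists>i. is_kernel D k x y i f"
    and [simp]: "x \<in> Obj C" "y \<in> Obj C" "f \<in> Hom C x y"
  shows "\<exists>k\<in>Obj C. \<exists>i. is_kernel C k x y i f"
proof -
  obtain k i where k [simp]: "k \<in> Obj D" and K: "is_kernel D k (Fo x) (Fo y) i (Fm x y f)"
    using D[of "Fo x" "Fo y" "Fm x y f"] by auto
  have [simp]: "i \<in> Hom D k (Fo x)" using K unfolding is_kernel_def by auto
  obtain c e e' where c [simp]: "c \<in> Obj C" "e \<in> Hom D k (Fo c)" "e' \<in> Hom D (Fo c) k"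
    "Comp D k (Fo c) k e' e = Ide D k" "Comp D (Fo c) k (Fo c) e e' = Ide D (Fo c)"
    using obtain_iso[OF k] .
  obtain j where j [simp]: "j \<in> Hom C c x" "Fm c x j = Comp D (Fo c) k (Fo x) i e'"
    using Fm_surj[of c x "Comp D (Fo c) k (Fo x) i e'"] by auto
  have "is_kernel D (Fo c) (Fo x) (Fo y) (Fm c x j) (Fm x y f)"
    unfolding is_kernel_def
  proof (intro conjI ballI impI)
    have "Comp D k (Fo x) (Fo y) (Fm x y f) i = Zero D k (Fo y)" using K unfolding is_kernel_def by auto
    then show "Comp D (Fo c) (Fo x) (Fo y) (Fm x y f) (Fm c x j) = Zero D (Fo c) (Fo y)"
      by (simp flip: D.comp_assoc)
    fix w h assume [simp]: "w \<in> Obj D" "h \<in> Hom D w (Fo x)"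
      and "Comp D w (Fo x) (Fo y) (Fm x y f) h = Zero D w (Fo y)"
    then have ex: "\<exists>!u. u \<in> Hom D w k \<and> Comp D w k (Fo x) i u = h" using K unfolding is_kernel_def by auto
    then obtain u where u [simp]: "u \<in> Hom D w k" "Comp D w k (Fo x) i u = h" by blast
    show "\<exists>!u. u \<in> Hom D w (Fo c) \<and> Comp D w (Fo c) (Fo x) (Fm c x j) u = h"
    proof (rule ex1I[of _ "Comp D w k (Fo c) e u"], intro conjI)
      have "Comp D w (Fo c) k e' (Comp D w k (Fo c) e u) = u" by (simp flip: D.comp_assoc)
      then show "Comp D w (Fo c) (Fo x) (Fm c x j) (Comp D w k (Fo c) e u) = h"
        by (simp add: D.comp_assoc)
      fix v assume v: "v \<in> Hom D w (Fo c) \<and> Comp D w (Fo c) (Fo x) (Fm c x j) v = h"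
      then have [simp]: "v \<in> Hom D w (Fo c)" by blast
      from v have "Comp D w k (Fo x) i (Comp D w (Fo c) k e' v) = h" by (simp add: D.comp_assoc)
      moreover have "Comp D w (Fo c) k e' v \<in> Hom D w k" by simp
      ultimately have "Comp D w (Fo c) k e' v = u" using ex u by blast
      then show "v = Comp D w k (Fo c) e u" using D.comp_assoc[of w "Fo c" k "Fo c" v e' e] by simp
    qed simp
  qed simp_all
  then have "is_kernel C c x y j f" by (rule reflect_kernel[rotated 5]) simp_all
  then show ?thesis using c by blast
qed

lemma preserve_mono:
  assumes [simp]: "x \<in> Obj C" "y \<in> Obj C" and m: "is_mono C x y f"
  shows "is_mono D (Fo x) (Fo y) (Fm x y f)"
proof -
  have [simp]: "f \<in> Hom C x y" using m unfolding is_mono_def by auto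
  show ?thesis unfolding is_mono_def
  proof (intro conjI ballI impI)
    fix d g h assume d [simp]: "d \<in> Obj D" and [simp]: "g \<in> Hom D d (Fo x)" "h \<in> Hom D d (Fo x)"
      and eq: "Comp D d (Fo x) (Fo y) (Fm x y f) g = Comp D d (Fo x) (Fo y) (Fm x y f) h"
    obtain c e e' where c [simp]: "c \<in> Obj C" "e \<in> Hom D d (Fo c)" "e' \<in> Hom D (Fo c) d"
      "Comp D d (Fo c) d e' e = Ide D d" "Comp D (Fo c) d (Fo c) e e' = Ide D (Fo c)"
      using obtain_iso[OF d] .
    obtain g' where g' [simp]: "g' \<in> Hom C c x" "Fm c x g' = Comp D (Fo c) d (Fo x) g e'"
      using Fm_surj[of c x "Comp D (Fo c) d (Fo x) g e'"] by auto
    obtain h' where h' [simp]: "h' \<in> Hom C c x" "Fm c x h' = Comp D (Fo c) d (Fo x) h e'"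
      using Fm_surj[of c x "Comp D (Fo c) d (Fo x) h e'"] by auto
    have "Comp C c x y f g' = Comp C c x y f h'"
      by (rule Fm_inj[of c y]) (simp_all add: Fm_comp eq flip: D.comp_assoc)
    then have "g' = h'" using m c unfolding is_mono_def by (metis g'(1) h'(1))
    then have "Comp D d (Fo c) (Fo x) (Comp D (Fo c) d (Fo x) g e') e
      = Comp D d (Fo c) (Fo x) (Comp D (Fo c) d (Fo x) h e') e" using g' h' by metis
    then show "g = h" by (simp add: D.comp_assoc)
  qed simp
qed

text \<open>The morphism \<open>g\<close> whose kernel is the image of \<open>f\<close> may end
  outside the image of \<open>Fo\<close>; composing it with the isomorphism \<open>e\<close> does
  not change its kernel.\<close>

lemma mono_is_kernel:
  assumes D: "\<And>x y f. \<lbrakk>x \<in> Obj D; y \<in> Obj D; is_mono D x y f\<rbrakk> \<Longrightarrow> \<exists>z\<in>Obj D. \<exists>g. is_kernel D x y z f g"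
    and [simp]: "x \<in> Obj C" "y \<in> Obj C" and m: "is_mono C x y f"
  shows "\<exists>z\<in>Obj C. \<exists>g. is_kernel C x y z f g"
proof -
  have [simp]: "f \<in> Hom C x y" using m unfolding is_mono_def by auto
  obtain z g where z [simp]: "z \<in> Obj D" and K: "is_kernel D (Fo x) (Fo y) z (Fm x y f) g"
    using D[of "Fo x" "Fo y" "Fm x y f"] preserve_mono[OF _ _ m] by auto
  have [simp]: "g \<in> Hom D (Fo y) z" using K unfolding is_kernel_def by auto
  obtain c e e' where c [simp]: "c \<in> Obj C" "e \<in> Hom D z (Fo c)" "e' \<in> Hom D (Fo c) z"
    "Comp D z (Fo c) z e' e = Ide D z" "Comp D (Fo c) z (Fo c) e e' = Ide D (Fo c)"
    using obtain_iso[OF z] .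
  obtain j where j [simp]: "j \<in> Hom C y c" "Fm y c j = Comp D (Fo y) z (Fo c) e g"
    using Fm_surj[of y c "Comp D (Fo y) z (Fo c) e g"] by auto
  have eg: "Comp D w (Fo y) (Fo c) (Comp D (Fo y) z (Fo c) e g) h = Zero D w (Fo c) \<longleftrightarrow>
    Comp D w (Fo y) z g h = Zero D w z" if [simp]: "w \<in> Obj D" "h \<in> Hom D w (Fo y)" for w h
  proof
    assume "Comp D w (Fo y) (Fo c) (Comp D (Fo y) z (Fo c) e g) h = Zero D w (Fo c)"
    then have "Comp D w (Fo c) z e' (Comp D w z (Fo c) e (Comp D w (Fo y) z g h)) = Zero D w z"
      by (simp add: D.comp_assoc)
    then show "Comp D w (Fo y) z g h = Zero D w z" by (simp flip: D.comp_assoc)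
  qed (simp add: D.comp_assoc)
  have "is_kernel D (Fo x) (Fo y) (Fo c) (Fm x y f) (Fm y c j)"
    using K unfolding is_kernel_def by (simp add: eg)
  then have "is_kernel C x y c f j" by (rule reflect_kernel[rotated 5]) simp_all
  then show ?thesis using c by blast
qed

text \<open>The conditions on cokernels and epimorphisms are those on kernels and monomorphisms for
  the opposite equivalence \<open>o\<close>. Zero object and biproducts are moved along isomorphisms
  to objects \<open>Fo c\<close> and lifted.\<close>

lemma reflect_abelian:
  assumes D: "abelian_category D"
  shows "abelian_category C"
proof -
  interpret o: linequiv "op_cat C" "op_cat D" Fo "\<lambda>x y. Fm y x" by (rule op_equiv)
  have zero: "\<exists>z. is_zero_object C z"
  proof -
    obtain z where z: "is_zero_object D z" using D unfolding abelian_category_def by auto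
    then have zD [simp]: "z \<in> Obj D" unfolding is_zero_object_def by auto
    obtain c e e' where c [simp]: "c \<in> Obj C" "e \<in> Hom D z (Fo c)" "e' \<in> Hom D (Fo c) z"
      "Comp D z (Fo c) z e' e = Ide D z" "Comp D (Fo c) z (Fo c) e e' = Ide D (Fo c)"
      using obtain_iso[OF zD] .
    have "e' = Zero D (Fo c) z" using z unfolding is_zero_object_def by (metis c(1,3) Fo_in D.zero_in zD)
    then have "Ide D (Fo c) = Zero D (Fo c) (Fo c)" using c(5) by simp
    then have "Ide C c = Zero C c c" by (intro Fm_inj[of c c]) simp_all
    then show ?thesis using C.zero_object_iff[of c] by auto
  qed
  have bip: "\<exists>b\<in>Obj C. \<exists>i1 i2 p1 p2. is_biproduct C x y b i1 i2 p1 p2"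
    if [simp]: "x \<in> Obj C" "y \<in> Obj C" for x y
  proof -
    obtain b i1 i2 p1 p2 where b [simp]: "b \<in> Obj D" and B: "is_biproduct D (Fo x) (Fo y) b i1 i2 p1 p2"
      using D Fo_in[OF \<open>x \<in> Obj C\<close>] Fo_in[OF \<open>y \<in> Obj C\<close>] unfolding abelian_category_def by blast
    obtain c e e' where c [simp]: "c \<in> Obj C" "e \<in> Hom D b (Fo c)" "e' \<in> Hom D (Fo c) b"
      "Comp D b (Fo c) b e' e = Ide D b" "Comp D (Fo c) b (Fo c) e e' = Ide D (Fo c)"
      using obtain_iso[OF b] .
    have [simp]: "i1 \<in> Hom D (Fo x) b" "i2 \<in> Hom D (Fo y) b" "p1 \<in> Hom D b (Fo x)" "p2 \<in> Hom D b (Fo y)"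
      and rel: "Comp D (Fo x) b (Fo x) p1 i1 = Ide D (Fo x)" "Comp D (Fo y) b (Fo y) p2 i2 = Ide D (Fo y)"
      "Comp D (Fo x) b (Fo y) p2 i1 = Zero D (Fo x) (Fo y)" "Comp D (Fo y) b (Fo x) p1 i2 = Zero D (Fo y) (Fo x)"
      and sum: "Add D b b (Comp D b (Fo x) b i1 p1) (Comp D b (Fo y) b i2 p2) = Ide D b"
      using B unfolding is_biproduct_def by auto
    obtain i1' where i1' [simp]: "i1' \<in> Hom C x c" "Fm x c i1' = Comp D (Fo x) b (Fo c) e i1"
      using Fm_surj[of x c "Comp D (Fo x) b (Fo c) e i1"] by auto
    obtain i2' where i2' [simp]: "i2' \<in> Hom C y c" "Fm y c i2' = Comp D (Fo y) b (Fo c) e i2"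
      using Fm_surj[of y c "Comp D (Fo y) b (Fo c) e i2"] by auto
    obtain p1' where p1' [simp]: "p1' \<in> Hom C c x" "Fm c x p1' = Comp D (Fo c) b (Fo x) p1 e'"
      using Fm_surj[of c x "Comp D (Fo c) b (Fo x) p1 e'"] by auto
    obtain p2' where p2' [simp]: "p2' \<in> Hom C c y" "Fm c y p2' = Comp D (Fo c) b (Fo y) p2 e'"
      using Fm_surj[of c y "Comp D (Fo c) b (Fo y) p2 e'"] by auto
    have ee: "Comp D d (Fo c) b e' (Comp D d b (Fo c) e f) = f" if "d \<in> Obj D" "f \<in> Hom D d b" for d f
      using that by (simp flip: D.comp_assoc)
    have "is_biproduct C x y c i1' i2' p1' p2'"
      unfolding is_biproduct_def
    proof (intro conjI)
      show "Comp C x c x p1' i1' = Ide C x" by (rule Fm_inj[of x x]) (simp_all add: Fm_comp D.comp_assoc ee rel)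
      show "Comp C y c y p2' i2' = Ide C y" by (rule Fm_inj[of y y]) (simp_all add: Fm_comp D.comp_assoc ee rel)
      show "Comp C x c y p2' i1' = Zero C x y" by (rule Fm_inj[of x y]) (simp_all add: Fm_comp D.comp_assoc ee rel)
      show "Comp C y c x p1' i2' = Zero C y x" by (rule Fm_inj[of y x]) (simp_all add: Fm_comp D.comp_assoc ee rel)
      have s: "Comp D (Fo c) b (Fo c) e (Comp D (Fo c) b b (Add D b b (Comp D b (Fo x) b i1 p1) (Comp D b (Fo y) b i2 p2)) e')
        = Ide D (Fo c)" by (simp add: sum)
      show "Add C c c (Comp C c x c i1' p1') (Comp C c y c i2' p2') = Ide C c"
        by (rule Fm_inj[of c c])
          (use s in \<open>simp_all add: Fm_comp Fm_add D.comp_assoc D.comp_add_left D.comp_add_right\<close>)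
    qed simp_all
    then show ?thesis using c by blast
  qed
  have "\<exists>k\<in>Obj C. \<exists>i. is_kernel C k x y i f" if "x \<in> Obj C" "y \<in> Obj C" "f \<in> Hom C x y" for x y f
    by (rule kernel_exists) (use D that in \<open>auto simp: abelian_category_def\<close>)
  moreover have "\<exists>k\<in>Obj (op_cat C). \<exists>i. is_kernel (op_cat C) k y x i f" if "x \<in> Obj C" "y \<in> Obj C" "f \<in> Hom C x y" for x y f
    by (rule o.kernel_exists) (use D that in \<open>auto simp: is_kernel_op abelian_category_def\<close>)
  moreover have "\<exists>z\<in>Obj C. \<exists>g. is_kernel C x y z f g" if "x \<in> Obj C" "y \<in> Obj C" "is_mono C x y f" for x y f
    by (rule mono_is_kernel) (use D that in \<open>auto simp: abelian_category_def\<close>)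
  moreover have "\<exists>z\<in>Obj (op_cat C). \<exists>g. is_kernel (op_cat C) y x z f g" if "x \<in> Obj C" "y \<in> Obj C" "is_epi C x y f" for x y f
    by (rule o.mono_is_kernel) (use D that in \<open>auto simp: is_kernel_op is_mono_op abelian_category_def\<close>)
  ultimately show ?thesis
    unfolding abelian_category_def using C.linear zero bip by (auto simp: is_kernel_op)
qed

lemma exact:
  assumes D: "abelian_category D"
  shows "exact_functor C D Fo Fm"
proof -
  interpret o: linequiv "op_cat C" "op_cat D" Fo "\<lambda>x y. Fm y x" by (rule op_equiv)
  have "short_exact D (Fo x) (Fo y) (Fo z) (Fm x y f) (Fm y z g)"
    if "x \<in> Obj C" "y \<in> Obj C" "z \<in> Obj C" "short_exact C x y z f g" for x y z f g
    using that preserve_kernel[of x y z f g] o.preserve_kernel[of z y x g f]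
    unfolding short_exact_def by (auto simp: is_kernel_op)
  then show ?thesis
    unfolding exact_functor_def using D reflect_abelian lin_functor by auto
qed

end

section \<open>Direct sums of lists of objects\<close>

text \<open>A finite biproduct indexed by a list. For the empty list the last equation says that the
  identity of \<open>X\<close> is zero.\<close>

definition is_dsum ::
  "('k, 'o, 'm) lcat \<Rightarrow> 'o list \<Rightarrow> 'o \<Rightarrow> (nat \<Rightarrow> 'm) \<Rightarrow> (nat \<Rightarrow> 'm) \<Rightarrow> bool" where
  "is_dsum C xs X \<iota> \<pi> \<longleftrightarrow>
     (\<forall>k<length xs. \<iota> k \<in> Hom C (xs ! k) X \<and> \<pi> k \<in> Hom C X (xs ! k)) \<and>
     (\<forall>k<length xs. \<forall>l<length xs. Comp C (xs ! l) X (xs ! k) (\<pi> k) (\<iota> l) =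
        (if k = l then Ide C (xs ! k) else Zero C (xs ! l) (xs ! k))) \<and>
     hom_sum C X X (map (\<lambda>k. Comp C X (xs ! k) X (\<iota> k) (\<pi> k)) [0..<length xs]) = Ide C X"

lemma is_dsumD:
  assumes "is_dsum C xs X \<iota> \<pi>"
  shows "k < length xs \<Longrightarrow> \<iota> k \<in> Hom C (xs ! k) X" "k < length xs \<Longrightarrow> \<pi> k \<in> Hom C X (xs ! k)"
    "k < length xs \<Longrightarrow> l < length xs \<Longrightarrow> Comp C (xs ! l) X (xs ! k) (\<pi> k) (\<iota> l) =
        (if k = l then Ide C (xs ! k) else Zero C (xs ! l) (xs ! k))"
    "hom_sum C X X (map (\<lambda>k. Comp C X (xs ! k) X (\<iota> k) (\<pi> k)) [0..<length xs]) = Ide C X"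
  using assms unfolding is_dsum_def by blast+

text \<open>The morphism of direct sums with matrix \<open>m\<close>; \<open>dsum_entry\<close>
  reads the matrix off again.\<close>

definition dsum_mor where
  "dsum_mor C xs X \<pi> ys Y \<iota> m = hom_sum C X Y (map (\<lambda>i. hom_sum C X Y (map (\<lambda>j.
     Comp C X (ys ! i) Y (\<iota> i) (Comp C X (xs ! j) (ys ! i) (m i j) (\<pi> j))) [0..<length xs])) [0..<length ys])"

definition dsum_entry where
  "dsum_entry C xs X \<iota> ys Y \<pi> f i j =
     Comp C (xs ! j) X (ys ! i) (Comp C X Y (ys ! i) (\<pi> i) f) (\<iota> j)"

context lincat
begin

lemma nth_Obj [simp]: "xs \<in> lists (Obj C) \<Longrightarrow> k < length xs \<Longrightarrow> xs ! k \<in> Obj C"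
  by (auto simp: in_lists_conv_set)

lemma dsum_Nil: "is_zero_object C z \<Longrightarrow> is_dsum C [] z \<iota> \<pi>"
  unfolding is_dsum_def using zero_object_iff[of z] by (auto simp: is_zero_object_def)

lemma dsum_single: "x \<in> Obj C \<Longrightarrow> is_dsum C [x] x (\<lambda>_. Ide C x) (\<lambda>_. Ide C x)"
  unfolding is_dsum_def by auto

text \<open>Index 0 belongs to the new summand \<open>x\<close>; \<open>case_nat\<close> shifts the
  indices of the old list by one.\<close>

lemma dsum_Cons:
  assumes x: "x \<in> Obj C" "K \<in> Obj C" "b \<in> Obj C" "xs \<in> lists (Obj C)"
    and B: "is_biproduct C x K b i1 i2 p1 p2" and S: "is_dsum C xs K \<iota> \<pi>"
  shows "is_dsum C (x # xs) b (case_nat i1 (\<lambda>k. Comp C (xs ! k) K b i2 (\<iota> k)))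
    (case_nat p1 (\<lambda>k. Comp C b K (xs ! k) (\<pi> k) p2))"
proof -
  note [simp] = x
  have [simp]: "i1 \<in> Hom C x b" "i2 \<in> Hom C K b" "p1 \<in> Hom C b x" "p2 \<in> Hom C b K"
    and r: "Comp C x b x p1 i1 = Ide C x" "Comp C K b K p2 i2 = Ide C K"
      "Comp C x b K p2 i1 = Zero C x K" "Comp C K b x p1 i2 = Zero C K x"
    and s: "Add C b b (Comp C b x b i1 p1) (Comp C b K b i2 p2) = Ide C b"
    using B unfolding is_biproduct_def by auto
  note D [simp] = is_dsumD(1,2)[OF S]
  have a: "\<forall>k<length (x # xs). case_nat i1 (\<lambda>k. Comp C (xs ! k) K b i2 (\<iota> k)) k \<in> Hom C ((x # xs) ! k) b \<and>
      case_nat p1 (\<lambda>k. Comp C b K (xs ! k) (\<pi> k) p2) k \<in> Hom C b ((x # xs) ! k)"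
    by (auto split: nat.split)
  have k1: "Comp C (xs ! l) b x p1 (Comp C (xs ! l) K b i2 (\<iota> l)) = Zero C (xs ! l) x" if "l < length xs" for l
    using comp_assoc[of "xs ! l" K b x "\<iota> l" i2 p1] that r by simp
  have k2: "Comp C x b (xs ! k) (Comp C b K (xs ! k) (\<pi> k) p2) i1 = Zero C x (xs ! k)" if "k < length xs" for k
    using comp_assoc[of x b K "xs ! k" i1 p2 "\<pi> k"] that r by simp
  have k3: "Comp C (xs ! l) b (xs ! k) (Comp C b K (xs ! k) (\<pi> k) p2) (Comp C (xs ! l) K b i2 (\<iota> l))
     = Comp C (xs ! l) K (xs ! k) (\<pi> k) (\<iota> l)" if "k < length xs" "l < length xs" for k l
    using comp_assoc[of "xs ! l" K b K "\<iota> l" i2 p2] that r by (simp add: comp_assoc)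
  have b: "\<forall>k<length (x # xs). \<forall>l<length (x # xs).
     Comp C ((x # xs) ! l) b ((x # xs) ! k) (case_nat p1 (\<lambda>k. Comp C b K (xs ! k) (\<pi> k) p2) k)
        (case_nat i1 (\<lambda>k. Comp C (xs ! k) K b i2 (\<iota> k)) l) =
        (if k = l then Ide C ((x # xs) ! k) else Zero C ((x # xs) ! l) ((x # xs) ! k))"
    using k1 k2 k3 r is_dsumD(3)[OF S] by (auto split: nat.split)
  have c: "hom_sum C b b (map (\<lambda>k. Comp C b (xs ! k) b (Comp C (xs ! k) K b i2 (\<iota> k)) (Comp C b K (xs ! k) (\<pi> k) p2)) [0..<length xs])
     = Comp C b K b i2 p2"
  proof -
    have "hom_sum C b b (map (\<lambda>k. Comp C b (xs ! k) b (Comp C (xs ! k) K b i2 (\<iota> k)) (Comp C b K (xs ! k) (\<pi> k) p2)) [0..<length xs])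
      = hom_sum C b b (map (\<lambda>k. Comp C b K b (Comp C K K b i2 (Comp C K (xs ! k) K (\<iota> k) (\<pi> k))) p2) [0..<length xs])"
      by (rule hom_sum_cong) (simp add: comp_assoc)
    also have "\<dots> = Comp C b K b (hom_sum C K b (map (\<lambda>k. Comp C K K b i2 (Comp C K (xs ! k) K (\<iota> k) (\<pi> k))) [0..<length xs])) p2"
      by (rule comp_hom_sum_left[symmetric]) auto
    also have "hom_sum C K b (map (\<lambda>k. Comp C K K b i2 (Comp C K (xs ! k) K (\<iota> k) (\<pi> k))) [0..<length xs])
      = Comp C K K b i2 (hom_sum C K K (map (\<lambda>k. Comp C K (xs ! k) K (\<iota> k) (\<pi> k)) [0..<length xs]))"
      by (rule comp_hom_sum_right[symmetric]) auto
    finally show ?thesis unfolding is_dsumD(4)[OF S] by simp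
  qed
  have "[0..<length (x # xs)] = 0 # map Suc [0..<length xs]" by (simp add: map_Suc_upt upt_conv_Cons del: upt_Suc)
  then have d: "hom_sum C b b (map (\<lambda>k. Comp C b ((x # xs) ! k) b (case_nat i1 (\<lambda>k. Comp C (xs ! k) K b i2 (\<iota> k)) k)
      (case_nat p1 (\<lambda>k. Comp C b K (xs ! k) (\<pi> k) p2) k)) [0..<length (x # xs)]) = Ide C b"
    using c s by (simp add: comp_def del: upt_Suc)
  show ?thesis unfolding is_dsum_def using a b d by blast
qed

text \<open>Inserting the resolution of the identity of \<open>X\<close> shows that a map into it is
  determined by its components.\<close>

lemma dsum_ext_left:
  assumes x: "w \<in> Obj C" "X \<in> Obj C" "xs \<in> lists (Obj C)" and S: "is_dsum C xs X \<iota> \<pi>"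
    and f: "f \<in> Hom C w X" "g \<in> Hom C w X"
    and e: "\<And>k. k < length xs \<Longrightarrow> Comp C w X (xs ! k) (\<pi> k) f = Comp C w X (xs ! k) (\<pi> k) g"
  shows "f = g"
proof -
  note [simp] = x is_dsumD(1,2)[OF S]
  have *: "h = hom_sum C w X (map (\<lambda>k. Comp C w (xs ! k) X (\<iota> k) (Comp C w X (xs ! k) (\<pi> k) h)) [0..<length xs])"
    if [simp]: "h \<in> Hom C w X" for h
  proof -
    have "h = Comp C w X X (Ide C X) h" by simp
    also have "\<dots> = hom_sum C w X (map (\<lambda>k. Comp C w X X (Comp C X (xs ! k) X (\<iota> k) (\<pi> k)) h) [0..<length xs])"
      unfolding is_dsumD(4)[OF S, symmetric] by (rule comp_hom_sum_left) auto
    also have "\<dots> = hom_sum C w X (map (\<lambda>k. Comp C w (xs ! k) X (\<iota> k) (Comp C w X (xs ! k) (\<pi> k) h)) [0..<length xs])"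
      by (rule arg_cong[of _ _ "hom_sum C w X"], rule map_cong) (auto simp: comp_assoc)
    finally show ?thesis .
  qed
  have "hom_sum C w X (map (\<lambda>k. Comp C w (xs ! k) X (\<iota> k) (Comp C w X (xs ! k) (\<pi> k) f)) [0..<length xs])
    = hom_sum C w X (map (\<lambda>k. Comp C w (xs ! k) X (\<iota> k) (Comp C w X (xs ! k) (\<pi> k) g)) [0..<length xs])"
    by (rule hom_sum_cong) (simp add: e)
  then show ?thesis by (rule trans[OF *[OF f(1)] trans[OF _ *[OF f(2), symmetric]]])
qed

lemma dsum_expand_right:
  assumes x: "w \<in> Obj C" "X \<in> Obj C" "xs \<in> lists (Obj C)" and S: "is_dsum C xs X \<iota> \<pi>"
    and h: "h \<in> Hom C X w"
  shows "h = hom_sum C X w (map (\<lambda>k. Comp C X (xs ! k) w (Comp C (xs ! k) X w h (\<iota> k)) (\<pi> k)) [0..<length xs])"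
proof -
  note [simp] = x is_dsumD(1,2)[OF S] h
  have "h = Comp C X X w h (Ide C X)" by simp
  also have "\<dots> = hom_sum C X w (map (\<lambda>k. Comp C X X w h (Comp C X (xs ! k) X (\<iota> k) (\<pi> k))) [0..<length xs])"
    unfolding is_dsumD(4)[OF S, symmetric] by (rule comp_hom_sum_right) auto
  also have "\<dots> = hom_sum C X w (map (\<lambda>k. Comp C X (xs ! k) w (Comp C (xs ! k) X w h (\<iota> k)) (\<pi> k)) [0..<length xs])"
    by (rule arg_cong[of _ _ "hom_sum C X w"], rule map_cong) (auto simp: comp_assoc)
  finally show ?thesis .
qed

lemma dsum_ext_right:
  assumes x: "w \<in> Obj C" "X \<in> Obj C" "xs \<in> lists (Obj C)" and S: "is_dsum C xs X \<iota> \<pi>"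
    and f: "f \<in> Hom C X w" "g \<in> Hom C X w"
    and e: "\<And>k. k < length xs \<Longrightarrow> Comp C (xs ! k) X w f (\<iota> k) = Comp C (xs ! k) X w g (\<iota> k)"
  shows "f = g"
proof -
  have "hom_sum C X w (map (\<lambda>k. Comp C X (xs ! k) w (Comp C (xs ! k) X w f (\<iota> k)) (\<pi> k)) [0..<length xs])
    = hom_sum C X w (map (\<lambda>k. Comp C X (xs ! k) w (Comp C (xs ! k) X w g (\<iota> k)) (\<pi> k)) [0..<length xs])"
    by (rule hom_sum_cong) (simp add: e)
  then show ?thesis
    by (rule trans[OF dsum_expand_right[OF x S f(1)] trans[OF _ dsum_expand_right[OF x S f(2), symmetric]]])
qed

lemma dsum_ext:
  assumes x: "X \<in> Obj C" "xs \<in> lists (Obj C)" "Y \<in> Obj C" "ys \<in> lists (Obj C)"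
    and S: "is_dsum C xs X \<iota> \<pi>" and T: "is_dsum C ys Y \<iota>' \<pi>'"
    and f: "f \<in> Hom C X Y" "g \<in> Hom C X Y"
    and e: "\<And>i j. i < length ys \<Longrightarrow> j < length xs \<Longrightarrow>
      dsum_entry C xs X \<iota> ys Y \<pi>' f i j = dsum_entry C xs X \<iota> ys Y \<pi>' g i j"
  shows "f = g"
proof (rule dsum_ext_left[OF x(1,3,4) T f])
  fix k assume k: "k < length ys"
  show "Comp C X Y (ys ! k) (\<pi>' k) f = Comp C X Y (ys ! k) (\<pi>' k) g"
  proof (rule dsum_ext_right[OF _ x(1,2) S])
    fix j assume "j < length xs"
    then show "Comp C (xs ! j) X (ys ! k) (Comp C X Y (ys ! k) (\<pi>' k) f) (\<iota> j) =
         Comp C (xs ! j) X (ys ! k) (Comp C X Y (ys ! k) (\<pi>' k) g) (\<iota> j)"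
      using e[OF k] unfolding dsum_entry_def by simp
  qed (use x f k is_dsumD(2)[OF T] in auto)
qed

lemma dsum_entry_in:
  assumes "X \<in> Obj C" "xs \<in> lists (Obj C)" "Y \<in> Obj C" "ys \<in> lists (Obj C)"
    "is_dsum C xs X \<iota> \<pi>" "is_dsum C ys Y \<iota>' \<pi>'" "f \<in> Hom C X Y" "i < length ys" "j < length xs"
  shows "dsum_entry C xs X \<iota> ys Y \<pi>' f i j \<in> Hom C (xs ! j) (ys ! i)"
  unfolding dsum_entry_def using assms is_dsumD(1)[OF assms(5)] is_dsumD(2)[OF assms(6)] by simp

lemma dsum_mor_in:
  assumes x: "X \<in> Obj C" "xs \<in> lists (Obj C)" "Y \<in> Obj C" "ys \<in> lists (Obj C)"
    and S: "is_dsum C xs X \<iota> \<pi>" and T: "is_dsum C ys Y \<iota>' \<pi>'"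
    and m: "\<And>i j. i < length ys \<Longrightarrow> j < length xs \<Longrightarrow> m i j \<in> Hom C (xs ! j) (ys ! i)"
  shows "dsum_mor C xs X \<pi> ys Y \<iota>' m \<in> Hom C X Y"
  unfolding dsum_mor_def using x is_dsumD(2)[OF S] is_dsumD(1)[OF T] m
  by (auto intro!: hom_sum_in comp_in)

text \<open>Composing the double sum with a projection and an injection leaves, by orthogonality,
  the single term with indices \<open>k\<close> and \<open>l\<close>.\<close>

lemma dsum_entry_mor:
  assumes x: "X \<in> Obj C" "xs \<in> lists (Obj C)" "Y \<in> Obj C" "ys \<in> lists (Obj C)"
    and S: "is_dsum C xs X \<iota> \<pi>" and T: "is_dsum C ys Y \<iota>' \<pi>'"
    and m: "\<And>i j. i < length ys \<Longrightarrow> j < length xs \<Longrightarrow> m i j \<in> Hom C (xs ! j) (ys ! i)"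
    and k: "k < length ys" and l: "l < length xs"
  shows "dsum_entry C xs X \<iota> ys Y \<pi>' (dsum_mor C xs X \<pi> ys Y \<iota>' m) k l = m k l"
proof -
  note [simp] = x is_dsumD(1,2)[OF S] is_dsumD(1,2)[OF T] m k l
  define t where "t i j = Comp C X (ys ! i) Y (\<iota>' i) (Comp C X (xs ! j) (ys ! i) (m i j) (\<pi> j))" for i j
  have t [simp]: "t i j \<in> Hom C X Y" if "i < length ys" "j < length xs" for i j
    using that by (simp add: t_def)
  have e: "Comp C (xs ! l) X (ys ! k) (Comp C X Y (ys ! k) (\<pi>' k) (t i j)) (\<iota> l)
     = (if i = k then if j = l then m k l else Zero C (xs ! l) (ys ! k) else Zero C (xs ! l) (ys ! k))"
    if [simp]: "i < length ys" "j < length xs" for i j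
  proof -
    have "Comp C (xs ! l) X (ys ! k) (Comp C X Y (ys ! k) (\<pi>' k) (t i j)) (\<iota> l)
      = Comp C (xs ! l) (ys ! i) (ys ! k) (Comp C (ys ! i) Y (ys ! k) (\<pi>' k) (\<iota>' i))
         (Comp C (xs ! l) (xs ! j) (ys ! i) (m i j) (Comp C (xs ! l) X (xs ! j) (\<pi> j) (\<iota> l)))"
      unfolding t_def by (simp add: comp_assoc)
    then show ?thesis using is_dsumD(3)[OF T k, of i] is_dsumD(3)[OF S, of j l] by auto
  qed
  have "dsum_entry C xs X \<iota> ys Y \<pi>' (dsum_mor C xs X \<pi> ys Y \<iota>' m) k l
    = hom_sum C (xs ! l) (ys ! k) (map (\<lambda>i. hom_sum C (xs ! l) (ys ! k) (map (\<lambda>j.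
        Comp C (xs ! l) X (ys ! k) (Comp C X Y (ys ! k) (\<pi>' k) (t i j)) (\<iota> l)) [0..<length xs])) [0..<length ys])"
    unfolding dsum_entry_def dsum_mor_def t_def[symmetric]
    by (simp add: comp_hom_sum_right comp_hom_sum_left cong: map_cong add: mem_uptD del: set_upt)
  also have "\<dots> = hom_sum C (xs ! l) (ys ! k) (map (\<lambda>i. if i = k then m k l else Zero C (xs ! l) (ys ! k)) [0..<length ys])"
  proof (rule arg_cong[of _ _ "hom_sum C (xs ! l) (ys ! k)"], rule map_cong[OF refl])
    fix i assume i: "i \<in> set [0..<length ys]"
    let ?z = "Zero C (xs ! l) (ys ! k)"
    let ?m = "if i = k then m k l else ?z"
    have "hom_sum C (xs ! l) (ys ! k) (map (\<lambda>j. Comp C (xs ! l) X (ys ! k) (Comp C X Y (ys ! k) (\<pi>' k) (t i j)) (\<iota> l)) [0..<length xs])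
      = hom_sum C (xs ! l) (ys ! k) (map (\<lambda>j. if j = l then ?m else ?z) [0..<length xs])"
      by (rule hom_sum_cong) (use e i in auto)
    also have "\<dots> = ?m"
      using hom_sum_delta[of "xs ! l" "ys ! k" "[0..<length xs]" l "\<lambda>j. if j = l then ?m else ?z"]
      by (cases "i = k") simp_all
    finally show "hom_sum C (xs ! l) (ys ! k) (map (\<lambda>j. Comp C (xs ! l) X (ys ! k) (Comp C X Y (ys ! k) (\<pi>' k) (t i j)) (\<iota> l)) [0..<length xs])
      = ?m" .
  qed
  also have "\<dots> = m k l"
    using hom_sum_delta[of "xs ! l" "ys ! k" "[0..<length ys]" k "\<lambda>i. if i = k then m k l else Zero C (xs ! l) (ys ! k)"]
    by simp
  finally show ?thesis .
qed

text \<open>Matrix multiplication: the resolution of the identity of the middle object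
  \<open>Y\<close> is inserted between \<open>g\<close> and \<open>f\<close>.\<close>

lemma dsum_entry_comp:
  assumes x: "X \<in> Obj C" "xs \<in> lists (Obj C)" "Y \<in> Obj C" "ys \<in> lists (Obj C)" "Z \<in> Obj C" "zs \<in> lists (Obj C)"
    and S: "is_dsum C xs X \<iota> \<pi>" and T: "is_dsum C ys Y \<iota>' \<pi>'" and U: "is_dsum C zs Z \<iota>'' \<pi>''"
    and f: "f \<in> Hom C X Y" and g: "g \<in> Hom C Y Z" and i: "i < length zs" and j: "j < length xs"
  shows "dsum_entry C xs X \<iota> zs Z \<pi>'' (Comp C X Y Z g f) i j =
    hom_sum C (xs ! j) (zs ! i) (map (\<lambda>l. Comp C (xs ! j) (ys ! l) (zs ! i)
      (dsum_entry C ys Y \<iota>' zs Z \<pi>'' g i l) (dsum_entry C xs X \<iota> ys Y \<pi>' f l j)) [0..<length ys])"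
proof -
  note [simp] = x is_dsumD(1,2)[OF S] is_dsumD(1,2)[OF T] is_dsumD(1,2)[OF U] f g i j
  define h where "h = Comp C Y Z (zs ! i) (\<pi>'' i) g"
  have h [simp]: "h \<in> Hom C Y (zs ! i)" by (simp add: h_def)
  define r where "r = Comp C (xs ! j) X Y f (\<iota> j)"
  have r [simp]: "r \<in> Hom C (xs ! j) Y" by (simp add: r_def)
  have "dsum_entry C xs X \<iota> zs Z \<pi>'' (Comp C X Y Z g f) i j = Comp C (xs ! j) Y (zs ! i) h r"
    unfolding dsum_entry_def h_def r_def by (simp add: comp_assoc)
  also have "\<dots> = Comp C (xs ! j) Y (zs ! i) (hom_sum C Y (zs ! i) (map (\<lambda>k. Comp C Y (ys ! k) (zs ! i) (Comp C (ys ! k) Y (zs ! i) h (\<iota>' k)) (\<pi>' k)) [0..<length ys])) r"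
    using dsum_expand_right[of "zs ! i" Y ys \<iota>' \<pi>' h, OF _ _ _ T] by simp
  also have "\<dots> = hom_sum C (xs ! j) (zs ! i) (map (\<lambda>k. Comp C (xs ! j) Y (zs ! i) (Comp C Y (ys ! k) (zs ! i) (Comp C (ys ! k) Y (zs ! i) h (\<iota>' k)) (\<pi>' k)) r) [0..<length ys])"
    by (rule comp_hom_sum_left) auto
  also have "\<dots> = hom_sum C (xs ! j) (zs ! i) (map (\<lambda>l. Comp C (xs ! j) (ys ! l) (zs ! i)
      (dsum_entry C ys Y \<iota>' zs Z \<pi>'' g i l) (dsum_entry C xs X \<iota> ys Y \<pi>' f l j)) [0..<length ys])"
    by (rule arg_cong[of _ _ "hom_sum C (xs ! j) (zs ! i)"], rule map_cong[OF refl])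
      (simp add: dsum_entry_def h_def r_def comp_assoc)
  finally show ?thesis .
qed

lemma dsum_entry_ide:
  assumes "X \<in> Obj C" "xs \<in> lists (Obj C)" "is_dsum C xs X \<iota> \<pi>" "i < length xs" "j < length xs"
  shows "dsum_entry C xs X \<iota> xs X \<pi> (Ide C X) i j =
    (if i = j then Ide C (xs ! i) else Zero C (xs ! j) (xs ! i))"
  unfolding dsum_entry_def using assms is_dsumD[OF assms(3)] by simp

text \<open>A map matching the projections of both direct sums exists in either direction, and since
  components determine maps, the two are inverse to each other.\<close>

lemma dsum_isomorphic:
  assumes x: "X \<in> Obj C" "Y \<in> Obj C" "xs \<in> lists (Obj C)"
    and S: "is_dsum C xs X \<iota> \<pi>" and T: "is_dsum C xs Y \<iota>' \<pi>'"
  shows "isomorphic_in C X Y"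
proof -
  have half: "\<exists>f\<in>Hom C X Y. \<forall>k<length xs. Comp C X Y (xs ! k) (\<pi>' k) f = \<pi> k"
    if x: "X \<in> Obj C" "Y \<in> Obj C" and S: "is_dsum C xs X \<iota> \<pi>" and T: "is_dsum C xs Y \<iota>' \<pi>'"
    for X Y \<iota> \<pi> \<iota>' \<pi>'
  proof -
    note [simp] = x \<open>xs \<in> lists (Obj C)\<close> is_dsumD(1,2)[OF S] is_dsumD(1,2)[OF T]
    define f where "f = hom_sum C X Y (map (\<lambda>k. Comp C X (xs ! k) Y (\<iota>' k) (\<pi> k)) [0..<length xs])"
    have f: "f \<in> Hom C X Y" unfolding f_def by (rule hom_sum_in) auto
    moreover have "Comp C X Y (xs ! k) (\<pi>' k) f = \<pi> k" if k [simp]: "k < length xs" for k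
    proof -
      have "Comp C X Y (xs ! k) (\<pi>' k) f
        = hom_sum C X (xs ! k) (map (\<lambda>l. Comp C X Y (xs ! k) (\<pi>' k) (Comp C X (xs ! l) Y (\<iota>' l) (\<pi> l))) [0..<length xs])"
        unfolding f_def by (rule comp_hom_sum_right) auto
      also have "\<dots> = hom_sum C X (xs ! k) (map (\<lambda>l. if l = k then \<pi> k else Zero C X (xs ! k)) [0..<length xs])"
        by (rule arg_cong[of _ _ "hom_sum C X (xs ! k)"], rule map_cong[OF refl])
          (simp flip: comp_assoc add: is_dsumD(3)[OF T])
      also have "\<dots> = \<pi> k"
        using hom_sum_delta[of X "xs ! k" "[0..<length xs]" k "\<lambda>l. if l = k then \<pi> k else Zero C X (xs ! k)"] by simp
      finally show ?thesis .
    qed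
    ultimately show ?thesis by blast
  qed
  obtain f where f: "f \<in> Hom C X Y" "\<forall>k<length xs. Comp C X Y (xs ! k) (\<pi>' k) f = \<pi> k"
    using half[OF x(1,2) S T] by blast
  obtain g where g: "g \<in> Hom C Y X" "\<forall>k<length xs. Comp C Y X (xs ! k) (\<pi> k) g = \<pi>' k"
    using half[OF x(2,1) T S] by blast
  note [simp] = x f(1) g(1) is_dsumD(1,2)[OF S] is_dsumD(1,2)[OF T]
  have "Comp C X Y X g f = Ide C X"
    by (rule dsum_ext_left[OF x(1,1,3) S]) (use f(2) g(2) in \<open>simp_all flip: comp_assoc\<close>)
  moreover have "Comp C Y X Y f g = Ide C Y"
    by (rule dsum_ext_left[OF x(2,2,3) T]) (use f(2) g(2) in \<open>simp_all flip: comp_assoc\<close>)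
  ultimately show ?thesis unfolding isomorphic_in_def is_iso_def using f g by blast
qed

end

lemma (in linfun) preserve_dsum:
  assumes x: "X \<in> Obj C" "xs \<in> lists (Obj C)" and S: "is_dsum C xs X \<iota> \<pi>"
  shows "is_dsum D (map Fo xs) (Fo X) (\<lambda>k. Fm (xs ! k) X (\<iota> k)) (\<lambda>k. Fm X (xs ! k) (\<pi> k))"
proof -
  note [simp] = x is_dsumD(1,2)[OF S]
  have "hom_sum D (Fo X) (Fo X) (map (\<lambda>k. Comp D (Fo X) (Fo (xs ! k)) (Fo X) (Fm (xs ! k) X (\<iota> k)) (Fm X (xs ! k) (\<pi> k))) [0..<length xs])
    = hom_sum D (Fo X) (Fo X) (map (\<lambda>k. Fm X X (Comp C X (xs ! k) X (\<iota> k) (\<pi> k))) [0..<length xs])"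
    by (rule arg_cong[of _ _ "hom_sum D (Fo X) (Fo X)"], rule map_cong[OF refl]) (simp add: Fm_comp)
  also have "\<dots> = Fm X X (Ide C X)"
    unfolding is_dsumD(4)[OF S, symmetric] by (rule Fm_hom_sum[symmetric]) auto
  finally have "hom_sum D (Fo X) (Fo X) (map (\<lambda>k. Comp D (Fo X) (map Fo xs ! k) (Fo X) (Fm (xs ! k) X (\<iota> k)) (Fm X (xs ! k) (\<pi> k))) [0..<length (map Fo xs)])
    = Ide D (Fo X)" by (simp cong: map_cong add: mem_uptD del: set_upt)
  moreover have "Comp D (map Fo xs ! l) (Fo X) (map Fo xs ! k) (Fm X (xs ! k) (\<pi> k)) (Fm (xs ! l) X (\<iota> l)) =
        (if k = l then Ide D (map Fo xs ! k) else Zero D (map Fo xs ! l) (map Fo xs ! k))"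
    if "k < length xs" "l < length xs" for k l
    using is_dsumD(3)[OF S that] that Fm_comp[of "xs ! l" X "xs ! k" "\<iota> l" "\<pi> k"] by auto
  ultimately show ?thesis unfolding is_dsum_def by auto
qed

text \<open>A morphism between direct sums amounts to its matrix, and a linear functor acts
  entrywise; so bijectivity on the hom-spaces between summands suffices.\<close>

lemma (in linfun) fully_faithful_from_summands:
  assumes dec: "\<And>X. X \<in> Obj C \<Longrightarrow> \<exists>xs \<iota> \<pi>. xs \<in> lists S \<and> is_dsum C xs X \<iota> \<pi>"
    and S: "S \<subseteq> Obj C"
    and ff: "\<And>x y. x \<in> S \<Longrightarrow> y \<in> S \<Longrightarrow> bij_betw (Fm x y) (Hom C x y) (Hom D (Fo x) (Fo y))"
  shows "fully_faithful C D Fo Fm"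
  unfolding fully_faithful_def
proof (intro ballI)
  fix X Y assume X [simp]: "X \<in> Obj C" and Y [simp]: "Y \<in> Obj C"
  obtain xs \<iota> \<pi> where xs: "xs \<in> lists S" and dX: "is_dsum C xs X \<iota> \<pi>" using dec[OF X] by blast
  obtain ys \<iota>' \<pi>' where ys: "ys \<in> lists S" and dY: "is_dsum C ys Y \<iota>' \<pi>'" using dec[OF Y] by blast
  have xs' [simp]: "xs \<in> lists (Obj C)" "ys \<in> lists (Obj C)" using xs ys S by (auto simp: in_lists_conv_set)
  have inS: "k < length xs \<Longrightarrow> xs ! k \<in> S" "k < length ys \<Longrightarrow> ys ! k \<in> S" for k
    using xs ys by (auto simp: in_lists_conv_set)
  have mObj [simp]: "map Fo xs \<in> lists (Obj D)" "map Fo ys \<in> lists (Obj D)"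
    using xs'[unfolded in_lists_conv_set] by (auto simp: in_lists_conv_set)
  note dFX = preserve_dsum[OF X xs'(1) dX] and dFY = preserve_dsum[OF Y xs'(2) dY]
  note [simp] = is_dsumD(1,2)[OF dX] is_dsumD(1,2)[OF dY]
  have entry: "dsum_entry D (map Fo xs) (Fo X) (\<lambda>k. Fm (xs ! k) X (\<iota> k)) (map Fo ys) (Fo Y) (\<lambda>k. Fm Y (ys ! k) (\<pi>' k)) (Fm X Y f) i j
    = Fm (xs ! j) (ys ! i) (dsum_entry C xs X \<iota> ys Y \<pi>' f i j)"
    if "f \<in> Hom C X Y" "i < length ys" "j < length xs" for f i j
    using that by (simp add: dsum_entry_def Fm_comp)
  show "bij_betw (Fm X Y) (Hom C X Y) (Hom D (Fo X) (Fo Y))"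
    unfolding bij_betw_def
  proof (intro conjI inj_onI subset_antisym subsetI)
    fix f g assume fg: "f \<in> Hom C X Y" "g \<in> Hom C X Y" "Fm X Y f = Fm X Y g"
    show "f = g"
    proof (rule C.dsum_ext[OF X xs'(1) Y xs'(2) dX dY fg(1,2)])
      fix i j assume ij: "i < length ys" "j < length xs"
      have "Fm (xs ! j) (ys ! i) (dsum_entry C xs X \<iota> ys Y \<pi>' f i j) = Fm (xs ! j) (ys ! i) (dsum_entry C xs X \<iota> ys Y \<pi>' g i j)"
        using entry[OF fg(1) ij] entry[OF fg(2) ij] fg(3) by simp
      moreover have "inj_on (Fm (xs ! j) (ys ! i)) (Hom C (xs ! j) (ys ! i))"
        using ff[OF inS(1)[OF ij(2)] inS(2)[OF ij(1)]] by (simp add: bij_betw_def)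
      ultimately show "dsum_entry C xs X \<iota> ys Y \<pi>' f i j = dsum_entry C xs X \<iota> ys Y \<pi>' g i j"
        using C.dsum_entry_in[OF X xs'(1) Y xs'(2) dX dY _ ij] fg by (meson inj_onD)
    qed
  next
    fix h assume h [simp]: "h \<in> Hom D (Fo X) (Fo Y)"
    let ?e = "dsum_entry D (map Fo xs) (Fo X) (\<lambda>k. Fm (xs ! k) X (\<iota> k)) (map Fo ys) (Fo Y) (\<lambda>k. Fm Y (ys ! k) (\<pi>' k))"
    define m where "m i j = inv_into (Hom C (xs ! j) (ys ! i)) (Fm (xs ! j) (ys ! i)) (?e h i j)" for i j
    have m: "m i j \<in> Hom C (xs ! j) (ys ! i)" "Fm (xs ! j) (ys ! i) (m i j) = ?e h i j"
      if ij: "i < length ys" "j < length xs" for i j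
    proof -
      have "?e h i j \<in> Hom D (map Fo xs ! j) (map Fo ys ! i)"
        by (rule D.dsum_entry_in[OF _ mObj(1) _ mObj(2) dFX dFY]) (use ij in simp_all)
      then have "?e h i j \<in> Fm (xs ! j) (ys ! i) ` Hom C (xs ! j) (ys ! i)"
        using ff[OF inS(1)[OF ij(2)] inS(2)[OF ij(1)]] ij by (simp add: bij_betw_def)
      then show "m i j \<in> Hom C (xs ! j) (ys ! i)" "Fm (xs ! j) (ys ! i) (m i j) = ?e h i j"
        unfolding m_def by (auto intro: inv_into_into f_inv_into_f)
    qed
    define f where "f = dsum_mor C xs X \<pi> ys Y \<iota>' m"
    have f [simp]: "f \<in> Hom C X Y" unfolding f_def by (rule C.dsum_mor_in[OF X xs'(1) Y xs'(2) dX dY m(1)])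
    have "Fm X Y f = h"
    proof (rule D.dsum_ext[OF _ mObj(1) _ mObj(2) dFX dFY])
      fix i j assume "i < length (map Fo ys)" "j < length (map Fo xs)"
      then have ij: "i < length ys" "j < length xs" by auto
      show "?e (Fm X Y f) i j = ?e h i j"
        unfolding entry[OF f ij] unfolding f_def
        by (simp add: C.dsum_entry_mor[OF X xs'(1) Y xs'(2) dX dY m(1) ij] m(2)[OF ij])
    qed simp_all
    then show "h \<in> Fm X Y ` Hom C X Y" using f by blast
  qed auto
qed

section \<open>The additive hull\<close>

lemma hull_sel [simp]:
  "Obj (additive_hull C) = lists (Obj C)"
  "Ide (additive_hull C) xs = hom_matrix (length xs) (length xs)
     (\<lambda>i j. if i = j then Ide C (xs ! i) else Zero C (xs ! j) (xs ! i))"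
  "Comp (additive_hull C) xs ys zs B A = hom_matrix (length zs) (length xs)
     (\<lambda>i j. hom_sum C (xs ! j) (zs ! i)
        (map (\<lambda>l. Comp C (xs ! j) (ys ! l) (zs ! i) (B i l) (A l j)) [0..<length ys]))"
  "Add (additive_hull C) xs ys A B = hom_matrix (length ys) (length xs)
     (\<lambda>i j. Add C (xs ! j) (ys ! i) (A i j) (B i j))"
  "Zero (additive_hull C) xs ys = hom_matrix (length ys) (length xs) (\<lambda>i j. Zero C (xs ! j) (ys ! i))"
  "Scl (additive_hull C) xs ys a A = hom_matrix (length ys) (length xs)
     (\<lambda>i j. Scl C (xs ! j) (ys ! i) a (A i j))"
  by (simp_all add: additive_hull_def)

lemma hom_matrix_nth [simp]: "i < r \<Longrightarrow> j < c \<Longrightarrow> hom_matrix r c A i j = A i j"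
  by (simp add: hom_matrix_def)

lemma hom_matrix_eqI: "(\<And>i j. i < r \<Longrightarrow> j < c \<Longrightarrow> A i j = B i j) \<Longrightarrow> hom_matrix r c A = hom_matrix r c B"
  by (auto simp: hom_matrix_def fun_eq_iff)

lemma hom_matrix_idem [simp]: "hom_matrix r c (hom_matrix r c A) = hom_matrix r c A"
  by (auto simp: hom_matrix_def fun_eq_iff)

text \<open>The first conjunct says that the matrix takes the default value outside its range; this
  normalization turns equality of morphisms into equality of entries.\<close>

lemma hull_Hom_iff: "A \<in> Hom (additive_hull C) xs ys \<longleftrightarrow>
    hom_matrix (length ys) (length xs) A = A \<and> (\<forall>i<length ys. \<forall>j<length xs. A i j \<in> Hom C (xs ! j) (ys ! i))"
  unfolding additive_hull_def by (auto, metis)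

lemma hom_matrix_in_hull: "(\<And>i j. i < length ys \<Longrightarrow> j < length xs \<Longrightarrow> A i j \<in> Hom C (xs ! j) (ys ! i)) \<Longrightarrow>
    r = length ys \<Longrightarrow> c = length xs \<Longrightarrow> hom_matrix r c A \<in> Hom (additive_hull C) xs ys"
  by (simp add: hull_Hom_iff)

lemma hull_entry: "A \<in> Hom (additive_hull C) xs ys \<Longrightarrow> i < length ys \<Longrightarrow> j < length xs \<Longrightarrow>
    A i j \<in> Hom C (xs ! j) (ys ! i)"
  by (simp add: hull_Hom_iff)

lemma hull_matrix_eqI: "A \<in> Hom (additive_hull C) xs ys \<Longrightarrow>
    (\<And>i j. i < length ys \<Longrightarrow> j < length xs \<Longrightarrow> B i j = A i j) \<Longrightarrow> hom_matrix (length ys) (length xs) B = A"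
  unfolding hull_Hom_iff by (metis hom_matrix_eqI)

lemma hull_eqI: "A \<in> Hom (additive_hull C) xs ys \<Longrightarrow> B \<in> Hom (additive_hull C) xs ys \<Longrightarrow>
    (\<And>i j. i < length ys \<Longrightarrow> j < length xs \<Longrightarrow> A i j = B i j) \<Longrightarrow> A = B"
  unfolding hull_Hom_iff by (metis hom_matrix_eqI)

context lincat
begin

abbreviation "H \<equiv> additive_hull C"

lemma hull_category: "category H"
proof -
  have hs: "hom_sum C x y (map (\<lambda>l. Comp C x (ys ! l) y (g l) (f l)) [0..<length ys]) \<in> Hom C x y"
    if "x \<in> Obj C" "y \<in> Obj C" "ys \<in> lists (Obj C)" "\<And>l. l < length ys \<Longrightarrow> f l \<in> Hom C x (ys ! l)"
      "\<And>l. l < length ys \<Longrightarrow> g l \<in> Hom C (ys ! l) y" for x y ys f g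
    using that by (intro hom_sum_in) auto
  have closed: "Comp H xs ys zs B A \<in> Hom H xs zs"
    if "xs \<in> lists (Obj C)" "ys \<in> lists (Obj C)" "zs \<in> lists (Obj C)" "A \<in> Hom H xs ys" "B \<in> Hom H ys zs"
    for xs ys zs A B
    unfolding hull_sel using that by (intro hom_matrix_in_hull hs) (auto simp: hull_Hom_iff)
  have ide: "Ide H xs \<in> Hom H xs xs" if "xs \<in> lists (Obj C)" for xs
    unfolding hull_sel using that by (intro hom_matrix_in_hull) auto
  have idl: "Comp H xs ys ys (Ide H ys) A = A" if x: "xs \<in> lists (Obj C)" "ys \<in> lists (Obj C)" "A \<in> Hom H xs ys" for xs ys A
  proof (rule hull_eqI[OF closed[OF x(1,2,2) x(3) ide[OF x(2)]] x(3)])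
    fix i j assume ij: "i < length ys" "j < length xs"
    have A: "\<And>i. i < length ys \<Longrightarrow> A i j \<in> Hom C (xs ! j) (ys ! i)" using x(3) ij unfolding hull_Hom_iff by blast
    have "hom_sum C (xs ! j) (ys ! i) (map (\<lambda>l. Comp C (xs ! j) (ys ! l) (ys ! i) (Ide H ys i l) (A l j)) [0..<length ys])
       = hom_sum C (xs ! j) (ys ! i) (map (\<lambda>l. if l = i then A i j else Zero C (xs ! j) (ys ! i)) [0..<length ys])"
      by (rule arg_cong[of _ _ "hom_sum C (xs ! j) (ys ! i)"], rule map_cong[OF refl]) (use x ij A in auto)
    also have "\<dots> = A i j"
      using hom_sum_delta[of "xs ! j" "ys ! i" "[0..<length ys]" i "\<lambda>l. if l = i then A i j else Zero C (xs ! j) (ys ! i)"] x ij A by simp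
    finally show "Comp H xs ys ys (Ide H ys) A i j = A i j" using ij by simp
  qed
  have idr: "Comp H xs xs ys A (Ide H xs) = A" if x: "xs \<in> lists (Obj C)" "ys \<in> lists (Obj C)" "A \<in> Hom H xs ys" for xs ys A
  proof (rule hull_eqI[OF closed[OF x(1,1,2) ide[OF x(1)] x(3)] x(3)])
    fix i j assume ij: "i < length ys" "j < length xs"
    have A: "\<And>j. j < length xs \<Longrightarrow> A i j \<in> Hom C (xs ! j) (ys ! i)" using x(3) ij unfolding hull_Hom_iff by blast
    have "hom_sum C (xs ! j) (ys ! i) (map (\<lambda>l. Comp C (xs ! j) (xs ! l) (ys ! i) (A i l) (Ide H xs l j)) [0..<length xs])
       = hom_sum C (xs ! j) (ys ! i) (map (\<lambda>l. if l = j then A i j else Zero C (xs ! j) (ys ! i)) [0..<length xs])"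
      by (rule arg_cong[of _ _ "hom_sum C (xs ! j) (ys ! i)"], rule map_cong[OF refl]) (use x ij A in auto)
    also have "\<dots> = A i j"
      using hom_sum_delta[of "xs ! j" "ys ! i" "[0..<length xs]" j "\<lambda>l. if l = j then A i j else Zero C (xs ! j) (ys ! i)"] x ij A by simp
    finally show "Comp H xs xs ys A (Ide H xs) i j = A i j" using ij by simp
  qed
  have assoc: "Comp H ws xs zs (Comp H xs ys zs D B) A = Comp H ws ys zs D (Comp H ws xs ys B A)"
    if x: "ws \<in> lists (Obj C)" "xs \<in> lists (Obj C)" "ys \<in> lists (Obj C)" "zs \<in> lists (Obj C)"
      and A: "A \<in> Hom H ws xs" and B: "B \<in> Hom H xs ys" and D: "D \<in> Hom H ys zs" for ws xs ys zs A B D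
  proof (rule hull_eqI[OF closed[OF x(1,2,4) A closed[OF x(2,3,4) B D]] closed[OF x(1,3,4) closed[OF x(1,2,3) A B] D]])
    fix i j assume ij: "i < length zs" "j < length ws"
    note [simp] = x ij
    have [simp]: "\<And>l. l < length xs \<Longrightarrow> A l j \<in> Hom C (ws ! j) (xs ! l)"
        "\<And>m. m < length ys \<Longrightarrow> D i m \<in> Hom C (ys ! m) (zs ! i)"
        "\<And>l m. l < length xs \<Longrightarrow> m < length ys \<Longrightarrow> B m l \<in> Hom C (xs ! l) (ys ! m)"
      using A B D ij unfolding hull_Hom_iff by auto
    have "Comp H ws xs zs (Comp H xs ys zs D B) A i j = hom_sum C (ws ! j) (zs ! i) (map (\<lambda>l. 
       hom_sum C (ws ! j) (zs ! i) (map (\<lambda>m. Comp C (ws ! j) (ys ! m) (zs ! i) (D i m) (Comp C (ws ! j) (xs ! l) (ys ! m) (B m l) (A l j)))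
         [0..<length ys])) [0..<length xs])"
      by (simp add: comp_hom_sum_left comp_assoc cong: map_cong add: mem_uptD del: set_upt)
    \<comment> \<open>Associativity of the matrix product is the exchange of the two
      summations.\<close>
    also have "\<dots> = hom_sum C (ws ! j) (zs ! i) (map (\<lambda>m. 
       hom_sum C (ws ! j) (zs ! i) (map (\<lambda>l. Comp C (ws ! j) (ys ! m) (zs ! i) (D i m) (Comp C (ws ! j) (xs ! l) (ys ! m) (B m l) (A l j)))
         [0..<length xs])) [0..<length ys])"
      by (rule hom_sum_swap) auto
    also have "\<dots> = Comp H ws ys zs D (Comp H ws xs ys B A) i j"
      by (simp add: comp_hom_sum_right cong: map_cong add: mem_uptD del: set_upt)
    finally show "Comp H ws xs zs (Comp H xs ys zs D B) A i j = Comp H ws ys zs D (Comp H ws xs ys B A) i j" .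
  qed
  show ?thesis unfolding category_def hull_sel(1) by (intro conjI ballI) (simp_all only: closed ide idl idr assoc)
qed

lemma hull_linear: "linear_category H"
  unfolding linear_category_def
proof (intro conjI hull_category ballI allI)
  fix xs ys assume x: "xs \<in> Obj H" "ys \<in> Obj H"
  then have [simp]: "xs \<in> lists (Obj C)" "ys \<in> lists (Obj C)" by auto
  show "hom_vector_space H xs ys"
    unfolding hom_vector_space_def
  proof (intro conjI ballI allI)
    fix A assume A: "A \<in> Hom H xs ys"
    show "\<exists>B\<in>Hom H xs ys. Add H xs ys A B = Zero H xs ys"
      by (rule bexI[of _ "Scl H xs ys (- 1) A"]) (use A in \<open>auto intro!: hom_matrix_eqI hom_matrix_in_hull simp: hull_Hom_iff\<close>)
  qed (auto intro!: hom_matrix_in_hull hom_matrix_eqI hull_matrix_eqI add_assoc scl_add scl_add_scalar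
        intro: add_comm simp: hull_entry)
  fix zs A A' B B' assume z: "zs \<in> Obj H" and A: "A \<in> Hom H xs ys" "A' \<in> Hom H xs ys" "B \<in> Hom H ys zs" "B' \<in> Hom H ys zs"
  have [simp]: "zs \<in> lists (Obj C)" using z by auto
  have e: "\<And>i j. i < length ys \<Longrightarrow> j < length xs \<Longrightarrow> A i j \<in> Hom C (xs ! j) (ys ! i)"
    "\<And>i j. i < length ys \<Longrightarrow> j < length xs \<Longrightarrow> A' i j \<in> Hom C (xs ! j) (ys ! i)"
    "\<And>i j. i < length zs \<Longrightarrow> j < length ys \<Longrightarrow> B i j \<in> Hom C (ys ! j) (zs ! i)"
    "\<And>i j. i < length zs \<Longrightarrow> j < length ys \<Longrightarrow> B' i j \<in> Hom C (ys ! j) (zs ! i)"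
    using A unfolding hull_Hom_iff by auto
  show "Comp H xs ys zs B (Add H xs ys A A') = Add H xs zs (Comp H xs ys zs B A) (Comp H xs ys zs B A')"
    unfolding hull_sel by (rule hom_matrix_eqI) (use e in \<open>simp add: comp_add_right hom_sum_add cong: map_cong add: mem_uptD del: set_upt\<close>)
  show "Comp H xs ys zs (Add H ys zs B B') A = Add H xs zs (Comp H xs ys zs B A) (Comp H xs ys zs B' A)"
    unfolding hull_sel by (rule hom_matrix_eqI) (use e in \<open>simp add: comp_add_left hom_sum_add cong: map_cong add: mem_uptD del: set_upt\<close>)
next
  fix xs ys zs a A B assume x: "xs \<in> Obj H" "ys \<in> Obj H" "zs \<in> Obj H" and A: "A \<in> Hom H xs ys" "B \<in> Hom H ys zs"
  then have [simp]: "xs \<in> lists (Obj C)" "ys \<in> lists (Obj C)" "zs \<in> lists (Obj C)" by auto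
  have e: "\<And>i j. i < length ys \<Longrightarrow> j < length xs \<Longrightarrow> A i j \<in> Hom C (xs ! j) (ys ! i)"
    "\<And>i j. i < length zs \<Longrightarrow> j < length ys \<Longrightarrow> B i j \<in> Hom C (ys ! j) (zs ! i)"
    using A unfolding hull_Hom_iff by auto
  show "Comp H xs ys zs B (Scl H xs ys a A) = Scl H xs zs a (Comp H xs ys zs B A)"
    unfolding hull_sel by (rule hom_matrix_eqI) (use e in \<open>simp add: hom_sum_scl cong: map_cong add: mem_uptD del: set_upt\<close>)
  show "Comp H xs ys zs (Scl H ys zs a B) A = Scl H xs zs a (Comp H xs ys zs B A)"
    unfolding hull_sel by (rule hom_matrix_eqI) (use e in \<open>simp add: hom_sum_scl cong: map_cong add: mem_uptD del: set_upt\<close>)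
qed

lemma hull_hom_sum:
  assumes "i < length ys" "j < length xs"
  shows "hom_sum H xs ys (map A ls) i j = hom_sum C (xs ! j) (ys ! i) (map (\<lambda>l. A l i j) ls)"
proof (induction ls)
  case Nil
  show ?case using assms by (simp add: hom_sum_def)
next
  case (Cons l ls)
  then show ?case using assms by (simp add: hom_sum_def)
qed

text \<open>A list is the direct sum of its one-element lists; the injections are the columns and
  the projections the rows of the identity matrix.\<close>

lemma hull_dsum:
  assumes xs [simp]: "xs \<in> lists (Obj C)"
  shows "is_dsum H (map (\<lambda>x. [x]) xs) xs
    (\<lambda>k. hom_matrix (length xs) 1 (\<lambda>i j. if i = k then Ide C (xs ! k) else Zero C (xs ! k) (xs ! i)))
    (\<lambda>k. hom_matrix 1 (length xs) (\<lambda>i j. if j = k then Ide C (xs ! k) else Zero C (xs ! j) (xs ! k)))"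
    (is "is_dsum H _ xs ?\<iota> ?\<pi>")
proof -
  interpret H: lincat H by (rule lincat.intro[OF hull_linear])
  have [simp]: "xs ! k \<in> Obj C" if "k < length xs" for k using that by simp
  have "?\<iota> k \<in> Hom H [xs ! k] xs" "?\<pi> k \<in> Hom H xs [xs ! k]" if "k < length xs" for k
    by (rule hom_matrix_in_hull; use that in simp)+
  moreover have "Comp H [xs ! l] xs [xs ! k] (?\<pi> k) (?\<iota> l) = (if k = l then Ide H [xs ! k] else Zero H [xs ! l] [xs ! k])"
    if "k < length xs" "l < length xs" for k l
  proof -
    have "hom_sum C (xs ! l) (xs ! k) (map (\<lambda>m. Comp C (xs ! l) (xs ! m) (xs ! k) (?\<pi> k 0 m) (?\<iota> l m 0)) [0..<length xs])
      = (if k = l then Ide C (xs ! k) else Zero C (xs ! l) (xs ! k))"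
    proof (cases "k = l")
      case True
      then show ?thesis using that
        hom_sum_delta[of "xs ! l" "xs ! k" "[0..<length xs]" k "\<lambda>m. Comp C (xs ! l) (xs ! m) (xs ! k) (?\<pi> k 0 m) (?\<iota> l m 0)"] by simp
    next
      case False
      have "hom_sum C (xs ! l) (xs ! k) (map (\<lambda>m. Comp C (xs ! l) (xs ! m) (xs ! k) (?\<pi> k 0 m) (?\<iota> l m 0)) [0..<length xs]) = Zero C (xs ! l) (xs ! k)"
        by (rule hom_sum_zero) (use that False in auto)
      then show ?thesis using False by simp
    qed
    then show ?thesis using that by (auto intro!: hom_matrix_eqI)
  qed
  moreover have "hom_sum H xs xs (map (\<lambda>k. Comp H xs [xs ! k] xs (?\<iota> k) (?\<pi> k)) [0..<length xs]) = Ide H xs" (is "?S = _")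
  proof (rule hull_eqI)
    show "?S \<in> Hom H xs xs" using calculation(1,2) by (auto intro!: H.hom_sum_in H.comp_in simp del: hull_sel(3))
    show "Ide H xs \<in> Hom H xs xs" by (rule H.ide_in) simp
    fix i j assume ij: "i < length xs" "j < length xs"
    have "?S i j = hom_sum C (xs ! j) (xs ! i) (map (\<lambda>k. if k = i then if i = j then Ide C (xs ! i) else Zero C (xs ! j) (xs ! i) else Zero C (xs ! j) (xs ! i)) [0..<length xs])"
      unfolding hull_hom_sum[OF ij]
      by (rule arg_cong[of _ _ "hom_sum C (xs ! j) (xs ! i)"], rule map_cong[OF refl]) (use ij in auto)
    also have "\<dots> = (if i = j then Ide C (xs ! i) else Zero C (xs ! j) (xs ! i))"
      using hom_sum_delta[of "xs ! j" "xs ! i" "[0..<length xs]" i "\<lambda>k. if k = i then if i = j then Ide C (xs ! i) else Zero C (xs ! j) (xs ! i) else Zero C (xs ! j) (xs ! i)"] ij by simp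
    finally show "?S i j = Ide H xs i j" using ij by simp
  qed
  ultimately show ?thesis unfolding is_dsum_def by (simp del: hull_sel One_nat_def set_upt cong: map_cong add: mem_uptD)
qed

end

text \<open>A list goes to a chosen direct sum of the images, a matrix to the morphism with the
  image matrix; functoriality is compared entry by entry.\<close>

lemma (in linfun) extension_to_hull_exists:
  assumes sums: "\<And>ds. ds \<in> lists (Obj D) \<Longrightarrow> \<exists>X\<in>Obj D. \<exists>\<iota> \<pi>. is_dsum D ds X \<iota> \<pi>"
  shows "\<exists>Go Gm. extends_to_hull C D Fo Fm Go Gm"
proof -
  define P where "P xs = (\<lambda>(X, \<iota>, \<pi>). X \<in> Obj D \<and> is_dsum D (map Fo xs) X \<iota> \<pi>)" for xs
  \<comment> \<open>One-element lists are not left to the choice: \<open>extends_to_hull\<close>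
    demands that \<open>[x]\<close> goes to \<open>Fo x\<close> itself, and identities as structure
    maps make the extension agree with \<open>Fm\<close> on 1 by 1 matrices.\<close>
  define S where "S xs = (if length xs = 1 then (Fo (hd xs), \<lambda>_. Ide D (Fo (hd xs)), \<lambda>_. Ide D (Fo (hd xs))) else SOME t. P xs t)" for xs
  have PS: "P xs (S xs)" if "xs \<in> lists (Obj C)" for xs
  proof (cases "length xs = 1")
    case True
    then obtain x where "xs = [x]" by (cases xs) auto
    then show ?thesis using that D.dsum_single[of "Fo x"] by (simp add: P_def S_def)
  next
    case False
    have "map Fo xs \<in> lists (Obj D)" using that by (auto simp: in_lists_conv_set)
    then obtain X \<iota> \<pi> where "P xs (X, \<iota>, \<pi>)" using sums[of "map Fo xs"] unfolding P_def by auto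
    then show ?thesis unfolding S_def using False by (simp add: someI[of "P xs"])
  qed
  define Go where "Go xs = fst (S xs)" for xs
  define \<iota> where "\<iota> xs = fst (snd (S xs))" for xs
  define \<pi> where "\<pi> xs = snd (snd (S xs))" for xs
  have Go [simp]: "Go xs \<in> Obj D" and dG: "is_dsum D (map Fo xs) (Go xs) (\<iota> xs) (\<pi> xs)" if "xs \<in> lists (Obj C)" for xs
    using PS[OF that] by (auto simp: P_def Go_def \<iota>_def \<pi>_def case_prod_beta)
  have mObj [simp]: "map Fo xs \<in> lists (Obj D)" if "xs \<in> lists (Obj C)" for xs
    using that by (auto simp: in_lists_conv_set)
  define Gm where "Gm xs ys A = dsum_mor D (map Fo xs) (Go xs) (\<pi> xs) (map Fo ys) (Go ys) (\<iota> ys) (\<lambda>i j. Fm (xs ! j) (ys ! i) (A i j))" for xs ys A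
  define en where "en xs ys = dsum_entry D (map Fo xs) (Go xs) (\<iota> xs) (map Fo ys) (Go ys) (\<pi> ys)" for xs ys
  have F: "Fm (xs ! j) (ys ! i) (A i j) \<in> Hom D (map Fo xs ! j) (map Fo ys ! i)"
    if "xs \<in> lists (Obj C)" "ys \<in> lists (Obj C)" "A \<in> Hom (additive_hull C) xs ys" "i < length ys" "j < length xs" for xs ys A i j
    using that by (auto simp: hull_Hom_iff)
  have Gm_in: "Gm xs ys A \<in> Hom D (Go xs) (Go ys)"
    if "xs \<in> lists (Obj C)" "ys \<in> lists (Obj C)" "A \<in> Hom (additive_hull C) xs ys" for xs ys A
    unfolding Gm_def by (rule D.dsum_mor_in[OF _ _ _ _ dG dG]) (use that F in auto)
  have en_Gm: "en xs ys (Gm xs ys A) i j = Fm (xs ! j) (ys ! i) (A i j)"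
    if "xs \<in> lists (Obj C)" "ys \<in> lists (Obj C)" "A \<in> Hom (additive_hull C) xs ys" "i < length ys" "j < length xs" for xs ys A i j
    unfolding en_def Gm_def by (rule D.dsum_entry_mor[OF _ _ _ _ dG dG]) (use that F in auto)
  have ext: "f = g" if "xs \<in> lists (Obj C)" "ys \<in> lists (Obj C)" "f \<in> Hom D (Go xs) (Go ys)" "g \<in> Hom D (Go xs) (Go ys)"
    "\<And>i j. i < length ys \<Longrightarrow> j < length xs \<Longrightarrow> en xs ys f i j = en xs ys g i j" for xs ys f g
    by (rule D.dsum_ext[OF _ _ _ _ dG dG that(3,4)]) (use that in \<open>auto simp: en_def\<close>)
  interpret H: lincat "additive_hull C" by (rule lincat.intro[OF C.hull_linear])
  let ?H = "additive_hull C"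
  have fun': "is_functor ?H D Go Gm"
    unfolding is_functor_def
  proof (intro conjI ballI)
    show "category ?H" "category D" by (rule H.cat, rule D.cat)
    fix xs assume "xs \<in> Obj ?H" then have xs [simp]: "xs \<in> lists (Obj C)" by simp
    show "Go xs \<in> Obj D" by simp
    show "Gm xs xs (Ide ?H xs) = Ide D (Go xs)"
    proof (rule ext[of xs xs])
      fix i j assume "i < length xs" "j < length xs"
      then show "en xs xs (Gm xs xs (Ide ?H xs)) i j = en xs xs (Ide D (Go xs)) i j"
        using H.ide_in[of xs] D.dsum_entry_ide[OF _ _ dG, of xs i j] en_Gm[OF xs xs H.ide_in]
        by (simp add: en_def)
    qed (use H.ide_in[of xs] Gm_in in auto)
    fix ys assume "ys \<in> Obj ?H" then have ys [simp]: "ys \<in> lists (Obj C)" by simp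
    { fix A assume "A \<in> Hom ?H xs ys" then show "Gm xs ys A \<in> Hom D (Go xs) (Go ys)" by (simp add: Gm_in) }
    fix zs A B assume "zs \<in> Obj ?H" and A: "A \<in> Hom ?H xs ys" and B: "B \<in> Hom ?H ys zs"
    then have zs [simp]: "zs \<in> lists (Obj C)" by simp
    have BA: "Comp ?H xs ys zs B A \<in> Hom ?H xs zs" by (rule H.comp_in) (use A B in auto)
    show "Gm xs zs (Comp ?H xs ys zs B A) = Comp D (Go xs) (Go ys) (Go zs) (Gm ys zs B) (Gm xs ys A)"
    proof (rule ext[of xs zs])
      fix i j assume ij [simp]: "i < length zs" "j < length xs"
      have Ae: "\<And>l. l < length ys \<Longrightarrow> A l j \<in> Hom C (xs ! j) (ys ! l)"
        and Be: "\<And>l. l < length ys \<Longrightarrow> B i l \<in> Hom C (ys ! l) (zs ! i)" using A B by (auto simp: hull_Hom_iff)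
      have "en xs zs (Comp D (Go xs) (Go ys) (Go zs) (Gm ys zs B) (Gm xs ys A)) i j
        = hom_sum D (Fo (xs ! j)) (Fo (zs ! i)) (map (\<lambda>l. Comp D (map Fo xs ! j) (map Fo ys ! l) (map Fo zs ! i) (en ys zs (Gm ys zs B) i l) (en xs ys (Gm xs ys A) l j)) [0..<length ys])"
        unfolding en_def using D.dsum_entry_comp[OF _ _ _ _ _ _ dG[OF xs] dG[OF ys] dG[OF zs] Gm_in[OF xs ys A] Gm_in[OF ys zs B], of i j] by simp
      also have "\<dots> = hom_sum D (Fo (xs ! j)) (Fo (zs ! i)) (map (\<lambda>l. Fm (xs ! j) (zs ! i) (Comp C (xs ! j) (ys ! l) (zs ! i) (B i l) (A l j))) [0..<length ys])"
        by (rule arg_cong[of _ _ "hom_sum D _ _"], rule map_cong[OF refl]) (use A B Ae Be in \<open>simp add: en_Gm Fm_comp\<close>)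
      also have "\<dots> = Fm (xs ! j) (zs ! i) (Comp ?H xs ys zs B A i j)"
        by (simp, rule Fm_hom_sum[symmetric]) (use Ae Be in auto)
      finally show "en xs zs (Gm xs zs (Comp ?H xs ys zs B A)) i j = en xs zs (Comp D (Go xs) (Go ys) (Go zs) (Gm ys zs B) (Gm xs ys A)) i j"
        using en_Gm[OF xs zs BA ij] by simp
    qed (use Gm_in[OF xs zs BA] Gm_in A B in auto)
  qed
  have lin: "linear_functor ?H D Go Gm"
    unfolding linear_functor_def
  proof (intro conjI H.linear D.linear fun' ballI allI)
    fix xs ys A assume "xs \<in> Obj ?H" "ys \<in> Obj ?H" and A: "A \<in> Hom ?H xs ys"
    then have xs [simp]: "xs \<in> lists (Obj C)" and ys [simp]: "ys \<in> lists (Obj C)" by auto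
    note GA = Gm_in[OF xs ys A]
    have [simp]: "\<iota> xs k \<in> Hom D (Fo (xs ! k)) (Go xs)" "\<pi> xs k \<in> Hom D (Go xs) (Fo (xs ! k))"
      if "k < length xs" "xs \<in> lists (Obj C)" for k xs
      using is_dsumD(1,2)[OF dG[OF that(2)], of k] that by auto
    { fix B assume B: "B \<in> Hom ?H xs ys"
      have AB: "Add ?H xs ys A B \<in> Hom ?H xs ys" by (rule H.add_in) (use A B in auto)
      show "Gm xs ys (Add ?H xs ys A B) = Add D (Go xs) (Go ys) (Gm xs ys A) (Gm xs ys B)"
      proof (rule ext[of xs ys])
        fix i j assume ij [simp]: "i < length ys" "j < length xs"
        have "en xs ys (Add D (Go xs) (Go ys) (Gm xs ys A) (Gm xs ys B)) i j
          = Add D (Fo (xs ! j)) (Fo (ys ! i)) (en xs ys (Gm xs ys A) i j) (en xs ys (Gm xs ys B) i j)"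
          unfolding en_def dsum_entry_def using GA Gm_in[OF xs ys B] by (simp add: D.comp_add_left D.comp_add_right)
        then show "en xs ys (Gm xs ys (Add ?H xs ys A B)) i j = en xs ys (Add D (Go xs) (Go ys) (Gm xs ys A) (Gm xs ys B)) i j"
          using en_Gm[OF xs ys AB ij] en_Gm[OF xs ys A ij] en_Gm[OF xs ys B ij] A B
          by (simp add: Fm_add hull_Hom_iff)
      qed (use Gm_in[OF xs ys AB] GA Gm_in[OF xs ys B] in auto) }
    fix a
    have aA: "Scl ?H xs ys a A \<in> Hom ?H xs ys" by (rule H.scl_in) (use A in auto)
    show "Gm xs ys (Scl ?H xs ys a A) = Scl D (Go xs) (Go ys) a (Gm xs ys A)"
    proof (rule ext[of xs ys])
      fix i j assume ij [simp]: "i < length ys" "j < length xs"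
      have "en xs ys (Scl D (Go xs) (Go ys) a (Gm xs ys A)) i j = Scl D (Fo (xs ! j)) (Fo (ys ! i)) a (en xs ys (Gm xs ys A) i j)"
        unfolding en_def dsum_entry_def using GA by simp
      then show "en xs ys (Gm xs ys (Scl ?H xs ys a A)) i j = en xs ys (Scl D (Go xs) (Go ys) a (Gm xs ys A)) i j"
        using en_Gm[OF xs ys aA ij] en_Gm[OF xs ys A ij] A by (simp add: Fm_scl hull_Hom_iff)
    qed (use Gm_in[OF xs ys aA] GA in auto)
  qed
  have "Go [x] = Fo x" "\<iota> [x] = (\<lambda>_. Ide D (Fo x))" "\<pi> [x] = (\<lambda>_. Ide D (Fo x))" for x
    by (simp_all add: Go_def S_def \<iota>_def \<pi>_def)
  then have "extends_to_hull C D Fo Fm Go Gm"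
    unfolding extends_to_hull_def using lin by (simp add: Gm_def dsum_mor_def)
  then show ?thesis by blast
qed

text \<open>Full faithfulness is tested on one-element lists, whose morphisms are 1 by 1 matrices
  over \<open>C\<close>. Essential surjectivity holds because direct sums of the same list are
  isomorphic.\<close>

lemma (in linfun) hull_extension_linequiv:
  assumes ff: "fully_faithful C D Fo Fm" and E: "extends_to_hull C D Fo Fm Go Gm"
    and dec: "\<And>X. X \<in> Obj D \<Longrightarrow> \<exists>xs \<iota> \<pi>. xs \<in> lists (Obj C) \<and> is_dsum D (map Fo xs) X \<iota> \<pi>"
  shows "linequiv (additive_hull C) D Go Gm"
proof -
  let ?H = "additive_hull C"
  interpret G: linfun ?H D Go Gm using E unfolding extends_to_hull_def by unfold_locales auto
  have Gs: "Go [x] = Fo x" if "x \<in> Obj C" for x using E that unfolding extends_to_hull_def by auto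
  have "fully_faithful ?H D Go Gm"
  proof (rule G.fully_faithful_from_summands[of "(\<lambda>x. [x]) ` Obj C"])
    fix xs assume "xs \<in> Obj ?H"
    then have "xs \<in> lists (Obj C)" by simp
    then show "\<exists>ys \<iota> \<pi>. ys \<in> lists ((\<lambda>x. [x]) ` Obj C) \<and> is_dsum ?H ys xs \<iota> \<pi>"
      using C.hull_dsum[of xs] by (intro exI[of _ "map (\<lambda>x. [x]) xs"] exI conjI) (auto simp: in_lists_conv_set)
  next
    fix x y assume "x \<in> (\<lambda>x. [x]) ` Obj C" "y \<in> (\<lambda>x. [x]) ` Obj C"
    then obtain u v where u: "u \<in> Obj C" "v \<in> Obj C" and xy: "x = [u]" "y = [v]" by blast
    have m: "hom_matrix 1 1 (\<lambda>_ _. A 0 0) = A" if "A \<in> Hom ?H [u] [v]" for A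
      using that unfolding hull_Hom_iff by (metis hom_matrix_eqI less_one length_Cons list.size(3) One_nat_def)
    have "bij_betw (\<lambda>f. hom_matrix 1 1 (\<lambda>_ _. f)) (Hom C u v) (Hom ?H [u] [v])"
    proof (rule bij_betw_byWitness[where f' = "\<lambda>A. A 0 0"])
      show "(\<lambda>f. hom_matrix 1 1 (\<lambda>_ _. f)) ` Hom C u v \<subseteq> Hom ?H [u] [v]"
        by (auto intro!: hom_matrix_in_hull)
      show "(\<lambda>A. A 0 0) ` Hom ?H [u] [v] \<subseteq> Hom C u v" by (auto simp: hull_Hom_iff)
      show "\<forall>f\<in>Hom C u v. hom_matrix 1 1 (\<lambda>_ _. f) 0 0 = f" by simp
      show "\<forall>A\<in>Hom ?H [u] [v]. hom_matrix 1 1 (\<lambda>_ _. A 0 0) = A" using m by blast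
    qed
    moreover have "bij_betw (\<lambda>f. Gm [u] [v] (hom_matrix 1 1 (\<lambda>_ _. f))) (Hom C u v) (Hom D (Fo u) (Fo v))"
      using ff u E bij_betw_cong[of "Hom C u v" "\<lambda>f. Gm [u] [v] (hom_matrix 1 1 (\<lambda>_ _. f))" "Fm u v"]
      unfolding fully_faithful_def extends_to_hull_def by auto
    ultimately have "bij_betw (Gm [u] [v]) (Hom ?H [u] [v]) (Hom D (Fo u) (Fo v))"
      using bij_betw_comp_iff[of "\<lambda>f. hom_matrix 1 1 (\<lambda>_ _. f)" "Hom C u v" "Hom ?H [u] [v]" "Gm [u] [v]"]
      by (simp add: comp_def)
    then show "bij_betw (Gm x y) (Hom ?H x y) (Hom D (Go x) (Go y))" using xy Gs u by simp
  qed auto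
  moreover have "essentially_surjective ?H D Go"
    unfolding essentially_surjective_def
  proof
    fix X assume X: "X \<in> Obj D"
    then obtain xs \<iota> \<pi> where xs: "xs \<in> lists (Obj C)" and d: "is_dsum D (map Fo xs) X \<iota> \<pi>" using dec by blast
    have xs': "xs \<in> Obj ?H" "map (\<lambda>x. [x]) xs \<in> lists (Obj ?H)" "map Fo xs \<in> lists (Obj D)"
      using xs by (auto simp: in_lists_conv_set)
    have eq: "map Go (map (\<lambda>x. [x]) xs) = map Fo xs" using xs Gs by (auto simp: in_lists_conv_set)
    have "\<exists>\<iota>' \<pi>'. is_dsum D (map Fo xs) (Go xs) \<iota>' \<pi>'"
      using G.preserve_dsum[OF xs'(1,2) C.hull_dsum[OF xs]] unfolding eq by blast
    then show "\<exists>c\<in>Obj ?H. isomorphic_in D X (Go c)"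
      using D.dsum_isomorphic[OF X G.Fo_in[OF xs'(1)] xs'(3) d] xs'(1) by blast
  qed
  ultimately show ?thesis by unfold_locales
qed

section \<open>Quotients and path categories\<close>

text \<open>The operations of the quotient are unions over all representatives; such a union
  collapses once the coset is independent of the representatives.\<close>

lemma UN_const:
  assumes "A \<noteq> {}" "\<And>f. f \<in> A \<Longrightarrow> h f = K"
  shows "(\<Union>f\<in>A. h f) = K"
proof -
  have "(\<Union>f\<in>A. h f) = (\<Union>f\<in>A. K)" using assms(2) by (rule SUP_cong[OF refl])
  then show ?thesis using assms(1) by simp
qed

locale lin_ideal = lincat C for C :: "('k::field, 'o, 'm) lcat" +
  fixes I :: "'o \<Rightarrow> 'o \<Rightarrow> 'm \<Rightarrow> bool"
  assumes I_hom: "I x y f \<Longrightarrow> x \<in> Obj C \<and> y \<in> Obj C \<and> f \<in> Hom C x y"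
    and I_zero: "x \<in> Obj C \<Longrightarrow> y \<in> Obj C \<Longrightarrow> I x y (Zero C x y)"
    and I_add: "I x y f \<Longrightarrow> I x y g \<Longrightarrow> I x y (Add C x y f g)"
    and I_scl: "I x y f \<Longrightarrow> I x y (Scl C x y a f)"
    and I_left: "I x y f \<Longrightarrow> z \<in> Obj C \<Longrightarrow> g \<in> Hom C y z \<Longrightarrow> I x z (Comp C x y z g f)"
    and I_right: "I y z g \<Longrightarrow> x \<in> Obj C \<Longrightarrow> f \<in> Hom C x y \<Longrightarrow> I x z (Comp C x y z g f)"
begin

abbreviation "coset \<equiv> ideal_coset C I"
abbreviation "quot \<equiv> quotient_category C I"

context
  fixes x y assumes xy [simp]: "x \<in> Obj C" "y \<in> Obj C"
begin

lemma mem_coset: "f \<in> Hom C x y \<Longrightarrow> f \<in> coset x y f"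
  unfolding ideal_coset_def using I_zero[of x y] add_zero_right[of x y f] by force

lemma coset_subset:
  assumes "f \<in> Hom C x y" "g \<in> coset x y f"
  shows "coset x y g \<subseteq> coset x y f"
proof
  obtain i where i: "I x y i" "g = Add C x y f i" using assms unfolding ideal_coset_def by blast
  fix h assume "h \<in> coset x y g"
  then obtain j where j: "I x y j" "h = Add C x y g j" unfolding ideal_coset_def by blast
  have "h = Add C x y f (Add C x y i j)"
    using i j I_hom[OF i(1)] I_hom[OF j(1)] assms by (simp add: add_assoc)
  then show "h \<in> coset x y f" unfolding ideal_coset_def using I_add[OF i(1) j(1)] by blast
qed

lemma coset_Hom: "f \<in> Hom C x y \<Longrightarrow> g \<in> coset x y f \<Longrightarrow> g \<in> Hom C x y"
  unfolding ideal_coset_def using I_hom by fastforce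

lemma coset_eq:
  assumes "f \<in> Hom C x y" "g \<in> coset x y f"
  shows "coset x y g = coset x y f"
proof -
  obtain i where i: "I x y i" "g = Add C x y f i" using assms unfolding ideal_coset_def by blast
  have "f = Add C x y g (Scl C x y (- 1) i)"
    using i I_hom[OF i(1)] assms by (simp add: add_assoc)
  then have "f \<in> coset x y g" unfolding ideal_coset_def using I_scl[OF i(1)] by blast
  then show ?thesis using coset_subset assms coset_Hom by blast
qed

lemma coset_eq_iff:
  assumes f: "f \<in> Hom C x y" "g \<in> Hom C x y"
  shows "coset x y f = coset x y g \<longleftrightarrow> I x y (Add C x y f (Scl C x y (- 1) g))"
proof
  assume "coset x y f = coset x y g"
  then obtain i where i: "I x y i" "f = Add C x y g i"
    using mem_coset[OF f(1)] unfolding ideal_coset_def by blast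
  have "Add C x y f (Scl C x y (- 1) g) = Add C x y i (Add C x y g (Scl C x y (- 1) g))"
    using i(2) f I_hom[OF i(1)] add_comm[OF xy f(2), of i] by (simp add: add_assoc)
  then show "I x y (Add C x y f (Scl C x y (- 1) g))" using i I_hom[OF i(1)] f by simp
next
  assume i: "I x y (Add C x y f (Scl C x y (- 1) g))"
  have "f = Add C x y g (Add C x y f (Scl C x y (- 1) g))"
    using f add_left_comm[OF xy f(2) f(1), of "Scl C x y (- 1) g"] by simp
  then have "f \<in> coset x y g" unfolding ideal_coset_def using i by blast
  then show "coset x y f = coset x y g" using coset_eq f by blast
qed

end

lemma quot_sel [simp]: "Obj quot = Obj C" "Ide quot x = coset x x (Ide C x)"
    "Zero quot x y = coset x y (Zero C x y)"
  by (simp_all add: quotient_category_def)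

lemma quot_Hom: "Hom quot x y = coset x y ` Hom C x y"
  by (simp add: quotient_category_def)

lemma quot_HomE:
  assumes "A \<in> Hom quot x y"
  obtains f where "f \<in> Hom C x y" "A = coset x y f"
  using assms by (auto simp: quot_Hom)

lemma coset_in [simp]: "f \<in> Hom C x y \<Longrightarrow> coset x y f \<in> Hom quot x y"
  by (simp add: quot_Hom)

lemma diff_in_ideal:
  assumes "x \<in> Obj C" "y \<in> Obj C" "f \<in> Hom C x y" "f' \<in> coset x y f"
  obtains i where "I x y i" "f' = Add C x y f i" "i \<in> Hom C x y"
  using assms(4) I_hom unfolding ideal_coset_def by blast

text \<open>Changing the representatives by \<open>i\<close> and \<open>j\<close> alters the
  composite by \<open>g i + j f + j i\<close>, which lies in the ideal.\<close>

lemma quot_Comp [simp]: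
  assumes [simp]: "x \<in> Obj C" "y \<in> Obj C" "z \<in> Obj C" "f \<in> Hom C x y" "g \<in> Hom C y z"
  shows "Comp quot x y z (coset y z g) (coset x y f) = coset x z (Comp C x y z g f)"
proof -
  have "coset x z (Comp C x y z g' f') = coset x z (Comp C x y z g f)"
    if g: "g' \<in> coset y z g" and f: "f' \<in> coset x y f" for f' g'
  proof -
    obtain i where i: "I x y i" "f' = Add C x y f i" and [simp]: "i \<in> Hom C x y" using diff_in_ideal[OF _ _ _ f] by auto
    obtain j where j: "I y z j" "g' = Add C y z g j" and [simp]: "j \<in> Hom C y z" using diff_in_ideal[OF _ _ _ g] by auto
    have "Comp C x y z g' f' = Add C x z (Comp C x y z g f)
       (Add C x z (Comp C x y z g i) (Add C x z (Comp C x y z j f) (Comp C x y z j i)))"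
      unfolding i j by (simp add: comp_add_left comp_add_right add_assoc add_left_comm)
    moreover have "I x z (Add C x z (Comp C x y z g i) (Add C x z (Comp C x y z j f) (Comp C x y z j i)))"
      by (intro I_add I_left[OF i(1)] I_right[OF j(1)]) auto
    ultimately have "Comp C x y z g' f' \<in> coset x z (Comp C x y z g f)" unfolding ideal_coset_def by blast
    then show ?thesis by (intro coset_eq) auto
  qed
  moreover have "coset x y f \<noteq> {}" "coset y z g \<noteq> {}" using mem_coset[of x y f] mem_coset[of y z g] by auto
  ultimately show ?thesis unfolding quotient_category_def lcat.simps by (intro UN_const)
qed

lemma quot_Add [simp]:
  assumes [simp]: "x \<in> Obj C" "y \<in> Obj C" "f \<in> Hom C x y" "g \<in> Hom C x y"
  shows "Add quot x y (coset x y f) (coset x y g) = coset x y (Add C x y f g)"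
proof -
  have "coset x y (Add C x y f' g') = coset x y (Add C x y f g)"
    if f: "f' \<in> coset x y f" and g: "g' \<in> coset x y g" for f' g'
  proof -
    obtain i where i: "I x y i" "f' = Add C x y f i" and [simp]: "i \<in> Hom C x y" using diff_in_ideal[OF _ _ _ f] by auto
    obtain j where j: "I x y j" "g' = Add C x y g j" and [simp]: "j \<in> Hom C x y" using diff_in_ideal[OF _ _ _ g] by auto
    have "Add C x y f' g' = Add C x y (Add C x y f g) (Add C x y i j)"
      unfolding i j by (simp add: add_assoc add_left_comm)
    then have "Add C x y f' g' \<in> coset x y (Add C x y f g)"
      unfolding ideal_coset_def using I_add[OF i(1) j(1)] by blast
    then show ?thesis by (intro coset_eq) auto
  qed
  moreover have "coset x y f \<noteq> {}" "coset x y g \<noteq> {}" using mem_coset[of x y f] mem_coset[of x y g] by auto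
  ultimately show ?thesis unfolding quotient_category_def lcat.simps by (intro UN_const)
qed

lemma quot_Scl [simp]:
  assumes [simp]: "x \<in> Obj C" "y \<in> Obj C" "f \<in> Hom C x y"
  shows "Scl quot x y a (coset x y f) = coset x y (Scl C x y a f)"
proof -
  have "coset x y (Scl C x y a f') = coset x y (Scl C x y a f)" if f: "f' \<in> coset x y f" for f'
  proof -
    obtain i where i: "I x y i" "f' = Add C x y f i" and [simp]: "i \<in> Hom C x y" using diff_in_ideal[OF _ _ _ f] by auto
    have "Scl C x y a f' = Add C x y (Scl C x y a f) (Scl C x y a i)" unfolding i by (simp add: scl_add)
    then have "Scl C x y a f' \<in> coset x y (Scl C x y a f)"
      unfolding ideal_coset_def using I_scl[OF i(1)] by blast
    then show ?thesis by (intro coset_eq) auto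
  qed
  moreover have "coset x y f \<noteq> {}" using mem_coset[of x y f] by auto
  ultimately show ?thesis unfolding quotient_category_def lcat.simps by (intro UN_const)
qed

lemma quot_linear: "linear_category quot"
  unfolding linear_category_def
proof (intro conjI ballI allI)
  show "category quot"
    unfolding category_def by (auto elim!: quot_HomE simp: comp_assoc)
  fix x y assume "x \<in> Obj quot" "y \<in> Obj quot"
  then have [simp]: "x \<in> Obj C" "y \<in> Obj C" by auto
  show "hom_vector_space quot x y"
    unfolding hom_vector_space_def
  proof (intro conjI ballI allI)
    fix A assume "A \<in> Hom quot x y"
    then obtain f where f [simp]: "f \<in> Hom C x y" "A = coset x y f" by (rule quot_HomE)
    show "\<exists>B\<in>Hom quot x y. Add quot x y A B = Zero quot x y"
      by (rule bexI[of _ "coset x y (Scl C x y (- 1) f)"]) auto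
  qed (auto elim!: quot_HomE simp: add_assoc scl_add scl_add_scalar simp: add_comm[of x y] )
qed (auto elim!: quot_HomE simp: comp_add_left comp_add_right)

text \<open>A linear functor killing the ideal is constant on cosets, so evaluating it at an
  arbitrary representative is legitimate.\<close>

lemma functor_on_quotient:
  assumes F: "linfun C D Fo E" and Z: "\<forall>x y f. I x y f \<longrightarrow> E x y f = Zero D (Fo x) (Fo y)"
  shows "\<exists>Fm. linear_functor quot D Fo Fm \<and>
    (\<forall>x\<in>Obj C. \<forall>y\<in>Obj C. \<forall>f\<in>Hom C x y. Fm x y (coset x y f) = E x y f)"
proof -
  interpret F: linfun C D Fo E by (rule F)
  define Fm where "Fm x y A = E x y (SOME f. f \<in> A)" for x y A
  have Fm [simp]: "Fm x y (coset x y f) = E x y f" if [simp]: "x \<in> Obj C" "y \<in> Obj C" "f \<in> Hom C x y" for x y f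
  proof -
    have S: "(SOME g. g \<in> coset x y f) \<in> coset x y f" using mem_coset[of x y f] by (auto intro: someI)
    obtain i where i: "I x y i" "(SOME g. g \<in> coset x y f) = Add C x y f i" and [simp]: "i \<in> Hom C x y"
      by (rule diff_in_ideal[OF \<open>x \<in> Obj C\<close> \<open>y \<in> Obj C\<close> \<open>f \<in> Hom C x y\<close> S])
    then show ?thesis unfolding Fm_def by (simp add: F.Fm_add Z)
  qed
  have "is_functor quot D Fo Fm"
    unfolding is_functor_def using quot_linear[unfolded linear_category_def] F.D.cat
    by (auto elim!: quot_HomE simp: F.Fm_comp)
  then have "linear_functor quot D Fo Fm"
    unfolding linear_functor_def using quot_linear F.D.linear
    by (auto elim!: quot_HomE simp: F.Fm_add F.Fm_scl)
  then show ?thesis using Fm by blast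
qed

end

lemma (in lincat) generated_ideal_in:
  "generated_ideal C G x y f \<Longrightarrow> x \<in> Obj C \<and> y \<in> Obj C \<and> f \<in> Hom C x y"
  by (induction rule: generated_ideal.induct) auto

lemma (in lincat) lin_ideal_generated: "lin_ideal C (generated_ideal C G)"
proof
  fix x y f assume "generated_ideal C G x y f"
  then show "x \<in> Obj C \<and> y \<in> Obj C \<and> f \<in> Hom C x y" by (rule generated_ideal_in)
qed (auto intro: generated_ideal.intros)

text \<open>The morphisms annihilated by a linear functor form an ideal, so only the generators have
  to be tested.\<close>

lemma (in linfun) generated_ideal_vanishes:
  assumes "generated_ideal C G x y f"
    and "\<And>x y f. x \<in> Obj C \<Longrightarrow> y \<in> Obj C \<Longrightarrow> f \<in> G x y \<Longrightarrow> Fm x y f = Zero D (Fo x) (Fo y)"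
  shows "Fm x y f = Zero D (Fo x) (Fo y)"
  using assms(1)
proof (induction rule: generated_ideal.induct)
  case (add x y f g)
  then show ?case using C.generated_ideal_in[OF add(1)] C.generated_ideal_in[OF add(2)] by (simp add: Fm_add)
next
  case (scl x y f a)
  then show ?case using C.generated_ideal_in[OF scl(1)] by (simp add: Fm_scl)
next
  case (comp_left x y f z g)
  then show ?case using C.generated_ideal_in[OF comp_left(1)] by (simp add: Fm_comp)
next
  case (comp_right y z g x f)
  then show ?case using C.generated_ideal_in[OF comp_right(1)] by (simp add: Fm_comp)
qed (use assms(2) in auto)

subsection \<open>Finitely supported functions\<close>

lemma poly_mapping_sum_singles: "(f :: 'a \<Rightarrow>\<^sub>0 'b::comm_monoid_add) = (\<Sum>p\<in>Poly_Mapping.keys f. Poly_Mapping.single p (Poly_Mapping.lookup f p))"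
proof (rule poly_mapping_eqI)
  fix k
  have "Poly_Mapping.lookup (\<Sum>p\<in>Poly_Mapping.keys f. Poly_Mapping.single p (Poly_Mapping.lookup f p)) k
    = (\<Sum>p\<in>Poly_Mapping.keys f. if p = k then Poly_Mapping.lookup f p else 0)"
    by (simp add: lookup_sum lookup_single when_def)
  also have "\<dots> = Poly_Mapping.lookup f k" by (simp add: in_keys_iff)
  finally show "Poly_Mapping.lookup f k = Poly_Mapping.lookup (\<Sum>p\<in>Poly_Mapping.keys f. Poly_Mapping.single p (Poly_Mapping.lookup f p)) k" ..
qed

lemma keys_induct [consumes 1, case_names zero single add]:
  fixes f :: "'a \<Rightarrow>\<^sub>0 'b::comm_monoid_add"
  assumes "Poly_Mapping.keys f \<subseteq> A" "P 0" "\<And>p a. p \<in> A \<Longrightarrow> P (Poly_Mapping.single p a)"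
    "\<And>f g. P f \<Longrightarrow> P g \<Longrightarrow> P (f + g)"
  shows "P f"
proof -
  have "P (\<Sum>p\<in>B. Poly_Mapping.single p (Poly_Mapping.lookup f p))" if "finite B" "B \<subseteq> A" for B
    using that by (induction B) (auto intro: assms)
  from this[OF finite_keys assms(1)] show ?thesis by (simp flip: poly_mapping_sum_singles)
qed

text \<open>The coefficient is handed to \<open>h\<close> instead of multiplying its value, so the
  target needs an addition but no scalar multiplication.\<close>

definition lin_ext :: "('a \<Rightarrow> 'k::comm_monoid_add \<Rightarrow> 'b::ab_group_add) \<Rightarrow> ('a \<Rightarrow>\<^sub>0 'k) \<Rightarrow> 'b" where
  "lin_ext h f = (\<Sum>p\<in>Poly_Mapping.keys f. h p (Poly_Mapping.lookup f p))"

lemma lin_ext_zero [simp]: "lin_ext h 0 = 0"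
  by (simp add: lin_ext_def)

lemma lin_ext_single [simp]: "h p 0 = 0 \<Longrightarrow> lin_ext h (Poly_Mapping.single p a) = h p a"
  by (cases "a = 0") (auto simp: lin_ext_def)

lemma lin_ext_add:
  assumes "\<And>p. h p 0 = 0" "\<And>p a b. h p (a + b) = h p a + h p b"
  shows "lin_ext h (f + g) = lin_ext h f + lin_ext h g"
  unfolding lin_ext_def by (rule setsum_keys_plus_distrib) (use assms in auto)

lemma lookup_scale [simp]: "Poly_Mapping.lookup (Poly_Mapping.map ((*) (a::'k::field)) f) k = a * Poly_Mapping.lookup f k"
  by (simp add: Poly_Mapping.map.rep_eq when_def)

lemma scale_single [simp]: "Poly_Mapping.map ((*) (a::'k::field)) (Poly_Mapping.single p b) = Poly_Mapping.single p (a * b)"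
  by (rule poly_mapping_eqI) (simp add: lookup_single when_def)

lemma scale_add: "Poly_Mapping.map ((*) (a::'k::field)) (f + g) = Poly_Mapping.map ((*) a) f + Poly_Mapping.map ((*) a) g"
  by (rule poly_mapping_eqI) (simp add: lookup_add algebra_simps)

lemma scale_zero [simp]: "Poly_Mapping.map ((*) (a::'k::field)) 0 = 0"
  by (rule poly_mapping_eqI) simp

subsection \<open>The path category\<close>

definition paths :: "('v, 'z) quiver_scheme \<Rightarrow> 'v \<Rightarrow> 'v \<Rightarrow> 'v list set" where
  "paths \<Gamma> x y = {p. quiver_path \<Gamma> p \<and> hd p = x \<and> last p = y}"

lemma paths_ne: "p \<in> paths \<Gamma> x y \<Longrightarrow> p \<noteq> []"
  by (auto simp: paths_def quiver_path_def)

lemma paths_append: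
  assumes p: "p \<in> paths \<Gamma> x y" and q: "q \<in> paths \<Gamma> y z"
  shows "p @ tl q \<in> paths \<Gamma> x z"
proof (cases q)
  case Nil then show ?thesis using paths_ne[OF q] by simp
next
  case (Cons a q')
  show ?thesis
  proof (cases q')
    case Nil then show ?thesis using p q Cons by (auto simp: paths_def)
  next
    case (Cons b q'')
    then show ?thesis using p q \<open>q = a # q'\<close>
      by (auto simp: paths_def quiver_path_def successively_append_iff)
  qed
qed

lemma paths_Nil: "x \<in> verts \<Gamma> \<Longrightarrow> [x] \<in> paths \<Gamma> x x"
  by (auto simp: paths_def quiver_path_def)

lemma paths_ConsI: "x \<in> verts \<Gamma> \<Longrightarrow> (x, y) \<in> arrs \<Gamma> \<Longrightarrow> p \<in> paths \<Gamma> y z \<Longrightarrow> x # p \<in> paths \<Gamma> x z"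
  by (cases p) (auto simp: paths_def quiver_path_def)

lemma paths_cases:
  assumes "p \<in> paths \<Gamma> x z"
  obtains "p = [x]" "x = z" "x \<in> verts \<Gamma>"
    | y p' where "p = x # p'" "x \<in> verts \<Gamma>" "y \<in> verts \<Gamma>" "(x, y) \<in> arrs \<Gamma>" "p' \<in> paths \<Gamma> y z"
proof (cases p)
  case Nil then show ?thesis using paths_ne[OF assms] by simp
next
  case (Cons a p')
  show ?thesis
  proof (cases p')
    case Nil then show ?thesis using Cons assms that(1) by (auto simp: paths_def quiver_path_def)
  next
    case (Cons b p'')
    then show ?thesis using \<open>p = a # p'\<close> assms that(2)[of p' b] by (auto simp: paths_def quiver_path_def)
  qed
qed

lemma paths_verts: "p \<in> paths \<Gamma> x y \<Longrightarrow> x \<in> verts \<Gamma> \<and> y \<in> verts \<Gamma>"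
  by (auto simp: paths_def quiver_path_def)

lemma path_sel [simp]:
  "Obj (path_category \<Gamma>) = verts \<Gamma>"
  "Ide (path_category \<Gamma>) x = Poly_Mapping.single [x] 1"
  "Add (path_category \<Gamma>) x y f g = f + g"
  "Zero (path_category \<Gamma>) x y = 0"
  "Scl (path_category \<Gamma>) x y a f = Poly_Mapping.map ((*) a) f"
  by (simp_all add: path_category_def)

lemma path_Hom: "f \<in> Hom (path_category \<Gamma>) x y \<longleftrightarrow> Poly_Mapping.keys f \<subseteq> paths \<Gamma> x y"
  by (simp add: path_category_def paths_def)

text \<open>Composition of paths as a double linear extension, which makes it additive in both
  arguments without any condition on the supports.\<close>

definition path_comp :: "('v list \<Rightarrow>\<^sub>0 'k::field) \<Rightarrow> ('v list \<Rightarrow>\<^sub>0 'k) \<Rightarrow> ('v list \<Rightarrow>\<^sub>0 'k)" where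
  "path_comp g f = lin_ext (\<lambda>p a. lin_ext (\<lambda>q b. Poly_Mapping.single (p @ tl q) (b * a)) g) f"

lemma path_Comp: "Comp (path_category \<Gamma>) x y z g f = path_comp g f"
  by (simp add: path_category_def path_comp_def lin_ext_def)

lemma path_comp_zero_right [simp]: "path_comp g 0 = 0"
  by (simp add: path_comp_def)

lemma path_comp_zero_left [simp]: "path_comp 0 f = 0"
  by (simp add: path_comp_def lin_ext_def)

lemma path_comp_single [simp]:
  "path_comp (Poly_Mapping.single q b) (Poly_Mapping.single p a) = Poly_Mapping.single (p @ tl q) (b * a)"
  by (simp add: path_comp_def)

lemma path_comp_add_right: "path_comp g (f + f') = path_comp g f + path_comp g f'"
  unfolding path_comp_def
  by (rule lin_ext_add) (auto simp: lin_ext_def distrib_left single_add sum.distrib)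

lemma path_comp_add_left: "path_comp (g + g') f = path_comp g f + path_comp g' f"
proof -
  have "lin_ext (\<lambda>q b. Poly_Mapping.single (p @ tl q) (b * a)) (g + g')
    = lin_ext (\<lambda>q b. Poly_Mapping.single (p @ tl q) (b * a)) g + lin_ext (\<lambda>q b. Poly_Mapping.single (p @ tl q) (b * a)) g'" for p a
    by (rule lin_ext_add) (auto simp: distrib_right single_add)
  then show ?thesis by (simp add: path_comp_def lin_ext_def sum.distrib)
qed

lemma path_single_in [simp]: "p \<in> paths \<Gamma> x y \<Longrightarrow> Poly_Mapping.single p a \<in> Hom (path_category \<Gamma>) x y"
  by (auto simp: path_Hom)

lemma path_add_in: "f \<in> Hom (path_category \<Gamma>) x y \<Longrightarrow> g \<in> Hom (path_category \<Gamma>) x y \<Longrightarrow> f + g \<in> Hom (path_category \<Gamma>) x y"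
  using Poly_Mapping.keys_add[of f g] by (auto simp: path_Hom)

lemma path_zero_in: "0 \<in> Hom (path_category \<Gamma>) x y"
  by (simp add: path_Hom)

lemma path_Hom_induct [consumes 1, case_names zero single add]:
  assumes "f \<in> Hom (path_category \<Gamma>) x y" "P 0" "\<And>p a. p \<in> paths \<Gamma> x y \<Longrightarrow> P (Poly_Mapping.single p a)"
    "\<And>f g. P f \<Longrightarrow> P g \<Longrightarrow> P (f + g)"
  shows "P f"
  using assms(1) unfolding path_Hom by (rule keys_induct) (use assms in auto)

lemma path_comp_in:
  assumes f: "f \<in> Hom (path_category \<Gamma>) x y" and g: "g \<in> Hom (path_category \<Gamma>) y z"
  shows "path_comp g f \<in> Hom (path_category \<Gamma>) x z"
  using f
proof (induction f rule: path_Hom_induct)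
  case (single p a)
  show ?case using g
  proof (induction g rule: path_Hom_induct)
    case (single q b)
    then show ?case using \<open>p \<in> _\<close> by (simp add: paths_append)
  qed (auto simp: path_comp_add_left path_add_in path_zero_in)
qed (auto simp: path_comp_add_right path_add_in path_zero_in)

lemma path_linear: "linear_category (path_category \<Gamma> :: ('k::field, 'v, 'v list \<Rightarrow>\<^sub>0 'k) lcat)"
proof -
  let ?P = "path_category \<Gamma> :: ('k::field, 'v, 'v list \<Rightarrow>\<^sub>0 'k) lcat"
  have idl: "path_comp (Poly_Mapping.single [y] 1) f = f" if "f \<in> Hom ?P x y" for f x y
    using that by (induction f rule: path_Hom_induct) (auto simp: path_comp_add_right)
  have idr: "path_comp f (Poly_Mapping.single [x] 1) = f" if "f \<in> Hom ?P x y" for f x y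
    using that
  proof (induction f rule: path_Hom_induct)
    case (single p a)
    then have "[x] @ tl p = p" using paths_ne[OF single] by (cases p) (auto simp: paths_def)
    then show ?case by simp
  qed (auto simp: path_comp_add_left)
  have assoc: "path_comp (path_comp h g) f = path_comp h (path_comp g f)"
    if f: "f \<in> Hom ?P w x" and g: "g \<in> Hom ?P x y" and h: "h \<in> Hom ?P y z" for f g h w x y z
    using f
  proof (induction f rule: path_Hom_induct)
    case (single p a)
    show ?case using g
    proof (induction g rule: path_Hom_induct)
      case (single q b)
      show ?case using h
      proof (induction h rule: path_Hom_induct)
        case (single r c)
        have "tl (q @ tl r) = tl q @ tl r" using paths_ne[OF \<open>q \<in> _\<close>] by (cases q) auto
        then show ?case by (simp add: mult.assoc)
      qed (auto simp: path_comp_add_left)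
    qed (auto simp: path_comp_add_left path_comp_add_right)
  qed (auto simp: path_comp_add_right)
  have cat: "category ?P"
    unfolding category_def path_sel path_Comp
    by (intro conjI ballI) (auto simp: paths_Nil path_comp_in idl idr assoc simp del: path_comp_single)
  have scl_in: "Poly_Mapping.map ((*) a) f \<in> Hom ?P x y" if "f \<in> Hom ?P x y" for a f x y
    using that by (induction f rule: path_Hom_induct) (auto simp: scale_add path_add_in path_zero_in)
  have hvs: "hom_vector_space ?P x y" for x y
    unfolding hom_vector_space_def path_sel
  proof (intro conjI ballI allI)
    show "(0 :: 'v list \<Rightarrow>\<^sub>0 'k) \<in> Hom ?P x y" by (simp add: path_Hom)
    fix f assume f: "f \<in> Hom ?P x y"
    show "\<exists>g\<in>Hom ?P x y. f + g = 0"
      by (rule bexI[of _ "- f"]) (use f in \<open>auto simp: path_Hom\<close>)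
    show "Poly_Mapping.map ((*) 1) f = f" by (rule poly_mapping_eqI) simp
    { fix a show "Poly_Mapping.map ((*) a) f \<in> Hom ?P x y" by (rule scl_in[OF f]) }
    { fix a b
      show "Poly_Mapping.map ((*) a) (Poly_Mapping.map ((*) b) f) = Poly_Mapping.map ((*) (a * b)) f"
        by (rule poly_mapping_eqI) (simp add: mult.assoc)
      show "Poly_Mapping.map ((*) (a + b)) f = Poly_Mapping.map ((*) a) f + Poly_Mapping.map ((*) b) f"
        by (rule poly_mapping_eqI) (simp add: lookup_add distrib_right) }
    fix g assume "g \<in> Hom ?P x y" then show "f + g \<in> Hom ?P x y" using f by (rule path_add_in[rotated])
  qed (auto simp: scale_add algebra_simps)
  have scl_right: "path_comp g (Poly_Mapping.map ((*) a) f) = Poly_Mapping.map ((*) a) (path_comp g f)"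
    if f: "f \<in> Hom ?P x y" and g: "g \<in> Hom ?P y z" for f g x y z a
    using f
  proof (induction f rule: path_Hom_induct)
    case (single p b)
    show ?case using g by (induction g rule: path_Hom_induct) (auto simp: path_comp_add_left scale_add mult.left_commute mult.assoc)
  qed (auto simp: path_comp_add_right scale_add)
  have scl_left: "path_comp (Poly_Mapping.map ((*) a) g) f = Poly_Mapping.map ((*) a) (path_comp g f)"
    if f: "f \<in> Hom ?P x y" and g: "g \<in> Hom ?P y z" for f g x y z a
    using f
  proof (induction f rule: path_Hom_induct)
    case (single p b)
    show ?case using g by (induction g rule: path_Hom_induct) (auto simp: path_comp_add_left scale_add mult.left_commute mult.assoc)
  qed (auto simp: path_comp_add_right scale_add)
  show ?thesis
    unfolding linear_category_def path_sel path_Comp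
    using cat hvs by (auto simp: path_comp_add_left path_comp_add_right scl_left scl_right)
qed

text \<open>Paths form a basis, so a multiplicative assignment \<open>E\<close> on paths extends
  linearly to a functor. Addition in \<open>D\<close> is assumed to be that of a type because the
  extension is a sum over a finite support.\<close>

lemma functor_on_paths:
  fixes D :: "('k::field, 'p, 'n::ab_group_add) lcat"
  assumes D: "linear_category D" and addD: "\<And>x y f g. Add D x y f g = f + g" and zeroD: "\<And>x y. Zero D x y = 0"
    and Fo: "\<And>x. x \<in> verts \<Gamma> \<Longrightarrow> Fo x \<in> Obj D"
    and E_in: "\<And>x y p. p \<in> paths \<Gamma> x y \<Longrightarrow> E p \<in> Hom D (Fo x) (Fo y)"
    and E_ide: "\<And>x. x \<in> verts \<Gamma> \<Longrightarrow> E [x] = Ide D (Fo x)"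
    and E_comp: "\<And>x y z p q. p \<in> paths \<Gamma> x y \<Longrightarrow> q \<in> paths \<Gamma> y z \<Longrightarrow>
      E (p @ tl q) = Comp D (Fo x) (Fo y) (Fo z) (E q) (E p)"
  obtains Em where "linfun (path_category \<Gamma>) D Fo Em"
    "\<And>x y p a. p \<in> paths \<Gamma> x y \<Longrightarrow> Em x y (Poly_Mapping.single p a) = Scl D (Fo x) (Fo y) a (E p)"
proof -
  interpret D: lincat D by (rule lincat.intro[OF D])
  let ?P = "path_category \<Gamma> :: ('k, _, _ \<Rightarrow>\<^sub>0 'k) lcat"
  interpret P: lincat ?P by (rule lincat.intro[OF path_linear])
  \<comment> \<open>Basis elements that are not paths from \<open>x\<close> to \<open>y\<close> are
    sent to 0, so that \<open>Em\<close> is additive on arbitrary \<open>f\<close> and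
    \<open>g\<close>.\<close>
  define Em where "Em x y f = lin_ext (\<lambda>p a. if p \<in> paths \<Gamma> x y then Scl D (Fo x) (Fo y) a (E p) else 0) f" for x y and f :: "_ \<Rightarrow>\<^sub>0 'k"
  have add_in: "f + g \<in> Hom D x y" if "x \<in> Obj D" "y \<in> Obj D" "f \<in> Hom D x y" "g \<in> Hom D x y" for x y f g
    using D.add_in[OF that] by (simp add: addD)
  have Em_single: "Em x y (Poly_Mapping.single p a) = Scl D (Fo x) (Fo y) a (E p)" if "p \<in> paths \<Gamma> x y" for x y p a
    using that E_in[OF that] Fo paths_verts[OF that] D.scl_zero_scalar[of "Fo x" "Fo y" "E p"]
    unfolding Em_def by (subst lin_ext_single) (auto simp: zeroD)
  have Em_add: "Em x y (f + g) = Em x y f + Em x y g" if "x \<in> verts \<Gamma>" "y \<in> verts \<Gamma>" for x y f g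
    unfolding Em_def
  proof (rule lin_ext_add)
    fix p a b
    show "(if p \<in> paths \<Gamma> x y then Scl D (Fo x) (Fo y) (a + b) (E p) else 0) =
       (if p \<in> paths \<Gamma> x y then Scl D (Fo x) (Fo y) a (E p) else 0) +
       (if p \<in> paths \<Gamma> x y then Scl D (Fo x) (Fo y) b (E p) else 0)"
      using D.scl_add_scalar[of "Fo x" "Fo y" "E p" a b] that E_in[of p x y] Fo by (simp add: addD)
  qed (use D.scl_zero_scalar[of "Fo x" "Fo y"] that E_in[of _ x y] Fo in \<open>auto simp: zeroD\<close>)
  have Em_zero [simp]: "Em x y 0 = 0" for x y by (simp add: Em_def)
  have Em_in: "Em x y f \<in> Hom D (Fo x) (Fo y)" if xy: "x \<in> verts \<Gamma>" "y \<in> verts \<Gamma>" and f: "f \<in> Hom ?P x y" for x y f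
    using f
  proof (induction f rule: path_Hom_induct)
    case zero show ?case using D.zero_in[of "Fo x" "Fo y"] Fo xy by (simp add: zeroD)
  next
    case (single p a) then show ?case using Fo xy E_in by (simp add: Em_single)
  next
    case (add f g) then show ?case using add_in Fo xy by (simp add: Em_add)
  qed
  have zr: "Comp D x y z g 0 = 0" "Comp D y z w 0 g = 0" if "x \<in> Obj D" "y \<in> Obj D" "z \<in> Obj D" "w \<in> Obj D" "g \<in> Hom D y z" for x y z w g
    using D.comp_zero_right[of x y z g] D.comp_zero_left[of y z w g] that by (simp_all add: zeroD)
  have ar: "Comp D x y z g (f + f') = Comp D x y z g f + Comp D x y z g f'"
    if "x \<in> Obj D" "y \<in> Obj D" "z \<in> Obj D" "g \<in> Hom D y z" "f \<in> Hom D x y" "f' \<in> Hom D x y" for x y z g f f'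
    using D.comp_add_right[of x y z f f' g] that by (simp add: addD)
  have al: "Comp D x y z (g + g') f = Comp D x y z g f + Comp D x y z g' f"
    if "x \<in> Obj D" "y \<in> Obj D" "z \<in> Obj D" "g \<in> Hom D y z" "g' \<in> Hom D y z" "f \<in> Hom D x y" for x y z g g' f
    using D.comp_add_left[of x y z f g g'] that by (simp add: addD)
  have Em_comp: "Em x z (path_comp g f) = Comp D (Fo x) (Fo y) (Fo z) (Em y z g) (Em x y f)"
    if xyz: "x \<in> verts \<Gamma>" "y \<in> verts \<Gamma>" "z \<in> verts \<Gamma>" and f: "f \<in> Hom ?P x y" and g: "g \<in> Hom ?P y z" for x y z f g
  proof -
    \<comment> \<open>Membership of \<open>f\<close> in the hom-space is carried along because the
      additive case of the induction does not provide it.\<close>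
    have "Em x z (path_comp g f) = Comp D (Fo x) (Fo y) (Fo z) (Em y z g) (Em x y f) \<and> f \<in> Hom ?P x y"
      using f
    proof (induction f rule: path_Hom_induct)
      case zero show ?case using xyz Fo Em_in[OF xyz(2,3) g] zr(1)[of "Fo x" "Fo y" "Fo z" "Fo x" "Em y z g"] by (simp add: path_Hom)
    next
      case (single p a)
      have "Em x z (path_comp g (Poly_Mapping.single p a)) = Comp D (Fo x) (Fo y) (Fo z) (Em y z g) (Scl D (Fo x) (Fo y) a (E p)) \<and> g \<in> Hom ?P y z"
        using g
      proof (induction g rule: path_Hom_induct)
        case zero show ?case using xyz Fo E_in[OF single] zr(2)[of "Fo x" "Fo x" "Fo y" "Fo z" "Scl D (Fo x) (Fo y) a (E p)"]
          by (simp add: path_Hom)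
      next
        case (single q b)
        show ?case using single \<open>p \<in> _\<close> xyz Fo E_in[OF single] E_in[OF \<open>p \<in> _\<close>]
          by (simp add: Em_single paths_append E_comp mult.commute)
      next
        case (add g g')
        then show ?case using xyz Fo E_in[OF \<open>p \<in> _\<close>] Em_in[OF xyz(2,3)]
          by (auto simp: path_comp_add_left Em_add al path_add_in)
      qed
      then show ?case using single by (simp add: Em_single)
    next
      case (add f f')
      then show ?case using xyz Fo Em_in[OF xyz(1,2)] Em_in[OF xyz(2,3) g]
        by (auto simp: path_comp_add_right Em_add ar path_add_in)
    qed
    then show ?thesis ..
  qed
  have Em_scl: "Em x y (Poly_Mapping.map ((*) a) f) = Scl D (Fo x) (Fo y) a (Em x y f)"
    if xy: "x \<in> verts \<Gamma>" "y \<in> verts \<Gamma>" and f: "f \<in> Hom ?P x y" for x y f a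
  proof -
    have "Em x y (Poly_Mapping.map ((*) a) f) = Scl D (Fo x) (Fo y) a (Em x y f) \<and> f \<in> Hom ?P x y"
      using f
    proof (induction f rule: path_Hom_induct)
      case zero show ?case using D.scl_zero[of "Fo x" "Fo y" a] xy Fo by (simp add: zeroD path_Hom)
    next
      case (single p b) then show ?case using xy Fo E_in by (simp add: Em_single)
    next
      case (add f g)
      then show ?case using xy Fo Em_in[OF xy] D.scl_add[of "Fo x" "Fo y" "Em x y f" "Em x y g" a]
        by (simp add: scale_add Em_add addD path_add_in)
    qed
    then show ?thesis ..
  qed
  have "is_functor ?P D Fo Em"
    unfolding is_functor_def path_sel path_Comp
    using P.cat D.cat Fo Em_in Em_comp by (auto simp: Em_single paths_Nil E_ide)
  then have "linear_functor ?P D Fo Em"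
    unfolding linear_functor_def path_sel using P.linear D.linear by (auto simp: Em_add addD Em_scl)
  then show ?thesis using that Em_single by (metis linfun.intro)
qed

section \<open>Finite-dimensional spaces of sequences\<close>

text \<open>As simplification rules these rewrite \<open>0\<close> and \<open>f + g\<close> to abstractions.\<close>

declare plus_fun_apply [simp del] zero_fun_apply [simp del]

lemma fun2_simps [simp]:
  "(f + g) v = f v + (g v :: 'b \<Rightarrow> 'c::plus)" "(0 :: 'a \<Rightarrow> 'b \<Rightarrow> 'd::zero) v = 0"
  by (simp_all add: plus_fun_apply zero_fun_apply)

lemmas fun_ext = fun_eq_iff plus_fun_apply zero_fun_apply

global_interpretation seq2: vector_space_pair vscale vscale
  by unfold_locales

definition fdim :: "(nat \<Rightarrow> 'k::field) set \<Rightarrow> bool" where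
  "fdim V \<longleftrightarrow> (\<exists>B. finite B \<and> V = seq.span B)"

lemma fdim_subspace: "fdim V \<Longrightarrow> seq.subspace V"
  by (auto simp: fdim_def)

text \<open>A maximal independent subset of \<open>U\<close> spans \<open>U\<close> and is bounded
  by a finite spanning set of \<open>V\<close>.\<close>

lemma fdim_mono:
  assumes "fdim V" "U \<subseteq> V" "seq.subspace U"
  shows "fdim U"
proof -
  obtain B where B: "finite B" "V = seq.span B" using assms by (auto simp: fdim_def)
  obtain A where A: "A \<subseteq> U" "seq.independent A" "U \<subseteq> seq.span A"
    using seq.maximal_independent_subset[of U] by blast
  have "finite A" using seq.independent_span_bound[OF B(1) A(2)] A(1) assms(2) B(2) by auto
  moreover have "U = seq.span A" using A assms(3) seq.span_minimal by blast
  ultimately show ?thesis by (auto simp: fdim_def)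
qed

lemma fdim_zero [simp]: "fdim {0}"
  unfolding fdim_def by (intro exI[of _ "{}"]) auto

lemma vscale_apply: "vscale a x m = a * x m"
  by (simp add: vscale_def)

lemma vscale_add: "vscale a (x + y) = vscale a x + vscale a y"
  by (auto simp: vscale_def fun_ext algebra_simps)

lemma vscale_add_scalar: "vscale (a + b) x = vscale a x + vscale b x"
  by (auto simp: vscale_def fun_ext algebra_simps)

lemma vscale_vscale [simp]: "vscale a (vscale b x) = vscale (a * b) x"
  by (auto simp: vscale_def fun_ext algebra_simps)

lemma sub_zero: "seq.subspace V \<Longrightarrow> 0 \<in> V"
  and sub_add: "seq.subspace V \<Longrightarrow> x \<in> V \<Longrightarrow> y \<in> V \<Longrightarrow> x + y \<in> V"
  and sub_scl: "seq.subspace V \<Longrightarrow> x \<in> V \<Longrightarrow> vscale a x \<in> V"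
  and sub_diff: "seq.subspace V \<Longrightarrow> x \<in> V \<Longrightarrow> y \<in> V \<Longrightarrow> x - y \<in> V"
  by (auto intro: seq.subspace_0 seq.subspace_add seq.subspace_scale seq.subspace_diff)

lemma subI: "0 \<in> V \<Longrightarrow> (\<And>x y. x \<in> V \<Longrightarrow> y \<in> V \<Longrightarrow> x + y \<in> V) \<Longrightarrow> (\<And>a x. x \<in> V \<Longrightarrow> vscale a x \<in> V) \<Longrightarrow> seq.subspace V"
  by (auto intro: seq.subspaceI)

lemma lmI:
  assumes "\<And>x. x \<in> V \<Longrightarrow> f x \<in> W" "\<And>x y. x \<in> V \<Longrightarrow> y \<in> V \<Longrightarrow> f (x + y) = f x + f y"
    "\<And>a x. x \<in> V \<Longrightarrow> f (vscale a x) = vscale a (f x)" "\<And>x. x \<notin> V \<Longrightarrow> f x = 0"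
  shows "f \<in> linear_maps V W"
  using assms unfolding linear_maps_def by blast

lemma lm_in: "f \<in> linear_maps V W \<Longrightarrow> x \<in> V \<Longrightarrow> f x \<in> W"
  and lm_add: "f \<in> linear_maps V W \<Longrightarrow> x \<in> V \<Longrightarrow> y \<in> V \<Longrightarrow> f (x + y) = f x + f y"
  and lm_scl: "f \<in> linear_maps V W \<Longrightarrow> x \<in> V \<Longrightarrow> f (vscale a x) = vscale a (f x)"
  and lm_out: "f \<in> linear_maps V W \<Longrightarrow> x \<notin> V \<Longrightarrow> f x = 0"
  unfolding linear_maps_def by blast+

lemma lm_zero: "f \<in> linear_maps V W \<Longrightarrow> f 0 = 0"
  using lm_scl[of f V W 0 0] lm_out[of f V W 0] by (cases "0 \<in> V") auto

lemma lm_diff: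
  assumes "f \<in> linear_maps V W" "seq.subspace V" "x \<in> V" "y \<in> V"
  shows "f (x - y) = f x - f y"
proof -
  have "f (x - y) = f (x + vscale (- 1) y)" by simp
  also have "\<dots> = f x + vscale (- 1) (f y)"
    using lm_add[OF assms(1,3) sub_scl[OF assms(2,4)], of "- 1"] lm_scl[OF assms(1,4), of "- 1"] by simp
  also have "\<dots> = f x - f y" by simp
  finally show ?thesis .
qed

lemma lm_comp:
  assumes "f \<in> linear_maps U V" "g \<in> linear_maps V W"
  shows "g \<circ> f \<in> linear_maps U W"
  by (rule lmI) (use assms in \<open>auto simp: lm_in lm_add lm_scl lm_out lm_zero[OF assms(2)]\<close>)

lemma lm_plus: "seq.subspace W \<Longrightarrow> f \<in> linear_maps V W \<Longrightarrow> g \<in> linear_maps V W \<Longrightarrow> f + g \<in> linear_maps V W"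
  by (rule lmI) (auto simp: lm_in lm_add lm_scl lm_out sub_add vscale_add)

lemma lm_null: "seq.subspace W \<Longrightarrow> 0 \<in> linear_maps V W"
  by (rule lmI) (auto simp: sub_zero)

lemma lm_scale: "seq.subspace W \<Longrightarrow> f \<in> linear_maps V W \<Longrightarrow> (\<lambda>x. vscale a (f x)) \<in> linear_maps V W"
  by (rule lmI) (auto simp: lm_in lm_add lm_scl lm_out sub_scl vscale_add mult.commute vscale_apply)

lemma lm_ext: "f \<in> linear_maps V W \<Longrightarrow> g \<in> linear_maps V W' \<Longrightarrow> (\<And>x. x \<in> V \<Longrightarrow> f x = g x) \<Longrightarrow> f = g"
  by (rule ext) (metis lm_out)

lemma span_image_linear:
  assumes "\<And>x y. x \<in> seq.span B \<Longrightarrow> y \<in> seq.span B \<Longrightarrow> f (x + y) = f x + f y"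
    "\<And>a x. x \<in> seq.span B \<Longrightarrow> f (vscale a x) = vscale a (f x)" and x: "x \<in> seq.span B"
  shows "f x \<in> seq.span (f ` B)"
proof -
  \<comment> \<open>\<open>f\<close> is linear on the span only, so membership in the span is part
    of the induction.\<close>
  have "x \<in> seq.span B \<and> f x \<in> seq.span (f ` B)"
    using x
  proof (induction rule: seq.span_induct_alt)
    case base
    have "f 0 = 0" using assms(2)[of 0 0] by (simp add: seq.span_zero)
    then show ?case by (simp only: seq.span_zero)
  next
    case (step c b y)
    then have b: "b \<in> seq.span B" "vscale c b \<in> seq.span B" by (auto intro: seq.span_base seq.span_scale)
    have "f (vscale c b + y) = vscale c (f b) + f y" using b step assms by simp
    then show ?case using b step by (simp add: seq.span_add seq.span_scale seq.span_base)
  qed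
  then show ?thesis ..
qed

lemma subspace_image:
  assumes "f \<in> linear_maps V W" "seq.subspace V"
  shows "seq.subspace (f ` V)"
proof (rule subI)
  show "0 \<in> f ` V" using lm_zero[OF assms(1)] sub_zero[OF assms(2)] by force
  fix x y assume "x \<in> f ` V" "y \<in> f ` V"
  then obtain u v where "u \<in> V" "v \<in> V" "x = f u" "y = f v" by auto
  then show "x + y \<in> f ` V" using lm_add[OF assms(1), of u v] sub_add[OF assms(2), of u v] by (simp add: image_iff) metis
next
  fix a x assume "x \<in> f ` V"
  then obtain u where "u \<in> V" "x = f u" by auto
  then show "vscale a x \<in> f ` V" using lm_scl[OF assms(1), of u a] sub_scl[OF assms(2), of u a] by (simp add: image_iff) metis
qed

lemma subspace_ker:
  assumes "f \<in> linear_maps V W" "seq.subspace V"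
  shows "seq.subspace {x \<in> V. f x = 0}"
  by (rule subI) (use assms in \<open>auto simp: sub_zero sub_add sub_scl lm_zero lm_add lm_scl\<close>)

text \<open>The quotient of \<open>V\<close> by \<open>U\<close> is realized as a complement inside
  \<open>V\<close>: a basis \<open>A\<close> of \<open>U\<close> is extended to a basis
  \<open>B\<close> of \<open>V\<close>, and \<open>g\<close> kills \<open>A\<close> and fixes
  \<open>B - A\<close>.\<close>

lemma quotient_map:
  fixes V :: "(nat \<Rightarrow> 'k::field) set"
  assumes V: "fdim V" and U: "seq.subspace U" "U \<subseteq> V"
  obtains C p where "fdim C" "p \<in> linear_maps V C" "p ` V = C" "\<And>x. x \<in> V \<Longrightarrow> p x = 0 \<longleftrightarrow> x \<in> U"
proof -
  obtain A where A: "A \<subseteq> U" "seq.independent A" "U \<subseteq> seq.span A"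
    using seq.maximal_independent_subset[of U] by blast
  have AU: "U = seq.span A" using A U(1) seq.span_minimal by blast
  obtain B where B: "A \<subseteq> B" "B \<subseteq> V" "seq.independent B" "V \<subseteq> seq.span B"
    by (rule seq.maximal_independent_subset_extend[of A V]) (use A U in auto)
  have BV: "V = seq.span B" using B V fdim_subspace seq.span_minimal by blast
  obtain g where g: "Vector_Spaces.linear vscale vscale g" "\<forall>x\<in>B. g x = (if x \<in> A then 0 else x)"
    using seq2.linear_independent_extend[OF B(3), of "\<lambda>x. if x \<in> A then 0 else x"] by blast
  interpret g: Vector_Spaces.linear vscale vscale g by (rule g(1))
  have gA: "g x = 0" if "x \<in> seq.span A" for x
    using that by (induction rule: seq.span_induct_alt) (use A B g in \<open>auto simp: g.add g.scale\<close>)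
  have gBA: "g x = x" if "x \<in> seq.span (B - A)" for x
    using that by (induction rule: seq.span_induct_alt) (use A B g in \<open>auto simp: g.add g.scale\<close>)
  have dec: "\<exists>u c. u \<in> seq.span A \<and> c \<in> seq.span (B - A) \<and> x = u + c" if "x \<in> V" for x
  proof -
    have "x \<in> seq.span (A \<union> (B - A))" using that BV B(1) by (simp add: Un_absorb1)
    then show ?thesis unfolding seq.span_Un by auto
  qed
  define p where "p x = (if x \<in> V then g x else 0)" for x
  define C where "C = seq.span (B - A)"
  have CV: "C \<subseteq> V" unfolding C_def BV by (rule seq.span_mono) auto
  have subV: "seq.subspace V" using V fdim_subspace by auto
  have pV: "p x \<in> C" if "x \<in> V" for x
    using dec[OF that] that gA gBA by (auto simp: p_def C_def g.add)
  have "fdim C" by (rule fdim_mono[OF V CV]) (simp add: C_def)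
  moreover have "p \<in> linear_maps V C"
    by (rule lmI) (use pV subV in \<open>auto simp: p_def g.add g.scale sub_add sub_scl\<close>)
  moreover have "p ` V = C"
  proof
    show "C \<subseteq> p ` V"
    proof
      fix c assume c: "c \<in> C"
      then have "p c = c" using CV gBA by (auto simp: p_def C_def)
      then show "c \<in> p ` V" using c CV by (metis imageI subsetD)
    qed
  qed (use pV in auto)
  moreover have "p x = 0 \<longleftrightarrow> x \<in> U" if "x \<in> V" for x
  proof
    assume "p x = 0"
    then show "x \<in> U" using dec[OF that] that gA gBA AU by (auto simp: p_def g.add)
  qed (use that gA AU in \<open>auto simp: p_def\<close>)
  ultimately show ?thesis by (rule that)
qed

text \<open>Some coordinate of the image of \<open>x\<close> in the quotient by \<open>W\<close> is
  nonzero; rescaled, this coordinate is the functional.\<close>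

lemma separating_functional:
  fixes V :: "(nat \<Rightarrow> 'k::field) set"
  assumes "fdim V" "seq.subspace W" "W \<subseteq> V" "x \<in> V" "x \<notin> W"
  obtains l :: "(nat \<Rightarrow> 'k) \<Rightarrow> 'k" where "l x = 1" "\<And>y. y \<in> W \<Longrightarrow> l y = 0"
    "\<And>y z. y \<in> V \<Longrightarrow> z \<in> V \<Longrightarrow> l (y + z) = l y + l z" "\<And>a y. y \<in> V \<Longrightarrow> l (vscale a y) = a * l y"
proof -
  obtain C p where p: "fdim C" "p \<in> linear_maps V C" "p ` V = C" "\<And>x. x \<in> V \<Longrightarrow> p x = 0 \<longleftrightarrow> x \<in> W"
    using quotient_map[OF assms(1,2,3)] by blast
  have "p x \<noteq> 0" using p(4) assms by auto
  then obtain m where m: "p x m \<noteq> 0" by (auto simp: fun_ext)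
  have "p y = 0" if "y \<in> W" for y using p(4) that assms(3) by blast
  then show ?thesis
    by (intro that[of "\<lambda>y. p y m / p x m"])
      (use m p(2) assms(4) in \<open>auto simp: lm_add lm_scl add_divide_distrib vscale_apply fun_ext\<close>)
qed

section \<open>The category of representations is abelian\<close>

lemma rep_sel [simp]:
  "Obj (rep_category Q) = {X. representation Q X}"
  "Ide (rep_category Q) X = (\<lambda>v x. if v \<in> verts Q \<and> x \<in> space_at X v then x else 0)"
  "Comp (rep_category Q) X Y Z \<psi> \<phi> = (\<lambda>v. \<psi> v \<circ> \<phi> v)"
  "Add (rep_category Q) X Y \<phi> \<psi> = \<phi> + \<psi>"
  "Zero (rep_category Q) X Y = 0"
  "Scl (rep_category Q) X Y a \<phi> = (\<lambda>v x. vscale a (\<phi> v x))"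
  by (simp_all add: rep_category_def)

lemma rep_Hom: "\<phi> \<in> Hom (rep_category Q) X Y \<longleftrightarrow>
    (\<forall>v\<in>verts Q. \<phi> v \<in> linear_maps (space_at X v) (space_at Y v)) \<and> (\<forall>v. v \<notin> verts Q \<longrightarrow> \<phi> v = 0) \<and>
    (\<forall>a b. (a, b) \<in> arrs Q \<longrightarrow> (\<forall>x\<in>space_at X a. \<phi> b (map_at X (a, b) x) = map_at Y (a, b) (\<phi> a x)))"
  by (auto simp: rep_category_def)

lemma rep_HomI:
  assumes "\<And>v. v \<in> verts Q \<Longrightarrow> \<phi> v \<in> linear_maps (space_at X v) (space_at Y v)" "\<And>v. v \<notin> verts Q \<Longrightarrow> \<phi> v = 0"
    "\<And>a b x. (a, b) \<in> arrs Q \<Longrightarrow> x \<in> space_at X a \<Longrightarrow> \<phi> b (map_at X (a, b) x) = map_at Y (a, b) (\<phi> a x)"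
  shows "\<phi> \<in> Hom (rep_category Q) X Y"
  using assms by (auto simp: rep_Hom)

lemma rep_lm: "\<phi> \<in> Hom (rep_category Q) X Y \<Longrightarrow> v \<in> verts Q \<Longrightarrow> \<phi> v \<in> linear_maps (space_at X v) (space_at Y v)"
  and rep_outside: "\<phi> \<in> Hom (rep_category Q) X Y \<Longrightarrow> v \<notin> verts Q \<Longrightarrow> \<phi> v = 0"
  and rep_nat: "\<phi> \<in> Hom (rep_category Q) X Y \<Longrightarrow> (a, b) \<in> arrs Q \<Longrightarrow> x \<in> space_at X a \<Longrightarrow>
    \<phi> b (map_at X (a, b) x) = map_at Y (a, b) (\<phi> a x)"
  by (auto simp: rep_Hom)

lemma rep_hom_eqI:
  assumes "\<phi> \<in> Hom (rep_category Q) X Y" "\<psi> \<in> Hom (rep_category Q) X Y"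
    "\<And>v x. v \<in> verts Q \<Longrightarrow> x \<in> space_at X v \<Longrightarrow> \<phi> v x = \<psi> v x"
  shows "\<phi> = \<psi>"
proof (rule ext)
  fix v show "\<phi> v = \<psi> v"
    by (cases "v \<in> verts Q") (use assms rep_outside[of \<phi>] rep_outside[of \<psi>] lm_ext[OF rep_lm[OF assms(1)] rep_lm[OF assms(2)]] in auto)
qed

lemma representationI:
  assumes "\<And>v. v \<in> verts Q \<Longrightarrow> fdim (space_at X v)"
    "\<And>a b. (a, b) \<in> arrs Q \<Longrightarrow> map_at X (a, b) \<in> linear_maps (space_at X a) (space_at X b)"
  shows "representation Q X"
  using assms by (auto simp: representation_def fdim_def)

lemma rep_fdim: "representation Q X \<Longrightarrow> v \<in> verts Q \<Longrightarrow> fdim (space_at X v)"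
  and rep_map: "representation Q X \<Longrightarrow> (a, b) \<in> arrs Q \<Longrightarrow> map_at X (a, b) \<in> linear_maps (space_at X a) (space_at X b)"
  by (auto simp: representation_def fdim_def)

lemma rep_sub [simp]: "representation Q X \<Longrightarrow> v \<in> verts Q \<Longrightarrow> seq.subspace (space_at X v)"
  by (rule fdim_subspace[OF rep_fdim])

locale proper_quiver =
  fixes Q :: "'v quiver"
  assumes arrs_verts: "(a, b) \<in> arrs Q \<Longrightarrow> a \<in> verts Q \<and> b \<in> verts Q"
begin

abbreviation "R \<equiv> rep_category Q"

lemma R_linear: "linear_category (R :: ('k::field, ('v, 'k) rep, ('v, 'k) rep_mor) lcat)"
proof -
  let ?R = "R :: ('k::field, ('v, 'k) rep, ('v, 'k) rep_mor) lcat"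
  have comp_in: "(\<lambda>v. g v \<circ> f v) \<in> Hom ?R X Z"
    if f: "f \<in> Hom ?R X Y" and g: "g \<in> Hom ?R Y Z" for f g X Y Z
  proof (rule rep_HomI)
    fix v assume "v \<in> verts Q" then show "g v \<circ> f v \<in> linear_maps (space_at X v) (space_at Z v)"
      using lm_comp[OF rep_lm[OF f] rep_lm[OF g]] by simp
  next
    fix v assume "v \<notin> verts Q" then show "g v \<circ> f v = 0"
      using rep_outside[OF f] rep_outside[OF g] by (simp add: fun_ext)
  next
    fix a b x assume ab: "(a, b) \<in> arrs Q" and x: "x \<in> space_at X a"
    have "f a x \<in> space_at Y a" using lm_in[OF rep_lm[OF f]] x arrs_verts[OF ab] by auto
    then show "(g b \<circ> f b) (map_at X (a, b) x) = map_at Z (a, b) ((g a \<circ> f a) x)"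
      using rep_nat[OF f ab x] rep_nat[OF g ab] by simp
  qed
  have ide_in: "Ide ?R X \<in> Hom ?R X X" if X: "representation Q X" for X
  proof (rule rep_HomI)
    fix v assume "v \<in> verts Q" then show "Ide ?R X v \<in> linear_maps (space_at X v) (space_at X v)"
      using rep_sub[OF X] by (intro lmI) (auto simp: sub_add sub_scl)
  next
    fix a b x assume ab: "(a, b) \<in> arrs Q" and x: "x \<in> space_at X a"
    then show "Ide ?R X b (map_at X (a, b) x) = map_at X (a, b) (Ide ?R X a x)"
      using arrs_verts[OF ab] lm_in[OF rep_map[OF X ab]] by auto
  qed (auto simp: fun_ext)
  have idl: "(\<lambda>v. Ide ?R Y v \<circ> f v) = f" and idr: "(\<lambda>v. f v \<circ> Ide ?R X v) = f"
    if X: "representation Q X" "representation Q Y" and f: "f \<in> Hom ?R X Y" for f X Y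
    using rep_hom_eqI[OF comp_in[OF f ide_in[OF X(2)]] f] rep_hom_eqI[OF comp_in[OF ide_in[OF X(1)] f] f]
      lm_in[OF rep_lm[OF f]] by auto
  have cat: "category ?R"
    unfolding category_def rep_sel(1,3)
    by (intro conjI ballI) (use comp_in ide_in idl idr in \<open>simp_all add: comp_assoc del: rep_sel(2)\<close>)
  have add_in: "f + g \<in> Hom ?R X Y" if X: "representation Q X" "representation Q Y" and f: "f \<in> Hom ?R X Y" and g: "g \<in> Hom ?R X Y" for f g X Y
  proof (rule rep_HomI)
    fix v assume "v \<in> verts Q" then show "(f + g) v \<in> linear_maps (space_at X v) (space_at Y v)"
      using lm_plus[OF _ rep_lm[OF f] rep_lm[OF g]] X by simp
  next
    fix v assume "v \<notin> verts Q" then show "(f + g) v = 0"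
      using rep_outside[OF f] rep_outside[OF g] by simp
  next
    fix a b x assume ab: "(a, b) \<in> arrs Q" and x: "x \<in> space_at X a"
    then show "(f + g) b (map_at X (a, b) x) = map_at Y (a, b) ((f + g) a x)"
      using arrs_verts[OF ab] lm_in[OF rep_lm[OF f]] lm_in[OF rep_lm[OF g]] lm_add[OF rep_map[OF X(2) ab]]
      by (simp add: rep_nat[OF f] rep_nat[OF g])
  qed
  have scl_in: "(\<lambda>v x. vscale a (f v x)) \<in> Hom ?R X Y" if X: "representation Q X" "representation Q Y" and f: "f \<in> Hom ?R X Y" for a f X Y
  proof (rule rep_HomI)
    fix v assume "v \<in> verts Q" then show "(\<lambda>x. vscale a (f v x)) \<in> linear_maps (space_at X v) (space_at Y v)"
      using lm_scale[OF _ rep_lm[OF f]] X by simp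
  next
    fix v assume "v \<notin> verts Q" then show "(\<lambda>x. vscale a (f v x)) = 0"
      using rep_outside[OF f] by (simp add: fun_ext vscale_apply)
  next
    fix u b x assume ab: "(u, b) \<in> arrs Q" and x: "x \<in> space_at X u"
    then show "vscale a (f b (map_at X (u, b) x)) = map_at Y (u, b) (vscale a (f u x))"
      using arrs_verts[OF ab] lm_in[OF rep_lm[OF f]] lm_scl[OF rep_map[OF X(2) ab]]
      by (simp add: rep_nat[OF f])
  qed
  have zero_in: "0 \<in> Hom ?R X Y" if X: "representation Q X" "representation Q Y" for X Y
    by (rule rep_HomI) (use X in \<open>auto simp: lm_null lm_zero[OF rep_map]\<close>)
  have hvs: "hom_vector_space ?R X Y" if X: "representation Q X" "representation Q Y" for X Y
    unfolding hom_vector_space_def rep_sel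
  proof (intro conjI ballI allI)
    fix f assume f: "f \<in> Hom ?R X Y"
    show "\<exists>g\<in>Hom ?R X Y. f + g = 0"
      by (rule bexI[OF _ scl_in[OF X f, of "- 1"]]) (auto simp: fun_ext vscale_def)
  qed (use X zero_in add_in scl_in in \<open>auto simp: fun_ext vscale_add vscale_add_scalar algebra_simps\<close>)
  have cr: "(\<lambda>v. g v \<circ> (f + f') v) = (\<lambda>v. g v \<circ> f v) + (\<lambda>v. g v \<circ> f' v)"
    if X: "representation Q X" "representation Q Y" "representation Q Z" and f: "f \<in> Hom ?R X Y" "f' \<in> Hom ?R X Y" and g: "g \<in> Hom ?R Y Z" for f f' g X Y Z
    by (rule rep_hom_eqI[OF comp_in[OF add_in[OF X(1,2) f] g] add_in[OF X(1,3) comp_in[OF f(1) g] comp_in[OF f(2) g]]])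
      (use lm_in[OF rep_lm[OF f(1)]] lm_in[OF rep_lm[OF f(2)]] lm_add[OF rep_lm[OF g]] in auto)
  have sr: "(\<lambda>v. g v \<circ> (\<lambda>x. vscale a (f v x))) = (\<lambda>v x. vscale a (g v (f v x)))"
    if X: "representation Q X" "representation Q Y" "representation Q Z" and f: "f \<in> Hom ?R X Y" and g: "g \<in> Hom ?R Y Z" for f g X Y Z a
    using rep_hom_eqI[OF comp_in[OF scl_in[OF X(1,2) f] g, of a] scl_in[OF X(1,3) comp_in[OF f g], of a]]
      lm_in[OF rep_lm[OF f]] lm_scl[OF rep_lm[OF g]] by (auto simp: comp_def)
  show ?thesis
    unfolding linear_category_def rep_sel
    using cat hvs cr sr by (auto simp: fun_ext)
qed

sublocale R: lincat "R :: ('k::field, ('v, 'k) rep, ('v, 'k) rep_mor) lcat"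
  by (rule lincat.intro[OF R_linear])

section \<open>Kernels, cokernels and quotients of representations, vertex by vertex\<close>

lemma comp_eq_zeroD: "(\<lambda>v. g v \<circ> f v) = 0 \<Longrightarrow> g v (f v x) = (0 :: nat \<Rightarrow> 'k::field)"
  by (auto simp: fun_ext)

text \<open>A map killed by \<open>\<phi>\<close> lands at each vertex in the image of
  \<open>i\<close>; injectivity of \<open>i\<close> makes the pointwise inverse linear and
  compatible with the arrows.\<close>

lemma kernelI:
  fixes \<phi> :: "('v, 'k::field) rep_mor"
  assumes K: "representation Q K" and X: "representation Q X" and Y: "representation Q Y"
    and i: "i \<in> Hom R K X" and \<phi>: "\<phi> \<in> Hom R X Y"
    and inj: "\<And>v. v \<in> verts Q \<Longrightarrow> inj_on (i v) (space_at K v)"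
    and im: "\<And>v. v \<in> verts Q \<Longrightarrow> i v ` space_at K v = {x \<in> space_at X v. \<phi> v x = 0}"
  shows "is_kernel R K X Y i \<phi>"
  unfolding is_kernel_def
proof (intro conjI ballI impI i \<phi>)
  have "(\<lambda>v. \<phi> v \<circ> i v) = 0"
    by (rule rep_hom_eqI[OF R.comp_in[OF _ _ _ i \<phi>, simplified] R.zero_in[of K Y, simplified]]) (use K X Y im in auto)
  then show "Comp R K X Y \<phi> i = Zero R K Y" by simp
  fix W h assume W: "W \<in> Obj R" and h: "h \<in> Hom R W X" and z: "Comp R W X Y \<phi> h = Zero R W Y"
  have hv: "h v x \<in> i v ` space_at K v" if "v \<in> verts Q" "x \<in> space_at W v" for v x
    using im[OF that(1)] lm_in[OF rep_lm[OF h that(1)] that(2)] z by (auto simp: fun_ext)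
  define u where "u v x = (if v \<in> verts Q \<and> x \<in> space_at W v then inv_into (space_at K v) (i v) (h v x) else 0)" for v x
  have u: "u v x \<in> space_at K v" "i v (u v x) = h v x" if "v \<in> verts Q" "x \<in> space_at W v" for v x
    using inv_into_into[OF hv[OF that]] f_inv_into_f[OF hv[OF that]] that by (simp_all add: u_def)
  have eqI: "y = z" if "v \<in> verts Q" "y \<in> space_at K v" "z \<in> space_at K v" "i v y = i v z" for v y z
    using inj that by (meson inj_onD)
  have uH: "u \<in> Hom R W K"
  proof (rule rep_HomI)
    fix v assume v: "v \<in> verts Q"
    have sW: "seq.subspace (space_at W v)" and sK: "seq.subspace (space_at K v)" using v W K by auto
    show "u v \<in> linear_maps (space_at W v) (space_at K v)"
    proof (rule lmI)
      fix x y assume xy: "x \<in> space_at W v" "y \<in> space_at W v"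
      show "u v (x + y) = u v x + u v y"
        by (rule eqI[OF v]) (use xy u[OF v] v sub_add[OF sW] sub_add[OF sK] lm_add[OF rep_lm[OF i v]] lm_add[OF rep_lm[OF h v]] in auto)
    next
      fix a x assume x: "x \<in> space_at W v"
      show "u v (vscale a x) = vscale a (u v x)"
        by (rule eqI[OF v]) (use x u[OF v] v sub_scl[OF sW] sub_scl[OF sK] lm_scl[OF rep_lm[OF i v]] lm_scl[OF rep_lm[OF h v]] in auto)
    qed (use u v in \<open>auto simp: u_def\<close>)
  next
    fix a b x assume ab: "(a, b) \<in> arrs Q" and x: "x \<in> space_at W a"
    note v = arrs_verts[OF ab]
    have Wx: "map_at W (a, b) x \<in> space_at W b" using lm_in[OF rep_map[of Q W, OF _ ab] x] W by simp
    show "u b (map_at W (a, b) x) = map_at K (a, b) (u a x)"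
      by (rule eqI[of b]) (use v u Wx x lm_in[OF rep_map[OF K ab]] rep_nat[OF i ab] rep_nat[OF h ab x] in auto)
  qed (auto simp: u_def fun_ext)
  show "\<exists>!u. u \<in> Hom R W K \<and> Comp R W K X i u = h"
  proof (rule ex1I[of _ u], intro conjI uH)
    show "Comp R W K X i u = h"
      unfolding rep_sel
      by (rule rep_hom_eqI[OF R.comp_in[OF _ _ _ uH i, simplified] h]) (use K X W u in auto)
    fix u' assume u': "u' \<in> Hom R W K \<and> Comp R W K X i u' = h"
    show "u' = u"
    proof (rule rep_hom_eqI[OF _ uH])
      fix v x assume v: "v \<in> verts Q" "x \<in> space_at W v"
      have "i v (u' v x) = h v x" using u' by (auto simp: fun_ext)
      then show "u' v x = u v x" using eqI[OF v(1)] u[OF v] lm_in[OF rep_lm v(2)] u' v by auto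
    qed (use u' in auto)
  qed
qed

text \<open>\<open>h\<close> is constant on the fibres of \<open>p\<close>, because the kernel of
  \<open>p\<close> is the image of \<open>\<phi>\<close>; so it descends along the surjection, with
  values read off at chosen preimages \<open>s\<close>.\<close>

lemma cokernelI:
  fixes \<phi> :: "('v, 'k::field) rep_mor"
  assumes X: "representation Q X" and Y: "representation Q Y" and Z: "representation Q Z"
    and \<phi>: "\<phi> \<in> Hom R X Y" and p: "p \<in> Hom R Y Z"
    and surj: "\<And>v. v \<in> verts Q \<Longrightarrow> p v ` space_at Y v = space_at Z v"
    and ker: "\<And>v. v \<in> verts Q \<Longrightarrow> {y \<in> space_at Y v. p v y = 0} = \<phi> v ` space_at X v"
  shows "is_cokernel R X Y Z \<phi> p"
  unfolding is_cokernel_def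
proof (intro conjI ballI impI p \<phi>)
  have "(\<lambda>v. p v \<circ> \<phi> v) = 0"
    by (rule rep_hom_eqI[OF R.comp_in[OF _ _ _ \<phi> p, simplified] R.zero_in[of X Z, simplified]]) (use X Y Z ker in auto)
  then show "Comp R X Y Z p \<phi> = Zero R X Z" by simp
  fix W h assume W: "W \<in> Obj R" and h: "h \<in> Hom R Y W" and z: "Comp R X Y W h \<phi> = Zero R X W"
  define s where "s v z = (SOME y. y \<in> space_at Y v \<and> p v y = z)" for v z
  have s: "s v z \<in> space_at Y v" "p v (s v z) = z" if "v \<in> verts Q" "z \<in> space_at Z v" for v z
  proof -
    have "\<exists>y. y \<in> space_at Y v \<and> p v y = z" using that(2) unfolding surj[OF that(1), symmetric] by blast
    from someI_ex[OF this] show "s v z \<in> space_at Y v" "p v (s v z) = z" unfolding s_def by auto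
  qed
  have hp: "h v y = h v y'" if "v \<in> verts Q" "y \<in> space_at Y v" "y' \<in> space_at Y v" "p v y = p v y'" for v y y'
  proof -
    have sY: "seq.subspace (space_at Y v)" using Y that by auto
    have "p v (y - y') = 0" using lm_diff[OF rep_lm[OF p that(1)] sY that(2,3)] that(4) by simp
    then have "y - y' \<in> \<phi> v ` space_at X v" using ker[OF that(1)] sub_diff[OF sY that(2,3)] by blast
    then obtain x where "y - y' = \<phi> v x" by blast
    then have "h v (y - y') = 0" using comp_eq_zeroD[OF z[unfolded rep_sel], of v x] by simp
    then show ?thesis using lm_diff[OF rep_lm[OF h that(1)] sY that(2,3)] by simp
  qed
  define u where "u v z = (if v \<in> verts Q \<and> z \<in> space_at Z v then h v (s v z) else 0)" for v z
  have u: "u v (p v y) = h v y" if "v \<in> verts Q" "y \<in> space_at Y v" for v y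
    using lm_in[OF rep_lm[OF p that(1)] that(2)] s[OF that(1), of "p v y"] that hp[of v "s v (p v y)" y]
    by (auto simp: u_def)
  have ex: "\<exists>y\<in>space_at Y v. z = p v y" if "v \<in> verts Q" "z \<in> space_at Z v" for v z
    using surj[OF that(1)] that by auto
  have uH: "u \<in> Hom R Z W"
  proof (rule rep_HomI)
    fix v assume v: "v \<in> verts Q"
    have sY: "seq.subspace (space_at Y v)" using v Y by auto
    show "u v \<in> linear_maps (space_at Z v) (space_at W v)"
    proof (rule lmI)
      fix x assume "x \<in> space_at Z v"
      then obtain y where "y \<in> space_at Y v" "x = p v y" using ex[OF v] by meson
      then show "u v x \<in> space_at W v" using u[OF v] lm_in[OF rep_lm[OF h v]] by simp
    next
      fix x y assume xy: "x \<in> space_at Z v" "y \<in> space_at Z v"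
      obtain x' y' where x': "x' \<in> space_at Y v" "x = p v x'" "y' \<in> space_at Y v" "y = p v y'"
        using ex[OF v] xy by meson
      have "x + y = p v (x' + y')" using x' lm_add[OF rep_lm[OF p v]] by simp
      then show "u v (x + y) = u v x + u v y"
        using x' u[OF v] sub_add[OF sY] lm_add[OF rep_lm[OF h v]] by simp
    next
      fix a x assume x: "x \<in> space_at Z v"
      obtain x' where x': "x' \<in> space_at Y v" "x = p v x'" using ex[OF v] x by meson
      have "vscale a x = p v (vscale a x')" using x' lm_scl[OF rep_lm[OF p v]] by simp
      then show "u v (vscale a x) = vscale a (u v x)"
        using x' u[OF v] sub_scl[OF sY] lm_scl[OF rep_lm[OF h v]] by simp
    qed (auto simp: u_def)
  next
    fix a b x assume ab: "(a, b) \<in> arrs Q" and x: "x \<in> space_at Z a"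
    note v = arrs_verts[OF ab]
    obtain y where y: "y \<in> space_at Y a" "x = p a y" using ex v x by meson
    have Yy: "map_at Y (a, b) y \<in> space_at Y b" using lm_in[OF rep_map[OF Y ab] y(1)] .
    have "map_at Z (a, b) x = p b (map_at Y (a, b) y)" using y rep_nat[OF p ab y(1)] by simp
    then show "u b (map_at Z (a, b) x) = map_at W (a, b) (u a x)"
      using u Yy v y rep_nat[OF h ab y(1)] by simp
  qed (auto simp: u_def fun_ext)
  show "\<exists>!u. u \<in> Hom R Z W \<and> Comp R Y Z W u p = h"
  proof (rule ex1I[of _ u], intro conjI uH)
    show "Comp R Y Z W u p = h"
      unfolding rep_sel
      by (rule rep_hom_eqI[OF R.comp_in[OF _ _ _ p uH, simplified] h]) (use Y Z W u in auto)
    fix u' assume u': "u' \<in> Hom R Z W \<and> Comp R Y Z W u' p = h"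
    show "u' = u"
    proof (rule rep_hom_eqI[OF _ uH])
      fix v x assume v: "v \<in> verts Q" "x \<in> space_at Z v"
      obtain y where y: "y \<in> space_at Y v" "x = p v y" using ex v by meson
      have "u' v (p v y) = h v y" using u' by (auto simp: fun_ext)
      then show "u' v x = u v x" using u[OF v(1) y(1)] y by simp
    qed (use u' in auto)
  qed
qed

text \<open>The maps are set to zero outside the subspaces, as the convention of
  \<open>linear_maps\<close> requires.\<close>

definition subrep :: "('v, 'k::field) rep \<Rightarrow> ('v \<Rightarrow> (nat \<Rightarrow> 'k) set) \<Rightarrow> ('v, 'k) rep" where
  "subrep X S = \<lparr>space_at = S, map_at = (\<lambda>(a, b) x. if x \<in> S a then map_at X (a, b) x else 0)\<rparr>"

definition incl :: "('v \<Rightarrow> (nat \<Rightarrow> 'k::field) set) \<Rightarrow> ('v, 'k) rep_mor" where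
  "incl S v x = (if v \<in> verts Q \<and> x \<in> S v then x else 0)"

definition stable :: "('v, 'k::field) rep \<Rightarrow> ('v \<Rightarrow> (nat \<Rightarrow> 'k) set) \<Rightarrow> bool" where
  "stable X S \<longleftrightarrow> (\<forall>v\<in>verts Q. seq.subspace (S v) \<and> S v \<subseteq> space_at X v) \<and>
     (\<forall>a b. (a, b) \<in> arrs Q \<longrightarrow> map_at X (a, b) ` S a \<subseteq> S b)"

lemma subrep:
  assumes X: "representation Q X" and S: "stable X S"
  shows "representation Q (subrep X S)" "incl S \<in> Hom R (subrep X S) X"
proof -
  have sub: "seq.subspace (S v)" "S v \<subseteq> space_at X v" if "v \<in> verts Q" for v
    using S that by (auto simp: stable_def)
  have st: "map_at X (a, b) x \<in> S b" if "(a, b) \<in> arrs Q" "x \<in> S a" for a b x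
    using S that unfolding stable_def by blast
  show "representation Q (subrep X S)"
  proof (rule representationI)
    fix v assume "v \<in> verts Q" then show "fdim (space_at (subrep X S) v)"
      using fdim_mono[OF rep_fdim[OF X]] sub by (simp add: subrep_def)
  next
    fix a b assume ab: "(a, b) \<in> arrs Q"
    note v = arrs_verts[OF ab]
    show "map_at (subrep X S) (a, b) \<in> linear_maps (space_at (subrep X S) a) (space_at (subrep X S) b)"
      unfolding subrep_def rep.simps prod.case
    proof (rule lmI)
      fix x y assume "x \<in> S a" "y \<in> S a"
      moreover from this have "x \<in> space_at X a" "y \<in> space_at X a" using sub(2) v by blast+
      ultimately show "(if x + y \<in> S a then map_at X (a, b) (x + y) else 0) =
           (if x \<in> S a then map_at X (a, b) x else 0) + (if y \<in> S a then map_at X (a, b) y else 0)"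
        using sub_add[OF sub(1)] lm_add[OF rep_map[OF X ab]] v by simp
    next
      fix c x assume "x \<in> S a"
      moreover from this have "x \<in> space_at X a" using sub(2) v by blast
      ultimately show "(if vscale c x \<in> S a then map_at X (a, b) (vscale c x) else 0) =
           vscale c (if x \<in> S a then map_at X (a, b) x else 0)"
        using sub_scl[OF sub(1)] lm_scl[OF rep_map[OF X ab]] v by simp
    qed (use st[OF ab] in auto)
  qed
  show "incl S \<in> Hom R (subrep X S) X"
  proof (rule rep_HomI)
    fix v assume "v \<in> verts Q" then show "incl S v \<in> linear_maps (space_at (subrep X S) v) (space_at X v)"
      using sub by (intro lmI) (auto simp: subrep_def incl_def sub_add sub_scl)
  qed (use arrs_verts st in \<open>auto simp: subrep_def incl_def fun_ext\<close>)
qed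

lemma kernel_stable:
  assumes X: "representation Q X" and Y: "representation Q Y" and \<phi>: "\<phi> \<in> Hom R X Y"
  shows "stable X (\<lambda>v. {x \<in> space_at X v. \<phi> v x = 0})"
  unfolding stable_def
proof (intro conjI ballI allI impI)
  fix v assume v: "v \<in> verts Q"
  show "seq.subspace {x \<in> space_at X v. \<phi> v x = 0}"
    using v X by (intro subspace_ker[OF rep_lm[OF \<phi> v]]) auto
next
  fix a b assume ab: "(a, b) \<in> arrs Q"
  show "map_at X (a, b) ` {x \<in> space_at X a. \<phi> a x = 0} \<subseteq> {x \<in> space_at X b. \<phi> b x = 0}"
    using lm_in[OF rep_map[OF X ab]] rep_nat[OF \<phi> ab] lm_zero[OF rep_map[OF Y ab]] by auto
qed auto

lemma kernel:
  assumes X: "representation Q X" and Y: "representation Q Y" and \<phi>: "\<phi> \<in> Hom R X Y"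
  defines "S \<equiv> \<lambda>v. {x \<in> space_at X v. \<phi> v x = 0}"
  shows "is_kernel R (subrep X S) X Y (incl S) \<phi>"
proof -
  note st = kernel_stable[OF X Y \<phi>, folded S_def]
  show ?thesis
    by (rule kernelI[OF subrep(1)[OF X st] X Y subrep(2)[OF X st] \<phi>])
      (auto simp: subrep_def incl_def S_def inj_on_def image_iff)
qed

lemma quotient_rep:
  fixes Y :: "('v, 'k::field) rep"
  assumes Y: "representation Q Y" and S: "stable Y S"
  obtains Z p where "representation Q Z" "p \<in> Hom R Y Z" "\<And>v. v \<in> verts Q \<Longrightarrow> p v ` space_at Y v = space_at Z v"
    "\<And>v. v \<in> verts Q \<Longrightarrow> {y \<in> space_at Y v. p v y = 0} = S v"
proof -
  have sub: "seq.subspace (S v)" "S v \<subseteq> space_at Y v" if "v \<in> verts Q" for v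
    using S that by (auto simp: stable_def)
  have st: "map_at Y (a, b) x \<in> S b" if "(a, b) \<in> arrs Q" "x \<in> S a" for a b x
    using S that unfolding stable_def by blast
  define P where "P v = (\<lambda>(C, p). fdim C \<and> p \<in> linear_maps (space_at Y v) C \<and> p ` space_at Y v = C \<and>
      (\<forall>x\<in>space_at Y v. p x = 0 \<longleftrightarrow> x \<in> S v))" for v
  have "\<exists>Cp. P v Cp" if v: "v \<in> verts Q" for v
  proof -
    obtain C p where "fdim C" "p \<in> linear_maps (space_at Y v) C" "p ` space_at Y v = C"
      "\<And>x. x \<in> space_at Y v \<Longrightarrow> p x = 0 \<longleftrightarrow> x \<in> S v"
      using quotient_map[OF rep_fdim[OF Y v] sub[OF v]] by blast
    then show ?thesis unfolding P_def by blast
  qed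
  then obtain F where F: "\<And>v. v \<in> verts Q \<Longrightarrow> P v (F v)" by metis
  define C where "C v = fst (F v)" for v
  define p where "p v = (if v \<in> verts Q then snd (F v) else 0)" for v
  have p: "fdim (C v)" "p v \<in> linear_maps (space_at Y v) (C v)" "p v ` space_at Y v = C v"
    "\<And>x. x \<in> space_at Y v \<Longrightarrow> p v x = 0 \<longleftrightarrow> x \<in> S v" if "v \<in> verts Q" for v
    using F[OF that] that by (auto simp: P_def C_def p_def case_prod_beta)
  define s where "s v z = (SOME y. y \<in> space_at Y v \<and> p v y = z)" for v z
  have s: "s v z \<in> space_at Y v" "p v (s v z) = z" if "v \<in> verts Q" "z \<in> C v" for v z
  proof -
    have "\<exists>y. y \<in> space_at Y v \<and> p v y = z" using that(2) unfolding p(3)[OF that(1), symmetric] by blast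
    from someI_ex[OF this] show "s v z \<in> space_at Y v" "p v (s v z) = z" unfolding s_def by auto
  qed
  define Z where "Z = \<lparr>space_at = C, map_at = (\<lambda>(a, b) z. if z \<in> C a then p b (map_at Y (a, b) (s a z)) else 0)\<rparr>"
  \<comment> \<open>Independence of the chosen preimage: two preimages differ by an element of
    \<open>S a\<close>, which the arrow maps into \<open>S b\<close>.\<close>
  have nat: "map_at Z (a, b) (p a y) = p b (map_at Y (a, b) y)" if ab: "(a, b) \<in> arrs Q" and y: "y \<in> space_at Y a" for a b y
  proof -
    note v = arrs_verts[OF ab]
    have sY: "seq.subspace (space_at Y a)" "seq.subspace (space_at Y b)" using Y v by auto
    have pc: "p a y \<in> C a" using lm_in[OF p(2) y] v by auto
    note s' = s[OF _ pc]
    have d: "s a (p a y) - y \<in> space_at Y a" using sub_diff[OF sY(1)] s' y v by auto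
    have "p a (s a (p a y) - y) = 0" using lm_diff[OF p(2) sY(1)] s' y v by auto
    then have "s a (p a y) - y \<in> S a" using p(4) d v by auto
    then have m: "map_at Y (a, b) (s a (p a y)) - map_at Y (a, b) y \<in> S b"
      using st[OF ab] lm_diff[OF rep_map[OF Y ab] sY(1)] s' y v by metis
    have "p b (map_at Y (a, b) (s a (p a y)) - map_at Y (a, b) y) = 0"
      using p(4)[of b] m sub(2)[of b] v by auto
    then have "p b (map_at Y (a, b) (s a (p a y))) = p b (map_at Y (a, b) y)"
      using lm_diff[OF p(2) sY(2)] lm_in[OF rep_map[OF Y ab]] s' y v by auto
    then show ?thesis using pc by (simp add: Z_def)
  qed
  have Z: "representation Q Z"
  proof (rule representationI)
    fix v assume "v \<in> verts Q" then show "fdim (space_at Z v)" using p by (simp add: Z_def)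
  next
    fix a b assume ab: "(a, b) \<in> arrs Q"
    note v = arrs_verts[OF ab]
    have sY: "seq.subspace (space_at Y a)" using Y v by auto
    have ex: "\<exists>y\<in>space_at Y a. z = p a y" if "z \<in> space_at Z a" for z
      using p(3)[of a] v that by (auto simp: Z_def)
    have inC: "p b (map_at Y (a, b) y) \<in> space_at Z b" if "y \<in> space_at Y a" for y
      using lm_in[OF p(2)] lm_in[OF rep_map[OF Y ab]] that v by (auto simp: Z_def)
    show "map_at Z (a, b) \<in> linear_maps (space_at Z a) (space_at Z b)"
    proof (rule lmI)
      fix x assume "x \<in> space_at Z a"
      then show "map_at Z (a, b) x \<in> space_at Z b" using ex nat[OF ab] inC by force
    next
      fix x y assume xy: "x \<in> space_at Z a" "y \<in> space_at Z a"
      obtain x' y' where x': "x' \<in> space_at Y a" "x = p a x'" "y' \<in> space_at Y a" "y = p a y'"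
        using ex xy by meson
      have "x + y = p a (x' + y')" using x' lm_add[OF p(2)] v by simp
      then have "map_at Z (a, b) (x + y) = p b (map_at Y (a, b) x' + map_at Y (a, b) y')"
        using nat[OF ab sub_add[OF sY x'(1,3)]] lm_add[OF rep_map[OF Y ab] x'(1,3)] by simp
      then show "map_at Z (a, b) (x + y) = map_at Z (a, b) x + map_at Z (a, b) y"
        using x' nat[OF ab] lm_add[OF p(2)] lm_in[OF rep_map[OF Y ab]] v by simp
    next
      fix c x assume x: "x \<in> space_at Z a"
      obtain x' where x': "x' \<in> space_at Y a" "x = p a x'" using ex x by meson
      have "vscale c x = p a (vscale c x')" using x' lm_scl[OF p(2)] v by simp
      then have "map_at Z (a, b) (vscale c x) = p b (vscale c (map_at Y (a, b) x'))"
        using nat[OF ab sub_scl[OF sY x'(1)]] lm_scl[OF rep_map[OF Y ab] x'(1)] by simp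
      then show "map_at Z (a, b) (vscale c x) = vscale c (map_at Z (a, b) x)"
        using x' nat[OF ab] lm_scl[OF p(2)] lm_in[OF rep_map[OF Y ab]] v by simp
    qed (auto simp: Z_def)
  qed
  moreover have "p \<in> Hom R Y Z"
    by (rule rep_HomI) (use p(2) nat in \<open>auto simp: Z_def p_def\<close>)
  moreover have "{y \<in> space_at Y v. p v y = 0} = S v" if "v \<in> verts Q" for v
    using p(4)[OF that] sub(2)[OF that] by blast
  moreover have "p v ` space_at Y v = space_at Z v" if "v \<in> verts Q" for v
    using p(3)[OF that] by (simp add: Z_def)
  ultimately show ?thesis using that[of Z p] by blast
qed

lemma image_stable:
  assumes X: "representation Q X" and Y: "representation Q Y" and \<phi>: "\<phi> \<in> Hom R X Y"
  shows "stable Y (\<lambda>v. \<phi> v ` space_at X v)"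
  unfolding stable_def
proof (intro conjI ballI allI impI)
  fix v assume v: "v \<in> verts Q"
  show "seq.subspace (\<phi> v ` space_at X v)" "\<phi> v ` space_at X v \<subseteq> space_at Y v"
    using v X subspace_image[OF rep_lm[OF \<phi> v]] lm_in[OF rep_lm[OF \<phi> v]] by auto
next
  fix a b assume ab: "(a, b) \<in> arrs Q"
  show "map_at Y (a, b) ` \<phi> a ` space_at X a \<subseteq> \<phi> b ` space_at X b"
    using lm_in[OF rep_map[OF X ab]] rep_nat[OF \<phi> ab] by (auto simp: image_iff) metis
qed

lemma cokernel:
  assumes X: "representation Q X" and Y: "representation Q Y" and \<phi>: "\<phi> \<in> Hom R X Y"
  shows "\<exists>Z p. representation Q Z \<and> p \<in> Hom R Y Z \<and> is_cokernel R X Y Z \<phi> p \<and>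
    (\<forall>v\<in>verts Q. p v ` space_at Y v = space_at Z v \<and> {y \<in> space_at Y v. p v y = 0} = \<phi> v ` space_at X v)"
proof -
  obtain Z p where Z: "representation Q Z" "p \<in> Hom R Y Z" "\<And>v. v \<in> verts Q \<Longrightarrow> p v ` space_at Y v = space_at Z v"
    "\<And>v. v \<in> verts Q \<Longrightarrow> {y \<in> space_at Y v. p v y = 0} = \<phi> v ` space_at X v"
    using quotient_rep[OF Y image_stable[OF X Y \<phi>]] by blast
  then show ?thesis using cokernelI[OF X Y Z(1) \<phi> Z(2-4)] by blast
qed

text \<open>The inclusion of the kernel becomes zero after composition with \<open>\<phi>\<close>,
  so it is zero itself.\<close>

lemma mono_inj:
  assumes X: "representation Q X" and Y: "representation Q Y" and m: "is_mono R X Y \<phi>" and v: "v \<in> verts Q"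
  shows "inj_on (\<phi> v) (space_at X v)"
proof (rule inj_onI)
  have \<phi>: "\<phi> \<in> Hom R X Y" using m unfolding is_mono_def by auto
  define S where "S = (\<lambda>v. {x \<in> space_at X v. \<phi> v x = 0})"
  note st = kernel_stable[OF X Y \<phi>, folded S_def]
  note s = subrep[OF X st]
  have "incl S = 0"
  proof -
    have "Comp R (subrep X S) X Y \<phi> (incl S) = Comp R (subrep X S) X Y \<phi> (Zero R (subrep X S) X)"
      using kernel[OF X Y \<phi>, folded S_def] R.comp_zero_right[of "subrep X S" X Y \<phi>] s X Y \<phi>
      unfolding is_kernel_def by (simp del: rep_sel(3,5))
    moreover have "Zero R (subrep X S) X \<in> Hom R (subrep X S) X"
      using R.zero_in[of "subrep X S" X] s X by (simp del: rep_sel(5))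
    ultimately have "incl S = Zero R (subrep X S) X" using m s unfolding is_mono_def by simp
    then show ?thesis by simp
  qed
  then have ker: "x = 0" if "x \<in> space_at X v" "\<phi> v x = 0" for x
    using that v by (auto simp: incl_def S_def fun_ext split: if_splits dest!: spec[of _ v] spec[of _ x])
  fix x y assume xy: "x \<in> space_at X v" "y \<in> space_at X v" "\<phi> v x = \<phi> v y"
  have "\<phi> v (x - y) = 0" using lm_diff[OF rep_lm[OF \<phi> v] _ xy(1,2)] xy X v by simp
  then show "x = y" using ker[of "x - y"] sub_diff[OF rep_sub[OF X v] xy(1,2)] by simp
qed

text \<open>The cokernel projection becomes zero after composition with \<open>\<phi>\<close>, so it
  is zero itself; its kernel, now all of \<open>Y\<close>, is the image of
  \<open>\<phi>\<close>.\<close>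

lemma epi_surj:
  assumes X: "representation Q X" and Y: "representation Q Y" and e: "is_epi R X Y \<phi>" and v: "v \<in> verts Q"
  shows "\<phi> v ` space_at X v = space_at Y v"
proof -
  have \<phi>: "\<phi> \<in> Hom R X Y" using e unfolding is_epi_def by auto
  obtain Z p where Z: "representation Q Z" "p \<in> Hom R Y Z" "is_cokernel R X Y Z \<phi> p"
    and Zk: "\<forall>v\<in>verts Q. p v ` space_at Y v = space_at Z v \<and> {y \<in> space_at Y v. p v y = 0} = \<phi> v ` space_at X v"
    using cokernel[OF X Y \<phi>] by (elim exE conjE)
  have "Comp R X Y Z p \<phi> = Comp R X Y Z (Zero R Y Z) \<phi>"
    using Z(3) R.comp_zero_left[of X Y Z \<phi>] X Y Z(1) \<phi> unfolding is_cokernel_def by (simp del: rep_sel(3,5))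
  moreover have "Zero R Y Z \<in> Hom R Y Z"
    using R.zero_in[of Y Z] Z Y by (simp del: rep_sel(5))
  ultimately have "p = Zero R Y Z" using e Z unfolding is_epi_def by simp
  then show ?thesis using bspec[OF Zk v] by auto
qed

text \<open>Interleaving even and odd coordinates stores a pair of sequences in one sequence, so
  that direct sums stay among the subspaces of the fixed sequence space.\<close>

definition merge :: "(nat \<Rightarrow> 'k) \<Rightarrow> (nat \<Rightarrow> 'k) \<Rightarrow> nat \<Rightarrow> 'k" where
  "merge x y = (\<lambda>m. if even m then x (m div 2) else y (m div 2))"

definition evens :: "(nat \<Rightarrow> 'k) \<Rightarrow> nat \<Rightarrow> 'k" where "evens z = (\<lambda>m. z (2 * m))"
definition odds :: "(nat \<Rightarrow> 'k) \<Rightarrow> nat \<Rightarrow> 'k" where "odds z = (\<lambda>m. z (2 * m + 1))"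

lemma merge_simps [simp]: "evens (merge x y) = x" "odds (merge x y) = y" "merge (evens z) (odds z) = z"
  "evens (y' + z') = evens y' + evens z'" "odds (y' + z') = odds y' + odds z'"
  "evens (vscale a z'') = vscale a (evens z'')" "odds (vscale a z'') = vscale a (odds z'')"
  "evens 0 = 0" "odds 0 = 0"
  by (auto simp: merge_def evens_def odds_def fun_ext vscale_def)

lemma merge_lin: "merge (x + x') (y + y') = merge x y + (merge x' y' :: nat \<Rightarrow> 'k::field)"
  "vscale a (merge x y) = merge (vscale a x) (vscale a (y :: nat \<Rightarrow> 'k::field))"
  by (auto simp: merge_def fun_ext vscale_def)

lemma merge_lin0:
  "merge (x + x') 0 = merge x 0 + (merge x' 0 :: nat \<Rightarrow> 'k::field)"
  "merge 0 (x + x') = merge 0 x + (merge 0 x' :: nat \<Rightarrow> 'k::field)"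
  "merge (vscale a x) 0 = vscale a (merge x (0 :: nat \<Rightarrow> 'k::field))"
  "merge 0 (vscale a x) = vscale a (merge (0 :: nat \<Rightarrow> 'k::field) x)"
  "merge x 0 + merge 0 x' = (merge x x' :: nat \<Rightarrow> 'k::field)"
  by (auto simp: merge_def fun_ext vscale_def)

lemma merge_zero [simp]: "merge 0 0 = (0 :: nat \<Rightarrow> 'k::zero)"
  by (auto simp: merge_def fun_ext)

lemma fdim_merge:
  assumes "fdim V" "fdim W"
  shows "fdim {z. evens z \<in> V \<and> odds z \<in> (W :: (nat \<Rightarrow> 'k::field) set)}"
proof -
  obtain A B where A: "finite A" "V = seq.span A" and B: "finite B" "W = seq.span B"
    using assms by (auto simp: fdim_def)
  let ?S = "(\<lambda>x. merge x 0) ` A \<union> merge 0 ` B"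
  have sub: "{z. evens z \<in> V \<and> odds z \<in> W} \<subseteq> seq.span ?S"
  proof
    fix z assume "z \<in> {z. evens z \<in> V \<and> odds z \<in> W}"
    then have z: "evens z \<in> seq.span A" "odds z \<in> seq.span B" using A B by auto
    have "merge (evens z) 0 \<in> seq.span ((\<lambda>x. merge x 0) ` A)"
      by (rule span_image_linear[OF _ _ z(1)]) (auto simp: merge_lin0)
    moreover have "merge 0 (odds z) \<in> seq.span (merge 0 ` B)"
      by (rule span_image_linear[OF _ _ z(2)]) (auto simp: merge_lin0)
    moreover have "z = merge (evens z) 0 + merge 0 (odds z)" by (simp add: merge_lin0)
    moreover have "seq.span ((\<lambda>x. merge x 0) ` A) \<subseteq> seq.span ?S" "seq.span (merge 0 ` B) \<subseteq> seq.span ?S"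
      by (rule seq.span_mono; simp)+
    ultimately show "z \<in> seq.span ?S" using seq.span_add[of "merge (evens z) 0" ?S "merge 0 (odds z)"] by auto
  qed
  show ?thesis
    by (rule fdim_mono[OF _ sub])
      (use A B assms[THEN fdim_subspace] in \<open>auto simp: fdim_def intro!: subI exI[of _ ?S] simp: sub_zero sub_add sub_scl\<close>)
qed

lemma biproduct:
  fixes X Y :: "('v, 'k::field) rep"
  assumes X: "representation Q X" and Y: "representation Q Y"
  shows "\<exists>B i1 i2 p1 p2. representation Q B \<and> is_biproduct R X Y B i1 i2 p1 p2"
proof -
  define S where "S v = {z. evens z \<in> space_at X v \<and> odds z \<in> space_at Y v}" for v
  define B where "B = \<lparr>space_at = S, map_at = (\<lambda>(a, b) z. if z \<in> S a then
     merge (map_at X (a, b) (evens z)) (map_at Y (a, b) (odds z)) else 0)\<rparr>"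
  have fd: "fdim (S v)" if "v \<in> verts Q" for v unfolding S_def by (rule fdim_merge[OF rep_fdim[OF X that] rep_fdim[OF Y that]])
  have sS: "seq.subspace (S v)" if "v \<in> verts Q" for v using fd[OF that] fdim_subspace by auto
  have mapB: "map_at B (a, b) z = merge (map_at X (a, b) (evens z)) (map_at Y (a, b) (odds z))" if "z \<in> S a" for a b z
    using that by (simp add: B_def)
  have B: "representation Q B"
  proof (rule representationI)
    fix v assume "v \<in> verts Q" then show "fdim (space_at B v)" using fd by (simp add: B_def)
  next
    fix a b assume ab: "(a, b) \<in> arrs Q"
    note v = arrs_verts[OF ab]
    show "map_at B (a, b) \<in> linear_maps (space_at B a) (space_at B b)"
      unfolding B_def rep.simps prod.case
      by (rule lmI) (use lm_in[OF rep_map[OF X ab]] lm_in[OF rep_map[OF Y ab]] lm_add[OF rep_map[OF X ab]] lm_add[OF rep_map[OF Y ab]]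
        lm_scl[OF rep_map[OF X ab]] lm_scl[OF rep_map[OF Y ab]] sub_add[OF sS] sub_scl[OF sS] v in \<open>auto simp: S_def merge_lin\<close>)
  qed
  define i1 where "i1 v x = (if v \<in> verts Q \<and> x \<in> space_at X v then merge x 0 else 0)" for v x
  define i2 where "i2 v x = (if v \<in> verts Q \<and> x \<in> space_at Y v then merge 0 x else 0)" for v x
  define p1 where "p1 v z = (if v \<in> verts Q \<and> z \<in> S v then evens z else 0)" for v z
  define p2 where "p2 v z = (if v \<in> verts Q \<and> z \<in> S v then odds z else 0)" for v z
  have sX: "seq.subspace (space_at X v)" "seq.subspace (space_at Y v)" if "v \<in> verts Q" for v using X Y that by auto
  have i1: "i1 \<in> Hom R X B"
  proof (rule rep_HomI)
    fix v assume v: "v \<in> verts Q"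
    show "i1 v \<in> linear_maps (space_at X v) (space_at B v)"
      by (rule lmI) (use v sX[OF v] in \<open>auto simp: i1_def B_def S_def sub_zero sub_add sub_scl merge_lin0\<close>)
  next
    fix a b x assume ab: "(a, b) \<in> arrs Q" and x: "x \<in> space_at X a"
    show "i1 b (map_at X (a, b) x) = map_at B (a, b) (i1 a x)"
      using arrs_verts[OF ab] x lm_in[OF rep_map[OF X ab] x] sX lm_zero[OF rep_map[OF Y ab]]
      by (auto simp: i1_def B_def S_def sub_zero)
  qed (auto simp: i1_def fun_ext)
  have i2: "i2 \<in> Hom R Y B"
  proof (rule rep_HomI)
    fix v assume v: "v \<in> verts Q"
    show "i2 v \<in> linear_maps (space_at Y v) (space_at B v)"
      by (rule lmI) (use v sX[OF v] in \<open>auto simp: i2_def B_def S_def sub_zero sub_add sub_scl merge_lin0\<close>)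
  next
    fix a b x assume ab: "(a, b) \<in> arrs Q" and x: "x \<in> space_at Y a"
    show "i2 b (map_at Y (a, b) x) = map_at B (a, b) (i2 a x)"
      using arrs_verts[OF ab] x lm_in[OF rep_map[OF Y ab] x] sX lm_zero[OF rep_map[OF X ab]]
      by (auto simp: i2_def B_def S_def sub_zero)
  qed (auto simp: i2_def fun_ext)
  have p1: "p1 \<in> Hom R B X"
  proof (rule rep_HomI)
    fix v assume v: "v \<in> verts Q"
    show "p1 v \<in> linear_maps (space_at B v) (space_at X v)"
      by (rule lmI) (use v sX[OF v] in \<open>auto simp: p1_def B_def S_def sub_add sub_scl\<close>)
  next
    fix a b x assume ab: "(a, b) \<in> arrs Q" and x: "x \<in> space_at B a"
    show "p1 b (map_at B (a, b) x) = map_at X (a, b) (p1 a x)"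
      using arrs_verts[OF ab] x lm_in[OF rep_map[OF X ab]] lm_in[OF rep_map[OF Y ab]]
      by (auto simp: p1_def B_def S_def)
  qed (auto simp: p1_def fun_ext)
  have p2: "p2 \<in> Hom R B Y"
  proof (rule rep_HomI)
    fix v assume v: "v \<in> verts Q"
    show "p2 v \<in> linear_maps (space_at B v) (space_at Y v)"
      by (rule lmI) (use v sX[OF v] in \<open>auto simp: p2_def B_def S_def sub_add sub_scl\<close>)
  next
    fix a b x assume ab: "(a, b) \<in> arrs Q" and x: "x \<in> space_at B a"
    show "p2 b (map_at B (a, b) x) = map_at Y (a, b) (p2 a x)"
      using arrs_verts[OF ab] x lm_in[OF rep_map[OF X ab]] lm_in[OF rep_map[OF Y ab]]
      by (auto simp: p2_def B_def S_def)
  qed (auto simp: p2_def fun_ext)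
  have sp: "space_at B v = S v" for v by (simp add: B_def)
  note [simp] = sub_zero[OF sX(1)] sub_zero[OF sX(2)] sub_zero[OF sS]
  have "Comp R X B X p1 i1 = Ide R X" "Comp R Y B Y p2 i2 = Ide R Y" "Comp R X B Y p2 i1 = Zero R X Y"
    "Comp R Y B X p1 i2 = Zero R Y X"
    by (auto simp: fun_ext p1_def p2_def i1_def i2_def S_def)
  moreover have "Add R B B (Comp R B X B i1 p1) (Comp R B Y B i2 p2) = Ide R B"
    unfolding rep_sel sp
  proof (intro ext)
    fix v z m
    show "((\<lambda>v. i1 v \<circ> p1 v) + (\<lambda>v. i2 v \<circ> p2 v)) v z m = (if v \<in> verts Q \<and> z \<in> S v then z else 0) m"
    proof (cases "v \<in> verts Q \<and> z \<in> S v")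
      case True
      then have "i1 v (p1 v z) + i2 v (p2 v z) = merge (evens z) 0 + merge 0 (odds z)"
        by (auto simp: i1_def i2_def p1_def p2_def S_def)
      also have "\<dots> = z" by (simp add: merge_lin0)
      finally show ?thesis using True by (auto simp: fun_ext)
    qed (auto simp: i1_def i2_def p1_def p2_def fun_ext)
  qed
  ultimately show ?thesis unfolding is_biproduct_def using B i1 i2 p1 p2 by blast
qed

lemma zero_rep_iff:
  fixes X :: "('v, 'k::field) rep"
  assumes "representation Q X"
  shows "is_zero_object R X \<longleftrightarrow> (\<forall>v\<in>verts Q. space_at X v = {0})"
proof -
  have "is_zero_object R X \<longleftrightarrow> Ide R X = Zero R X X" using R.zero_object_iff[of X] assms by simp
  also have "\<dots> \<longleftrightarrow> (\<forall>v\<in>verts Q. \<forall>x\<in>space_at X v. x = 0)"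
    unfolding rep_sel fun_eq_iff[of "\<lambda>v x. if v \<in> verts Q \<and> x \<in> space_at X v then x else 0"]
      fun_eq_iff[of "\<lambda>x. if _ \<and> x \<in> _ then x else 0"] zero_fun_apply by auto
  also have "\<dots> \<longleftrightarrow> (\<forall>v\<in>verts Q. space_at X v = {0})" using sub_zero[OF rep_sub[OF assms]] by blast
  finally show ?thesis .
qed

lemma zero_rep: "is_zero_object R (\<lparr>space_at = \<lambda>_. {0}, map_at = \<lambda>_. 0\<rparr> :: ('v, 'k::field) rep)"
proof -
  have "representation Q (\<lparr>space_at = \<lambda>_. {0}, map_at = \<lambda>_. 0\<rparr> :: ('v, 'k::field) rep)"
    by (rule representationI) (auto simp: linear_maps_def)
  then show ?thesis by (simp add: zero_rep_iff)
qed

text \<open>Injective maps are kernels of their cokernels and surjective maps cokernels of their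
  kernels, both of which is checked at the vertices.\<close>

lemma R_abelian: "abelian_category (R :: ('k::field, ('v, 'k) rep, ('v, 'k) rep_mor) lcat)"
  unfolding abelian_category_def
proof (intro conjI ballI allI impI R_linear)
  let ?R = "R :: ('k::field, ('v, 'k) rep, ('v, 'k) rep_mor) lcat"
  show "\<exists>z. is_zero_object ?R z" using zero_rep by blast
  fix X Y assume "X \<in> Obj ?R" "Y \<in> Obj ?R"
  then have X: "representation Q X" and Y: "representation Q Y" by auto
  show "\<exists>b\<in>Obj ?R. \<exists>i1 i2 p1 p2. is_biproduct ?R X Y b i1 i2 p1 p2" using biproduct[OF X Y] by auto
  { fix f assume f: "f \<in> Hom ?R X Y"
    show "\<exists>k\<in>Obj ?R. \<exists>i. is_kernel ?R k X Y i f"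
      using kernel[OF X Y f] subrep(1)[OF X kernel_stable[OF X Y f]] by auto
    show "\<exists>q\<in>Obj ?R. \<exists>p. is_cokernel ?R X Y q f p"
      using cokernel[OF X Y f] by auto }
  fix f
  { assume m: "is_mono ?R X Y f"
    then have f: "f \<in> Hom ?R X Y" unfolding is_mono_def by auto
    obtain Z p where Z: "representation Q Z" "p \<in> Hom ?R Y Z" and
      Zk: "\<forall>v\<in>verts Q. p v ` space_at Y v = space_at Z v \<and> {y \<in> space_at Y v. p v y = 0} = f v ` space_at X v"
      using cokernel[OF X Y f] by (elim exE conjE)
    have "is_kernel ?R X Y Z f p" by (rule kernelI[OF X Y Z(1) f Z(2) mono_inj[OF X Y m]]) (use Zk in auto)
    then show "\<exists>z\<in>Obj ?R. \<exists>g. is_kernel ?R X Y z f g" using Z(1) by auto }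
  { assume e: "is_epi ?R X Y f"
    then have f: "f \<in> Hom ?R X Y" unfolding is_epi_def by auto
    define S where "S = (\<lambda>v. {x \<in> space_at X v. f v x = 0})"
    note s = subrep[OF X kernel_stable[OF X Y f, folded S_def]]
    have "is_cokernel ?R (subrep X S) X Y (incl S) f"
      by (rule cokernelI[OF s(1) X Y s(2) f epi_surj[OF X Y e]])
        (auto simp: subrep_def incl_def S_def image_iff)
    then show "\<exists>w\<in>Obj ?R. \<exists>g. is_cokernel ?R w X Y g f" using s(1) by auto }
qed

end

section \<open>Combinatorics of the polygon\<close>

locale dynkin =
  fixes n :: nat and Q :: "nat quiver"
  assumes dynkin: "dynkin_A (n + 2) Q"
begin

abbreviation "up \<equiv> upper n Q"
abbreviation "low \<equiv> lower n Q"
abbreviation "s \<equiv> R_inv n Q"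
abbreviation "r \<equiv> R_vertex n Q"

lemma verts_Q [simp]: "verts Q = {1..n + 2}"
  using dynkin by (simp add: dynkin_A_def)

lemma upD: "i \<in> up \<Longrightarrow> 1 \<le> i \<and> i \<le> n + 1"
  and lowD: "i \<in> low \<Longrightarrow> 1 \<le> i \<and> i \<le> n + 1"
  by (auto simp: upper_def lower_def)

lemma low_iff: "1 \<le> i \<Longrightarrow> i \<le> n + 1 \<Longrightarrow> i \<in> low \<longleftrightarrow> i \<notin> up"
  using dynkin by (auto simp: upper_def lower_def dynkin_A_def)

lemma disj: "i \<in> up \<Longrightarrow> i \<notin> low"
  using low_iff[of i] upD[of i] by auto

lemma arr_iff: "(a, b) \<in> arrs Q \<longleftrightarrow> (b = a + 1 \<and> a \<in> up) \<or> (a = b + 1 \<and> b \<in> low)"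
proof
  assume "(a, b) \<in> arrs Q"
  then have "(a, b) \<in> {(i, i + 1) | i. 1 \<le> i \<and> i < n + 2} \<union> {(i + 1, i) | i. 1 \<le> i \<and> i < n + 2}"
    using dynkin unfolding dynkin_A_def by blast
  then show "(b = a + 1 \<and> a \<in> up) \<or> (a = b + 1 \<and> b \<in> low)"
    using \<open>(a, b) \<in> arrs Q\<close> by (auto simp: upper_def lower_def)
qed (auto simp: upper_def lower_def)

sublocale proper_quiver Q
  by unfold_locales (auto simp: arr_iff dest: upD lowD)

lemma cases4:
  assumes "i \<le> n + 2"
  obtains "i = 0" | "i \<in> up" "i \<notin> low" "1 \<le> i" "i \<le> n + 1" | "i \<in> low" "i \<notin> up" "1 \<le> i" "i \<le> n + 1" | "i = n + 2"
  using assms low_iff[of i] by (cases "i = 0"; cases "i = n + 2") auto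

text \<open>Counterclockwise along the lower boundary one moves right, and the vertices jumped over
  all lie on the other boundary. The next three lemmas record the same for the other boundary and
  for the clockwise direction.\<close>

lemma s_up:
  assumes "l = 0 \<or> l \<in> low"
  shows "l < s l \<and> s l \<le> n + 2 \<and> (s l = n + 2 \<or> s l \<in> low) \<and> (\<forall>m. l < m \<and> m < s l \<longrightarrow> m \<in> up)"
proof -
  let ?A = "{m \<in> insert (n + 2) low. l < m}"
  have fin: "finite ?A" by (rule finite_subset[of _ "{..n + 2}"]) (auto dest: lowD)
  have ne: "n + 2 \<in> ?A" using assms lowD[of l] by auto
  have e: "s l = Min ?A" using assms by (auto simp: R_inv_def)
  have m: "Min ?A \<in> ?A" using Min_in[OF fin] ne by blast
  have "m \<in> up" if "l < m" "m < Min ?A" for m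
  proof (rule ccontr)
    assume "m \<notin> up"
    moreover have "Min ?A \<le> n + 2" using Min_le[OF fin ne] .
    ultimately have "m \<in> low" using low_iff[of m] that by auto
    then have "Min ?A \<le> m" using that by (intro Min_le[OF fin]) auto
    then show False using that by simp
  qed
  then show ?thesis unfolding e using m lowD Min_le[OF fin ne] by auto
qed

lemma s_down:
  assumes "l \<in> up \<or> l = n + 2"
  shows "s l < l \<and> (s l = 0 \<or> s l \<in> up) \<and> (\<forall>m. s l < m \<and> m < l \<longrightarrow> m \<in> low)"
proof -
  let ?A = "{m \<in> insert 0 up. m < l}"
  have fin: "finite ?A" by (rule finite_subset[of _ "{..l}"]) auto
  have ne: "0 \<in> ?A" using assms upD[of l] by auto
  have "l \<noteq> 0" "l \<notin> low" using assms upD[of l] disj lowD[of l] by auto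
  then have e: "s l = Max ?A" by (auto simp: R_inv_def)
  have m: "Max ?A \<in> ?A" using Max_in[OF fin] ne by blast
  have "m \<in> low" if "Max ?A < m" "m < l" for m
  proof (rule ccontr)
    assume "m \<notin> low"
    then have "m \<in> up" using low_iff[of m] that assms upD[of l] by auto
    then have "m \<le> Max ?A" using that by (intro Max_ge[OF fin]) auto
    then show False using that by simp
  qed
  then show ?thesis unfolding e using m by auto
qed

lemma r_up:
  assumes "l = 0 \<or> l \<in> up"
  shows "l < r l \<and> r l \<le> n + 2 \<and> (r l = n + 2 \<or> r l \<in> up) \<and> (\<forall>m. l < m \<and> m < r l \<longrightarrow> m \<in> low)"
proof -
  let ?A = "{m \<in> insert (n + 2) up. l < m}"
  have fin: "finite ?A" by (rule finite_subset[of _ "{..n + 2}"]) (auto dest: upD)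
  have ne: "n + 2 \<in> ?A" using assms upD[of l] by auto
  have e: "r l = Min ?A" using assms by (auto simp: R_vertex_def)
  have m: "Min ?A \<in> ?A" using Min_in[OF fin] ne by blast
  have "m \<in> low" if "l < m" "m < Min ?A" for m
  proof (rule ccontr)
    assume "m \<notin> low"
    moreover have "Min ?A \<le> n + 2" using Min_le[OF fin ne] .
    ultimately have "m \<in> up" using low_iff[of m] that by auto
    then have "Min ?A \<le> m" using that by (intro Min_le[OF fin]) auto
    then show False using that by simp
  qed
  then show ?thesis unfolding e using m upD Min_le[OF fin ne] by auto
qed

lemma r_down:
  assumes "l \<in> low \<or> l = n + 2"
  shows "r l < l \<and> (r l = 0 \<or> r l \<in> low) \<and> (\<forall>m. r l < m \<and> m < l \<longrightarrow> m \<in> up)"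
proof -
  let ?A = "{m \<in> insert 0 low. m < l}"
  have fin: "finite ?A" by (rule finite_subset[of _ "{..l}"]) auto
  have ne: "0 \<in> ?A" using assms lowD[of l] by auto
  have "l \<noteq> 0" "l \<notin> up" using assms lowD[of l] disj upD[of l] by auto
  then have e: "r l = Max ?A" by (auto simp: R_vertex_def)
  have m: "Max ?A \<in> ?A" using Max_in[OF fin] ne by blast
  have "m \<in> up" if "Max ?A < m" "m < l" for m
  proof (rule ccontr)
    assume "m \<notin> up"
    then have "m \<in> low" using low_iff[of m] that assms lowD[of l] by auto
    then have "m \<le> Max ?A" using that by (intro Max_ge[OF fin]) auto
    then show False using that by simp
  qed
  then show ?thesis unfolding e using m by auto
qed

lemma vertex_cases:
  "l \<le> n + 2 \<Longrightarrow> (l = 0 \<or> l \<in> low) \<or> (l \<in> up \<or> l = n + 2)"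
  "l \<le> n + 2 \<Longrightarrow> (l = 0 \<or> l \<in> up) \<or> (l \<in> low \<or> l = n + 2)"
  using low_iff[of l] by auto

lemma s_le: "l \<le> n + 2 \<Longrightarrow> s l \<le> n + 2"
  using s_up[of l] s_down[of l] vertex_cases(1)[of l] by auto

lemma r_le: "l \<le> n + 2 \<Longrightarrow> r l \<le> n + 2"
  using r_up[of l] r_down[of l] vertex_cases(2)[of l] by auto

lemma s_ne: "l \<le> n + 2 \<Longrightarrow> s l \<noteq> l"
  using s_up[of l] s_down[of l] vertex_cases(1)[of l] by auto

text \<open>If \<open>r (s l)\<close> differed from \<open>l\<close>, one of the two would lie
  strictly between the other and \<open>s l\<close>, where the descriptions of the neighbours allow
  only vertices of the other boundary.\<close>

lemma r_s: assumes "l \<le> n + 2" shows "r (s l) = l"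
proof -
  have "l = 0 \<or> l \<in> low \<or> l \<in> up \<or> l = n + 2" using assms by (cases l rule: cases4) auto
  then consider (a) "l = 0 \<or> l \<in> low" | (b) "l \<in> up \<or> l = n + 2" by blast
  then show ?thesis
  proof cases
    case a
    note S = s_up[OF a]
    then have R: "r (s l) < s l" "r (s l) = 0 \<or> r (s l) \<in> low" "\<forall>m. r (s l) < m \<and> m < s l \<longrightarrow> m \<in> up"
      using r_down[of "s l"] by auto
    show ?thesis
    proof (cases "r (s l)" l rule: linorder_cases)
      case less then show ?thesis using R S a disj lowD upD by (metis not_less_zero)
    next
      case greater then show ?thesis using R S a disj by (metis not_less_zero)
    qed
  next
    case b
    note S = s_down[OF b]
    then have R: "s l < r (s l)" "r (s l) = n + 2 \<or> r (s l) \<in> up" "\<forall>m. s l < m \<and> m < r (s l) \<longrightarrow> m \<in> low" "r (s l) \<le> n + 2"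
      using r_up[of "s l"] by auto
    show ?thesis
    proof (cases "r (s l)" l rule: linorder_cases)
      case less then show ?thesis using R S b disj assms by (metis leD)
    next
      case greater then show ?thesis using R S b disj by (metis leD)
    qed
  qed
qed

text \<open>An injective self-map of a finite set is onto, so the one-sided inverse is
  two-sided.\<close>

lemma s_r: assumes "l \<le> n + 2" shows "s (r l) = l"
proof -
  have "inj_on s {..n + 2}" by (rule inj_on_inverseI[of _ r]) (simp add: r_s)
  moreover have "s ` {..n + 2} \<subseteq> {..n + 2}" using s_le by auto
  ultimately have "s ` {..n + 2} = {..n + 2}" by (simp add: endo_inj_surj)
  then obtain m where "m \<le> n + 2" "l = s m" using assms by (metis atMost_iff imageE)
  then show ?thesis by (simp add: r_s)
qed

lemma s_inj: "k \<le> n + 2 \<Longrightarrow> l \<le> n + 2 \<Longrightarrow> s k = s l \<longleftrightarrow> k = l"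
  by (metis r_s)

text \<open>The polygon vertices cut open at \<open>n + 2\<close> (possible left endpoints) and at \<open>0\<close> (possible right
  endpoints) are linearly ordered counterclockwise, so that pivoting takes immediate successors.\<close>

definition lle where "lle i k \<longleftrightarrow> i = k \<or> (i < k \<and> k \<in> low) \<or> (k < i \<and> i \<in> up)"
definition rle where "rle j k \<longleftrightarrow> j = k \<or> (j < k \<and> j \<in> low) \<or> (k < j \<and> k \<in> up)"

lemma lle_refl [simp]: "lle i i" and rle_refl [simp]: "rle j j"
  by (auto simp: lle_def rle_def)

lemma lle_antisym: "lle i k \<Longrightarrow> lle k i \<Longrightarrow> i = k"
  using disj by (auto simp: lle_def)

lemma rle_antisym: "rle i k \<Longrightarrow> rle k i \<Longrightarrow> i = k"
  using disj by (auto simp: rle_def)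

lemma lle_trans: "lle i k \<Longrightarrow> lle k l \<Longrightarrow> lle i l"
  using disj[of k] by (cases i l rule: linorder_cases) (auto simp: lle_def)

lemma rle_trans: "rle i k \<Longrightarrow> rle k l \<Longrightarrow> rle i l"
  using disj[of k] by (cases i l rule: linorder_cases) (auto simp: rle_def)

lemma lle_total: "i < n + 2 \<Longrightarrow> k < n + 2 \<Longrightarrow> lle i k \<or> lle k i"
  using low_iff[of i] low_iff[of k] by (cases i k rule: linorder_cases) (auto simp: lle_def)

text \<open>Along the left order the vertex numbers first fall and then rise, so an intermediate
  vertex never exceeds both ends. Along the right order they rise and then fall, which gives
  \<open>rle_min\<close>.\<close>

lemma lle_max: "lle i k \<Longrightarrow> lle k l \<Longrightarrow> k \<le> max i l"
  using disj[of k] by (auto simp: lle_def)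

lemma rle_min: "rle i k \<Longrightarrow> rle k l \<Longrightarrow> min i l \<le> k"
  using disj[of k] by (auto simp: rle_def)

lemma lle_s: "i < n + 2 \<Longrightarrow> s i \<noteq> n + 2 \<Longrightarrow> lle i (s i)"
  using s_up[of i] s_down[of i] cases4[of i] by (auto simp: lle_def)

lemma rle_s: "1 \<le> j \<Longrightarrow> j \<le> n + 2 \<Longrightarrow> s j \<noteq> 0 \<Longrightarrow> rle j (s j)"
  using s_up[of j] s_down[of j] cases4[of j] by (auto simp: rle_def)

text \<open>\<open>s i\<close> is the immediate successor of \<open>i\<close>, and as long as
  something lies above \<open>i\<close> the cut at \<open>n + 2\<close> is not crossed.\<close>

lemma lle_next:
  assumes "i < n + 2" "k < n + 2" "lle i k" "i \<noteq> k"
  shows "s i \<noteq> n + 2 \<and> lle (s i) k"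
proof -
  have "i \<le> n + 2" using assms by simp
  then show ?thesis
  proof (cases rule: cases4)
    case 1
    then have k: "k \<in> low" "i < k" using assms by (auto simp: lle_def)
    have "s i \<le> k" using s_up[of i] 1 k disj[of k] by (metis leI)
    then show ?thesis using k assms by (auto simp: lle_def)
  next
    case 2
    note S = s_down[of i]
    have "s i \<noteq> n + 2" using S 2 by auto
    moreover have "lle (s i) k"
    proof (cases "k \<in> low")
      case True
      then show ?thesis using S 2 assms upD[of "s i"] by (cases "s i" k rule: linorder_cases) (auto simp: lle_def)
    next
      case False
      then have "k < i" using assms 2 by (auto simp: lle_def)
      then have "k \<le> s i" using S 2 False by (metis leI)
      then show ?thesis using S 2 by (auto simp: lle_def)
    qed
    ultimately show ?thesis ..
  next
    case 3
    then have k: "k \<in> low" "i < k" using assms by (auto simp: lle_def)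
    have "s i \<le> k" using s_up[of i] 3 k disj[of k] by (metis leI)
    then show ?thesis using k assms by (auto simp: lle_def)
  qed (use assms in simp)
qed

lemma rle_next:
  assumes "1 \<le> j" "j \<le> n + 2" "1 \<le> k" "k \<le> n + 2" "rle j k" "j \<noteq> k"
  shows "s j \<noteq> 0 \<and> rle (s j) k"
  using assms(2)
proof (cases rule: cases4)
  case 2
  then have k: "k \<in> up" "k < j" using assms by (auto simp: rle_def)
  have "k \<le> s j" using s_down[of j] 2 k disj[of k] by (metis leI)
  then show ?thesis using k assms by (auto simp: rle_def)
next
  case 4
  then have k: "k \<in> up" "k < j" using assms by (auto simp: rle_def)
  have "k \<le> s j" using s_down[of j] 4 k disj[of k] by (metis leI)
  then show ?thesis using k assms by (auto simp: rle_def)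
next
  case 3
  note S = s_up[of j]
  have "s j \<noteq> 0" using S 3 by auto
  moreover have "rle (s j) k"
  proof (cases "k \<in> up")
    case True
    then show ?thesis using S 3 assms lowD[of "s j"] upD[of k] by (cases "s j" k rule: linorder_cases) (auto simp: rle_def)
  next
    case False
    then have "j < k" using assms 3 by (auto simp: rle_def)
    then have "s j \<le> k" using S 3 False by (metis leI)
    then show ?thesis using S 3 assms(4) by (auto simp: rle_def)
  qed
  ultimately show ?thesis ..
qed (use assms in simp)

section \<open>Ranks, segments and linked segments\<close>

definition lrank where "lrank i = card {k. k < n + 2 \<and> lle k i}"
definition rrank where "rrank j = card {k. 1 \<le> k \<and> k \<le> n + 2 \<and> rle k j}"

text \<open>As the immediate successor of \<open>i\<close>, the vertex \<open>s i\<close> adds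
  exactly itself to the set counted by \<open>lrank\<close>.\<close>

lemma lrank_s: assumes "i < n + 2" "s i < n + 2" shows "lrank (s i) = lrank i + 1"
proof -
  have st: "lle i (s i)" using lle_s[of i] assms by simp
  have "lle k (s i) \<longleftrightarrow> k = s i \<or> lle k i" if k: "k < n + 2" for k
  proof
    assume l: "lle k (s i)"
    show "k = s i \<or> lle k i"
    proof (rule disjCI)
      assume "\<not> lle k i"
      then have "lle i k" "i \<noteq> k" using lle_total[OF assms(1) k] by auto
      then show "k = s i" using lle_next[OF assms(1) k] lle_antisym[OF l] by blast
    qed
  qed (use lle_trans[OF _ st] in auto)
  then have "{k. k < n + 2 \<and> lle k (s i)} = insert (s i) {k. k < n + 2 \<and> lle k i}"
    using assms by blast
  moreover have "s i \<notin> {k. k < n + 2 \<and> lle k i}" using lle_s[of i] lle_antisym s_ne[of i] assms by auto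
  ultimately show ?thesis by (simp add: lrank_def)
qed

lemma rle_total: "1 \<le> i \<Longrightarrow> i \<le> n + 2 \<Longrightarrow> 1 \<le> k \<Longrightarrow> k \<le> n + 2 \<Longrightarrow> rle i k \<or> rle k i"
  using low_iff[of i] low_iff[of k] by (cases i k rule: linorder_cases) (auto simp: rle_def)

lemma rrank_s: assumes "1 \<le> j" "j \<le> n + 2" "1 \<le> s j" shows "rrank (s j) = rrank j + 1"
proof -
  have st: "rle j (s j)" using rle_s[of j] assms by simp
  have "rle k (s j) \<longleftrightarrow> k = s j \<or> rle k j" if k: "1 \<le> k" "k \<le> n + 2" for k
  proof
    assume l: "rle k (s j)"
    show "k = s j \<or> rle k j"
    proof (rule disjCI)
      assume "\<not> rle k j"
      then have "rle j k" "j \<noteq> k" using rle_total[OF assms(1,2) k] by auto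
      then show "k = s j" using rle_next[OF assms(1,2) k] rle_antisym[OF l] by blast
    qed
  qed (use rle_trans[OF _ st] in auto)
  then have "{k. 1 \<le> k \<and> k \<le> n + 2 \<and> rle k (s j)} = insert (s j) {k. 1 \<le> k \<and> k \<le> n + 2 \<and> rle k j}"
    using assms s_le[OF assms(2)] by blast
  moreover have "s j \<notin> {k. 1 \<le> k \<and> k \<le> n + 2 \<and> rle k j}" using rle_s[of j] rle_antisym s_ne[of j] assms by auto
  ultimately show ?thesis by (simp add: rrank_def)
qed

definition sle :: "nat \<times> nat \<Rightarrow> nat \<times> nat \<Rightarrow> bool" where
  "sle x y \<longleftrightarrow> lle (fst x) (fst y) \<and> rle (snd x) (snd y)"

definition supp :: "nat \<times> nat \<Rightarrow> nat set" where "supp x = {fst x + 1..snd x}"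

definition linked :: "nat \<times> nat \<Rightarrow> nat \<times> nat \<Rightarrow> bool" where
  "linked x y \<longleftrightarrow> sle x y \<and> fst x < snd y \<and> fst y < snd x"

abbreviation "S \<equiv> segments n"
abbreviation "P \<equiv> pivots n Q"

lemma S_iff: "x \<in> S \<longleftrightarrow> fst x < snd x \<and> snd x \<le> n + 2"
  by (cases x) (simp add: segments_def)

lemma S_bounds: "x \<in> S \<Longrightarrow> fst x < n + 2 \<and> 1 \<le> snd x \<and> snd x \<le> n + 2"
  by (simp add: S_iff)

lemma finite_S [simp]: "finite S"
  by (rule finite_subset[of _ "{..n + 2} \<times> {..n + 2}"]) (auto simp: segments_def)

lemma P_iff: "(x, y) \<in> P \<longleftrightarrow> x \<in> S \<and> y \<in> S \<and>
    (fst y = s (fst x) \<and> snd y = snd x \<or> fst y = fst x \<and> snd y = s (snd x))"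
proof -
  obtain i j k l where [simp]: "x = (i, j)" "y = (k, l)" by (cases x; cases y)
  have "i < j \<Longrightarrow> j \<le> n + 2 \<Longrightarrow> s j \<le> n + 2" using s_le by simp
  then show ?thesis by (auto simp: pivots_def segments_def)
qed

lemma sle_refl [simp]: "sle x x" by (simp add: sle_def)

lemma sle_trans: "sle x y \<Longrightarrow> sle y z \<Longrightarrow> sle x z"
  using lle_trans rle_trans by (auto simp: sle_def)

lemma sle_antisym: "sle x y \<Longrightarrow> sle y x \<Longrightarrow> x = y"
  using lle_antisym rle_antisym by (auto simp: sle_def prod_eq_iff)

lemma P_sle: "(x, y) \<in> P \<Longrightarrow> sle x y \<and> x \<noteq> y"
proof -
  assume p: "(x, y) \<in> P"
  then have b: "x \<in> S" "y \<in> S" by (auto simp: P_iff)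
  note B = S_bounds[OF b(1)] S_bounds[OF b(2)]
  from p have "fst y = s (fst x) \<and> snd y = snd x \<or> fst y = fst x \<and> snd y = s (snd x)" by (simp add: P_iff)
  then show "sle x y \<and> x \<noteq> y"
  proof
    assume c: "fst y = s (fst x) \<and> snd y = snd x"
    then have "s (fst x) \<noteq> n + 2" "s (fst x) \<noteq> fst x" using B s_ne[of "fst x"] by auto
    then show ?thesis using c B lle_s[of "fst x"] by (metis sle_def rle_refl)
  next
    assume c: "fst y = fst x \<and> snd y = s (snd x)"
    then have "s (snd x) \<noteq> 0" "s (snd x) \<noteq> snd x" using B s_ne[of "snd x"] by auto
    then show ?thesis using c B rle_s[of "snd x"] by (metis sle_def lle_refl)
  qed
qed

lemma supp_inter_empty: "x \<in> S \<Longrightarrow> y \<in> S \<Longrightarrow> sle x y \<Longrightarrow> \<not> linked x y \<Longrightarrow> supp x \<inter> supp y = {}"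
  by (auto simp: linked_def supp_def S_iff)

lemma supp_inter_nonempty: "x \<in> S \<Longrightarrow> y \<in> S \<Longrightarrow> linked x y \<Longrightarrow> supp x \<inter> supp y \<noteq> {}"
  by (cases "fst x \<le> fst y"; cases "snd x \<le> snd y") (auto simp: linked_def supp_def S_iff)

text \<open>A consequence of the shapes recorded in \<open>lle_max\<close> and
  \<open>rle_min\<close>. It makes canonical maps along a chain in \<open>sle\<close> compose to the
  canonical map.\<close>

lemma supp_between: "sle x y \<Longrightarrow> sle y z \<Longrightarrow> supp x \<inter> supp z \<subseteq> supp y"
  using lle_max[of "fst x" "fst y" "fst z"] rle_min[of "snd x" "snd y" "snd z"]
  by (auto simp: sle_def supp_def)

lemma linked_refl: "x \<in> S \<Longrightarrow> linked x x"
  by (auto simp: linked_def S_iff)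

text \<open>By \<open>lle_max\<close> the left endpoint of \<open>z\<close> is at most the larger
  left endpoint of \<open>x\<close> and \<open>y\<close>, by \<open>rle_min\<close> its right
  endpoint at least the smaller right one. So linked segments span a full rectangle of segments in
  the product of the two orders.\<close>

lemma rectangle:
  assumes "x \<in> S" "y \<in> S" "linked x y" "sle x z" "sle z y" "fst z < n + 2" "snd z \<le> n + 2"
  shows "z \<in> S" "linked x z" "linked z y"
  using assms lle_max[of "fst x" "fst z" "fst y"] rle_min[of "snd x" "snd z" "snd y"]
  by (auto simp: linked_def sle_def S_iff)

text \<open>The moves from \<open>x\<close> inside the rectangle that it spans with
  \<open>y\<close>; the third clause supplies the fourth corner of a mesh when both endpoints have
  to move.\<close>

lemma first_pivot_cases:
  assumes x: "x \<in> S" and y: "y \<in> S" and l: "linked x y"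
  shows "fst x \<noteq> fst y \<Longrightarrow> (x, (s (fst x), snd x)) \<in> P \<and> linked (s (fst x), snd x) y"
    and "snd x \<noteq> snd y \<Longrightarrow> (x, (fst x, s (snd x))) \<in> P \<and> linked (fst x, s (snd x)) y"
    and "fst x \<noteq> fst y \<Longrightarrow> snd x \<noteq> snd y \<Longrightarrow> (s (fst x), s (snd x)) \<in> S \<and> linked (s (fst x), s (snd x)) y"
proof -
  note B = S_bounds[OF x] S_bounds[OF y]
  have sl: "lle (fst x) (fst y)" "rle (snd x) (snd y)" using l by (auto simp: linked_def sle_def)
  have L: "lle (fst x) (s (fst x)) \<and> lle (s (fst x)) (fst y) \<and> s (fst x) < n + 2" if "fst x \<noteq> fst y"
    using lle_next[of "fst x" "fst y"] lle_s[of "fst x"] s_le[of "fst x"] B sl that by auto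
  have R: "rle (snd x) (s (snd x)) \<and> rle (s (snd x)) (snd y) \<and> s (snd x) \<le> n + 2" if "snd x \<noteq> snd y"
    using rle_next[of "snd x" "snd y"] rle_s[of "snd x"] s_le[of "snd x"] B sl that by auto
  show "(x, (s (fst x), snd x)) \<in> P \<and> linked (s (fst x), snd x) y" if "fst x \<noteq> fst y"
    using rectangle[OF x y l, of "(s (fst x), snd x)"] L[OF that] sl B x by (auto simp: P_iff sle_def)
  show "(x, (fst x, s (snd x))) \<in> P \<and> linked (fst x, s (snd x)) y" if "snd x \<noteq> snd y"
    using rectangle[OF x y l, of "(fst x, s (snd x))"] R[OF that] sl B x by (auto simp: P_iff sle_def)
  show "(s (fst x), s (snd x)) \<in> S \<and> linked (s (fst x), s (snd x)) y" if "fst x \<noteq> fst y" "snd x \<noteq> snd y"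
    using rectangle[OF x y l, of "(s (fst x), s (snd x))"] L[OF that(1)] R[OF that(2)] B x by (auto simp: sle_def)
qed

lemma first_pivot:
  assumes "x \<in> S" "y \<in> S" "linked x y" "x \<noteq> y"
  obtains z where "(x, z) \<in> P" "linked z y"
proof -
  have "fst x \<noteq> fst y \<or> snd x \<noteq> snd y" using assms(4) by (auto simp: prod_eq_iff)
  then show ?thesis using first_pivot_cases(1,2)[OF assms(1-3)] that by blast
qed

definition rank :: "nat \<times> nat \<Rightarrow> nat" where "rank x = lrank (fst x) + rrank (snd x)"

lemma rank_P: "(x, y) \<in> P \<Longrightarrow> rank y = rank x + 1"
proof -
  assume p: "(x, y) \<in> P"
  then have b: "x \<in> S" "y \<in> S" by (auto simp: P_iff)
  show "rank y = rank x + 1"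
    using p S_bounds[OF b(1)] S_bounds[OF b(2)] lrank_s[of "fst x"] rrank_s[of "snd x"] by (auto simp: P_iff rank_def)
qed

lemma lrank_mono: "lle i k \<Longrightarrow> lrank i \<le> lrank k"
  unfolding lrank_def by (rule card_mono) (auto intro: lle_trans)

lemma rrank_mono: "rle i k \<Longrightarrow> rrank i \<le> rrank k"
  unfolding rrank_def by (rule card_mono) (auto intro: rle_trans intro!: finite_subset[of _ "{..n + 2}"])

lemma rank_mono: "sle x y \<Longrightarrow> rank x \<le> rank y"
  using lrank_mono rrank_mono by (force simp: sle_def rank_def)

lemma linked_sle: "linked x y \<Longrightarrow> sle x y" by (simp add: linked_def)

text \<open>Walk from \<open>x\<close> by \<open>first_pivot\<close> until the next step is
  \<open>y\<close>; the remaining difference of \<open>rank\<close> bounds the walk.\<close>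

lemma last_pivot:
  assumes "x \<in> S" "y \<in> S" "linked x y" "x \<noteq> y"
  obtains z where "(z, y) \<in> P" "linked x z"
proof -
  have "\<exists>z. (z, y) \<in> P \<and> linked x z"
    using assms
  proof (induction "rank y - rank x" arbitrary: x rule: less_induct)
    case less
    obtain w where w: "(x, w) \<in> P" "linked w y" using first_pivot less.prems by blast
    show ?case
    proof (cases "w = y")
      case True
      then show ?thesis using w linked_refl less.prems(1) by blast
    next
      case False
      have wS: "w \<in> S" using w by (simp add: P_iff)
      have "rank y - rank w < rank y - rank x"
        using rank_P[OF w(1)] rank_mono[OF linked_sle[OF w(2)]] by simp
      then obtain z where z: "(z, y) \<in> P" "linked w z" using less.hyps[OF _ wS less.prems(2) w(2) False] by blast
      have "sle x z" using sle_trans[of x w z] P_sle[OF w(1)] linked_sle[OF z(2)] by blast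
      moreover have "z \<in> S" using z by (simp add: P_iff)
      ultimately have "linked x z"
        using rectangle(2)[OF less.prems(1-3), of z] P_sle[OF z(1)] S_bounds by blast
      then show ?thesis using z by blast
    qed
  qed
  then show ?thesis using that by blast
qed

text \<open>Expresses the translation through \<open>s\<close>: the translate of \<open>x\<close> is
  the segment from which \<open>x\<close> arises by pivoting both endpoints.\<close>

lemma R_segment_iff: "x \<in> S \<Longrightarrow> R_segment n Q x = Some t \<longleftrightarrow> t \<in> S \<and> x = (s (fst t), s (snd t))"
proof -
  assume x: "x \<in> S"
  obtain i j where [simp]: "x = (i, j)" by (cases x)
  obtain k l where [simp]: "t = (k, l)" by (cases t)
  have b: "i \<le> n + 2" "j \<le> n + 2" using x by (auto simp: segments_def)
  have "k < l \<Longrightarrow> l \<le> n + 2 \<Longrightarrow> r (s k) = k \<and> r (s l) = l" using r_s by simp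
  then show ?thesis using s_r[of i] s_r[of j] r_le[of i] r_le[of j] b by (auto simp: R_segment_def segments_def)
qed

text \<open>Injectivity of \<open>s\<close> identifies the predecessors of \<open>x\<close> with the
  successors of \<open>t\<close>. A middle term is missing exactly when its two endpoints are not in
  increasing order, and this cannot happen to both.\<close>

lemma mesh_shape:
  assumes "t \<in> S" "x \<in> S" "x = (s (fst t), s (snd t))"
  shows "(y, x) \<in> P \<longleftrightarrow> y \<in> S \<and> (y = (s (fst t), snd t) \<or> y = (fst t, s (snd t)))"
    and "(t, y) \<in> P \<longleftrightarrow> y \<in> S \<and> (y = (s (fst t), snd t) \<or> y = (fst t, s (snd t)))"
    and "(s (fst t), snd t) \<noteq> (fst t, s (snd t))"
    and "(s (fst t), snd t) \<in> S \<or> (fst t, s (snd t)) \<in> S"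
    and "sle t x"
proof -
  note B = S_bounds[OF assms(1)] S_bounds[OF assms(2)]
  obtain k l where [simp]: "y = (k, l)" by (cases y)
  have i: "k < l \<Longrightarrow> l \<le> n + 2 \<Longrightarrow> s k = s (fst t) \<longleftrightarrow> k = fst t" "k < l \<Longrightarrow> l \<le> n + 2 \<Longrightarrow> s l = s (snd t) \<longleftrightarrow> l = snd t"
    using s_inj[of k "fst t"] s_inj[of l "snd t"] B by auto
  show "(y, x) \<in> P \<longleftrightarrow> y \<in> S \<and> (y = (s (fst t), snd t) \<or> y = (fst t, s (snd t)))"
  proof (cases "y \<in> S")
    case True
    then have "s k = s (fst t) \<longleftrightarrow> k = fst t" "s l = s (snd t) \<longleftrightarrow> l = snd t" using i by (auto simp: S_iff)
    then show ?thesis using True assms(2) unfolding P_iff assms(3) by (auto simp: eq_commute)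
  qed (simp add: P_iff)
  show "(t, y) \<in> P \<longleftrightarrow> y \<in> S \<and> (y = (s (fst t), snd t) \<or> y = (fst t, s (snd t)))"
    using assms by (auto simp: P_iff)
  show "(s (fst t), snd t) \<noteq> (fst t, s (snd t))" using s_ne[of "fst t"] B by auto
  show "(s (fst t), snd t) \<in> S \<or> (fst t, s (snd t)) \<in> S"
    using assms s_le[of "snd t"] by (auto simp: S_iff)
  show "sle t x" using lle_s[of "fst t"] rle_s[of "snd t"] B assms(3) by (auto simp: sle_def S_iff)
qed

lemma polygon_sel [simp]: "verts (polygon_quiver n Q) = S" "arrs (polygon_quiver n Q) = P"
    "transl (polygon_quiver n Q) = R_segment n Q"
  by (simp_all add: polygon_quiver_def)

lemma polygon_translation_quiver: "translation_quiver (polygon_quiver n Q)"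
  unfolding translation_quiver_def polygon_sel
proof (intro conjI ballI allI impI)
  show "P \<subseteq> S \<times> S" by (auto simp: P_iff)
  fix x show "(x, x) \<notin> P" using P_sle by blast
next
  fix x assume x: "x \<in> S"
  show "finite {y. (x, y) \<in> P}" "finite {y. (y, x) \<in> P}"
    by (rule finite_subset[OF _ finite_S]; auto simp: P_iff)+
  fix t assume "R_segment n Q x = Some t"
  then have t: "t \<in> S" "x = (s (fst t), s (snd t))" using R_segment_iff[OF x] by auto
  show "t \<in> S" by (rule t(1))
  fix y show "(y, x) \<in> P \<longleftrightarrow> (t, y) \<in> P" using mesh_shape(1,2)[OF t(1) x t(2)] by blast
next
  fix x y assume "x \<in> S" "y \<in> S" "R_segment n Q x \<noteq> None \<and> R_segment n Q x = R_segment n Q y"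
  then show "x = y" using R_segment_iff by (metis option.exhaust)
qed

section \<open>Morphisms between interval representations\<close>

abbreviation F :: "nat \<times> nat \<Rightarrow> (nat, 'k::field) rep" where "F \<equiv> F_obj"

lemma F_space: "space_at (F x) v = (if v \<in> supp x then line else {0})"
  by (cases x) (simp add: F_obj_def M_def supp_def)

lemma F_map: "map_at (F x) (a, b) y = (if a \<in> supp x \<and> b \<in> supp x \<and> y \<in> line then y else 0)"
  by (cases x) (simp add: F_obj_def M_def supp_def)

definition unit0 :: "nat \<Rightarrow> 'k::field" where "unit0 = (\<lambda>m. if m = 0 then 1 else 0)"

lemma line_iff: "x \<in> line \<longleftrightarrow> (x :: nat \<Rightarrow> 'k::field) = vscale (x 0) unit0"
  by (auto simp: line_def unit0_def vscale_def fun_eq_iff)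

lemma line_simps [simp]: "0 \<in> line" "unit0 \<in> line" "x \<in> line \<Longrightarrow> y \<in> line \<Longrightarrow> x + y \<in> line"
    "x \<in> line \<Longrightarrow> vscale a x \<in> line" "unit0 \<noteq> 0" "unit0 0 = 1"
  by (auto simp: line_def unit0_def vscale_def fun_ext)

lemma subspace_line: "seq.subspace line"
  by (rule subI) auto

lemma fdim_line: "fdim (line :: (nat \<Rightarrow> 'k::field) set)"
proof -
  have "line \<subseteq> seq.span {unit0 :: nat \<Rightarrow> 'k}"
  proof
    fix x :: "nat \<Rightarrow> 'k" assume "x \<in> line"
    then have "x = vscale (x 0) unit0" by (simp add: line_iff)
    then show "x \<in> seq.span {unit0}" by (metis seq.span_base seq.span_scale singletonI)
  qed
  moreover have "fdim (seq.span {unit0 :: nat \<Rightarrow> 'k})" unfolding fdim_def by blast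
  ultimately show ?thesis using fdim_mono subspace_line by blast
qed

lemma F_rep [simp]: "representation Q (F x)"
  by (rule representationI) (auto simp: F_space F_map fdim_line intro!: lmI)

lemma F_Obj: "F x \<in> Obj (rep_category Q)" by simp

lemma supp_verts: "x \<in> S \<Longrightarrow> v \<in> supp x \<Longrightarrow> 1 \<le> v \<and> v \<le> n + 2"
  by (auto simp: supp_def S_iff)

lemma identity_on_empty [simp]: "identity_on {} = 0"
  by (simp add: identity_on_def fun_ext)

lemma F_ide: "x \<in> S \<Longrightarrow> Ide R (F x) = identity_on (supp x)"
  using supp_verts[of x] by (auto simp: F_space identity_on_def fun_ext)

text \<open>By the order \<open>sle\<close>, an arrow from the support of \<open>x\<close> to that
  of \<open>y\<close> runs inside the common support, which makes all squares commute. Neither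
  \<open>x\<close> nor \<open>y\<close> has to be a segment; this admits a degenerate middle term of
  a mesh.\<close>

lemma identity_on_Hom:
  assumes "sle x y" "snd x \<le> n + 2 \<or> snd y \<le> n + 2"
  shows "identity_on (supp x \<inter> supp y) \<in> Hom R (F x) (F y)"
proof (rule rep_HomI)
  fix v show "identity_on (supp x \<inter> supp y) v \<in> linear_maps (space_at (F x) v) (space_at (F y) v)"
    by (rule lmI) (auto simp: F_space identity_on_def)
next
  fix v assume "v \<notin> verts Q"
  then show "identity_on (supp x \<inter> supp y) v = 0"
    using assms(2) by (auto simp: identity_on_def supp_def fun_ext)
next
  fix a b z assume ab: "(a, b) \<in> arrs Q" and z: "z \<in> space_at (F x) a"
  show "identity_on (supp x \<inter> supp y) b (map_at (F x) (a, b) z) = map_at (F y) (a, b) (identity_on (supp x \<inter> supp y) a z)"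
  proof (cases "a \<in> supp x")
    case True
    have l: "lle (fst x) (fst y)" "rle (snd x) (snd y)" using assms(1) by (auto simp: sle_def)
    \<comment> \<open>The order forbids the support of \<open>x\<close> or of \<open>y\<close> to
      end between \<open>a\<close> and \<open>b\<close>, so both memberships hold.\<close>
    have "b \<in> supp x \<longleftrightarrow> a \<in> supp y" if b: "b \<in> supp y"
      using ab unfolding arr_iff
    proof
      assume u: "b = a + 1 \<and> a \<in> up"
      then have "fst y \<noteq> a" "snd x \<noteq> a" using l True b disj by (auto simp: lle_def rle_def supp_def)
      then show ?thesis using u True b by (auto simp: supp_def)
    next
      assume u: "a = b + 1 \<and> b \<in> low"
      then have "fst x \<noteq> b" "snd y \<noteq> b" using l True b disj by (auto simp: lle_def rle_def supp_def)
      then show ?thesis using u True b by (auto simp: supp_def)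
    qed
    then show ?thesis using True z by (auto simp: F_space F_map identity_on_def)
  qed (use z in \<open>auto simp: F_space F_map identity_on_def\<close>)
qed

text \<open>At every vertex of the common support the map is a scalar, and the arrows within this
  interval force the scalars to agree. If the supports meet but the order fails, the square of an
  arrow crossing an end of the common support forces the scalar to be zero.\<close>

lemma F_Hom:
  fixes \<phi> :: "(nat, 'k::field) rep_mor"
  assumes x: "x \<in> S" and y: "y \<in> S" and \<phi>: "\<phi> \<in> Hom R (F x) (F y)"
  shows "\<exists>c. \<phi> = (\<lambda>v z. vscale c (identity_on (supp x \<inter> supp y) v z))" "\<not> linked x y \<Longrightarrow> \<phi> = 0"
proof -
  define I where "I = supp x \<inter> supp y"
  have Iv: "1 \<le> v \<and> v \<le> n + 2" if "v \<in> I" for v using that supp_verts[OF x] by (auto simp: I_def)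
  define c where "c v = \<phi> v unit0 0" for v
  have lm: "\<phi> v \<in> linear_maps (space_at (F x) v) (space_at (F y) v)" if "v \<in> I" for v
    using rep_lm[OF \<phi>, of v] Iv[OF that] by simp
  have on: "\<phi> v z = vscale (c v) z" if v: "v \<in> I" and z: "z \<in> line" for v z
  proof -
    have sx: "space_at (F x) v = (line :: (nat \<Rightarrow> 'k) set)" "space_at (F y) v = (line :: (nat \<Rightarrow> 'k) set)"
      using v by (auto simp: F_space I_def)
    have "\<phi> v unit0 \<in> line" using lm_in[OF lm[OF v], of unit0] sx by simp
    then have "\<phi> v unit0 = vscale (c v) unit0" unfolding c_def by (simp flip: line_iff)
    moreover have "z = vscale (z 0) unit0" using z by (simp flip: line_iff)
    ultimately show ?thesis using lm_scl[OF lm[OF v], of unit0 "z 0"] sx by (metis line_simps(2) mult.commute vscale_vscale)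
  qed
  have off: "\<phi> v z = 0" if "v \<notin> I \<or> z \<notin> line" for v z
  proof (cases "1 \<le> v \<and> v \<le> n + 2")
    case True
    then have l: "\<phi> v \<in> linear_maps (space_at (F x) v) (space_at (F y) v)" using rep_lm[OF \<phi>, of v] by simp
    show ?thesis
      using that lm_in[OF l, of z] lm_out[OF l, of z] lm_zero[OF l]
      by (cases "v \<in> supp x"; cases "v \<in> supp y"; cases "z = 0"; cases "z \<in> line"; simp add: F_space I_def)
  next
    case False
    then have "\<phi> v = 0" using rep_outside[OF \<phi>, of v] by auto
    then show ?thesis by simp
  qed
  have nat: "\<phi> b (map_at (F x) (a, b) unit0) = map_at (F y) (a, b) (\<phi> a unit0)" if "(a, b) \<in> arrs Q" "a \<in> supp x" for a b
    using rep_nat[OF \<phi> that(1), of unit0] that(2) by (simp add: F_space)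
  have step: "c v = c (v + 1)" if "v \<in> I" "v + 1 \<in> I" for v
  proof -
    have "v \<in> up \<or> v \<in> low" using low_iff[of v] Iv[OF that(1)] Iv[OF that(2)] by auto
    then show ?thesis
    proof
      assume "v \<in> up"
      then have "(v, v + 1) \<in> arrs Q" by (simp add: arr_iff)
      then have "\<phi> (v + 1) unit0 = \<phi> v unit0"
        using nat[of v "v + 1"] that on[OF that(1), of unit0] by (auto simp: F_map I_def)
      then show ?thesis by (simp add: c_def)
    next
      assume "v \<in> low"
      then have "(v + 1, v) \<in> arrs Q" by (simp add: arr_iff)
      then have "\<phi> v unit0 = \<phi> (v + 1) unit0"
        using nat[of "v + 1" v] that on[OF that(2), of unit0] by (auto simp: F_map I_def)
      then show ?thesis by (simp add: c_def)
    qed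
  qed
  define m where "m = max (fst x) (fst y) + 1"
  have I_eq: "I = {m..min (snd x) (snd y)}" by (auto simp: I_def supp_def m_def)
  have const: "c v = c m" if "v \<in> I" for v
  proof -
    have "m \<le> v" using that by (simp add: I_eq)
    then show ?thesis using that
    proof (induction v rule: dec_induct)
      case (step v)
      then show ?case using \<open>\<And>v. v \<in> I \<Longrightarrow> v + 1 \<in> I \<Longrightarrow> c v = c (v + 1)\<close>[of v] by (simp add: I_eq)
    qed simp
  qed
  have eq: "\<phi> = (\<lambda>v z. vscale (c m) (identity_on I v z))"
    using on off const by (auto simp: identity_on_def fun_eq_iff)
  then show "\<exists>c. \<phi> = (\<lambda>v z. vscale c (identity_on (supp x \<inter> supp y) v z))" by (auto simp: I_def)
  show "\<phi> = 0" if nl: "\<not> linked x y"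
  proof (cases "I = {}")
    case True
    then show ?thesis using eq by (simp add: fun_eq_iff)
  next
    case False
    then have lt: "max (fst x) (fst y) < min (snd x) (snd y)" by (auto simp: I_eq m_def)
    then have nsle: "\<not> sle x y" using nl by (auto simp: linked_def)
    have vI: "v \<in> I \<longleftrightarrow> fst x < v \<and> fst y < v \<and> v \<le> snd x \<and> v \<le> snd y" for v by (auto simp: I_def supp_def)
    have supp_iff: "v \<in> supp z \<longleftrightarrow> fst z < v \<and> v \<le> snd z" for v z by (auto simp: supp_def)
    \<comment> \<open>The order fails at the left or at the right end. There an arrow crosses the
      end of the common support in the wrong direction: one way around its square is zero, the other
      is the scalar.\<close>
    have "\<exists>v\<in>I. \<phi> v unit0 = 0"
    proof (cases "lle (fst x) (fst y)")
      case False
      show ?thesis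
      proof (cases "fst x < fst y")
        case True
        then have u: "fst y \<in> up" using False low_iff[of "fst y"] S_bounds[OF y] by (auto simp: lle_def)
        have v: "fst y + 1 \<in> I" using lt True by (simp add: vI)
        have "\<phi> (fst y + 1) unit0 = 0"
          using nat[of "fst y" "fst y + 1"] u v True lt off[of "fst y" unit0] by (auto simp: arr_iff F_map supp_iff vI)
        then show ?thesis using v by blast
      next
        case 2: False
        then have lt': "fst y < fst x" using False by (auto simp: lle_def)
        then have u: "fst x \<in> low" using False low_iff[of "fst x"] S_bounds[OF x] by (auto simp: lle_def)
        have v: "fst x + 1 \<in> I" using lt lt' by (simp add: vI)
        have "\<phi> (fst x + 1) unit0 = 0"
          using nat[of "fst x + 1" "fst x"] u v lt lt' off[of "fst x" 0] on[OF v, of unit0]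
          by (auto simp: arr_iff F_map supp_iff vI)
        then show ?thesis using v by blast
      qed
    next
      case True
      then have nr: "\<not> rle (snd x) (snd y)" using nsle by (simp add: sle_def)
      show ?thesis
      proof (cases "snd x < snd y")
        case True
        then have u: "snd x \<in> up" using nr low_iff[of "snd x"] S_bounds[OF x] S_bounds[OF y] by (auto simp: rle_def)
        have v: "snd x \<in> I" using lt True by (simp add: vI)
        have "\<phi> (snd x) unit0 = 0"
          using nat[of "snd x" "snd x + 1"] u v True lt off[of "snd x + 1" 0] on[OF v, of unit0]
          by (auto simp: arr_iff F_map supp_iff vI)
        then show ?thesis using v by blast
      next
        case False
        then have lt': "snd y < snd x" using nr by (auto simp: rle_def)
        then have u: "snd y \<in> low" using nr low_iff[of "snd y"] S_bounds[OF x] S_bounds[OF y] by (auto simp: rle_def)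
        have v: "snd y \<in> I" using lt lt' by (simp add: vI)
        have "\<phi> (snd y) unit0 = 0"
          using nat[of "snd y + 1" "snd y"] u v lt lt' off[of "snd y + 1" unit0]
          by (auto simp: arr_iff F_map supp_iff vI)
        then show ?thesis using v by blast
      qed
    qed
    then obtain v where v: "v \<in> I" "\<phi> v unit0 = 0" by blast
    then have "c m = 0" using const[OF v(1)] unfolding c_def by (simp add: zero_fun_apply)
    then show ?thesis using eq by (simp add: fun_eq_iff)
  qed
qed

lemma identity_on_nonzero: "A \<noteq> {} \<Longrightarrow> c \<noteq> 0 \<Longrightarrow> (\<lambda>v z. vscale c (identity_on A v z)) \<noteq> (0 :: (nat, 'k::field) rep_mor)"
proof
  assume "A \<noteq> {}" "c \<noteq> 0" and e: "(\<lambda>v z. vscale c (identity_on A v z)) = (0 :: (nat, 'k::field) rep_mor)"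
  then obtain v where v: "v \<in> A" by blast
  have "vscale c unit0 = (0 :: nat \<Rightarrow> 'k)" using fun_cong[OF fun_cong[OF e, of v], of unit0] v by (simp add: identity_on_def)
  from fun_cong[OF this, of 0] show False using \<open>c \<noteq> 0\<close> by (simp add: vscale_apply zero_fun_apply)
qed

text \<open>An isomorphism and its inverse are nonzero maps in both directions, so the segments are
  linked both ways and coincide by antisymmetry.\<close>

lemma F_iso:
  assumes "x \<in> S" "y \<in> S" "isomorphic_in R (F x) (F y :: (nat, 'k::field) rep)"
  shows "x = y"
proof -
  obtain f g where f: "f \<in> Hom R (F x) (F y :: (nat, 'k) rep)" and g: "g \<in> Hom R (F y) (F x :: (nat, 'k) rep)"
    and gf: "Comp R (F x) (F y) (F x) g f = Ide R (F x)"
    using assms(3) unfolding isomorphic_in_def is_iso_def by blast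
  have "supp x \<noteq> {}" using assms by (auto simp: supp_def S_iff)
  then have "identity_on (supp x) \<noteq> (0 :: (nat, 'k) rep_mor)" using identity_on_nonzero[of "supp x" 1] by simp
  then have nz: "Ide R (F x) \<noteq> Zero R (F x) (F x :: (nat, 'k) rep)" unfolding F_ide[OF assms(1)] rep_sel(5) .
  have "f \<noteq> Zero R (F x) (F y)"
    using nz gf R.comp_zero_right[OF F_Obj F_Obj F_Obj g] by metis
  moreover have "g \<noteq> Zero R (F y) (F x)"
    using nz gf R.comp_zero_left[OF F_Obj F_Obj F_Obj f] by metis
  ultimately have "f \<noteq> 0" "g \<noteq> 0" by simp_all
  then have "linked x y" "linked y x" using F_Hom(2) assms f g by blast+
  then show ?thesis using sle_antisym linked_sle by blast
qed

lemma F_inj: "inj_on (F :: _ \<Rightarrow> (nat, 'k::field) rep) S"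
proof (rule inj_onI)
  fix x y assume "x \<in> S" "y \<in> S" "F x = (F y :: (nat, 'k) rep)"
  moreover have "isomorphic_in R (F x) (F x :: (nat, 'k) rep)"
    unfolding isomorphic_in_def is_iso_def using R.ide_in[OF F_Obj[of x]] R.comp_ide_left[OF F_Obj F_Obj, of "Ide R (F x)" x x]
    by blast
  ultimately show "x = y" using F_iso by metis
qed

lemma F_image: "F ` S = (ind_objects n :: (nat, 'k::field) rep set)"
proof
  show "F ` S \<subseteq> (ind_objects n :: (nat, 'k) rep set)"
  proof
    fix X :: "(nat, 'k) rep" assume "X \<in> F ` S"
    then obtain i j where "(i, j) \<in> S" "X = (M (i + 1) j :: (nat, 'k) rep)" by (auto simp: F_obj_def)
    then show "X \<in> ind_objects n" unfolding ind_objects_def S_iff by force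
  qed
  show "(ind_objects n :: (nat, 'k) rep set) \<subseteq> F ` S"
  proof
    fix X assume "X \<in> (ind_objects n :: (nat, 'k) rep set)"
    then obtain i j where X: "X = M i j" and ij: "1 \<le> i" "i \<le> j" "j \<le> n + 2" by (auto simp: ind_objects_def)
    then have "X = F (i - 1, j)" "(i - 1, j) \<in> S" by (auto simp: F_obj_def S_iff)
    then show "X \<in> F ` S" by blast
  qed
qed

section \<open>Hooks and cohooks\<close>

lemma path_asc:
  assumes "1 \<le> a" "a \<le> b" "b \<le> n + 2" "\<And>m. a \<le> m \<Longrightarrow> m < b \<Longrightarrow> m \<in> up"
  shows "quiver_path Q [a..<b + 1]"
  using assms by (auto simp: quiver_path_def successively_conv_nth arr_iff simp del: upt_Suc)

lemma path_desc:
  assumes "1 \<le> a" "a \<le> b" "b \<le> n + 2" "\<And>m. a \<le> m \<Longrightarrow> m < b \<Longrightarrow> m \<in> low"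
  shows "quiver_path Q (rev [a..<b + 1])"
  unfolding quiver_path_def successively_rev
  using assms by (auto simp: successively_conv_nth arr_iff simp del: upt_Suc)

lemma asc_not_uses: "\<not> uses_arrow [a..<b] (Suc m, m)"
  by (auto simp: uses_arrow_def)

lemma desc_not_uses: "\<not> uses_arrow (rev [a..<b]) (m, Suc m)"
  by (auto simp: uses_arrow_def rev_nth)

lemma uses_arrow_mid: "h \<noteq> [] \<Longrightarrow> q \<noteq> [] \<Longrightarrow> uses_arrow (h @ q) (last h, hd q)"
  unfolding uses_arrow_def
  by (rule exI[of _ "length h - 1"]) (auto simp: nth_append last_conv_nth hd_conv_nth neq_Nil_conv)

lemma path_mid: "quiver_path Q (h @ q) \<Longrightarrow> h \<noteq> [] \<Longrightarrow> q \<noteq> [] \<Longrightarrow> (last h, hd q) \<in> arrs Q"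
  by (auto simp: quiver_path_def successively_append_iff)

text \<open>A proper continuation of \<open>h\<close> begins with an arrow out of
  \<open>last h\<close>; by hypothesis this is \<open>\<alpha>\<close>, which must not be
  used.\<close>

lemma is_hookI:
  assumes "quiver_path Q h" "hd h = fst \<alpha>" "\<not> uses_arrow h \<alpha>"
    "\<And>c. (last h, c) \<in> arrs Q \<Longrightarrow> (last h, c) = \<alpha>"
  shows "is_hook Q \<alpha> h"
  unfolding is_hook_def Let_def
proof (intro conjI allI impI)
  have "h \<noteq> []" using assms(1) by (auto simp: quiver_path_def)
  fix q assume "h @ q \<in> {p. quiver_path Q p \<and> hd p = fst \<alpha> \<and> \<not> uses_arrow p \<alpha>}"
  then show "q = []" using path_mid[of h q] uses_arrow_mid[of h q] assms(4)[of "hd q"] \<open>h \<noteq> []\<close> by auto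
qed (use assms in auto)

lemma is_cohookI:
  assumes "quiver_path Q h" "last h = snd \<alpha>" "\<not> uses_arrow h \<alpha>"
    "\<And>c. (c, hd h) \<in> arrs Q \<Longrightarrow> (c, hd h) = \<alpha>"
  shows "is_cohook Q \<alpha> h"
  unfolding is_cohook_def Let_def
proof (intro conjI allI impI)
  have "h \<noteq> []" using assms(1) by (auto simp: quiver_path_def)
  fix q assume "q @ h \<in> {p. quiver_path Q p \<and> last p = snd \<alpha> \<and> \<not> uses_arrow p \<alpha>}"
  then show "q = []" using path_mid[of q h] uses_arrow_mid[of q h] assms(4)[of "last q"] \<open>h \<noteq> []\<close> by auto
qed (use assms in auto)

lemma pivot_morphism_exists:
  assumes p: "(x, y) \<in> P"
  shows "pivot_morphism n Q x y (identity_on (supp x \<inter> supp y) :: (nat, 'k::field) rep_mor)"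
proof -
  let ?I = "identity_on (supp x \<inter> supp y) :: (nat, 'k) rep_mor"
  obtain i j k l where [simp]: "x = (i, j)" "y = (k, l)" by (cases x; cases y)
  have b: "i < j" "j \<le> n + 2" "k < l" "l \<le> n + 2" and
    c: "k = s i \<and> l = j \<or> k = i \<and> l = s j" using p by (auto simp: P_iff segments_def)
  have sets: "set [a + 1..<b + 1] = {a + 1..b}" "set (rev [a + 1..<b + 1]) = {a + 1..b}" for a b by auto
  have sub: "k < i \<Longrightarrow> l = j \<Longrightarrow> supp x \<inter> supp y = {i + 1..j}" "i < k \<Longrightarrow> l = j \<Longrightarrow> supp x \<inter> supp y = {k + 1..l}"
    "j < l \<Longrightarrow> k = i \<Longrightarrow> supp x \<inter> supp y = {i + 1..j}" "l < j \<Longrightarrow> k = i \<Longrightarrow> supp x \<inter> supp y = {k + 1..l}"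
    by (auto simp: supp_def)
  from c show ?thesis
  proof
    assume c: "k = s i \<and> l = j"
    show ?thesis
    proof (cases "k < i")
      case True
      have u: "i \<in> up" using c True s_up[of i] cases4[of i] b by fastforce
      note S = s_down[of i]
      \<comment> \<open>The hook of the arrow from \<open>i\<close> to \<open>i + 1\<close> descends
        from \<open>i\<close> to \<open>k + 1\<close>. It stops there because \<open>k\<close> is 0
        or an upper vertex, so no arrow leads from \<open>k + 1\<close> to \<open>k\<close>.\<close>
      have "is_hook Q (i, i + 1) (rev [k + 1..<i + 1])"
      proof (rule is_hookI)
        show "quiver_path Q (rev [k + 1..<i + 1])" by (rule path_desc) (use S u c b in auto)
        show "hd (rev [k + 1..<i + 1]) = fst (i, i + 1)" using True by (simp add: hd_rev)
        show "\<not> uses_arrow (rev [k + 1..<i + 1]) (i, i + 1)" using desc_not_uses[of "k + 1" "i + 1" i] by simp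
        have l: "last (rev [k + 1..<i + 1]) = k + 1" using True by (simp add: last_rev del: upt_Suc)
        fix d assume "(last (rev [k + 1..<i + 1]), d) \<in> arrs Q"
        then show "(last (rev [k + 1..<i + 1]), d) = (i, i + 1)"
          unfolding l using S u c True disj[of "k + 1"] disj[of k] lowD[of k] by (auto simp: arr_iff)
      qed
      moreover have "(i, i + 1) \<in> arrs Q" using u by (simp add: arr_iff)
      ultimately have "adds_hook Q k i {i + 1..j} {k + 1..l} ?I"
        unfolding adds_hook_def sub(1)[OF True conjunct2[OF c]] using c True b
        by (intro bexI[of _ "(i, i + 1)"] exI[of _ "rev [k + 1..<i + 1]"]) (auto simp: sets simp del: upt_Suc)
      then show ?thesis using c True by (simp add: pivot_morphism_def)
    next
      case False
      then have lt: "i < k" using c s_ne[of i] b by auto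
      have u: "i = 0 \<or> i \<in> low" using c lt s_down[of i] cases4[of i] b by fastforce
      note S = s_up[OF u]
      have kl: "k \<in> low" using S c b by auto
      \<comment> \<open>The cohook of the arrow from \<open>k + 1\<close> to \<open>k\<close>
        ascends from \<open>i + 1\<close> to \<open>k\<close>; nothing enters it from
        \<open>i\<close>, which is 0 or a lower vertex.\<close>
      have "is_cohook Q (k + 1, k) [i + 1..<k + 1]"
      proof (rule is_cohookI)
        show "quiver_path Q [i + 1..<k + 1]" by (rule path_asc) (use S c b lt in auto)
        show "last [i + 1..<k + 1] = snd (k + 1, k)" using lt by simp
        show "\<not> uses_arrow [i + 1..<k + 1] (k + 1, k)" using asc_not_uses[of "i + 1" "k + 1" k] by simp
        have l: "hd [i + 1..<k + 1] = i + 1" using lt by (simp del: upt_Suc)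
        fix d assume "(d, hd [i + 1..<k + 1]) \<in> arrs Q"
        then show "(d, hd [i + 1..<k + 1]) = (k + 1, k)"
          unfolding l using S u c lt disj[of "i + 1"] disj[of i] upD[of i] by (auto simp: arr_iff)
      qed
      moreover have "(k + 1, k) \<in> arrs Q" using kl by (simp add: arr_iff)
      ultimately have "removes_cohook Q i k {i + 1..j} {k + 1..l} ?I"
        unfolding removes_cohook_def sub(2)[OF lt conjunct2[OF c]] using c lt b
        by (intro bexI[of _ "(k + 1, k)"] exI[of _ "[i + 1..<k + 1]"]) (auto simp: sets simp del: upt_Suc)
      then show ?thesis using c False by (simp add: pivot_morphism_def)
    qed
  next
    assume c: "k = i \<and> l = s j"
    show ?thesis
    proof (cases "j < l")
      case True
      have u: "j \<in> low" using c True s_down[of j] cases4[of j] b by fastforce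
      note S = s_up[of j]
      \<comment> \<open>The hook of the arrow from \<open>j + 1\<close> to \<open>j\<close> ascends
        from \<open>j + 1\<close> to \<open>l\<close>; no arrow leads on to \<open>l + 1\<close>,
        since \<open>l\<close> is \<open>n + 2\<close> or a lower vertex.\<close>
      have "is_hook Q (j + 1, j) [j + 1..<l + 1]"
      proof (rule is_hookI)
        show "quiver_path Q [j + 1..<l + 1]" by (rule path_asc) (use S u c b in auto)
        show "hd [j + 1..<l + 1] = fst (j + 1, j)" using True by (simp del: upt_Suc)
        show "\<not> uses_arrow [j + 1..<l + 1] (j + 1, j)" using asc_not_uses[of "j + 1" "l + 1" j] by simp
        have e: "last [j + 1..<l + 1] = l" using True by simp
        \<comment> \<open>The vertices strictly between \<open>j\<close> and \<open>l\<close> are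
          upper, so an arrow from \<open>l\<close> to \<open>l - 1\<close> exists only for
          \<open>l - 1 = j\<close>; then it is the excluded arrow.\<close>
        have "l - 1 \<in> low \<Longrightarrow> l = j + 1" using S u c True disj[of "l - 1"] by (metis One_nat_def Suc_eq_plus1 Suc_pred diff_less less_Suc_eq less_imp_Suc_add zero_less_Suc)
        moreover fix d assume "(last [j + 1..<l + 1], d) \<in> arrs Q"
        ultimately show "(last [j + 1..<l + 1], d) = (j + 1, j)"
          unfolding e using S u c True disj[of l] upD[of l] by (auto simp: arr_iff)
      qed
      moreover have "(j + 1, j) \<in> arrs Q" using u by (simp add: arr_iff)
      ultimately have "adds_hook Q j l {i + 1..j} {k + 1..l} ?I"
        unfolding adds_hook_def sub(3)[OF True conjunct1[OF c]] using c True b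
        by (intro bexI[of _ "(j + 1, j)"] exI[of _ "[j + 1..<l + 1]"]) (auto simp: sets simp del: upt_Suc)
      then show ?thesis using c True by (simp add: pivot_morphism_def)
    next
      case False
      then have lt: "l < j" using c s_ne[of j] b by auto
      have u: "j \<in> up \<or> j = n + 2" using c lt s_up[of j] cases4[of j] b by fastforce
      note S = s_down[OF u]
      have lu: "l \<in> up" using S c b by auto
      \<comment> \<open>The cohook of the arrow from \<open>l\<close> to \<open>l + 1\<close>
        descends from \<open>j\<close> to \<open>l + 1\<close>; nothing enters it from
        \<open>j + 1\<close>, since \<open>j\<close> is \<open>n + 2\<close> or an upper
        vertex.\<close>
      have "is_cohook Q (l, l + 1) (rev [l + 1..<j + 1])"
      proof (rule is_cohookI)
        show "quiver_path Q (rev [l + 1..<j + 1])" by (rule path_desc) (use S c b lt in auto)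
        show "last (rev [l + 1..<j + 1]) = snd (l, l + 1)" using lt by (simp add: last_rev del: upt_Suc)
        show "\<not> uses_arrow (rev [l + 1..<j + 1]) (l, l + 1)" using desc_not_uses[of "l + 1" "j + 1" l] by simp
        have e: "hd (rev [l + 1..<j + 1]) = j" using lt by (simp add: hd_rev)
        have "j - 1 \<in> up \<Longrightarrow> j = l + 1" using S u c lt disj[of "j - 1"] by (metis One_nat_def Suc_eq_plus1 Suc_pred diff_less less_Suc_eq less_imp_Suc_add zero_less_Suc)
        moreover fix d assume "(d, hd (rev [l + 1..<j + 1])) \<in> arrs Q"
        ultimately show "(d, hd (rev [l + 1..<j + 1])) = (l, l + 1)"
          unfolding e using S u c lt disj[of j] lowD[of j] by (auto simp: arr_iff)
      qed
      moreover have "(l, l + 1) \<in> arrs Q" using lu by (simp add: arr_iff)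
      ultimately have "removes_cohook Q l j {i + 1..j} {k + 1..l} ?I"
        unfolding removes_cohook_def sub(4)[OF lt conjunct1[OF c]] using c lt b
        by (intro bexI[of _ "(l, l + 1)"] exI[of _ "rev [l + 1..<j + 1]"]) (auto simp: sets simp del: upt_Suc)
      then show ?thesis using c False by (simp add: pivot_morphism_def)
    qed
  qed
qed

lemma pivot_morphism_unique:
  assumes "pivot_morphism n Q x y \<phi>"
  shows "\<phi> = identity_on (supp x \<inter> supp y)"
proof -
  obtain i j k l where [simp]: "x = (i, j)" "y = (k, l)" by (cases x; cases y)
  have "\<phi> = identity_on ({i + 1..j} \<inter> {k + 1..l})"
    using assms unfolding pivot_morphism_def adds_hook_def removes_cohook_def
    by (auto split: if_splits intro!: arg_cong[of _ _ identity_on])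
  then show ?thesis by (simp add: supp_def)
qed

end

section \<open>Every representation is a direct sum of interval representations\<close>

text \<open>The ambient sequence space is infinite dimensional, so dimensions are compared through a
  basis of \<open>U\<close> extended to a finite one of \<open>V\<close>.\<close>

lemma dim_strict_mono:
  fixes V :: "(nat \<Rightarrow> 'k::field) set"
  assumes V: "fdim V" and U: "seq.subspace U" "U \<subseteq> V"
  shows "seq.dim U \<le> seq.dim V" "U \<noteq> V \<Longrightarrow> seq.dim U < seq.dim V"
proof -
  obtain A where A: "A \<subseteq> U" "seq.independent A" "U \<subseteq> seq.span A"
    using seq.maximal_independent_subset[of U] by blast
  have AU: "U = seq.span A" using A U(1) seq.span_minimal by blast
  obtain B where B: "A \<subseteq> B" "B \<subseteq> V" "seq.independent B" "V \<subseteq> seq.span B"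
    by (rule seq.maximal_independent_subset_extend[of A V]) (use A U in auto)
  have BV: "V = seq.span B" using B V fdim_subspace seq.span_minimal by blast
  obtain B0 where "finite B0" "V = seq.span B0" using V by (auto simp: fdim_def)
  then have fin: "finite B" using seq.independent_span_bound[of B0 B] B by auto
  have d: "seq.dim U = card A" "seq.dim V = card B"
    using seq.basis_card_eq_dim[of A U] seq.basis_card_eq_dim[of B V] A B by auto
  then show "seq.dim U \<le> seq.dim V" using card_mono[OF fin B(1)] by simp
  assume "U \<noteq> V"
  then have "A \<subset> B" using AU BV B(1) by auto
  then show "seq.dim U < seq.dim V" using d psubset_card_mono[OF fin] by simp
qed

context dynkin
begin

lemma lrank_strict:
  assumes "lle i k" "i \<noteq> k" "k < n + 2"
  shows "lrank i < lrank k"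
  unfolding lrank_def
proof (rule psubset_card_mono)
  have "k \<notin> {l. l < n + 2 \<and> lle l i}" using assms lle_antisym by auto
  then show "{l. l < n + 2 \<and> lle l i} \<subset> {l. l < n + 2 \<and> lle l k}"
    using assms lle_trans[of _ i k] lle_refl[of k] by blast
qed auto

text \<open>\<open>lrank\<close> is bounded and strictly increasing along \<open>lle\<close>, so a
  member of largest rank is maximal.\<close>

lemma ex_lle_max:
  assumes "P0 k" "\<And>k. P0 k \<Longrightarrow> k < n + 2"
  obtains i where "P0 i" "\<And>k. P0 k \<Longrightarrow> lle i k \<Longrightarrow> k = i"
proof -
  have "lrank k < n + 3" for k
  proof -
    have "card {l. l < n + 2 \<and> lle l k} \<le> card {..<n + 2}" by (rule card_mono) auto
    then show ?thesis by (simp add: lrank_def)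
  qed
  then obtain i where "P0 i" "\<forall>k. P0 k \<longrightarrow> lrank k \<le> lrank i"
    using ex_has_greatest_nat[of P0 k lrank "n + 3"] assms(1) by blast
  then show ?thesis using that[of i] lrank_strict assms(2) by (metis leD)
qed

lemma ex_lle_min:
  assumes "P0 k" "\<And>k. P0 k \<Longrightarrow> k < n + 2"
  obtains i where "P0 i" "\<And>k. P0 k \<Longrightarrow> lle i k"
proof -
  obtain i where "P0 i" "\<forall>k. P0 k \<longrightarrow> lrank i \<le> lrank k"
    using ex_has_least_nat[of P0 k lrank] assms(1) by auto
  then show ?thesis using that[of i] lrank_strict assms(2) lle_total lle_refl by (metis leD)
qed

text \<open>A morphism out of an interval is a family of vectors compatible along its arrows and
  killed by the arrows leaving it. Arrows entering it impose nothing, because the interval is zero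
  at their source.\<close>

lemma family_Hom:
  fixes X :: "(nat, 'k::field) rep"
  assumes X: "representation Q X" and x: "x \<in> S" and w: "\<And>v. v \<in> supp x \<Longrightarrow> w v \<in> space_at X v"
    and c: "\<And>a b. (a, b) \<in> arrs Q \<Longrightarrow> a \<in> supp x \<Longrightarrow> map_at X (a, b) (w a) = (if b \<in> supp x then w b else 0)"
  shows "(\<lambda>v z. if v \<in> supp x \<and> z \<in> line then vscale (z 0) (w v) else 0) \<in> Hom R (F x) X" (is "?f \<in> _")
proof (rule rep_HomI)
  fix v assume v: "v \<in> verts Q"
  then have sX: "seq.subspace (space_at X v)" using X by simp
  show "?f v \<in> linear_maps (space_at (F x) v) (space_at X v)"
    by (rule lmI) (use w sX in \<open>auto simp: F_space sub_zero sub_scl vscale_add_scalar plus_fun_apply vscale_apply\<close>)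
next
  fix v assume "v \<notin> verts Q" then show "?f v = 0" using supp_verts[OF x, of v] by (auto simp: fun_eq_iff zero_fun_apply)
next
  fix a b and z :: "nat \<Rightarrow> 'k" assume ab: "(a, b) \<in> arrs Q" and z: "z \<in> space_at (F x) a"
  show "?f b (map_at (F x) (a, b) z) = map_at X (a, b) (?f a z)"
  proof (cases "a \<in> supp x")
    case True
    then have zl: "z \<in> line" using z by (simp add: F_space)
    show ?thesis using True zl c[OF ab True] lm_scl[OF rep_map[OF X ab] w[OF True]] by (auto simp: F_map)
  next
    case False
    then show ?thesis using lm_zero[OF rep_map[OF X ab]] by (auto simp: F_map zero_fun_apply[of 0])
  qed
qed

text \<open>\<open>left_sub X i v\<close> consists of the vectors at \<open>v\<close> that extend to a compatible family on \<open>i + 1, \<dots>, v\<close>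
  which, if the arrow between \<open>i\<close> and \<open>i + 1\<close> points to \<open>i\<close>, is mapped to 0 there.\<close>

primrec left_sub :: "(nat, 'k::field) rep \<Rightarrow> nat \<Rightarrow> nat \<Rightarrow> (nat \<Rightarrow> 'k) set" where
  "left_sub X i 0 = {0}"
| "left_sub X i (Suc v) =
    (if v = i then if i \<in> low then {y \<in> space_at X (Suc v). map_at X (Suc v, v) y = 0} else space_at X (Suc v)
     else if v \<in> up then map_at X (v, Suc v) ` left_sub X i v
     else {y \<in> space_at X (Suc v). map_at X (Suc v, v) y \<in> left_sub X i v})"

section \<open>Vectors that extend to the left, and functionals dual to them\<close>

context
  fixes X :: "(nat, 'k::field) rep"
  assumes X: "representation Q X"
begin

lemma sp_sub: "1 \<le> v \<Longrightarrow> v \<le> n + 2 \<Longrightarrow> seq.subspace (space_at X v)"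
  using X by (intro rep_sub) auto

lemma sp_fdim: "1 \<le> v \<Longrightarrow> v \<le> n + 2 \<Longrightarrow> fdim (space_at X v)"
  using X by (intro rep_fdim[of Q]) auto

lemma up_map: "v \<in> up \<Longrightarrow> map_at X (v, Suc v) \<in> linear_maps (space_at X v) (space_at X (Suc v))"
  by (rule rep_map[OF X]) (simp add: arr_iff)

lemma low_map: "v \<in> low \<Longrightarrow> map_at X (Suc v, v) \<in> linear_maps (space_at X (Suc v)) (space_at X v)"
  by (rule rep_map[OF X]) (simp add: arr_iff)

lemma up_or_low: "1 \<le> v \<Longrightarrow> v < n + 2 \<Longrightarrow> v \<in> up \<and> v \<notin> low \<or> v \<in> low \<and> v \<notin> up"
  using low_iff[of v] by auto

lemma left_sub_subspace:
  assumes "i < v" "v \<le> n + 2"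
  shows "seq.subspace (left_sub X i v) \<and> left_sub X i v \<subseteq> space_at X v"
  using assms
proof (induction v)
  case (Suc v)
  show ?case
  proof (cases "v = i")
    case True
    then show ?thesis using sp_sub[of "Suc v"] Suc.prems subspace_ker[OF low_map, of i] by auto
  next
    case False
    then have IH: "seq.subspace (left_sub X i v)" "left_sub X i v \<subseteq> space_at X v" and v: "1 \<le> v" "v < n + 2"
      using Suc by auto
    show ?thesis
    proof (cases "v \<in> up")
      case True
      note m = up_map[OF True]
      have "seq.subspace (map_at X (v, Suc v) ` left_sub X i v)"
      proof (rule subI)
        show "0 \<in> map_at X (v, Suc v) ` left_sub X i v" using sub_zero[OF IH(1)] lm_zero[OF m] by force
        fix y z assume "y \<in> map_at X (v, Suc v) ` left_sub X i v" "z \<in> map_at X (v, Suc v) ` left_sub X i v"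
        then obtain a b where ab: "a \<in> left_sub X i v" "b \<in> left_sub X i v" "y = map_at X (v, Suc v) a" "z = map_at X (v, Suc v) b" by blast
        then have "y + z = map_at X (v, Suc v) (a + b)" using lm_add[OF m, of a b] subsetD[OF IH(2)] by simp
        then show "y + z \<in> map_at X (v, Suc v) ` left_sub X i v" using sub_add[OF IH(1) ab(1,2)] by blast
      next
        fix c y assume "y \<in> map_at X (v, Suc v) ` left_sub X i v"
        then obtain a where ab: "a \<in> left_sub X i v" "y = map_at X (v, Suc v) a" by blast
        then have "vscale c y = map_at X (v, Suc v) (vscale c a)" using lm_scl[OF m, of a c] subsetD[OF IH(2)] by simp
        then show "vscale c y \<in> map_at X (v, Suc v) ` left_sub X i v" using sub_scl[OF IH(1) ab(1)] by blast
      qed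
      then show ?thesis using False True IH(2) lm_in[OF m] by auto
    next
      case nu: False
      then have m: "map_at X (Suc v, v) \<in> linear_maps (space_at X (Suc v)) (space_at X v)"
        using up_or_low[OF v] low_map by blast
      have sS: "seq.subspace (space_at X (Suc v))" using sp_sub v by auto
      have "seq.subspace {y \<in> space_at X (Suc v). map_at X (Suc v, v) y \<in> left_sub X i v}"
        by (rule subI) (auto simp: sub_zero[OF sS] sub_zero[OF IH(1)] lm_zero[OF m] sub_add[OF sS] sub_add[OF IH(1)]
          lm_add[OF m] lm_scl[OF m] sub_scl[OF sS] sub_scl[OF IH(1)])
      then show ?thesis using False nu by auto
    qed
  qed
qed simp

lemma left_sub_mono_step:
  assumes "left_sub X k v \<subseteq> left_sub X i v" "k < v" "i < v"
  shows "left_sub X k (Suc v) \<subseteq> left_sub X i (Suc v)"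
  using assms by auto

lemma left_sub_mono_from:
  assumes "left_sub X k u \<subseteq> left_sub X i u" "k < u" "i < u" "u \<le> v"
  shows "left_sub X k v \<subseteq> left_sub X i v"
  using assms(4,1-3)
proof (induction v rule: dec_induct)
  case (step v)
  then show ?case using left_sub_mono_step[of k v i] by simp
qed simp

text \<open>Advancing \<open>i\<close> in the left order restricts the extendable vectors. For a
  lower \<open>k > i\<close>, vectors killed by the arrow into \<open>k\<close> extend by zero
  further left; for an upper \<open>i > k\<close> there is no condition at \<open>i + 1\<close>.
  From there the inclusion propagates to the right.\<close>

lemma left_sub_antimono:
  assumes "lle i k" "i < v" "k < v" "v \<le> n + 2"
  shows "left_sub X k v \<subseteq> left_sub X i v"
  using assms(1) unfolding lle_def
proof (elim disjE conjE)
  assume c: "i < k" "k \<in> low"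
  have "left_sub X k (Suc k) \<subseteq> left_sub X i (Suc k)"
    using c disj[of k] sub_zero[OF conjunct1[OF left_sub_subspace[of i k]]] assms by auto
  then show ?thesis by (rule left_sub_mono_from) (use c assms in auto)
next
  assume c: "k < i" "i \<in> up"
  have "left_sub X k (Suc i) \<subseteq> left_sub X i (Suc i)"
    using c disj[of i] left_sub_subspace[of k "Suc i"] assms by auto
  then show ?thesis by (rule left_sub_mono_from) (use c assms in auto)
qed simp

text \<open>The witness is the nearest vertex to the left whose arrow points right, or 0: all arrows
  from there to \<open>v\<close> point left and merely transport the vector.\<close>

lemma left_sub_full: "1 \<le> v \<Longrightarrow> v \<le> n + 2 \<Longrightarrow> \<exists>i<v. left_sub X i v = space_at X v"
proof (induction v)
  case (Suc v)
  show ?case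
  proof (cases "v = 0 \<or> v \<in> up")
    case True
    then have "v \<notin> low" using disj lowD[of v] by auto
    then show ?thesis by (intro exI[of _ v]) simp
  next
    case False
    then obtain i where i: "i < v" "left_sub X i v = space_at X v" using Suc by auto
    have "v \<in> low" using False up_or_low[of v] Suc by auto
    then have "left_sub X i (Suc v) = space_at X (Suc v)" using i False lm_in[OF low_map] by auto
    then show ?thesis using i by (intro exI[of _ i]) auto
  qed
qed simp

lemma left_sub_family:
  assumes "y \<in> left_sub X i v" "i < v" "v \<le> n + 2"
  shows "\<exists>w. w v = y \<and> (\<forall>u. i < u \<and> u \<le> v \<longrightarrow> w u \<in> space_at X u) \<and>
    (\<forall>u. i < u \<and> u < v \<longrightarrow> (u \<in> up \<longrightarrow> map_at X (u, Suc u) (w u) = w (Suc u)) \<and>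
       (u \<in> low \<longrightarrow> map_at X (Suc u, u) (w (Suc u)) = w u)) \<and>
    (i \<in> low \<longrightarrow> map_at X (Suc i, i) (w (Suc i)) = 0)"
  using assms
proof (induction v arbitrary: y)
  case (Suc v)
  have y: "y \<in> space_at X (Suc v)" using left_sub_subspace[of i "Suc v"] Suc.prems by auto
  show ?case
  proof (cases "v = i")
    case True
    then show ?thesis using Suc.prems y by (intro exI[of _ "\<lambda>_. y"]) (auto simp: less_Suc_eq le_Suc_eq split: if_splits)
  next
    case False
    then have iv: "i < v" using Suc.prems by auto
    have "\<exists>z\<in>left_sub X i v. (v \<in> up \<longrightarrow> map_at X (v, Suc v) z = y) \<and> (v \<in> low \<longrightarrow> map_at X (Suc v, v) y = z)"
      using Suc.prems False disj[of v] up_or_low[of v] iv by (auto split: if_splits)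
    then obtain z where z: "z \<in> left_sub X i v" "v \<in> up \<longrightarrow> map_at X (v, Suc v) z = y" "v \<in> low \<longrightarrow> map_at X (Suc v, v) y = z" by blast
    obtain w where w: "w v = z" "\<forall>u. i < u \<and> u \<le> v \<longrightarrow> w u \<in> space_at X u"
      "\<forall>u. i < u \<and> u < v \<longrightarrow> (u \<in> up \<longrightarrow> map_at X (u, Suc u) (w u) = w (Suc u)) \<and>
         (u \<in> low \<longrightarrow> map_at X (Suc u, u) (w (Suc u)) = w u)"
      "i \<in> low \<longrightarrow> map_at X (Suc i, i) (w (Suc i)) = 0"
      using Suc.IH[OF z(1) iv] Suc.prems by auto
    show ?thesis
      by (rule exI[of _ "w(Suc v := y)"]) (use w z y iv in \<open>auto simp: less_Suc_eq le_Suc_eq\<close>)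
  qed
qed simp

text \<open>If this fails at \<open>v\<close>, an interval summand can end there: a nonzero vector
  dies under the arrow to the right, or some vector is not hit by the arrow from the right, or
  \<open>v\<close> is the last vertex and carries a nonzero vector.\<close>

definition trimmed :: "nat \<Rightarrow> bool" where
  "trimmed v \<longleftrightarrow> (v \<in> up \<longrightarrow> (\<forall>x\<in>space_at X v. map_at X (v, Suc v) x = 0 \<longrightarrow> x = 0)) \<and>
     (v \<in> low \<longrightarrow> map_at X (Suc v, v) ` space_at X (Suc v) = space_at X v) \<and>
     (v = n + 2 \<longrightarrow> space_at X v = {0})"

text \<open>If all vertices were trimmed, the spaces would vanish one after the other from
  \<open>n + 2\<close> downwards.\<close>

lemma first_untrimmed:
  assumes "v0 \<in> {1..n + 2}" "space_at X v0 \<noteq> {0}"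
  obtains j where "1 \<le> j" "j \<le> n + 2" "\<not> trimmed j" "\<And>v. 1 \<le> v \<Longrightarrow> v < j \<Longrightarrow> trimmed v"
proof -
  have "\<exists>j. 1 \<le> j \<and> j \<le> n + 2 \<and> \<not> trimmed j"
  proof (rule ccontr)
    assume "\<not> (\<exists>j. 1 \<le> j \<and> j \<le> n + 2 \<and> \<not> trimmed j)"
    then have t: "trimmed v" if "1 \<le> v" "v \<le> n + 2" for v using that by blast
    have "v0 \<le> n + 2" using assms by simp
    then have "space_at X v0 = {0}" using assms(1)
    proof (induction v0 rule: inc_induct)
      case base
      then show ?case using t[of "n + 2"] by (simp add: trimmed_def)
    next
      case (step v)
      then have z: "space_at X (Suc v) = {0}" by auto
      have v: "1 \<le> v" "v < n + 2" using step by auto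
      have zv: "0 \<in> space_at X v" using sub_zero[OF sp_sub] v by auto
      from up_or_low[OF v] show ?case
      proof
        assume u: "v \<in> up \<and> v \<notin> low"
        then have "map_at X (v, Suc v) x = 0" if "x \<in> space_at X v" for x
          using lm_in[OF up_map that] z by auto
        then show ?case using t[of v] v u zv by (auto simp: trimmed_def)
      next
        assume u: "v \<in> low \<and> v \<notin> up"
        then have "space_at X v = map_at X (Suc v, v) ` {0}" using t[of v] v z by (auto simp: trimmed_def)
        then show ?case using lm_zero[OF low_map] u by simp
      qed
    qed
    then show False using assms by simp
  qed
  then obtain j where "1 \<le> j \<and> j \<le> n + 2 \<and> \<not> trimmed j"
    "\<And>v. v < j \<Longrightarrow> \<not> (1 \<le> v \<and> v \<le> n + 2 \<and> \<not> trimmed v)"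
    using exists_least_iff[of "\<lambda>j. 1 \<le> j \<and> j \<le> n + 2 \<and> \<not> trimmed j"] by blast
  then show ?thesis using that[of j] by auto
qed

text \<open>The data for an interval ending at \<open>j\<close>. A functional with value 1 at
  \<open>x\<close> and 0 on \<open>W\<close> is to become a retraction, so \<open>W\<close> has to
  contain what comes in from the right and all \<open>left_sub X k j\<close> with \<open>k\<close>
  beyond \<open>i\<close> in the left order.\<close>

lemma summand_seed:
  assumes j: "1 \<le> j" "j \<le> n + 2" and nt: "\<not> trimmed j"
  obtains i x W where "i < j" "x \<in> left_sub X i j" "x \<notin> W" "seq.subspace W" "W \<subseteq> space_at X j"
    "\<And>k. k < j \<Longrightarrow> lle i k \<Longrightarrow> k \<noteq> i \<Longrightarrow> left_sub X k j \<subseteq> W"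
    "j \<in> up \<Longrightarrow> map_at X (j, Suc j) x = 0" "j \<in> low \<Longrightarrow> map_at X (Suc j, j) ` space_at X (Suc j) \<subseteq> W"
proof -
  obtain i0 where i0: "i0 < j" "left_sub X i0 j = space_at X j" using left_sub_full[OF j] by blast
  show ?thesis
  proof (cases "j \<in> low")
    case True
    define I where "I = map_at X (Suc j, j) ` space_at X (Suc j)"
    have jn: "j \<notin> up" "j \<noteq> n + 2" using True disj lowD[of j] by auto
    have sI: "seq.subspace I" "I \<subseteq> space_at X j" "I \<noteq> space_at X j"
      unfolding I_def using subspace_image[OF low_map[OF True] sp_sub] lm_in[OF low_map[OF True]] j lowD[OF True] nt jn True
      by (auto simp: trimmed_def)
    \<comment> \<open>With an arrow from \<open>j + 1\<close> to \<open>j\<close>, take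
      \<open>i\<close> maximal such that some vector of \<open>left_sub X i j\<close> is not hit
      from the right. By maximality the image \<open>I\<close> contains the later subspaces and
      serves as \<open>W\<close>.\<close>
    define P0 where "P0 k \<longleftrightarrow> k < j \<and> \<not> left_sub X k j \<subseteq> I" for k
    have "P0 i0" using i0 sI by (auto simp: P0_def)
    then obtain i where i: "P0 i" "\<And>k. P0 k \<Longrightarrow> lle i k \<Longrightarrow> k = i"
      using ex_lle_max[of P0 i0] j by (auto simp: P0_def)
    then obtain x where x: "x \<in> left_sub X i j" "x \<notin> I" "i < j" by (auto simp: P0_def)
    show ?thesis
      by (rule that[OF x(3,1,2) sI(1,2)]) (use i(2) jn in \<open>auto simp: P0_def I_def\<close>)
  next
    case False
    have "\<exists>x\<in>space_at X j. x \<noteq> 0 \<and> (j \<in> up \<longrightarrow> map_at X (j, Suc j) x = 0)"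
    proof (cases "j = n + 2")
      case True
      then have "j \<notin> up" using upD[of j] by auto
      then have "space_at X j \<noteq> {0}" using nt True False by (auto simp: trimmed_def)
      then show ?thesis using \<open>j \<notin> up\<close> sub_zero[OF sp_sub[OF j]] by blast
    qed (use nt False up_or_low[of j] j in \<open>auto simp: trimmed_def\<close>)
    then obtain x where x: "x \<in> space_at X j" "x \<noteq> 0" "j \<in> up \<longrightarrow> map_at X (j, Suc j) x = 0" by blast
    \<comment> \<open>Here \<open>x\<close> is a nonzero vector killed by the arrow to the right, if
      there is one, and \<open>i\<close> is maximal with \<open>x\<close> in
      \<open>left_sub X i j\<close>.\<close>
    define P0 where "P0 k \<longleftrightarrow> k < j \<and> x \<in> left_sub X k j" for k
    have "P0 i0" using i0 x by (auto simp: P0_def)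
    then obtain i where i: "P0 i" "\<And>k. P0 k \<Longrightarrow> lle i k \<Longrightarrow> k = i"
      using ex_lle_max[of P0 i0] j by (auto simp: P0_def)
    define P1 where "P1 k \<longleftrightarrow> k < j \<and> lle i k \<and> k \<noteq> i" for k
    have "\<exists>W. seq.subspace W \<and> W \<subseteq> space_at X j \<and> x \<notin> W \<and> (\<forall>k. P1 k \<longrightarrow> left_sub X k j \<subseteq> W)"
    proof (cases "\<exists>k. P1 k")
      case True
      then obtain k where "P1 k" by blast
      \<comment> \<open>The subspaces beyond \<open>i\<close> decrease, so the one at the least such
        \<open>k0\<close> contains all others and, by maximality of \<open>i\<close>, misses
        \<open>x\<close>.\<close>
      then obtain k0 where k0: "P1 k0" "\<And>k. P1 k \<Longrightarrow> lle k0 k"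
        using ex_lle_min[of P1 k] j by (auto simp: P1_def)
      have "x \<notin> left_sub X k0 j" using i(2)[of k0] k0(1) by (auto simp: P0_def P1_def)
      then show ?thesis using left_sub_subspace[of k0 j] left_sub_antimono[of k0 _ j] k0 j
        by (intro exI[of _ "left_sub X k0 j"]) (auto simp: P1_def)
    next
      case False
      then show ?thesis using x(2) sub_zero[OF sp_sub[OF j]] by (intro exI[of _ "{0}"]) (auto intro!: subI)
    qed
    then obtain W where "seq.subspace W" "W \<subseteq> space_at X j" "x \<notin> W" "\<And>k. P1 k \<Longrightarrow> left_sub X k j \<subseteq> W" by blast
    then show ?thesis using that[of i x W] i(1) x(3) False by (auto simp: P0_def P1_def)
  qed
qed

definition functional_on :: "(nat \<Rightarrow> 'k) set \<Rightarrow> ((nat \<Rightarrow> 'k) \<Rightarrow> 'k) \<Rightarrow> bool" where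
  "functional_on V l \<longleftrightarrow> (\<forall>y\<in>V. \<forall>z\<in>V. l (y + z) = l y + l z) \<and> (\<forall>a. \<forall>y\<in>V. l (vscale a y) = a * l y)"

text \<open>Surjectivity of the arrows pointing left is what allows to propagate a functional leftwards.\<close>

lemma dual_family:
  assumes j: "j \<le> n + 2" and i: "i < j" and tr: "\<And>v. 1 \<le> v \<Longrightarrow> v < j \<Longrightarrow> trimmed v"
    and l: "functional_on (space_at X j) l" "\<And>k y. k < j \<Longrightarrow> lle i k \<Longrightarrow> k \<noteq> i \<Longrightarrow> y \<in> left_sub X k j \<Longrightarrow> l y = 0"
    and v: "i < v" "v \<le> j"
  shows "\<exists>\<gamma>. \<gamma> j = l \<and> (\<forall>u. v \<le> u \<and> u \<le> j \<longrightarrow> functional_on (space_at X u) (\<gamma> u) \<and>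
      (\<forall>k y. k < u \<longrightarrow> lle i k \<longrightarrow> k \<noteq> i \<longrightarrow> y \<in> left_sub X k u \<longrightarrow> \<gamma> u y = 0)) \<and>
    (\<forall>u. v \<le> u \<and> u < j \<longrightarrow> (u \<in> up \<longrightarrow> (\<forall>y\<in>space_at X u. \<gamma> u y = \<gamma> (Suc u) (map_at X (u, Suc u) y))) \<and>
       (u \<in> low \<longrightarrow> (\<forall>y\<in>space_at X (Suc u). \<gamma> (Suc u) y = \<gamma> u (map_at X (Suc u, u) y))))"
  using v(2,1)
proof (induction v rule: inc_induct)
  case base
  show ?case using l by (intro exI[of _ "\<lambda>_. l"]) auto
next
  case (step v)
  then obtain \<gamma> where \<gamma>: "\<gamma> j = l"
    "\<And>u. Suc v \<le> u \<Longrightarrow> u \<le> j \<Longrightarrow> functional_on (space_at X u) (\<gamma> u)"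
    "\<And>u k y. Suc v \<le> u \<Longrightarrow> u \<le> j \<Longrightarrow> k < u \<Longrightarrow> lle i k \<Longrightarrow> k \<noteq> i \<Longrightarrow> y \<in> left_sub X k u \<Longrightarrow> \<gamma> u y = 0"
    "\<And>u y. Suc v \<le> u \<Longrightarrow> u < j \<Longrightarrow> u \<in> up \<Longrightarrow> y \<in> space_at X u \<Longrightarrow> \<gamma> u y = \<gamma> (Suc u) (map_at X (u, Suc u) y)"
    "\<And>u y. Suc v \<le> u \<Longrightarrow> u < j \<Longrightarrow> u \<in> low \<Longrightarrow> y \<in> space_at X (Suc u) \<Longrightarrow> \<gamma> (Suc u) y = \<gamma> u (map_at X (Suc u, u) y)"
    by auto
  have vb: "1 \<le> v" "v < n + 2" "i < v" "v < j" using step j by auto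
  let ?l = "\<gamma> (Suc v)"
  have fl: "functional_on (space_at X (Suc v)) ?l" using \<gamma>(2)[of "Suc v"] vb by auto
  have kl: "?l y = 0" if "k < Suc v" "lle i k" "k \<noteq> i" "y \<in> left_sub X k (Suc v)" for k y
    using \<gamma>(3)[of "Suc v" k y] vb that by auto
  have "\<exists>g. functional_on (space_at X v) g \<and> (\<forall>k y. k < v \<longrightarrow> lle i k \<longrightarrow> k \<noteq> i \<longrightarrow> y \<in> left_sub X k v \<longrightarrow> g y = 0) \<and>
     (v \<in> up \<longrightarrow> (\<forall>y\<in>space_at X v. g y = ?l (map_at X (v, Suc v) y))) \<and>
     (v \<in> low \<longrightarrow> (\<forall>y\<in>space_at X (Suc v). ?l y = g (map_at X (Suc v, v) y)))"
    using up_or_low[OF vb(1,2)]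
  proof
    assume u: "v \<in> up \<and> v \<notin> low"
    note m = up_map[of v]
    show ?thesis
    proof (rule exI[of _ "\<lambda>y. ?l (map_at X (v, Suc v) y)"], intro conjI allI impI)
      show "functional_on (space_at X v) (\<lambda>y. ?l (map_at X (v, Suc v) y))"
        using fl u lm_in[OF m] by (auto simp: functional_on_def lm_add[OF m] lm_scl[OF m])
      fix k y assume "k < v" "lle i k" "k \<noteq> i" "y \<in> left_sub X k v"
      then show "?l (map_at X (v, Suc v) y) = 0" using kl[of k "map_at X (v, Suc v) y"] u by auto
    qed (use u in auto)
  next
    assume u: "v \<in> low \<and> v \<notin> up"
    have m: "map_at X (Suc v, v) \<in> linear_maps (space_at X (Suc v)) (space_at X v)" using low_map u by blast
    have sS: "seq.subspace (space_at X (Suc v))" using sp_sub vb by auto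
    have surj: "map_at X (Suc v, v) ` space_at X (Suc v) = space_at X v" using tr[of v] vb u by (auto simp: trimmed_def)
    \<comment> \<open>Two preimages differ by a vector of \<open>left_sub X v (Suc v)\<close>, the
      kernel of the arrow. As \<open>v\<close> is lower and \<open>v > i\<close>, it lies beyond
      \<open>i\<close> in the left order, so the functional vanishes there and descends to the space
      at \<open>v\<close>.\<close>
    have wd: "?l y = ?l z" if "y \<in> space_at X (Suc v)" "z \<in> space_at X (Suc v)" "map_at X (Suc v, v) y = map_at X (Suc v, v) z" for y z
    proof -
      have d: "y - z \<in> space_at X (Suc v)" using sub_diff[OF sS] that by auto
      have "y - z \<in> left_sub X v (Suc v)" using u lm_diff[OF m sS that(1,2)] that(3) d by simp
      moreover have "lle i v" using u vb by (simp add: lle_def)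
      ultimately have "?l (y - z) = 0" using kl[of v "y - z"] vb by auto
      moreover have "?l y = ?l (z + (y - z))" by simp
      ultimately show ?thesis using fl that(2) d unfolding functional_on_def by (metis add.right_neutral)
    qed
    define g where "g y = ?l (SOME z. z \<in> space_at X (Suc v) \<and> map_at X (Suc v, v) z = y)" for y
    have g: "g (map_at X (Suc v, v) z) = ?l z" if "z \<in> space_at X (Suc v)" for z
    proof -
      have "\<exists>z'. z' \<in> space_at X (Suc v) \<and> map_at X (Suc v, v) z' = map_at X (Suc v, v) z" using that by blast
      from someI_ex[OF this] show ?thesis unfolding g_def using wd[OF _ that] by blast
    qed
    have ex: "\<exists>z\<in>space_at X (Suc v). y = map_at X (Suc v, v) z" if "y \<in> space_at X v" for y using surj that by auto
    show ?thesis
    proof (rule exI[of _ g], intro conjI allI impI ballI)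
      show "functional_on (space_at X v) g"
        unfolding functional_on_def
      proof (intro conjI allI ballI)
        fix y z assume "y \<in> space_at X v" "z \<in> space_at X v"
        then obtain y' z' where y': "y' \<in> space_at X (Suc v)" "y = map_at X (Suc v, v) y'" "z' \<in> space_at X (Suc v)" "z = map_at X (Suc v, v) z'"
          using ex by meson
        have "g (y + z) = ?l (y' + z')" using g[OF sub_add[OF sS y'(1,3)]] lm_add[OF m y'(1,3)] y' by simp
        then show "g (y + z) = g y + g z" using y' g fl by (simp add: functional_on_def)
      next
        fix a y assume "y \<in> space_at X v"
        then obtain y' where y': "y' \<in> space_at X (Suc v)" "y = map_at X (Suc v, v) y'" using ex by meson
        have "g (vscale a y) = ?l (vscale a y')" using g[OF sub_scl[OF sS y'(1)], of a] lm_scl[OF m y'(1), of a] y' by simp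
        then show "g (vscale a y) = a * g y" using y' g fl by (simp add: functional_on_def)
      qed
      fix k y assume k: "k < v" "lle i k" "k \<noteq> i" "y \<in> left_sub X k v"
      then have "y \<in> space_at X v" using left_sub_subspace[of k v] vb by auto
      then obtain z where z: "z \<in> space_at X (Suc v)" "y = map_at X (Suc v, v) z" using ex by meson
      then have "z \<in> left_sub X k (Suc v)" using k u by simp
      then show "g y = 0" using kl[of k z] k z g by simp
    qed (use u g in auto)
  qed
  then obtain g where g: "functional_on (space_at X v) g"
    "\<And>k y. k < v \<Longrightarrow> lle i k \<Longrightarrow> k \<noteq> i \<Longrightarrow> y \<in> left_sub X k v \<Longrightarrow> g y = 0"
    "v \<in> up \<Longrightarrow> (\<forall>y\<in>space_at X v. g y = ?l (map_at X (v, Suc v) y))"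
    "v \<in> low \<Longrightarrow> (\<forall>y\<in>space_at X (Suc v). ?l y = g (map_at X (Suc v, v) y))" by blast
  let ?\<gamma> = "\<gamma>(v := g)"
  show ?case
  proof (rule exI[of _ ?\<gamma>], intro conjI allI impI)
    show "?\<gamma> j = l" using \<gamma>(1) vb by simp
    fix u assume u: "v \<le> u \<and> u \<le> j"
    show "functional_on (space_at X u) (?\<gamma> u)" using u g(1) \<gamma>(2)[of u] by (cases "u = v") auto
    fix k y assume "k < u" "lle i k" "k \<noteq> i" "y \<in> left_sub X k u"
    then show "?\<gamma> u y = 0" using u g(2)[of k y] \<gamma>(3)[of u k y] by (cases "u = v") auto
  next
    fix u assume u: "v \<le> u \<and> u < j"
    { assume "u \<in> up"
      then show "\<forall>y\<in>space_at X u. ?\<gamma> u y = ?\<gamma> (Suc u) (map_at X (u, Suc u) y)"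
        using u g(3) \<gamma>(4)[of u] by (cases "u = v") auto }
    { assume "u \<in> low"
      then show "\<forall>y\<in>space_at X (Suc u). ?\<gamma> (Suc u) y = ?\<gamma> u (map_at X (Suc u, u) y)"
        using u g(4) \<gamma>(5)[of u] by (cases "u = v") auto }
  qed
qed

text \<open>The vector \<open>x\<close> spreads to a family giving \<open>f\<close>, the functional
  to a family giving \<open>g\<close>. The composite is a scalar by \<open>F_Hom\<close>, and at
  \<open>j\<close> this scalar is \<open>l x = 1\<close>.\<close>

lemma interval_summand:
  assumes "v0 \<in> {1..n + 2}" "space_at X v0 \<noteq> {0}"
  obtains x f g where "x \<in> S" "f \<in> Hom R (F x) X" "g \<in> Hom R X (F x)" "Comp R (F x) X (F x) g f = Ide R (F x)"
proof -
  obtain j where j: "1 \<le> j" "j \<le> n + 2" "\<not> trimmed j" and tr: "\<And>v. 1 \<le> v \<Longrightarrow> v < j \<Longrightarrow> trimmed v"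
    using first_untrimmed[OF assms] by blast
  obtain i x W where ix: "i < j" "x \<in> left_sub X i j" "x \<notin> W" "seq.subspace W" "W \<subseteq> space_at X j"
    and W: "\<And>k. k < j \<Longrightarrow> lle i k \<Longrightarrow> k \<noteq> i \<Longrightarrow> left_sub X k j \<subseteq> W"
    and x0: "j \<in> up \<Longrightarrow> map_at X (j, Suc j) x = 0" and WI: "j \<in> low \<Longrightarrow> map_at X (Suc j, j) ` space_at X (Suc j) \<subseteq> W"
    by (rule summand_seed[OF j]) blast
  let ?x = "(i, j)"
  have xS: "?x \<in> S" using ix j by (simp add: S_iff)
  have supp: "v \<in> supp ?x \<longleftrightarrow> i < v \<and> v \<le> j" for v by (auto simp: supp_def)
  have xj: "x \<in> space_at X j" using left_sub_subspace[OF ix(1) j(2)] ix(2) by blast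
  obtain w where w: "w j = x" "\<forall>u. i < u \<and> u \<le> j \<longrightarrow> w u \<in> space_at X u"
    "\<forall>u. i < u \<and> u < j \<longrightarrow> (u \<in> up \<longrightarrow> map_at X (u, Suc u) (w u) = w (Suc u)) \<and>
         (u \<in> low \<longrightarrow> map_at X (Suc u, u) (w (Suc u)) = w u)"
    "i \<in> low \<longrightarrow> map_at X (Suc i, i) (w (Suc i)) = 0"
    using left_sub_family[OF ix(2,1) j(2)] by blast
  obtain l where l: "l x = 1" "\<And>y. y \<in> W \<Longrightarrow> l y = 0" "functional_on (space_at X j) l"
    using separating_functional[OF sp_fdim[OF j(1,2)] ix(4,5) xj ix(3)] unfolding functional_on_def by metis
  have "\<exists>\<gamma>. \<gamma> j = l \<and> (\<forall>u. Suc i \<le> u \<and> u \<le> j \<longrightarrow> functional_on (space_at X u) (\<gamma> u) \<and>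
      (\<forall>k y. k < u \<longrightarrow> lle i k \<longrightarrow> k \<noteq> i \<longrightarrow> y \<in> left_sub X k u \<longrightarrow> \<gamma> u y = 0)) \<and>
    (\<forall>u. Suc i \<le> u \<and> u < j \<longrightarrow> (u \<in> up \<longrightarrow> (\<forall>y\<in>space_at X u. \<gamma> u y = \<gamma> (Suc u) (map_at X (u, Suc u) y))) \<and>
       (u \<in> low \<longrightarrow> (\<forall>y\<in>space_at X (Suc u). \<gamma> (Suc u) y = \<gamma> u (map_at X (Suc u, u) y))))"
    by (rule dual_family[OF j(2) ix(1) tr l(3)]) (use l(2) W ix(1) in auto)
  then obtain \<gamma> where \<gamma>: "\<gamma> j = l" "\<And>u. i < u \<Longrightarrow> u \<le> j \<Longrightarrow> functional_on (space_at X u) (\<gamma> u)"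
    "\<And>u k y. i < u \<Longrightarrow> u \<le> j \<Longrightarrow> k < u \<Longrightarrow> lle i k \<Longrightarrow> k \<noteq> i \<Longrightarrow> y \<in> left_sub X k u \<Longrightarrow> \<gamma> u y = 0"
    "\<And>u y. i < u \<Longrightarrow> u < j \<Longrightarrow> u \<in> up \<Longrightarrow> y \<in> space_at X u \<Longrightarrow> \<gamma> u y = \<gamma> (Suc u) (map_at X (u, Suc u) y)"
    "\<And>u y. i < u \<Longrightarrow> u < j \<Longrightarrow> u \<in> low \<Longrightarrow> y \<in> space_at X (Suc u) \<Longrightarrow> \<gamma> (Suc u) y = \<gamma> u (map_at X (Suc u, u) y)"
    by (auto simp: Suc_le_eq)
  define f where "f v c = (if v \<in> supp ?x \<and> c \<in> line then vscale (c 0) (w v) else 0)" for v and c :: "nat \<Rightarrow> 'k"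
  define g where "g v y = (if v \<in> supp ?x \<and> y \<in> space_at X v then vscale (\<gamma> v y) unit0 else 0)" for v y
  have wc: "map_at X (a, b) (w a) = (if b \<in> supp ?x then w b else 0)" if ab: "(a, b) \<in> arrs Q" and a: "a \<in> supp ?x" for a b
    using ab unfolding arr_iff
  proof
    assume u: "b = a + 1 \<and> a \<in> up"
    then show ?thesis using w(1,3) x0 a by (cases "a = j") (auto simp: supp)
  next
    assume u: "a = b + 1 \<and> b \<in> low"
    then show ?thesis using w(3,4) a by (cases "b = i") (auto simp: supp)
  qed
  have f: "f \<in> Hom R (F ?x) X"
    unfolding f_def by (rule family_Hom[OF X xS _ wc]) (use w(2) in \<open>auto simp: supp\<close>)
  have g: "g \<in> Hom R X (F ?x)"
  proof (rule rep_HomI)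
    fix v assume v: "v \<in> verts Q"
    then have sX: "seq.subspace (space_at X v)" using sp_sub by auto
    show "g v \<in> linear_maps (space_at X v) (space_at (F ?x) v)"
      by (rule lmI) (use \<gamma>(2)[of v] sX in \<open>auto simp: g_def F_space supp sub_add sub_scl vscale_add_scalar functional_on_def\<close>)
  next
    fix v assume "v \<notin> verts Q" then show "g v = 0" using supp_verts[OF xS, of v] by (auto simp: g_def fun_eq_iff zero_fun_apply)
  next
    fix a b y assume ab: "(a, b) \<in> arrs Q" and y: "y \<in> space_at X a"
    have yb: "map_at X (a, b) y \<in> space_at X b" using lm_in[OF rep_map[OF X ab] y] .
    show "g b (map_at X (a, b) y) = map_at (F ?x) (a, b) (g a y)"
    proof (cases "b \<in> supp ?x")
      case True
      show ?thesis
      proof (cases "a \<in> supp ?x")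
        case aS: True
        have "\<gamma> b (map_at X (a, b) y) = \<gamma> a y"
          using ab unfolding arr_iff
        proof
          assume u: "b = a + 1 \<and> a \<in> up"
          then show ?thesis using \<gamma>(4)[of a y] y True aS by (auto simp: supp)
        next
          assume u: "a = b + 1 \<and> b \<in> low"
          then show ?thesis using \<gamma>(5)[of b y] y True aS by (auto simp: supp)
        qed
        then show ?thesis using True aS y yb by (simp add: g_def F_map)
      next
        case aS: False
        have "\<gamma> b (map_at X (a, b) y) = 0"
          using ab unfolding arr_iff
        proof
          assume u: "b = a + 1 \<and> a \<in> up"
          then have a: "a = i" using True aS by (auto simp: supp)
          have a1: "1 \<le> a" "a \<le> n + 2" using u upD[of a] by auto
          \<comment> \<open>An arrow entering the support on the left starts at the upper vertex
            \<open>i\<close>. The whole space there is \<open>left_sub X k i\<close> for some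
            \<open>k < i\<close>, and this \<open>k\<close> lies beyond \<open>i\<close> in the left
            order, so the functional vanishes on the image.\<close>
          obtain k where k: "k < a" "left_sub X k a = space_at X a" using left_sub_full[OF a1] by blast
          have "map_at X (a, b) y \<in> left_sub X k b" using k u y by auto
          moreover have "lle i k" "k \<noteq> i" "k < b" using k a u by (auto simp: lle_def)
          ultimately show ?thesis using \<gamma>(3)[of b k "map_at X (a, b) y"] True by (simp add: supp)
        next
          assume u: "a = b + 1 \<and> b \<in> low"
          then have b: "b = j" using True aS by (auto simp: supp)
          \<comment> \<open>What enters on the right lies in \<open>W\<close>, where
            \<open>l\<close> vanishes.\<close>
          then have "map_at X (a, b) y \<in> W" using WI u y by auto
          then show ?thesis using l(2) b \<gamma>(1) by simp
        qed
        then show ?thesis using True aS y yb by (simp add: g_def F_map)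
      qed
    next
      case False
      then show ?thesis by (simp add: g_def F_map)
    qed
  qed
  have gf: "(\<lambda>v. g v \<circ> f v) \<in> Hom R (F ?x) (F ?x)"
    using R.comp_in[OF F_Obj _ F_Obj f g] X by simp
  obtain c where c: "(\<lambda>v. g v \<circ> f v) = (\<lambda>v z. vscale c (identity_on (supp ?x \<inter> supp ?x) v z))"
    using F_Hom(1)[OF xS xS gf] by blast
  have jS: "j \<in> supp ?x" using ix by (simp add: supp)
  have "g j (f j unit0) = unit0" using jS xj w(1) \<gamma>(1) l(1) by (simp add: f_def g_def)
  moreover have "g j (f j unit0) = vscale c unit0"
    using fun_cong[OF fun_cong[OF c, of j], of unit0] jS by (simp add: identity_on_def)
  ultimately have "vscale c unit0 0 = (unit0 0 :: 'k)" by simp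
  then have "c = 1" by (simp add: vscale_apply)
  then have "Comp R (F ?x) X (F ?x) g f = Ide R (F ?x)"
    using c unfolding F_ide[OF xS] by simp
  then show ?thesis using that[OF xS f g] by blast
qed

end

text \<open>Induction on the total dimension: an interval summand is split off, and the kernel of
  the retraction is a complement of smaller dimension.\<close>

theorem decomposition:
  fixes X :: "(nat, 'k::field) rep"
  assumes "representation Q X"
  shows "\<exists>xs \<iota> \<pi>. xs \<in> lists S \<and> is_dsum R (map F xs) X \<iota> \<pi>"
  using assms
proof (induction "\<Sum>v\<in>{1..n + 2}. seq.dim (space_at X v)" arbitrary: X rule: less_induct)
  case less
  note X = less.prems
  show ?case
  proof (cases "is_zero_object R X")
    case True
    then have "[] \<in> lists S \<and> is_dsum R (map F []) X (\<lambda>_. 0) (\<lambda>_. 0)" using R.dsum_Nil[OF True] by simp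
    then show ?thesis by blast
  next
    case False
    then obtain v0 where v0: "v0 \<in> {1..n + 2}" "space_at X v0 \<noteq> {0}" unfolding zero_rep_iff[OF X] verts_Q by blast
    obtain x f g where x: "x \<in> S" and f: "f \<in> Hom R (F x) X" and g: "g \<in> Hom R X (F x)"
      and gf: "Comp R (F x) X (F x) g f = Ide R (F x)"
      using interval_summand[OF X v0] by blast
    define T where "T = (\<lambda>v. {y \<in> space_at X v. g v y = 0})"
    note st = kernel_stable[OF X F_rep g, folded T_def]
    note K = subrep(1)[OF X st] and ker = kernel[OF X F_rep g, folded T_def]
    obtain q where q: "is_biproduct R (F x) (subrep X T) X f (incl T) g q"
      using R.split_mono_biproduct[OF F_Obj _ f g gf _ ker] X K by auto
    have sub: "seq.subspace (T v)" "T v \<subseteq> space_at X v" if "v \<in> {1..n + 2}" for v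
      using st that unfolding stable_def by auto
    have v1: "snd x \<in> supp x" using x by (auto simp: supp_def S_iff)
    define v1 where "v1 = snd x"
    note v1 = v1[folded v1_def]
    have v1Q: "v1 \<in> {1..n + 2}" using supp_verts[OF x v1] by simp
    \<comment> \<open>At the vertex \<open>v1\<close> of the support the complement misses the image
      of \<open>unit0\<close>, so its dimension drops there.\<close>
    have "T v1 \<noteq> space_at X v1"
    proof -
      have "f v1 unit0 \<in> space_at X v1" using lm_in[OF rep_lm[OF f], of v1 unit0] v1 v1Q by (simp add: F_space)
      moreover have "g v1 (f v1 unit0) = unit0"
        using fun_cong[OF fun_cong[OF gf[unfolded F_ide[OF x]], of v1], of unit0] v1 by (simp add: identity_on_def)
      then have "f v1 unit0 \<notin> T v1" by (simp add: T_def)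
      ultimately show ?thesis by auto
    qed
    then have "seq.dim (T v1) < seq.dim (space_at X v1)"
      using dim_strict_mono(2)[OF rep_fdim[OF X] sub] v1Q by simp
    then have "(\<Sum>v\<in>{1..n + 2}. seq.dim (space_at (subrep X T) v)) < (\<Sum>v\<in>{1..n + 2}. seq.dim (space_at X v))"
      using dim_strict_mono(1)[OF rep_fdim[OF X] sub] v1Q
      by (intro sum_strict_mono_ex1) (auto simp: subrep_def)
    from less.hyps[OF this K] obtain xs \<iota> \<pi> where xs: "xs \<in> lists S" "is_dsum R (map F xs) (subrep X T) \<iota> \<pi>" by blast
    have "map F xs \<in> lists (Obj R)" by (auto simp: in_lists_conv_set)
    from R.dsum_Cons[OF F_Obj _ _ this q xs(2)] show ?thesis
      using xs(1) x X K by (intro exI[of _ "x # xs"]) (auto simp del: rep_sel(3))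
  qed
qed

end

section \<open>The mesh category of the polygon\<close>

lemma (in lincat) full_subcategory_linear:
  assumes "T \<subseteq> Obj C"
  shows "linear_category (full_subcategory C T)"
proof -
  have [simp]: "Obj (full_subcategory C T) = T" "Hom (full_subcategory C T) = Hom C" "Ide (full_subcategory C T) = Ide C"
    "Comp (full_subcategory C T) = Comp C" "Add (full_subcategory C T) = Add C" "Zero (full_subcategory C T) = Zero C"
    "Scl (full_subcategory C T) = Scl C"
    by (simp_all add: full_subcategory_def)
  have o [simp]: "x \<in> T \<Longrightarrow> x \<in> Obj C" for x using assms by blast
  have "category (full_subcategory C T)"
    unfolding category_def by (simp add: comp_assoc)
  moreover have "hom_vector_space (full_subcategory C T) x y \<longleftrightarrow> hom_vector_space C x y" for x y
    unfolding hom_vector_space_def by simp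
  ultimately show ?thesis
    unfolding linear_category_def by (simp add: comp_add_left comp_add_right hvs)
qed

fun path_scalar :: "('v \<Rightarrow> 'v \<Rightarrow> 'k::field) \<Rightarrow> 'v list \<Rightarrow> 'k" where
  "path_scalar c (x # y # p) = c x y * path_scalar c (y # p)"
| "path_scalar c p = 1"

lemma path_scalar_append:
  "p \<noteq> [] \<Longrightarrow> q \<noteq> [] \<Longrightarrow> last p = hd q \<Longrightarrow> path_scalar c (p @ tl q) = path_scalar c p * path_scalar c q"
proof (induction c p rule: path_scalar.induct)
  case ("2_2" c v)
  then show ?case by (cases q) auto
qed auto

context dynkin
begin

abbreviation "\<Gamma> \<equiv> polygon_quiver n Q"
abbreviation "I \<equiv> mesh_ideal \<Gamma>"

sublocale PC: lin_ideal "path_category \<Gamma> :: ('k::field, nat \<times> nat, (nat \<times> nat) list \<Rightarrow>\<^sub>0 'k) lcat" "mesh_ideal \<Gamma>"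
  unfolding mesh_ideal_def by (rule lincat.lin_ideal_generated[OF lincat.intro[OF path_linear]])

abbreviation "paths_between \<equiv> paths \<Gamma>"

lemma path_S: "p \<in> paths_between x y \<Longrightarrow> x \<in> S \<and> y \<in> S"
  using paths_verts[of p \<Gamma>] by simp

text \<open>Each pivot raises \<open>rank\<close> by one; hence parallel paths have equal
  length.\<close>

lemma path_sle_rank: "p \<in> paths_between x y \<Longrightarrow> sle x y \<and> rank y + 1 = rank x + length p"
proof (induction p arbitrary: x)
  case Nil
  then show ?case by (auto dest: paths_ne)
next
  case (Cons a p)
  from Cons.prems show ?case
  proof (cases rule: paths_cases)
    case (2 z p')
    then show ?thesis using Cons.IH[of z] P_sle[of x z] rank_P[of x z] sle_trans[of x z y] by auto
  qed auto
qed

lemma path_between_linked: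
  assumes "x \<in> S" "y \<in> S" "linked x y"
  obtains p where "p \<in> paths_between x y"
proof -
  have "\<exists>p. p \<in> paths_between x y"
    using assms
  proof (induction "rank y - rank x" arbitrary: x rule: less_induct)
    case less
    show ?case
    proof (cases "x = y")
      case True
      then show ?thesis using paths_Nil[of x \<Gamma>] less.prems by auto
    next
      case False
      obtain w where w: "(x, w) \<in> P" "linked w y" using first_pivot less.prems False by blast
      have wS: "w \<in> S" using w by (simp add: P_iff)
      have "rank y - rank w < rank y - rank x"
        using rank_P[OF w(1)] rank_mono[OF linked_sle[OF w(2)]] by simp
      then obtain p where "p \<in> paths_between w y" using less.hyps[OF _ wS less.prems(2) w(2)] by blast
      then have "x # p \<in> paths_between x y" using paths_ConsI[of x \<Gamma> w p y] w less.prems by simp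
      then show ?thesis by blast
    qed
  qed
  then show ?thesis using that by blast
qed

section \<open>Proportional and vanishing paths modulo the mesh ideal\<close>

abbreviation sg :: "(nat \<times> nat) list \<Rightarrow> 'k::field \<Rightarrow> (nat \<times> nat) list \<Rightarrow>\<^sub>0 'k" where "sg \<equiv> Poly_Mapping.single"

lemma I_plus: "I x y f \<Longrightarrow> I x y g \<Longrightarrow> I x y (f + g :: _ \<Rightarrow>\<^sub>0 'k::field)"
  using PC.I_add[of x y f g] by simp

lemma I_scale: "I x y f \<Longrightarrow> I x y (Poly_Mapping.map ((*) (a::'k::field)) f)"
  using PC.I_scl[of x y f a] by simp

lemma I_null: "x \<in> S \<Longrightarrow> y \<in> S \<Longrightarrow> I x y (0 :: _ \<Rightarrow>\<^sub>0 'k::field)"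
  using PC.I_zero[of x y] by simp

lemma I_post: "I x y f \<Longrightarrow> q \<in> paths_between y z \<Longrightarrow> I x z (path_comp (sg q (1::'k::field)) f)"
  using PC.I_left[of x y f z "sg q 1"] path_S[of q y z] by (simp add: path_Comp)

lemma I_pre: "I y z f \<Longrightarrow> p \<in> paths_between x y \<Longrightarrow> I x z (path_comp f (sg p (1::'k::field)))"
  using PC.I_right[of y z f x "sg p 1"] path_S[of p x y] by (simp add: path_Comp)

text \<open>Proportionality of paths modulo the mesh ideal, with a nonzero factor. It is phrased
  with a sum because a mesh with two middle terms is a sum of two paths. The type argument names the
  field, which the paths do not determine.\<close>

definition path_rel :: "'k::field itself \<Rightarrow> nat \<times> nat \<Rightarrow> nat \<times> nat \<Rightarrow> (nat \<times> nat) list \<Rightarrow> (nat \<times> nat) list \<Rightarrow> bool" where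
  "path_rel _ x y p q \<longleftrightarrow> (\<exists>c::'k. c \<noteq> 0 \<and> I x y (sg p 1 + sg q c))"

abbreviation "null_path (_::'k::field itself) x y p \<equiv> I x y (sg p (1::'k))"

context
  fixes K :: "'k::field itself"
begin

lemma path_rel_refl: "p \<in> paths_between x y \<Longrightarrow> path_rel K x y p p"
  unfolding path_rel_def using I_null[of x y] path_S[of p x y]
  by (intro exI[of _ "- 1"]) (simp flip: single_add)

lemma path_rel_trans: "path_rel K x y p q \<Longrightarrow> path_rel K x y q w \<Longrightarrow> path_rel K x y p w"
proof -
  assume "path_rel K x y p q" "path_rel K x y q w"
  then obtain c d :: 'k where c: "c \<noteq> 0" "I x y (sg p 1 + sg q c)" and d: "d \<noteq> 0" "I x y (sg q 1 + sg w d)"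
    unfolding path_rel_def by blast
  have "(sg p 1 + sg q c) + Poly_Mapping.map ((*) (- c)) (sg q 1 + sg w d) = sg p 1 + (sg q c + sg q (- c)) + sg w (- c * d)"
    by (simp add: scale_add add.assoc)
  also have "\<dots> = sg p 1 + sg w (- c * d)" by (simp flip: single_add)
  finally have eq: "(sg p 1 + sg q c) + Poly_Mapping.map ((*) (- c)) (sg q 1 + sg w d) = sg p 1 + sg w (- c * d)" .
  have "I x y (sg p 1 + sg w (- c * d))"
    using I_plus[OF c(2) I_scale[OF d(2), of "- c"]] unfolding eq .
  moreover have "- c * d \<noteq> 0" using c(1) d(1) by simp
  ultimately show ?thesis unfolding path_rel_def by blast
qed

lemma path_rel_null: "path_rel K x y p q \<Longrightarrow> null_path K x y q \<Longrightarrow> null_path K x y p"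
proof -
  assume "path_rel K x y p q" and q: "null_path K x y q"
  then obtain c :: 'k where c: "c \<noteq> 0" "I x y (sg p 1 + sg q c)" unfolding path_rel_def by blast
  have eq: "(sg p 1 + sg q c) + Poly_Mapping.map ((*) (- c)) (sg q 1) = sg p 1"
    by (simp add: add.assoc flip: single_add)
  show ?thesis using I_plus[OF c(2) I_scale[OF q, of "- c"]] unfolding eq .
qed

lemma path_rel_pre: "path_rel K y z p q \<Longrightarrow> w \<in> paths_between x y \<Longrightarrow> path_rel K x z (w @ tl p) (w @ tl q)"
proof -
  assume "path_rel K y z p q" and w: "w \<in> paths_between x y"
  then obtain c :: 'k where c: "c \<noteq> 0" "I y z (sg p 1 + sg q c)" unfolding path_rel_def by blast
  show ?thesis unfolding path_rel_def using I_pre[OF c(2) w] c(1) by (auto simp: path_comp_add_left)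
qed

lemma path_rel_post: "path_rel K x y p q \<Longrightarrow> w \<in> paths_between y z \<Longrightarrow> path_rel K x z (p @ tl w) (q @ tl w)"
proof -
  assume "path_rel K x y p q" and w: "w \<in> paths_between y z"
  then obtain c :: 'k where c: "c \<noteq> 0" "I x y (sg p 1 + sg q c)" unfolding path_rel_def by blast
  show ?thesis unfolding path_rel_def using I_post[OF c(2) w] c(1) by (auto simp: path_comp_add_right)
qed

lemma null_pre: "null_path K y z p \<Longrightarrow> w \<in> paths_between x y \<Longrightarrow> null_path K x z (w @ tl p)"
  using I_pre[of y z "sg p 1" w x] by simp

lemma null_post: "null_path K x y p \<Longrightarrow> w \<in> paths_between y z \<Longrightarrow> null_path K x z (p @ tl w)"
  using I_post[of x y "sg p 1" w z] by simp

lemma path_rel_Cons: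
  assumes "path_rel K y z p q" "(x, y) \<in> P" "p \<in> paths_between y z" "q \<in> paths_between y z"
  shows "path_rel K x z (x # p) (x # q)"
proof -
  have "[x, y] \<in> paths_between x y" using assms(2) paths_ConsI[of x \<Gamma> y "[y]" y] paths_Nil[of y \<Gamma>] by (simp add: P_iff)
  from path_rel_pre[OF assms(1) this] show ?thesis
    using assms(3,4) paths_ne[OF assms(3)] paths_ne[OF assms(4)] by (cases p; cases q) (auto simp: paths_def)
qed

lemma mesh_relation_eq:
  assumes "t \<in> S" "x \<in> S" "x = (s (fst t), s (snd t))"
  shows "mesh_relation \<Gamma> t x = (\<Sum>y\<in>{(s (fst t), snd t), (fst t, s (snd t))} \<inter> S. sg [t, y, x] (1::'k))"
  unfolding mesh_relation_def polygon_sel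
  by (rule sum.cong) (use mesh_shape(1)[OF assms] in auto)

lemma mesh_in_ideal:
  assumes "t \<in> S" "x \<in> S" "x = (s (fst t), s (snd t))"
  shows "I t x (mesh_relation \<Gamma> t x :: _ \<Rightarrow>\<^sub>0 'k)"
proof -
  have "[t, y, x] \<in> paths_between t x" if "y \<in> {(s (fst t), snd t), (fst t, s (snd t))} \<inter> S" for y
    using mesh_shape(1,2)[OF assms, of y] that assms(1,2) paths_ConsI[of t \<Gamma> y "[y, x]" x] paths_ConsI[of y \<Gamma> x "[x]" x]
      paths_Nil[of x \<Gamma>] by (simp add: Int_iff)
  then have "(\<Sum>y\<in>{(s (fst t), snd t), (fst t, s (snd t))} \<inter> S. sg [t, y, x] (1::'k)) \<in> Hom (path_category \<Gamma>) t x"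
    by (induction rule: infinite_finite_induct[of _ "{(s (fst t), snd t), (fst t, s (snd t))} \<inter> S"])
      (auto simp: path_zero_in sum.Int_Diff intro!: path_add_in)
  then show ?thesis
    unfolding mesh_ideal_def mesh_relation_eq[OF assms]
    by (intro generated_ideal.gen) (use assms R_segment_iff[OF assms(2), of t] mesh_relation_eq[OF assms] in auto)
qed

lemma mesh_path:
  assumes "t \<in> S" "x \<in> S" "x = (s (fst t), s (snd t))" "(y, x) \<in> P"
  shows "[t, y, x] \<in> paths_between t x" "(t, y) \<in> P"
proof -
  show "(t, y) \<in> P" using assms(4) mesh_shape(1,2)[OF assms(1-3)] by blast
  then show "[t, y, x] \<in> paths_between t x"
    using assms paths_ConsI[of t \<Gamma> y "[y, x]" x] paths_ConsI[of y \<Gamma> x "[x]" x] paths_Nil[of x \<Gamma>] by (simp add: P_iff)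
qed

lemma mesh_rel:
  assumes "t \<in> S" "x \<in> S" "x = (s (fst t), s (snd t))" "(y, x) \<in> P" "(y', x) \<in> P" "y \<noteq> y'"
  shows "path_rel K t x [t, y, x] [t, y', x]"
proof -
  have "{(s (fst t), snd t), (fst t, s (snd t))} \<inter> S = {y, y'}"
    using mesh_shape(1)[OF assms(1-3)] assms(4-6) by auto
  then have "mesh_relation \<Gamma> t x = sg [t, y, x] (1::'k) + sg [t, y', x] 1"
    unfolding mesh_relation_eq[OF assms(1-3)] using assms(6) by simp
  then show ?thesis unfolding path_rel_def using mesh_in_ideal[OF assms(1-3)] by (metis one_neq_zero)
qed

lemma mesh_null:
  assumes "t \<in> S" "x \<in> S" "x = (s (fst t), s (snd t))" "(y, x) \<in> P" "\<And>y'. (y', x) \<in> P \<Longrightarrow> y' = y"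
  shows "null_path K t x [t, y, x]"
proof -
  have "{(s (fst t), snd t), (fst t, s (snd t))} \<inter> S = {y}"
    using mesh_shape(1)[OF assms(1-3)] assms(4,5) by blast
  then have "mesh_relation \<Gamma> t x = sg [t, y, x] (1::'k)"
    unfolding mesh_relation_eq[OF assms(1-3)] by simp
  then show ?thesis using mesh_in_ideal[OF assms(1-3)] by metis
qed

lemma linked_middle:
  assumes "linked x y" "sle x z" "sle z y" "x \<in> S" "y \<in> S" "z \<in> S"
  shows "linked x z" "linked z y"
  using rectangle[OF assms(4,5,1,2,3)] S_bounds[OF assms(6)] by auto

text \<open>Paths between linked segments stay inside a rectangle of segments all of whose meshes have two
  middle terms.\<close>

lemma linked_paths_rel:
  assumes "p \<in> paths_between x y" "q \<in> paths_between x y" "linked x y"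
  shows "path_rel K x y p q"
  using assms
proof (induction "length p" arbitrary: x p q rule: less_induct)
  case less
  note p = less.prems(1) and q = less.prems(2) and l = less.prems(3)
  have S: "x \<in> S" "y \<in> S" using path_S[OF p] by auto
  have len: "length p = length q" using path_sle_rank[OF p] path_sle_rank[OF q] by simp
  from p show ?case
  proof (cases rule: paths_cases)
    case 1
    then have "q = [x]" using len q by (cases q) (auto simp: paths_def)
    then show ?thesis using 1 path_rel_refl[OF p] by simp
  next
    case (2 x1 p')
    have p1: "(x, x1) \<in> P" "x1 \<in> S" using 2 by auto
    from q show ?thesis
    proof (cases rule: paths_cases)
      case 1
      then show ?thesis using len 2 paths_ne[OF 2(5)] by simp
    next
      case q2: (2 x2 q')
      have p2: "(x, x2) \<in> P" "x2 \<in> S" using q2 by auto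
      have s1: "sle x1 y" "sle x2 y" using path_sle_rank[OF 2(5)] path_sle_rank[OF q2(5)] by auto
      have l1: "linked x1 y" "linked x2 y"
        using linked_middle(2)[OF l _ s1(1) S p1(2)] linked_middle(2)[OF l _ s1(2) S p2(2)] P_sle p1 p2 by auto
      have lp: "length p' < length p" "length q' < length p" using 2 q2 len by auto
      show ?thesis
      proof (cases "x1 = x2")
        case True
        have "path_rel K x1 y p' q'" using less.hyps[OF lp(1) 2(5) _ l1(1)] q2(5) True by blast
        then show ?thesis using path_rel_Cons[OF _ p1(1) 2(5)] 2(1) q2(1,5) True by simp
      next
        case False
        \<comment> \<open>The two first pivots move different endpoints, and \<open>x3\<close> is
          reached by moving both. Each path is compared with one continuing through
          \<open>x3\<close>, and these two detours differ by the mesh from \<open>x\<close> to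
          \<open>x3\<close>.\<close>
        define x3 where "x3 = (s (fst x), s (snd x))"
        have c: "x1 = (s (fst x), snd x) \<and> x2 = (fst x, s (snd x)) \<or> x2 = (s (fst x), snd x) \<and> x1 = (fst x, s (snd x))"
          using p1 p2 False by (auto simp: P_iff prod_eq_iff)
        have "sle (s (fst x), snd x) y" "sle (fst x, s (snd x)) y" "(x, (s (fst x), snd x)) \<in> P" "(x, (fst x, s (snd x))) \<in> P"
          using c s1 p1 p2 by auto
        \<comment> \<open>If an endpoint of \<open>x\<close> already agreed with that of
          \<open>y\<close>, pivoting it would leave the segments below \<open>y\<close> in
          \<open>sle\<close>.\<close>
        then have "fst x \<noteq> fst y" "snd x \<noteq> snd y"
          using P_sle[of x "(s (fst x), snd x)"] P_sle[of x "(fst x, s (snd x))"] lle_antisym[of "fst x" "s (fst x)"] rle_antisym[of "snd x" "s (snd x)"]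
          by (auto simp: sle_def prod_eq_iff)
        then have x3: "x3 \<in> S" "linked x3 y" using first_pivot_cases(3)[OF S l] by (auto simp: x3_def)
        obtain rr where rr: "rr \<in> paths_between x3 y" using path_between_linked[OF x3(1) S(2) x3(2)] .
        have q13: "(x1, x3) \<in> P" "(x2, x3) \<in> P"
          using mesh_shape(1)[OF S(1) x3(1) x3_def] c p1 p2 by auto
        have r1: "x1 # rr \<in> paths_between x1 y" "x2 # rr \<in> paths_between x2 y"
          using paths_ConsI[OF _ _ rr] q13 p1 p2 by auto
        have lr: "length (x2 # rr) < length p" using path_sle_rank[OF r1(2)] path_sle_rank[OF q2(5)] lp by simp
        have a: "path_rel K x y p (x # x1 # rr)"
          using path_rel_Cons[OF less.hyps[OF lp(1) 2(5) r1(1) l1(1)] p1(1) 2(5) r1(1)] 2(1) by simp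
        have b: "path_rel K x y (x # x2 # rr) q"
          using path_rel_Cons[OF less.hyps[OF lr r1(2) q2(5) l1(2)] p2(1) r1(2) q2(5)] q2(1) by simp
        have rt: "x3 # tl rr = rr" using rr paths_ne[OF rr] by (cases rr) (auto simp: paths_def)
        have "path_rel K x y ([x, x1, x3] @ tl rr) ([x, x2, x3] @ tl rr)"
          by (rule path_rel_post[OF mesh_rel[OF S(1) x3(1) x3_def q13 False] rr])
        then have "path_rel K x y (x # x1 # rr) (x # x2 # rr)" using rt by simp
        then show ?thesis using path_rel_trans a b by blast
      qed
    qed
  qed
qed

text \<open>The rest of the path is rerouted over \<open>x1\<close>, \<open>w\<close>,
  \<open>z\<close>, \<open>y\<close>, and then its beginning from \<open>x\<close> to
  \<open>w\<close> is rerouted over \<open>u\<close>; both changes happen between linked segments.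
  The part from \<open>u\<close> over \<open>w\<close> to \<open>z\<close> is a mesh with a single
  middle term, hence zero.\<close>

lemma reroute_null:
  assumes x1: "(x, x1) \<in> P" "linked x1 y" "p' \<in> paths_between x1 y"
    and uwz: "u \<in> S" "(w, z) \<in> P" "z = (s (fst u), s (snd u))" "\<And>w'. (w', z) \<in> P \<Longrightarrow> w' = w"
    and l: "linked x u" "linked x w" "linked x1 w" "linked z y"
  shows "null_path K x y (x # p')"
proof -
  have S: "x \<in> S" "x1 \<in> S" "y \<in> S" "w \<in> S" "z \<in> S" using x1 uwz path_S[OF x1(3)] by (auto simp: P_iff)
  note m = mesh_path[OF uwz(1) S(5) uwz(3,2)]
  obtain \<alpha> where \<alpha>: "\<alpha> \<in> paths_between x1 w" using path_between_linked[OF S(2,4) l(3)] .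
  obtain \<beta> where \<beta>: "\<beta> \<in> paths_between z y" using path_between_linked[OF S(5,3) l(4)] .
  obtain \<delta> where \<delta>: "\<delta> \<in> paths_between x u" using path_between_linked[OF S(1) uwz(1) l(1)] .
  have wz: "[w, z] \<in> paths_between w z" using uwz(2) S paths_ConsI[of w \<Gamma> z "[z]" z] paths_Nil[of z \<Gamma>] by simp
  have uw: "[u, w] \<in> paths_between u w" using m(2) uwz(1) S paths_ConsI[of u \<Gamma> w "[w]" w] paths_Nil[of w \<Gamma>] by simp
  note wzy = paths_append[OF wz \<beta>]
  note 1 = linked_paths_rel[OF x1(3) paths_append[OF \<alpha> wzy] x1(2)]
  note xa = paths_ConsI[of x \<Gamma> x1 \<alpha> w]
  have xa: "x # \<alpha> \<in> paths_between x w" using paths_ConsI[of x \<Gamma> x1 \<alpha> w] x1 \<alpha> S by simp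
  have "path_rel K x w (x # \<alpha>) (\<delta> @ tl [u, w])" by (rule linked_paths_rel[OF xa paths_append[OF \<delta> uw] l(2)])
  then have 2: "path_rel K x y ((x # \<alpha>) @ tl ([w, z] @ tl \<beta>)) ((\<delta> @ tl [u, w]) @ tl ([w, z] @ tl \<beta>))"
    by (rule path_rel_post[OF _ wzy])
  have "null_path K u z [u, w, z]" by (rule mesh_null[OF uwz(1) S(5) uwz(3,2,4)])
  from null_post[OF null_pre[OF this \<delta>] \<beta>]
  have "null_path K x y ((\<delta> @ tl [u, w]) @ tl ([w, z] @ tl \<beta>))" by simp
  from path_rel_null[OF 2 this] have "null_path K x y (x # (\<alpha> @ tl ([w, z] @ tl \<beta>)))" by simp
  from path_rel_null[OF path_rel_Cons[OF 1 x1(1,3) paths_append[OF \<alpha> wzy]] this] show ?thesis .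
qed

text \<open>By induction it suffices to treat a first arrow that makes the segments linked. Then the
  intervals of \<open>x\<close> and \<open>y\<close> are adjacent, and their shared endpoint
  produces a mesh whose other middle term is degenerate.\<close>

lemma unlinked_path_null:
  assumes "p \<in> paths_between x y" "\<not> linked x y"
  shows "null_path K x y p"
  using assms
proof (induction p arbitrary: x)
  case Nil
  then show ?case by (auto dest: paths_ne)
next
  case (Cons a p)
  from Cons.prems(1) show ?case
  proof (cases rule: paths_cases)
    case 1
    then show ?thesis using Cons.prems linked_refl by simp
  next
    case (2 x1 p')
    then have p': "p' = p" "a = x" and p1: "(x, x1) \<in> P" "x1 \<in> S" "x \<in> S" and yS: "y \<in> S" using path_S[OF 2(5)] by auto
    show ?thesis
    proof (cases "linked x1 y")
      case False
      have "[x, x1] \<in> paths_between x x1" using p1 paths_ConsI[of x \<Gamma> x1 "[x1]" x1] paths_Nil[of x1 \<Gamma>] by simp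
      from null_pre[OF Cons.IH[OF _ False] this] show ?thesis
        using 2(5) p' paths_ne[OF 2(5)] by (cases p) (auto simp: paths_def)
    next
      case l1: True
      obtain i j where x: "x = (i, j)" by (cases x)
      obtain i' j' where y: "y = (i', j')" by (cases y)
      have b: "i < j" "j \<le> n + 2" "i' < j'" "j' \<le> n + 2" using p1 yS x y by (auto simp: S_iff)
      have sxy: "sle x y" using path_sle_rank[OF Cons.prems(1)] by simp
      then have sij: "lle i i'" "rle j j'" by (auto simp: sle_def x y)
      have nl: "j' \<le> i \<or> j \<le> i'" using Cons.prems(2) sxy by (auto simp: linked_def x y)
      have "x1 = (s i, j) \<or> x1 = (i, s j)" using p1 x by (auto simp: P_iff prod_eq_iff)
      then show ?thesis
      proof
        assume c: "x1 = (s i, j)"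
        have bl: "s i < j'" "i' < j" using l1 by (auto simp: linked_def c y)
        have ij': "j' \<le> i" using nl bl by auto
        have iu: "i \<in> up" using s_up[of i] vertex_cases(1)[of i] b ij' bl by fastforce
        have ju: "j' \<in> up" using sij(2) ij' b disj by (auto simp: rle_def)
        \<comment> \<open>\<open>j'\<close> is an upper vertex with \<open>s i < j' \<le> i\<close>,
          while all vertices strictly between \<open>s i\<close> and \<open>i\<close> are
          lower.\<close>
        have eq: "j' = i" using s_down[of i] iu ju ij' bl disj[of j'] by (metis le_neq_implies_less)
        \<comment> \<open>\<open>z\<close> is the corner between \<open>x1\<close> and
          \<open>y\<close> where only the right endpoint has moved. The last pivot into it also
          moves the right endpoint, since moving the left one would start from the degenerate pair
          \<open>(i, i)\<close>.\<close>
        define z where "z = (s i, j')"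
        have sz: "sle x1 z" "sle z y" using linked_sle[OF l1] sij by (auto simp: sle_def z_def c y)
        have zS: "z \<in> S" and lz: "linked x1 z" "linked z y"
          using rectangle[OF p1(2) yS l1 sz] bl b by (auto simp: z_def)
        have "x1 \<noteq> z" using b eq by (auto simp: c z_def)
        then obtain w where w: "(w, z) \<in> P" "linked x1 w" using last_pivot[OF p1(2) zS lz(1)] by blast
        have ws: "w = (s i, snd w) \<and> s (snd w) = j'"
        proof -
          have "z = (s (fst w), snd w) \<or> z = (fst w, s (snd w))" "w \<in> S" using w(1) by (auto simp: P_iff prod_eq_iff)
          then show ?thesis using s_inj[of "fst w" i] b eq by (auto simp: z_def S_iff prod_eq_iff)
        qed
        have fw: "fst w = s i" using ws by (metis fst_conv)
        \<comment> \<open>\<open>u\<close> undoes the left pivot of \<open>w\<close>, so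
          \<open>z\<close> arises from \<open>u\<close> by pivoting both endpoints; the other middle
          term would be \<open>(i, j')\<close> with \<open>j' = i\<close>.\<close>
        define u where "u = (i, snd w)"
        have wS: "w \<in> S" using w by (simp add: P_iff)
        \<comment> \<open>Otherwise \<open>s\<close> would move \<open>snd w\<close> to the right,
          hence onto the lower boundary or to \<open>n + 2\<close>, whereas \<open>j'\<close> is an
          upper vertex.\<close>
        have iw: "i < snd w"
        proof (rule ccontr)
          assume "\<not> i < snd w"
          then have "s (snd w) > snd w" "snd w \<noteq> i" using s_ne[of "snd w"] ws eq wS by (auto simp: S_iff)
          then have "snd w = 0 \<or> snd w \<in> low" using s_down[of "snd w"] vertex_cases(1)[of "snd w"] wS by (auto simp: S_iff)
          then show False using s_up[of "snd w"] ws ju disj[of j'] upD[of j'] by auto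
        qed
        have uS: "u \<in> S" using iw wS by (simp add: u_def S_iff)
        have jw: "rle j (snd w)" using linked_sle[OF w(2)] by (auto simp: sle_def c)
        have lu: "linked x u" using iw jw b by (auto simp: linked_def sle_def x u_def)
        have lw: "linked x w"
          using sle_trans[of x x1 w] P_sle[OF p1(1)] linked_sle[OF w(2)] iw fw ij' bl b by (auto simp: linked_def x)
        have zu: "z = (s (fst u), s (snd u))" using ws by (simp add: z_def u_def)
        have uniq: "w' = w" if "(w', z) \<in> P" for w'
          using that mesh_shape(1)[OF uS zS zu, of w'] ws eq by (auto simp: u_def S_iff)
        show ?thesis using reroute_null[OF p1(1) l1 2(5) uS w(1) zu uniq lu lw w(2) lz(2)] p' by simp
      next
        assume c: "x1 = (i, s j)"
        have bl: "i < j'" "i' < s j" using l1 by (auto simp: linked_def c y)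
        have ij': "j \<le> i'" using nl bl by auto
        have jl: "j \<in> low" using s_down[of j] vertex_cases(1)[of j] b ij' bl by fastforce
        have il: "i' \<in> low" using sij(1) ij' b disj by (auto simp: lle_def)
        \<comment> \<open>Mirror image of the first case: \<open>i'\<close> is a lower vertex with
          \<open>j \<le> i' < s j\<close>, while all vertices strictly between \<open>j\<close> and
          \<open>s j\<close> are upper.\<close>
        have eq: "i' = j" using s_up[of j] jl il ij' bl disj[of i'] by (metis le_neq_implies_less)
        define z where "z = (i', s j)"
        have sz: "sle x1 z" "sle z y" using linked_sle[OF l1] sij by (auto simp: sle_def z_def c y)
        have zS: "z \<in> S" and lz: "linked x1 z" "linked z y"
          using rectangle[OF p1(2) yS l1 sz] bl b s_le[of j] by (auto simp: z_def)
        have "x1 \<noteq> z" using b eq by (auto simp: c z_def)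
        then obtain w where w: "(w, z) \<in> P" "linked x1 w" using last_pivot[OF p1(2) zS lz(1)] by blast
        have wS: "w \<in> S" using w by (simp add: P_iff)
        have ws: "w = (fst w, s j) \<and> s (fst w) = i'"
        proof -
          have "z = (s (fst w), snd w) \<or> z = (fst w, s (snd w))" using w(1) by (auto simp: P_iff prod_eq_iff)
          then show ?thesis using s_inj[of "snd w" j] b eq wS by (auto simp: z_def S_iff prod_eq_iff)
        qed
        have fw: "snd w = s j" using ws by (metis snd_conv)
        define u where "u = (fst w, j)"
        have wj: "fst w < j"
        proof (rule ccontr)
          assume "\<not> fst w < j"
          then have "s (fst w) < fst w" using s_ne[of "fst w"] ws eq wS by (auto simp: S_iff)
          then have "fst w \<in> up" using s_up[of "fst w"] vertex_cases(1)[of "fst w"] wS by (auto simp: S_iff)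
          then show False using s_down[of "fst w"] ws il disj[of i'] lowD[of i'] by auto
        qed
        have uS: "u \<in> S" using wj b by (simp add: u_def S_iff)
        have jw: "lle i (fst w)" using linked_sle[OF w(2)] by (auto simp: sle_def c)
        have lu: "linked x u" using wj jw b by (auto simp: linked_def sle_def x u_def)
        have lw: "linked x w"
          using sle_trans[of x x1 w] P_sle[OF p1(1)] linked_sle[OF w(2)] wj fw ij' bl b by (auto simp: linked_def x)
        have zu: "z = (s (fst u), s (snd u))" using ws by (simp add: z_def u_def)
        have uniq: "w' = w" if "(w', z) \<in> P" for w'
          using that mesh_shape(1)[OF uS zS zu, of w'] ws eq by (auto simp: u_def S_iff)
        show ?thesis using reroute_null[OF p1(1) l1 2(5) uS w(1) zu uniq lu lw w(2) lz(2)] p' by simp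
      qed
    qed
  qed
qed

end

lemma I_single: "I x y (sg p (1::'k::field)) \<Longrightarrow> I x y (sg p (a::'k))"
  using I_scale[of x y "sg p 1" a] by simp

text \<open>All paths between linked segments are proportional to \<open>p0\<close>, so its class
  spans the hom-space of the mesh category.\<close>

lemma Hom_linked_normal_form:
  fixes f :: "(nat \<times> nat) list \<Rightarrow>\<^sub>0 'k::field"
  assumes p0: "p0 \<in> paths_between x y" and l: "linked x y" and f: "f \<in> Hom (path_category \<Gamma>) x y"
  shows "\<exists>a. I x y (f + sg p0 a)"
  using f
proof (induction f rule: path_Hom_induct)
  case zero
  then show ?case using I_null[of x y] path_S[OF p0] by (intro exI[of _ 0]) simp
next
  case (single p a)
  obtain c :: 'k where "I x y (sg p 1 + sg p0 c)"
    using linked_paths_rel[OF single p0 l, of "TYPE('k)"] unfolding path_rel_def by blast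
  from I_scale[OF this, of a] show ?case by (auto simp: scale_add)
next
  case (add f g)
  then obtain a b where "I x y (f + sg p0 a)" "I x y (g + sg p0 b)" by blast
  from I_plus[OF this] have "I x y (f + g + sg p0 (a + b))" by (simp add: single_add algebra_simps)
  then show ?case by blast
qed

lemma Hom_unlinked_null:
  fixes f :: "(nat \<times> nat) list \<Rightarrow>\<^sub>0 'k::field"
  assumes "x \<in> S" "y \<in> S" "\<not> linked x y" "f \<in> Hom (path_category \<Gamma>) x y"
  shows "I x y f"
  using assms(4)
proof (induction f rule: path_Hom_induct)
  case (single p a)
  then show ?case using unlinked_path_null[OF single assms(3)] I_single by blast
next
  case zero
  show ?case by (rule I_null[OF assms(1,2)])
next
  case (add f g)
  then show ?case by (rule I_plus)
qed

section \<open>The functor\<close>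

abbreviation "PolC \<equiv> polygon_category n Q"
abbreviation "IndC \<equiv> ind_category n Q"

lemma PolC_eq: "PolC = quotient_category (path_category \<Gamma>) I"
  by (simp add: polygon_category_def mesh_category_def)

lemma ind_sel [simp]: "Obj IndC = ind_objects n" "Hom IndC = Hom R" "Ide IndC = Ide R" "Comp IndC = Comp R"
    "Add IndC = Add R" "Zero IndC = Zero R" "Scl IndC = Scl R"
  by (simp_all add: ind_category_def full_subcategory_def)

lemma ind_rep: "X \<in> ind_objects n \<Longrightarrow> representation Q (X :: (nat, 'k::field) rep)"
  unfolding F_image[symmetric] by auto

lemma Ind_linear: "linear_category (IndC :: ('k::field, _, _) lcat)"
  unfolding ind_category_def by (rule R.full_subcategory_linear) (use ind_rep in auto)

lemma F_in_ind: "x \<in> S \<Longrightarrow> F x \<in> (ind_objects n :: (nat, 'k::field) rep set)"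
  unfolding F_image[symmetric] by blast

lemma scaled_identity_comp:
  "(\<lambda>v. (\<lambda>z. vscale b (identity_on B v z)) \<circ> (\<lambda>z. vscale a (identity_on A v z)))
    = (\<lambda>v z. vscale (b * a) (identity_on (A \<inter> B) v z) :: nat \<Rightarrow> 'k::field)"
  by (auto simp: identity_on_def fun_eq_iff)

lemma scaled_identity_Hom:
  assumes "x \<in> S" "y \<in> S" "sle x y"
  shows "(\<lambda>v z. vscale a (identity_on (supp x \<inter> supp y) v z)) \<in> Hom R (F x) (F y)"
  using R.scl_in[OF F_Obj F_Obj identity_on_Hom[of x y]] assms by (simp add: S_iff)

text \<open>Only pivots of the left endpoint carry a sign. The two such pivots in a mesh have right
  endpoints \<open>snd t\<close> and \<open>s (snd t)\<close>, whose ranks differ by one, so the two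
  paths around the mesh get opposite signs.\<close>

definition mesh_sign :: "nat \<times> nat \<Rightarrow> nat \<times> nat \<Rightarrow> 'k::field" where
  "mesh_sign x y = (if snd x = snd y then (- 1) ^ rrank (snd x) else 1)"

lemma mesh_sign: "mesh_sign x y \<in> {1, - 1}"
  by (cases "even (rrank (snd x))") (auto simp: mesh_sign_def)

lemma mesh_sign_nonzero [simp]: "mesh_sign x y \<noteq> 0"
  by (simp add: mesh_sign_def)

text \<open>A path goes to a signed canonical map between its ends; \<open>supp_between\<close>
  makes this multiplicative.\<close>

lemma functor_on_path_category:
  obtains Em where "linfun (path_category \<Gamma>) (IndC :: ('k::field, _, _) lcat) F Em"
    "\<And>x y p a. p \<in> paths_between x y \<Longrightarrow>
       Em x y (sg p a) = (\<lambda>v z. vscale (a * path_scalar mesh_sign p) (identity_on (supp x \<inter> supp y) v z))"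
proof -
  define E :: "(nat \<times> nat) list \<Rightarrow> (nat, 'k) rep_mor" where
    "E p = (\<lambda>v z. vscale (path_scalar mesh_sign p) (identity_on (supp (hd p) \<inter> supp (last p)) v z))" for p
  have E: "E p = (\<lambda>v z. vscale (path_scalar mesh_sign p) (identity_on (supp x \<inter> supp y) v z))" if "p \<in> paths_between x y" for p x y
    using that by (simp add: E_def paths_def)
  have E_comp: "E (p @ tl q) = Comp IndC (F x) (F y) (F z) (E q) (E p)"
    if p: "p \<in> paths_between x y" and q: "q \<in> paths_between y z" for x y z p q
  proof -
    have "supp x \<inter> supp y \<inter> (supp y \<inter> supp z) = supp x \<inter> supp z"
      using supp_between[of x y z] path_sle_rank[OF p] path_sle_rank[OF q] by auto
    moreover have "path_scalar mesh_sign (p @ tl q) = path_scalar mesh_sign p * (path_scalar mesh_sign q :: 'k)"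
      using path_scalar_append[of p q] p q paths_ne[OF p] paths_ne[OF q] by (simp add: paths_def)
    ultimately show ?thesis
      unfolding E[OF p] E[OF q] E[OF paths_append[OF p q]] ind_sel rep_sel scaled_identity_comp by (simp add: mult.commute)
  qed
  obtain Em where Em: "linfun (path_category \<Gamma>) (IndC :: ('k, _, _) lcat) F Em"
    "\<And>x y p a. p \<in> paths_between x y \<Longrightarrow> Em x y (sg p a) = Scl IndC (F x) (F y) a (E p)"
  proof (rule functor_on_paths[where D = "IndC :: ('k, _, _) lcat" and \<Gamma> = \<Gamma> and Fo = F and E = E])
    show "linear_category (IndC :: ('k, _, _) lcat)" by (rule Ind_linear)
    show "E [x] = Ide IndC (F x)" if "x \<in> verts \<Gamma>" for x
      using that unfolding E_def ind_sel by (simp add: F_ide del: rep_sel(2))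
    show "E p \<in> Hom IndC (F x) (F y)" if "p \<in> paths_between x y" for x y p
      unfolding E[OF that] ind_sel using scaled_identity_Hom path_S[OF that] path_sle_rank[OF that] by blast
  qed (use F_in_ind E_comp in auto)
  show ?thesis
  proof (rule that[OF Em(1)])
    fix x y p a assume "p \<in> paths_between x y"
    then show "Em x y (sg p a) = (\<lambda>v z. vscale (a * path_scalar mesh_sign p) (identity_on (supp x \<inter> supp y) v z))"
      using Em(2)[of p x y a] E[of p x y] by (simp add: fun_eq_iff)
  qed
qed

lemma mesh_arrow_eq: "mesh_arrow \<Gamma> x y = PC.coset x y (sg [x, y] (1::'k::field))"
  by (simp add: mesh_arrow_def)

lemma P_path: "(x, y) \<in> P \<Longrightarrow> [x, y] \<in> paths_between x y"
  using paths_ConsI[of x \<Gamma> y "[y]" y] paths_Nil[of y \<Gamma>] by (simp add: P_iff)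

lemma hook_functor_exists:
  "\<exists>(c :: nat \<times> nat \<Rightarrow> nat \<times> nat \<Rightarrow> 'k::field) Fm. (\<forall>x y. c x y \<in> {1, - 1}) \<and> hook_functor n Q c Fm"
proof -
  obtain Em where Em: "linfun (path_category \<Gamma>) (IndC :: ('k, _, _) lcat) F Em"
    and Ep: "\<And>x y p a. p \<in> paths_between x y \<Longrightarrow>
       Em x y (sg p a) = (\<lambda>v z. vscale (a * path_scalar mesh_sign p) (identity_on (supp x \<inter> supp y) v z))"
    using functor_on_path_category by blast
  interpret E: linfun "path_category \<Gamma>" "IndC :: ('k, _, _) lcat" F Em by (rule Em)
  have mesh0: "Em t x (mesh_relation \<Gamma> t x) = 0"
    if t: "t \<in> S" "x \<in> S" "x = (s (fst t), s (snd t))" for t x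
  proof -
    let ?y1 = "(s (fst t), snd t)" and ?y2 = "(fst t, s (snd t))"
    note ms = mesh_shape[OF t]
    have p: "[t, y, x] \<in> paths_between t x" if "y = ?y1 \<or> y = ?y2" "y \<in> S" for y
      using mesh_path[OF t, of y] ms(1)[of y] that by blast
    have ne: "s (snd t) \<noteq> snd t" using s_ne[of "snd t"] t by (auto simp: S_iff)
    show ?thesis
    proof (cases "?y1 \<in> S \<and> ?y2 \<in> S")
      case True
      then have "mesh_relation \<Gamma> t x = sg [t, ?y1, x] (1::'k) + sg [t, ?y2, x] 1"
        unfolding mesh_relation_eq[OF t] using ms(3) by simp
      then have "Em t x (mesh_relation \<Gamma> t x) = Em t x (sg [t, ?y1, x] 1) + Em t x (sg [t, ?y2, x] 1)"
        using E.Fm_add[of t x "sg [t, ?y1, x] 1" "sg [t, ?y2, x] 1"] p True t by simp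
      moreover have "path_scalar mesh_sign [t, ?y1, x] = (- 1 :: 'k) ^ rrank (snd t)"
        using t(3) ne by (simp add: mesh_sign_def)
      moreover have "path_scalar mesh_sign [t, ?y2, x] = - ((- 1 :: 'k) ^ rrank (snd t))"
        using t ne rrank_s[of "snd t"] by (simp add: mesh_sign_def S_iff)
      ultimately show ?thesis using Ep[OF p] True by (simp add: fun_eq_iff fun_ext vscale_apply)
    next
      case False
      \<comment> \<open>A missing middle term means that the supports of \<open>t\<close> and
        \<open>x\<close> are disjoint, so the one remaining path goes to zero.\<close>
      then have e: "supp t \<inter> supp x = {}" using t by (auto simp: supp_def S_iff)
      have z: "Em t x (sg [t, y, x] 1) = 0" if "y = ?y1 \<or> y = ?y2" "y \<in> S" for y
        using Ep[OF p[OF that], of 1] e by (simp add: fun_eq_iff fun_ext)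
      have "mesh_relation \<Gamma> t x = sg [t, ?y1, x] (1::'k) \<and> ?y1 \<in> S \<or> mesh_relation \<Gamma> t x = sg [t, ?y2, x] (1::'k) \<and> ?y2 \<in> S"
        unfolding mesh_relation_eq[OF t] using ms(4) False by (auto simp: Int_insert_left)
      then show ?thesis using z by auto
    qed
  qed
  have van: "\<forall>x y f. I x y f \<longrightarrow> Em x y f = Zero IndC (F x) (F y)"
  proof (intro allI impI)
    fix x y and f :: "(nat \<times> nat) list \<Rightarrow>\<^sub>0 'k" assume "I x y f"
    then show "Em x y f = Zero IndC (F x) (F y)"
      unfolding mesh_ideal_def
  proof (rule E.generated_ideal_vanishes)
    fix t x and f :: "(nat \<times> nat) list \<Rightarrow>\<^sub>0 'k" assume "t \<in> Obj (path_category \<Gamma>)" "x \<in> Obj (path_category \<Gamma>)"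
      "f \<in> (if transl \<Gamma> x = Some t then {mesh_relation \<Gamma> t x} else {})"
    then show "Em t x f = Zero IndC (F t) (F x)"
      using mesh0[of t x] R_segment_iff[of x t] by (auto split: if_splits)
  qed
  qed
  obtain Fm where Fm: "linear_functor (quotient_category (path_category \<Gamma>) I) (IndC :: ('k, _, _) lcat) F Fm"
    "\<forall>x\<in>Obj (path_category \<Gamma> :: ('k, _, _ \<Rightarrow>\<^sub>0 'k) lcat). \<forall>y\<in>Obj (path_category \<Gamma> :: ('k, _, _ \<Rightarrow>\<^sub>0 'k) lcat).
       \<forall>f\<in>Hom (path_category \<Gamma>) x y. Fm x y (PC.coset x y f) = Em x y f"
    using PC.functor_on_quotient[OF Em van] by (elim exE conjE)
  have "hook_functor n Q mesh_sign Fm"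
    unfolding hook_functor_def
  proof (intro conjI ballI)
    show "linear_functor PolC IndC F Fm" unfolding PolC_eq by (rule Fm(1))
    fix xy assume "xy \<in> P"
    then obtain x y where xy: "xy = (x, y)" and p: "(x, y) \<in> P" by (cases xy) auto
    then have S: "x \<in> S" "y \<in> S" by (auto simp: P_iff)
    have "Fm x y (mesh_arrow \<Gamma> x y) = Scl IndC (F x) (F y) (mesh_sign x y) (identity_on (supp x \<inter> supp y))"
      unfolding mesh_arrow_eq using Fm(2)[rule_format, of x y "sg [x, y] 1"] S Ep[OF P_path[OF p], of 1] P_path[OF p] by simp
    then show "case xy of (x, y) \<Rightarrow> mesh_sign x y \<noteq> (0::'k) \<and> (\<exists>\<phi>. pivot_morphism n Q x y \<phi> \<and>
        Fm x y (mesh_arrow \<Gamma> x y) = Scl IndC (F x) (F y) (mesh_sign x y) \<phi>)"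
      using pivot_morphism_exists[OF p] mesh_sign[of x y] unfolding xy prod.case by auto
  qed
  then show ?thesis using mesh_sign by blast
qed

section \<open>Full faithfulness of an arbitrary hook functor\<close>

context
  fixes c :: "nat \<times> nat \<Rightarrow> nat \<times> nat \<Rightarrow> 'k::field" and Fm
  assumes hook: "hook_functor n Q c Fm"
begin

lemma hook_linfun: "linfun PolC IndC F Fm"
  using hook by (intro linfun.intro) (auto simp: hook_functor_def)

lemma c_nonzero: "(x, y) \<in> P \<Longrightarrow> c x y \<noteq> 0"
  using hook by (auto simp: hook_functor_def)

lemma hook_arrow:
  "(x, y) \<in> P \<Longrightarrow> Fm x y (mesh_arrow \<Gamma> x y) = (\<lambda>v z. vscale (c x y) (identity_on (supp x \<inter> supp y) v z))"
  using hook pivot_morphism_unique[of x y] unfolding hook_functor_def by fastforce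

lemma PolC_Obj: "Obj (PolC :: ('k, _, _) lcat) = S"
  unfolding PolC_eq by simp

text \<open>Whatever the nonzero scalars \<open>c\<close>, a path goes to a nonzero multiple of the
  canonical map; full faithfulness rests on this.\<close>

lemma hook_path:
  "p \<in> paths_between x y \<Longrightarrow> Fm x y (PC.coset x y (sg p 1)) = (\<lambda>v z. vscale (path_scalar c p) (identity_on (supp x \<inter> supp y) v z))
     \<and> path_scalar c p \<noteq> 0"
proof (induction p arbitrary: x)
  case Nil
  then show ?case by (auto dest: paths_ne)
next
  case (Cons a p)
  interpret L: linfun PolC IndC F Fm by (rule hook_linfun)
  from Cons.prems show ?case
  proof (cases rule: paths_cases)
    case 1
    then have xS: "x \<in> S" by simp
    have "Fm x x (Ide PolC x) = Ide R (F x)" using L.Fm_ide[of x] xS by (simp add: PolC_Obj del: rep_sel(2))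
    then show ?thesis using 1 F_ide[OF xS] by (simp add: PolC_eq)
  next
    case (2 x1 p')
    then have p': "p' = p" "a = x" and p1: "(x, x1) \<in> P" and p: "p \<in> paths_between x1 y" by auto
    have S: "x \<in> S" "x1 \<in> S" "y \<in> S" using p1 path_S[OF p] by (auto simp: P_iff)
    obtain p'' where pp: "p = x1 # p''" using p paths_ne[OF p] by (cases p) (auto simp: paths_def)
    have "PC.coset x y (sg (x # p) 1) = Comp PolC x x1 y (PC.coset x1 y (sg p 1)) (PC.coset x x1 (sg [x, x1] (1::'k)))"
      unfolding PolC_eq using PC.quot_Comp[of x x1 y "sg [x, x1] 1" "sg p 1"] S P_path[OF p1] p pp by (simp add: path_Comp)
    then have "Fm x y (PC.coset x y (sg (x # p) 1)) = Comp IndC (F x) (F x1) (F y) (Fm x1 y (PC.coset x1 y (sg p 1))) (Fm x x1 (PC.coset x x1 (sg [x, x1] (1::'k))))"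
      using L.Fm_comp[of x x1 y "PC.coset x x1 (sg [x, x1] (1::'k))" "PC.coset x1 y (sg p 1)"] S P_path[OF p1] p
      by (simp add: PolC_Obj PolC_eq)
    also have "\<dots> = (\<lambda>v z. vscale (path_scalar c (x # p)) (identity_on (supp x \<inter> supp x1 \<inter> (supp x1 \<inter> supp y)) v z))"
      using Cons.IH[OF p] hook_arrow[OF p1] unfolding mesh_arrow_eq
      by (simp add: scaled_identity_comp[unfolded comp_def] comp_def pp mult.commute)
    also have "supp x \<inter> supp x1 \<inter> (supp x1 \<inter> supp y) = supp x \<inter> supp y"
      using supp_between[of x x1 y] P_sle[OF p1] path_sle_rank[OF p] by auto
    finally show ?thesis using p' Cons.IH[OF p] c_nonzero[OF p1] pp by simp
  qed
qed

text \<open>Between linked segments both hom-spaces are lines: one is spanned by a path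
  \<open>p0\<close>, the other by the canonical map, and \<open>p0\<close> goes to a nonzero
  multiple of it. Between other segments both are zero.\<close>

lemma hook_fully_faithful: "fully_faithful PolC IndC F Fm"
  unfolding fully_faithful_def PolC_Obj
proof (intro ballI)
  interpret L: linfun PolC IndC F Fm by (rule hook_linfun)
  fix x y assume S: "x \<in> S" "y \<in> S"
  have HomP: "Hom PolC x y = PC.coset x y ` Hom (path_category \<Gamma> :: ('k, _, _) lcat) x y"
    unfolding PolC_eq by (rule PC.quot_Hom)
  let ?id = "identity_on (supp x \<inter> supp y) :: (nat, 'k) rep_mor"
  show "bij_betw (Fm x y) (Hom PolC x y) (Hom IndC (F x) (F y))"
  proof (cases "linked x y")
    case True
    obtain p0 where p0: "p0 \<in> paths_between x y" using path_between_linked[OF S True] .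
    define u where "u = path_scalar c p0"
    have u: "u \<noteq> 0" using hook_path[OF p0] by (simp add: u_def)
    have Fp: "Fm x y (PC.coset x y (sg p0 a)) = (\<lambda>v z. vscale (a * u) (?id v z))" for a
    proof -
      have "PC.coset x y (sg p0 a) = Scl PolC x y a (PC.coset x y (sg p0 1))"
        unfolding PolC_eq using PC.quot_Scl[of x y "sg p0 1" a] S p0 by simp
      then show ?thesis
        using L.Fm_scl[of x y "PC.coset x y (sg p0 1)" a] S p0 hook_path[OF p0]
        by (simp add: PolC_Obj HomP u_def)
    qed
    have norm: "\<exists>a. A = PC.coset x y (sg p0 a)" if A: "A \<in> Hom PolC x y" for A :: "((nat \<times> nat) list \<Rightarrow>\<^sub>0 'k) set"
    proof -
      obtain f where f: "f \<in> Hom (path_category \<Gamma> :: ('k, _, _) lcat) x y" "A = PC.coset x y f" using A HomP by auto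
      obtain a where "I x y (f + sg p0 a)" using Hom_linked_normal_form[OF p0 True f(1)] by blast
      then have "PC.coset x y f = PC.coset x y (sg p0 (- a))"
        using PC.coset_eq_iff[of x y f "sg p0 (- a)"] f(1) p0 S by simp
      then show ?thesis using f(2) by blast
    qed
    have nz: "(\<lambda>v z. vscale a (?id v z)) = (\<lambda>v z. vscale b (?id v z)) \<Longrightarrow> a = b" for a b
    proof -
      assume e: "(\<lambda>v z. vscale a (?id v z)) = (\<lambda>v z. vscale b (?id v z))"
      obtain v where "v \<in> supp x \<inter> supp y" using supp_inter_nonempty[OF S True] by blast
      then have "vscale a unit0 = vscale b (unit0 :: nat \<Rightarrow> 'k)"
        using fun_cong[OF fun_cong[OF e, of v], of unit0] by (simp add: identity_on_def)
      from fun_cong[OF this, of 0] show "a = b" by (simp add: vscale_apply)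
    qed
    show ?thesis
    proof (rule bij_betw_imageI[OF inj_onI equalityI[OF image_subsetI subsetI]])
      fix A B assume AB: "A \<in> Hom PolC x y" "B \<in> Hom PolC x y" "Fm x y A = Fm x y B"
      obtain a b where ab: "A = PC.coset x y (sg p0 a)" "B = PC.coset x y (sg p0 b)" using norm AB by meson
      then have "a * u = b * u" using AB(3) Fp nz by metis
      then show "A = B" using u ab by simp
    next
      fix \<phi> :: "(nat, 'k) rep_mor" assume "\<phi> \<in> Hom IndC (F x) (F y)"
      then obtain a where "\<phi> = (\<lambda>v z. vscale a (?id v z))" using F_Hom(1)[OF S, of \<phi>] by auto
      then have "\<phi> = Fm x y (PC.coset x y (sg p0 (a / u)))" using Fp[of "a / u"] u by simp
      moreover have "PC.coset x y (sg p0 (a / u)) \<in> Hom PolC x y" unfolding HomP using p0 by simp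
      ultimately show "\<phi> \<in> Fm x y ` Hom PolC x y" by blast
    next
      fix A :: "((nat \<times> nat) list \<Rightarrow>\<^sub>0 'k) set" assume "A \<in> Hom PolC x y"
      then show "Fm x y A \<in> Hom IndC (F x) (F y)" using L.Fm_in S by (simp add: PolC_Obj)
    qed
  next
    case False
    have "PC.coset x y f = PC.coset x y 0" if "f \<in> Hom (path_category \<Gamma> :: ('k, _, _) lcat) x y" for f
      using PC.coset_eq_iff[of x y f 0] that Hom_unlinked_null[OF S False that] S path_zero_in[of \<Gamma> x y] by simp
    then have "Hom PolC x y = {PC.coset x y (0 :: (nat \<times> nat) list \<Rightarrow>\<^sub>0 'k)}" unfolding HomP using path_zero_in[of \<Gamma> x y] by blast
    moreover have "Hom IndC (F x) (F y) = {0 :: (nat, 'k) rep_mor}"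
      using F_Hom(2)[OF S _ False] R.zero_in[OF F_Obj F_Obj, of x y] by (auto simp: set_eq_iff)
    moreover have "Fm x y (PC.coset x y (0 :: (nat \<times> nat) list \<Rightarrow>\<^sub>0 'k)) = 0"
      using L.Fm_zero[of x y] S by (simp add: PolC_Obj PolC_eq)
    ultimately show ?thesis by (simp add: bij_betw_def)
  qed
qed

lemma hook_equivalence: "equivalence_of_categories PolC IndC F Fm"
proof -
  interpret L: linfun PolC IndC F Fm by (rule hook_linfun)
  have "essentially_surjective (PolC :: ('k, _, _) lcat) (IndC :: ('k, _, _) lcat) F"
    unfolding essentially_surjective_def
  proof
    fix X assume X: "X \<in> Obj (IndC :: ('k, _, _) lcat)"
    then obtain x where "x \<in> S" "X = F x" unfolding ind_sel F_image[symmetric] by blast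
    moreover have "is_iso IndC X X (Ide IndC X)"
      unfolding is_iso_def using L.D.ide_in[OF X] L.D.comp_ide_left[OF X X] by blast
    ultimately show "\<exists>x\<in>Obj (PolC :: ('k, _, _) lcat). isomorphic_in IndC X (F x)"
      unfolding PolC_Obj isomorphic_in_def by blast
  qed
  then have "linequiv PolC IndC F Fm"
    using hook_fully_faithful hook_linfun by (simp add: linequiv_def linequiv_axioms_def)
  then show ?thesis by (rule linequiv.equivalence)
qed

end

end

section \<open>Auslander--Reiten theory\<close>

context lincat
begin

text \<open>Factorizations are found component by component and summed;
  \<open>dsum_factor_right\<close> is the dual.\<close>

lemma dsum_factor_left:
  assumes x: "E \<in> Obj C" "T \<in> Obj C" "X \<in> Obj C" "xs \<in> lists (Obj C)" and D: "is_dsum C xs X \<iota> \<pi>"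
    and f: "f \<in> Hom C T E" and h: "h \<in> Hom C T X"
    and u: "\<And>k. k < length xs \<Longrightarrow> \<exists>u\<in>Hom C E (xs ! k). Comp C T E (xs ! k) u f = Comp C T X (xs ! k) (\<pi> k) h"
  shows "\<exists>u\<in>Hom C E X. Comp C T E X u f = h"
proof -
  obtain v where v: "\<And>k. k < length xs \<Longrightarrow> v k \<in> Hom C E (xs ! k)"
    "\<And>k. k < length xs \<Longrightarrow> Comp C T E (xs ! k) (v k) f = Comp C T X (xs ! k) (\<pi> k) h"
    using u by metis
  note [simp] = x f h v(1) is_dsumD(1,2)[OF D]
  define w where "w = hom_sum C E X (map (\<lambda>k. Comp C E (xs ! k) X (\<iota> k) (v k)) [0..<length xs])"
  have w: "w \<in> Hom C E X" unfolding w_def by (rule hom_sum_in) auto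
  have pw: "Comp C E X (xs ! k) (\<pi> k) w = v k" if k [simp]: "k < length xs" for k
  proof -
    have "Comp C E X (xs ! k) (\<pi> k) w
      = hom_sum C E (xs ! k) (map (\<lambda>l. Comp C E X (xs ! k) (\<pi> k) (Comp C E (xs ! l) X (\<iota> l) (v l))) [0..<length xs])"
      unfolding w_def by (rule comp_hom_sum_right) auto
    also have "\<dots> = hom_sum C E (xs ! k) (map (\<lambda>l. if l = k then v k else Zero C E (xs ! k)) [0..<length xs])"
      by (rule hom_sum_cong) (simp flip: comp_assoc add: is_dsumD(3)[OF D])
    also have "\<dots> = v k"
      using hom_sum_delta[of E "xs ! k" "[0..<length xs]" k "\<lambda>l. if l = k then v k else Zero C E (xs ! k)"] by simp
    finally show ?thesis .
  qed
  have "Comp C T E X w f = h"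
  proof (rule dsum_ext_left[OF x(2,3,4) D])
    fix k assume k [simp]: "k < length xs"
    have "Comp C T X (xs ! k) (\<pi> k) (Comp C T E X w f) = Comp C T E (xs ! k) (Comp C E X (xs ! k) (\<pi> k) w) f"
      using w by (simp add: comp_assoc)
    then show "Comp C T X (xs ! k) (\<pi> k) (Comp C T E X w f) = Comp C T X (xs ! k) (\<pi> k) h"
      using pw v(2) by simp
  qed (use w in simp_all)
  then show ?thesis using w by blast
qed

lemma dsum_factor_right:
  assumes x: "E \<in> Obj C" "T \<in> Obj C" "X \<in> Obj C" "xs \<in> lists (Obj C)" and D: "is_dsum C xs X \<iota> \<pi>"
    and g: "g \<in> Hom C E T" and h: "h \<in> Hom C X T"
    and u: "\<And>k. k < length xs \<Longrightarrow> \<exists>u\<in>Hom C (xs ! k) E. Comp C (xs ! k) E T g u = Comp C (xs ! k) X T h (\<iota> k)"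
  shows "\<exists>u\<in>Hom C X E. Comp C X E T g u = h"
proof -
  obtain v where v: "\<And>k. k < length xs \<Longrightarrow> v k \<in> Hom C (xs ! k) E"
    "\<And>k. k < length xs \<Longrightarrow> Comp C (xs ! k) E T g (v k) = Comp C (xs ! k) X T h (\<iota> k)"
    using u by metis
  note [simp] = x g h v(1) is_dsumD(1,2)[OF D]
  define w where "w = hom_sum C X E (map (\<lambda>k. Comp C X (xs ! k) E (v k) (\<pi> k)) [0..<length xs])"
  have w: "w \<in> Hom C X E" unfolding w_def by (rule hom_sum_in) auto
  have pw: "Comp C (xs ! k) X E w (\<iota> k) = v k" if k [simp]: "k < length xs" for k
  proof -
    have "Comp C (xs ! k) X E w (\<iota> k)
      = hom_sum C (xs ! k) E (map (\<lambda>l. Comp C (xs ! k) X E (Comp C X (xs ! l) E (v l) (\<pi> l)) (\<iota> k)) [0..<length xs])"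
      unfolding w_def by (rule comp_hom_sum_left) auto
    also have "\<dots> = hom_sum C (xs ! k) E (map (\<lambda>l. if l = k then v k else Zero C (xs ! k) E) [0..<length xs])"
      by (rule hom_sum_cong) (auto simp: comp_assoc is_dsumD(3)[OF D])
    also have "\<dots> = v k"
      using hom_sum_delta[of "xs ! k" E "[0..<length xs]" k "\<lambda>l. if l = k then v k else Zero C (xs ! k) E"] by simp
    finally show ?thesis .
  qed
  have "Comp C X E T g w = h"
  proof (rule dsum_ext_right[OF x(2,3,4) D])
    fix k assume k [simp]: "k < length xs"
    have "Comp C (xs ! k) X T (Comp C X E T g w) (\<iota> k) = Comp C (xs ! k) E T g (Comp C (xs ! k) X E w (\<iota> k))"
      using w by (simp add: comp_assoc)
    then show "Comp C (xs ! k) X T (Comp C X E T g w) (\<iota> k) = Comp C (xs ! k) X T h (\<iota> k)"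
      using pw v(2) by simp
  qed (use w in simp_all)
  then show ?thesis using w by blast
qed

lemma dsum_exists:
  assumes z: "is_zero_object C z"
    and bip: "\<And>x y. x \<in> Obj C \<Longrightarrow> y \<in> Obj C \<Longrightarrow> \<exists>b\<in>Obj C. \<exists>i1 i2 p1 p2. is_biproduct C x y b i1 i2 p1 p2"
    and xs: "xs \<in> lists (Obj C)"
  shows "\<exists>X\<in>Obj C. \<exists>\<iota> \<pi>. is_dsum C xs X \<iota> \<pi>"
  using xs
proof (induction xs)
  case Nil
  then show ?case using dsum_Nil[OF z] z unfolding is_zero_object_def by blast
next
  case (Cons x xs)
  then obtain K \<iota> \<pi> where K: "K \<in> Obj C" "is_dsum C xs K \<iota> \<pi>" by blast
  obtain b i1 i2 p1 p2 where "b \<in> Obj C" "is_biproduct C x K b i1 i2 p1 p2" using bip[OF Cons(1) K(1)] by blast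
  then show ?case using dsum_Cons[OF Cons(1) K(1) _ Cons(2) _ K(2)] by blast
qed

section \<open>Uniqueness of almost split sequences\<close>

lemma cokernel_epi:
  assumes x: "x \<in> Obj C" "e \<in> Obj C" "z \<in> Obj C" and k: "is_cokernel C x e z f g"
  shows "is_epi C e z g"
proof -
  have [simp]: "f \<in> Hom C x e" "g \<in> Hom C e z" and gf: "Comp C x e z g f = Zero C x z"
    using k unfolding is_cokernel_def by auto
  show ?thesis unfolding is_epi_def
  proof (intro conjI ballI impI)
    fix w a b assume w: "w \<in> Obj C" and a: "a \<in> Hom C z w" and b: "b \<in> Hom C z w"
      and ab: "Comp C e z w a g = Comp C e z w b g"
    have "Comp C x e w (Comp C e z w a g) f = Zero C x w"
      using comp_assoc[of x e z w f g a] x w a gf by simp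
    moreover have "Comp C e z w a g \<in> Hom C e w" using x w a by simp
    ultimately have "\<exists>!u. u \<in> Hom C z w \<and> Comp C e z w u g = Comp C e z w a g"
      using k w unfolding is_cokernel_def by blast
    then show "a = b" using a b ab by metis
  qed simp
qed

text \<open>Suppose the scalar is 0. Then \<open>u u' f = 0\<close>, so \<open>u u'\<close> factors
  through \<open>g\<close> as \<open>w g\<close>, and \<open>g w g = g u u' = g\<close>. As
  \<open>g\<close> is an epimorphism, \<open>w\<close> splits it, which an almost split sequence
  forbids.\<close>

lemma almost_split_left_compare:
  assumes x: "x \<in> Obj C" "e \<in> Obj C" "z \<in> Obj C" "x' \<in> Obj C" "e' \<in> Obj C"
    and A: "almost_split_sequence C x e z f g" and B: "almost_split_sequence C x' e' z f' g'"
    and scal: "\<And>h. h \<in> Hom C x x \<Longrightarrow> \<exists>a. h = Scl C x x a (Ide C x)"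
    and u: "u \<in> Hom C e' e" "Comp C e' e z g u = g'" and u': "u' \<in> Hom C e e'" "Comp C e e' z g' u' = g"
    and v: "v \<in> Hom C x' x" "Comp C x' x e f v = Comp C x' e' e u f'"
    and v': "v' \<in> Hom C x x'" "Comp C x x' e' f' v' = Comp C x e e' u' f"
  shows "\<exists>a. a \<noteq> 0 \<and> Comp C x x' x v v' = Scl C x x a (Ide C x)"
proof -
  note [simp] = x u(1) u'(1) v(1) v'(1)
  have k: "is_kernel C x e z f g" and ck: "is_cokernel C x e z f g" and ns: "\<not> split_epi C e z g"
    using A unfolding almost_split_sequence_def short_exact_def by auto
  have [simp]: "f \<in> Hom C x e" "g \<in> Hom C e z" "f' \<in> Hom C x' e'" "g' \<in> Hom C e' z"
    using k B unfolding is_kernel_def almost_split_sequence_def short_exact_def by auto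
  obtain a where a: "Comp C x x' x v v' = Scl C x x a (Ide C x)" using scal[of "Comp C x x' x v v'"] by auto
  have "a \<noteq> 0"
  proof
    assume "a = 0"
    then have "Comp C x x' x v v' = Zero C x x" using a by simp
    then have "Comp C x x' e (Comp C x' x e f v) v' = Zero C x e" by (simp add: comp_assoc)
    then have "Comp C x e' e u (Comp C x x' e' f' v') = Zero C x e" unfolding v(2) by (simp add: comp_assoc)
    then have "Comp C x e e (Comp C e e' e u u') f = Zero C x e" unfolding v'(2) by (simp add: comp_assoc)
    then obtain w where w [simp]: "w \<in> Hom C z e" and wg: "Comp C e z e w g = Comp C e e' e u u'"
      using ck unfolding is_cokernel_def by (metis comp_in u(1) u'(1) x(2) x(5))
    have "Comp C e z z (Comp C z e z g w) g = Comp C e e z g (Comp C e e' e u u')"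
      unfolding wg[symmetric] by (simp add: comp_assoc)
    also have "\<dots> = Comp C e e' z (Comp C e' e z g u) u'" by (simp add: comp_assoc)
    also have "\<dots> = Comp C e z z (Ide C z) g" unfolding u(2) u'(2) by simp
    finally have "Comp C z e z g w = Ide C z"
      using cokernel_epi[OF x(1-3) ck] unfolding is_epi_def by (metis comp_in ide_in w x(2,3) \<open>g \<in> Hom C e z\<close>)
    then show False using ns w unfolding split_epi_def by blast
  qed
  then show ?thesis using a by blast
qed

text \<open>Each right-hand map factors through the other by the almost split property. This induces
  maps \<open>v\<close> and \<open>v'\<close> between the left-hand terms whose composites are
  nonzero scalars.\<close>

lemma almost_split_unique:
  assumes x: "x \<in> Obj C" "e \<in> Obj C" "z \<in> Obj C" "x' \<in> Obj C" "e' \<in> Obj C"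
    and A: "almost_split_sequence C x e z f g" and B: "almost_split_sequence C x' e' z f' g'"
    and scal: "\<And>h. h \<in> Hom C x x \<Longrightarrow> \<exists>a. h = Scl C x x a (Ide C x)"
    and scal': "\<And>h. h \<in> Hom C x' x' \<Longrightarrow> \<exists>a. h = Scl C x' x' a (Ide C x')"
  shows "isomorphic_in C x x'"
proof -
  note [simp] = x
  have k: "is_kernel C x e z f g" "is_kernel C x' e' z f' g'"
    using A B unfolding almost_split_sequence_def short_exact_def by auto
  then have [simp]: "f \<in> Hom C x e" "g \<in> Hom C e z" "f' \<in> Hom C x' e'" "g' \<in> Hom C e' z"
    and gf: "Comp C x e z g f = Zero C x z" "Comp C x' e' z g' f' = Zero C x' z"
    unfolding is_kernel_def by auto
  obtain u where u [simp]: "u \<in> Hom C e' e" and gu: "Comp C e' e z g u = g'"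
    using A B x(5) unfolding almost_split_sequence_def by (metis \<open>g' \<in> Hom C e' z\<close>)
  obtain u' where u' [simp]: "u' \<in> Hom C e e'" and gu': "Comp C e e' z g' u' = g"
    using A B x(2) unfolding almost_split_sequence_def by (metis \<open>g \<in> Hom C e z\<close>)
  have "Comp C x' e z g (Comp C x' e' e u f') = Zero C x' z"
    using comp_assoc[of x' e' e z f' u g] gu gf by simp
  then obtain v where v [simp]: "v \<in> Hom C x' x" and fv: "Comp C x' x e f v = Comp C x' e' e u f'"
    using k(1) unfolding is_kernel_def by (metis comp_in u x(2,4,5) \<open>f' \<in> Hom C x' e'\<close>)
  have "Comp C x e' z g' (Comp C x e e' u' f) = Zero C x z"
    using comp_assoc[of x e e' z f u' g'] gu' gf by simp
  then obtain v' where v' [simp]: "v' \<in> Hom C x x'" and fv': "Comp C x x' e' f' v' = Comp C x e e' u' f"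
    using k(2) unfolding is_kernel_def by (metis comp_in u' x(1,2,5) \<open>f \<in> Hom C x e\<close>)
  obtain a where a: "a \<noteq> 0" "Comp C x x' x v v' = Scl C x x a (Ide C x)"
    using almost_split_left_compare[OF x A B scal u gu u' gu' v fv v' fv'] by blast
  obtain b where b: "b \<noteq> 0" "Comp C x' x x' v' v = Scl C x' x' b (Ide C x')"
    using almost_split_left_compare[OF x(4,5,3,1,2) B A scal' u' gu' u gu v' fv' v fv] by blast
  \<comment> \<open>Rescaled by \<open>inverse a\<close>, the map \<open>v\<close> is a left inverse
    of \<open>v'\<close>, rescaled by \<open>inverse b\<close> a right inverse; so the two
    coincide.\<close>
  let ?l = "Scl C x' x (inverse a) v" and ?r = "Scl C x' x (inverse b) v"
  have l: "Comp C x x' x ?l v' = Ide C x" using a by simp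
  have r: "Comp C x' x x' v' ?r = Ide C x'" using b by simp
  have "?l = Comp C x' x' x ?l (Comp C x' x x' v' ?r)" unfolding r by simp
  also have "\<dots> = Comp C x' x x (Comp C x x' x ?l v') ?r" by (rule comp_assoc[symmetric]) auto
  also have "\<dots> = ?r" unfolding l by simp
  finally have "Comp C x' x x' v' ?l = Ide C x'" using r by simp
  then show ?thesis unfolding isomorphic_in_def is_iso_def using l v' scl_in[of x' x v "inverse a"] by (metis v x(1,4))
qed

end

text \<open>The axioms of a translation quiver are transported along the bijection, so for the
  Auslander-Reiten quiver they follow from those for the polygon.\<close>

lemma translation_quiver_transport:
  assumes T: "translation_quiver \<Gamma>" and b: "bij_betw h (verts \<Gamma>) (verts \<Delta>)" and A: "arrs \<Delta> \<subseteq> verts \<Delta> \<times> verts \<Delta>"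
    and a: "\<And>x y. x \<in> verts \<Gamma> \<Longrightarrow> y \<in> verts \<Gamma> \<Longrightarrow> (x, y) \<in> arrs \<Gamma> \<longleftrightarrow> (h x, h y) \<in> arrs \<Delta>"
    and t: "\<And>x. x \<in> verts \<Gamma> \<Longrightarrow> transl \<Delta> (h x) = map_option h (transl \<Gamma> x)"
  shows "translation_quiver_iso \<Gamma> \<Delta> h"
proof -
  have inj: "h x = h y \<longleftrightarrow> x = y" if "x \<in> verts \<Gamma>" "y \<in> verts \<Gamma>" for x y
    using b that unfolding bij_betw_def inj_on_def by blast
  have V: "verts \<Delta> = h ` verts \<Gamma>" using b by (simp add: bij_betw_def)
  note T' = T[unfolded translation_quiver_def]
  have AG: "arrs \<Gamma> \<subseteq> verts \<Gamma> \<times> verts \<Gamma>" by (rule T'[THEN conjunct1])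
  have nl: "(x, x) \<notin> arrs \<Gamma>" for x using T'[THEN conjunct2, THEN conjunct1] by blast
  have fin: "finite {y. (x, y) \<in> arrs \<Gamma>} \<and> finite {y. (y, x) \<in> arrs \<Gamma>}" if "x \<in> verts \<Gamma>" for x
    by (rule bspec[OF T'[THEN conjunct2, THEN conjunct2, THEN conjunct1] that])
  have tr: "u \<in> verts \<Gamma> \<and> (\<forall>y. (y, x) \<in> arrs \<Gamma> \<longleftrightarrow> (u, y) \<in> arrs \<Gamma>)" if "x \<in> verts \<Gamma>" "transl \<Gamma> x = Some u" for x u
    by (rule bspec[OF T'[THEN conjunct2, THEN conjunct2, THEN conjunct2, THEN conjunct1] that(1), THEN spec, THEN mp, OF that(2)])
  have ti: "x = y" if "x \<in> verts \<Gamma>" "y \<in> verts \<Gamma>" "transl \<Gamma> x \<noteq> None" "transl \<Gamma> x = transl \<Gamma> y" for x y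
    by (rule bspec[OF bspec[OF T'[THEN conjunct2, THEN conjunct2, THEN conjunct2, THEN conjunct2] that(1)] that(2), THEN mp, OF conjI[OF that(3,4)]])
  have "translation_quiver \<Delta>"
    unfolding translation_quiver_def
  proof (intro conjI allI ballI impI A)
    fix X show "(X, X) \<notin> arrs \<Delta>"
    proof
      assume XX: "(X, X) \<in> arrs \<Delta>"
      then obtain x where "x \<in> verts \<Gamma>" "X = h x" using A unfolding V by blast
      then show False using XX a[of x x] nl[of x] by simp
    qed
  next
    fix X assume "X \<in> verts \<Delta>"
    then obtain x where x: "x \<in> verts \<Gamma>" "X = h x" using V by blast
    have "{Y. (X, Y) \<in> arrs \<Delta>} \<subseteq> h ` {y. (x, y) \<in> arrs \<Gamma>}" "{Y. (Y, X) \<in> arrs \<Delta>} \<subseteq> h ` {y. (y, x) \<in> arrs \<Gamma>}"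
      using A a[OF x(1)] a[OF _ x(1)] unfolding V x(2) by blast+
    then show "finite {Y. (X, Y) \<in> arrs \<Delta>}" "finite {Y. (Y, X) \<in> arrs \<Delta>}"
      using fin[OF x(1)] by (meson finite_imageI finite_subset)+
    fix U assume U: "transl \<Delta> X = Some U"
    then obtain u where u: "transl \<Gamma> x = Some u" "U = h u" using t[OF x(1)] x(2) by auto
    note tu = tr[OF x(1) u(1)]
    then show "U \<in> verts \<Delta>" unfolding V u(2) by blast
    fix Y show "(Y, X) \<in> arrs \<Delta> \<longleftrightarrow> (U, Y) \<in> arrs \<Delta>"
    proof (cases "Y \<in> verts \<Delta>")
      case True
      then obtain y where "y \<in> verts \<Gamma>" "Y = h y" using V by blast
      then show ?thesis using a[of y x] a[of u y] x u tu by simp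
    qed (use A in blast)
  next
    fix X Y assume XY: "X \<in> verts \<Delta>" "Y \<in> verts \<Delta>" "transl \<Delta> X \<noteq> None \<and> transl \<Delta> X = transl \<Delta> Y"
    then obtain x y where x: "x \<in> verts \<Gamma>" "X = h x" "y \<in> verts \<Gamma>" "Y = h y" using V by blast
    then obtain u v where uv: "transl \<Gamma> x = Some u" "transl \<Gamma> y = Some v" "h u = h v"
      using XY(3) t[OF x(1)] t[OF x(3)] by (cases "transl \<Gamma> x"; cases "transl \<Gamma> y") auto
    then have "u = v" using inj tr[OF x(1) uv(1)] tr[OF x(3) uv(2)] by blast
    then show "X = Y" using ti[OF x(1,3)] uv x by simp
  qed
  then show ?thesis unfolding translation_quiver_iso_def using T b a t by blast
qed

context dynkin
begin

abbreviation idm :: "nat \<times> nat \<Rightarrow> nat \<times> nat \<Rightarrow> (nat, 'k::field) rep_mor" where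
  "idm x y \<equiv> identity_on (supp x \<inter> supp y)"

abbreviation smul :: "'k::field \<Rightarrow> (nat, 'k) rep_mor \<Rightarrow> (nat, 'k) rep_mor" where
  "smul a \<phi> \<equiv> \<lambda>v z. vscale a (\<phi> v z)"

lemma F_End: "x \<in> S \<Longrightarrow> h \<in> Hom R (F x) (F x) \<Longrightarrow> \<exists>a. h = Scl R (F x) (F x) a (Ide R (F x) :: (nat, 'k::field) rep_mor)"
  using F_Hom(1)[of x x h] by (simp add: F_ide del: rep_sel(2))

lemma F_ide_nonzero: "x \<in> S \<Longrightarrow> Ide R (F x) \<noteq> Zero R (F x) (F x :: (nat, 'k::field) rep)"
  using identity_on_nonzero[of "supp x" "1::'k"] unfolding rep_sel(5)
  by (simp add: F_ide supp_def S_iff del: rep_sel(2))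

text \<open>A splitting gives nonzero maps in both directions between different intervals, against
  antisymmetry.\<close>

lemma no_split:
  assumes x: "x \<in> S" "y \<in> S" "x \<noteq> y"
  shows "f \<in> Hom R (F x) (F y) \<Longrightarrow> \<not> split_mono R (F x) (F y) (f :: (nat, 'k::field) rep_mor)"
    and "f \<in> Hom R (F x) (F y) \<Longrightarrow> \<not> split_epi R (F x) (F y) (f :: (nat, 'k::field) rep_mor)"
proof -
  have main: False if f: "f \<in> Hom R (F x) (F y :: (nat, 'k) rep)" and g: "g \<in> Hom R (F y) (F x)"
    and gf: "Comp R (F x) (F y) (F x) g f = Ide R (F x)" and x: "x \<in> S" "y \<in> S" "x \<noteq> y" for f g x y
  proof -
    have "f \<noteq> Zero R (F x) (F y)"
      using gf F_ide_nonzero[OF x(1)] R.comp_zero_right[OF F_Obj F_Obj F_Obj g] by metis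
    moreover have "g \<noteq> Zero R (F y) (F x)"
      using gf F_ide_nonzero[OF x(1)] R.comp_zero_left[OF F_Obj F_Obj F_Obj f] by metis
    ultimately have "f \<noteq> 0" "g \<noteq> 0" by simp_all
    then have "linked x y" "linked y x" using F_Hom(2)[OF x(1,2) f] F_Hom(2)[OF x(2,1) g] by blast+
    then show False using sle_antisym[of x y] linked_sle x(3) by blast
  qed
  show "f \<in> Hom R (F x) (F y) \<Longrightarrow> \<not> split_mono R (F x) (F y) (f :: (nat, 'k) rep_mor)"
    unfolding split_mono_def using main x by blast
  show "f \<in> Hom R (F x) (F y) \<Longrightarrow> \<not> split_epi R (F x) (F y) (f :: (nat, 'k) rep_mor)"
    unfolding split_epi_def using main[of _ y x] x by metis
qed

lemma F_indecomposable: "x \<in> S \<Longrightarrow> indecomposable_object R (F x :: (nat, 'k::field) rep)"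
proof -
  assume x: "x \<in> S"
  have "\<not> is_zero_object R (F x :: (nat, 'k) rep)"
    using F_ide_nonzero[OF x] R.zero_object_iff[OF F_Obj] by blast
  then show ?thesis
    unfolding indecomposable_object_def
    using R.biproduct_of_scalar_endomorphisms_trivial[OF F_Obj _ _ F_End[OF x] F_ide_nonzero[OF x]] F_Obj by blast
qed

text \<open>An indecomposable has an interval summand; the complement must be zero, so the
  retraction is an isomorphism. Different intervals are not isomorphic by
  \<open>F_iso\<close>.\<close>

lemma representatives: "indecomposable_representatives R (ind_objects n :: (nat, 'k::field) rep set)"
  unfolding indecomposable_representatives_def
proof (intro conjI ballI allI impI)
  fix X :: "(nat, 'k) rep"
  assume "X \<in> ind_objects n"
  then obtain x where "x \<in> S" "X = F x" unfolding F_image[symmetric] by blast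
  then show "indecomposable_object R X" using F_indecomposable[of x] by simp
next
  fix X :: "(nat, 'k) rep"
  assume ind: "indecomposable_object R X"
  then have X: "representation Q X" and nz: "\<not> is_zero_object R X" unfolding indecomposable_object_def by auto
  obtain v0 where v0: "v0 \<in> {1..n + 2}" "space_at X v0 \<noteq> {0}" using nz unfolding zero_rep_iff[OF X] verts_Q by blast
  obtain x f g where x: "x \<in> S" and f: "f \<in> Hom R (F x) X" and g: "g \<in> Hom R X (F x)"
    and gf: "Comp R (F x) X (F x) g f = Ide R (F x)"
    using interval_summand[OF X v0] by blast
  define T where "T = (\<lambda>v. {y \<in> space_at X v. g v y = 0})"
  note K = subrep(1)[OF X kernel_stable[OF X F_rep g, folded T_def]] and ker = kernel[OF X F_rep g, folded T_def]
  have XO: "X \<in> Obj R" "subrep X T \<in> Obj R" using X K by auto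
  obtain q where q: "is_biproduct R (F x) (subrep X T) X f (incl T) g q"
    using R.split_mono_biproduct[OF F_Obj XO(1) f g gf XO(2) ker] .
  have "\<not> is_zero_object R (F x :: (nat, 'k) rep)"
    using F_ide_nonzero[OF x] R.zero_object_iff[OF F_Obj] by blast
  then have "is_zero_object R (subrep X T)"
    using ind q F_Obj XO unfolding indecomposable_object_def by blast
  then have iso: "is_iso R X (F x) g" using R.biproduct_with_zero_iso[OF F_Obj XO(2,1) q] by blast
  show "\<exists>!t. t \<in> ind_objects n \<and> isomorphic_in R X t"
  proof (rule ex1I[of _ "F x"])
    show "F x \<in> ind_objects n \<and> isomorphic_in R X (F x)" using F_in_ind[OF x] iso unfolding isomorphic_in_def by blast
    fix t assume t: "t \<in> ind_objects n \<and> isomorphic_in R X t"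
    then obtain y where y: "y \<in> S" "t = F y" unfolding F_image[symmetric] by blast
    obtain h where h: "is_iso R X (F y) h" using t y unfolding isomorphic_in_def by blast
    obtain g' where "is_iso R (F x) X g'" using iso unfolding is_iso_def by blast
    then have "is_iso R (F x) (F y) (Comp R (F x) X (F y) h g')" by (rule R.isomorphic_trans[OF F_Obj XO(1) F_Obj _ h])
    then have "x = y" by (intro F_iso[OF x y(1)]) (auto simp: isomorphic_in_def)
    then show "t = F x" using y by simp
  qed
qed

section \<open>Irreducible morphisms are multiples of pivot morphisms\<close>

lemma rank_strict: "x \<in> S \<Longrightarrow> y \<in> S \<Longrightarrow> linked x y \<Longrightarrow> x \<noteq> y \<Longrightarrow> rank x < rank y"
  using first_pivot[of x y] rank_P rank_mono linked_sle by (metis less_add_one less_le_trans)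

text \<open>A pivot raises \<open>rank\<close> by one, which leaves no room for a segment strictly
  between.\<close>

lemma pivot_factors:
  assumes p: "(x, y) \<in> P" and z: "z \<in> S" "linked x z" "linked z y"
  shows "z = x \<or> z = y"
proof (rule ccontr)
  assume "\<not> (z = x \<or> z = y)"
  then have "rank x < rank z" "rank z < rank y" using rank_strict[of x z] rank_strict[of z y] p z by (auto simp: P_iff)
  then show False using rank_P[OF p] by simp
qed

text \<open>A factorization through \<open>Z\<close> is expanded over the interval summands of
  \<open>Z\<close>. One with a nonzero contribution lies between \<open>x\<close> and
  \<open>y\<close> and so equals one of them; there the component is a nonzero scalar and splits the
  first or the second factor.\<close>

lemma pivot_irreducible:
  assumes p: "(x, y) \<in> P" and c: "c \<noteq> 0"
  shows "irreducible_morphism R (F x) (F y) (smul c (idm x y) :: (nat, 'k::field) rep_mor)" (is "irreducible_morphism R _ _ ?f")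
proof -
  have x: "x \<in> S" "y \<in> S" and xy: "x \<noteq> y" "sle x y" using p P_sle[OF p] by (auto simp: P_iff)
  have f: "?f \<in> Hom R (F x) (F y)" by (rule scaled_identity_Hom[OF x xy(2)])
  have S': "linked x y"
    using supp_inter_empty[OF x xy(2)] p S_bounds[OF x(1)] S_bounds[OF x(2)] x
    by (auto simp: linked_def xy(2) P_iff S_iff)
  have fne: "?f \<noteq> 0" by (rule identity_on_nonzero[OF supp_inter_nonempty[OF x S'] c])
  show ?thesis
    unfolding irreducible_morphism_def
  proof (intro conjI ballI impI f no_split(1)[OF x xy(1) f] no_split(2)[OF x xy(1) f])
    fix Z g h assume Z: "Z \<in> Obj R" and g: "g \<in> Hom R (F x) Z" and h: "h \<in> Hom R Z (F y)"
      and hg: "Comp R (F x) Z (F y) h g = ?f"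
    obtain zs \<iota> \<pi> where zs: "zs \<in> lists S" and D: "is_dsum R (map F zs) Z \<iota> \<pi>"
      using decomposition[of Z] Z by auto
    have mO: "map F zs \<in> lists (Obj R)" by (auto simp: in_lists_conv_set)
    have \<iota>: "\<iota> k \<in> Hom R (F (zs ! k)) Z" and \<pi>: "\<pi> k \<in> Hom R Z (F (zs ! k))" and zk: "zs ! k \<in> S" if "k < length zs" for k
      using is_dsumD(1,2)[OF D, of k] that zs by (auto simp: in_lists_conv_set)
    have "\<exists>k<length zs. Comp R Z (F (zs ! k)) (F y) (Comp R (F (zs ! k)) Z (F y) h (\<iota> k)) (\<pi> k) \<noteq> Zero R Z (F y)
        \<and> Comp R (F x) (F (zs ! k)) (F y) (Comp R (F (zs ! k)) Z (F y) h (\<iota> k)) (Comp R (F x) Z (F (zs ! k)) (\<pi> k) g) \<noteq> Zero R (F x) (F y)"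
    proof (rule ccontr)
      assume neg: "\<not> ?thesis"
      have z0: "Comp R (F x) Z (F y) (Comp R Z (F (zs ! k)) (F y) (Comp R (F (zs ! k)) Z (F y) h (\<iota> k)) (\<pi> k)) g = Zero R (F x) (F y)"
        if k: "k < length zs" for k
      proof -
        have "Comp R (F x) Z (F y) (Comp R Z (F (zs ! k)) (F y) (Comp R (F (zs ! k)) Z (F y) h (\<iota> k)) (\<pi> k)) g
          = Comp R (F x) (F (zs ! k)) (F y) (Comp R (F (zs ! k)) Z (F y) h (\<iota> k)) (Comp R (F x) Z (F (zs ! k)) (\<pi> k) g)"
          by (rule R.comp_assoc[OF F_Obj Z F_Obj F_Obj g \<pi>[OF k] R.comp_in[OF F_Obj Z F_Obj \<iota>[OF k] h]])
        then show ?thesis using neg k R.comp_zero_left[OF F_Obj Z F_Obj g] by metis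
      qed
      have "h = hom_sum R Z (F y) (map (\<lambda>k. Comp R Z (F (zs ! k)) (F y) (Comp R (F (zs ! k)) Z (F y) h (\<iota> k)) (\<pi> k)) [0..<length zs])"
        using R.dsum_expand_right[OF F_Obj Z mO D h]
        by (simp cong: map_cong add: mem_uptD del: set_upt rep_sel)
      then have "?f = Comp R (F x) Z (F y) (hom_sum R Z (F y) (map (\<lambda>k. Comp R Z (F (zs ! k)) (F y) (Comp R (F (zs ! k)) Z (F y) h (\<iota> k)) (\<pi> k)) [0..<length zs])) g"
        using hg by metis
      also have "\<dots> = hom_sum R (F x) (F y) (map (\<lambda>k. Comp R (F x) Z (F y) (Comp R Z (F (zs ! k)) (F y) (Comp R (F (zs ! k)) Z (F y) h (\<iota> k)) (\<pi> k)) g) [0..<length zs])"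
        by (rule R.comp_hom_sum_left[OF F_Obj Z F_Obj _ g])
          (rule R.comp_in[OF Z F_Obj F_Obj \<pi> R.comp_in[OF F_Obj Z F_Obj \<iota> h]], auto)
      also have "\<dots> = Zero R (F x) (F y)" by (rule R.hom_sum_zero[OF F_Obj F_Obj z0]) auto
      finally show False using fne by simp
    qed
    then obtain k where k: "k < length zs" and
      nz: "Comp R (F x) (F (zs ! k)) (F y) (Comp R (F (zs ! k)) Z (F y) h (\<iota> k)) (Comp R (F x) Z (F (zs ! k)) (\<pi> k) g) \<noteq> Zero R (F x) (F y)" by blast
    define a where "a = Comp R (F x) Z (F (zs ! k)) (\<pi> k) g"
    define b where "b = Comp R (F (zs ! k)) Z (F y) h (\<iota> k)"
    have a: "a \<in> Hom R (F x) (F (zs ! k))" unfolding a_def by (rule R.comp_in[OF F_Obj Z F_Obj g \<pi>[OF k]])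
    have b: "b \<in> Hom R (F (zs ! k)) (F y)" unfolding b_def by (rule R.comp_in[OF F_Obj Z F_Obj \<iota>[OF k] h])
    have "a \<noteq> Zero R (F x) (F (zs ! k))" "b \<noteq> Zero R (F (zs ! k)) (F y)"
      using nz R.comp_zero_right[OF F_Obj F_Obj F_Obj b] R.comp_zero_left[OF F_Obj F_Obj F_Obj a]
      unfolding a_def[symmetric] b_def[symmetric] by metis+
    then have "a \<noteq> 0" "b \<noteq> 0" by simp_all
    then have "linked x (zs ! k)" "linked (zs ! k) y" using F_Hom(2)[OF x(1) zk[OF k] a] F_Hom(2)[OF zk[OF k] x(2) b] by blast+
    from pivot_factors[OF p zk[OF k] this] show "split_mono R (F x) Z g \<or> split_epi R Z (F y) h"
    proof
      assume e: "zs ! k = x"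
      obtain d where d: "a = Scl R (F x) (F x) d (Ide R (F x))" using F_End[OF x(1)] a e by metis
      then have "d \<noteq> 0" using \<open>a \<noteq> 0\<close> by (auto simp: fun_ext)
      have "Comp R (F x) Z (F x) (Scl R Z (F x) (inverse d) (\<pi> k)) g = Scl R (F x) (F x) (inverse d) (Comp R (F x) Z (F x) (\<pi> k) g)"
        by (rule R.comp_scl_left[OF F_Obj Z F_Obj g]) (use \<pi>[OF k] e in simp)
      also have "\<dots> = Ide R (F x)"
        using d \<open>d \<noteq> 0\<close> R.scl_scl[OF F_Obj F_Obj R.ide_in[OF F_Obj], of x "inverse d" d] R.scl_one[OF F_Obj F_Obj R.ide_in[OF F_Obj], of x]
        unfolding a_def e by simp
      finally have "split_mono R (F x) Z g"
        unfolding split_mono_def using R.scl_in[OF Z F_Obj \<pi>[OF k]] e by metis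
      then show ?thesis ..
    next
      assume e: "zs ! k = y"
      obtain d where d: "b = Scl R (F y) (F y) d (Ide R (F y))" using F_End[OF x(2)] b e by metis
      then have "d \<noteq> 0" using \<open>b \<noteq> 0\<close> by (auto simp: fun_ext)
      have "Comp R (F y) Z (F y) h (Scl R (F y) Z (inverse d) (\<iota> k)) = Scl R (F y) (F y) (inverse d) (Comp R (F y) Z (F y) h (\<iota> k))"
        by (rule R.comp_scl_right[OF F_Obj Z F_Obj _ h]) (use \<iota>[OF k] e in simp)
      also have "\<dots> = Ide R (F y)"
        using d \<open>d \<noteq> 0\<close> R.scl_scl[OF F_Obj F_Obj R.ide_in[OF F_Obj], of y "inverse d" d] R.scl_one[OF F_Obj F_Obj R.ide_in[OF F_Obj], of y]
        unfolding b_def e by simp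
      finally have "split_epi R Z (F y) h"
        unfolding split_epi_def using R.scl_in[OF F_Obj Z \<iota>[OF k]] e by metis
      then show ?thesis ..
    qed
  qed
qed

text \<open>If \<open>x\<close> and \<open>y\<close> are linked and different but not joined by a
  pivot, the map factors through a first pivot \<open>z\<close> of \<open>x\<close> with
  \<open>z \<noteq> y\<close>, and neither factor splits.\<close>

lemma irreducible_pivot:
  fixes f :: "(nat, 'k::field) rep_mor"
  assumes x: "x \<in> S" "y \<in> S" and irr: "irreducible_morphism R (F x) (F y) f"
  shows "(x, y) \<in> P \<and> (\<exists>c. c \<noteq> 0 \<and> f = smul c (idm x y))"
proof -
  have f: "f \<in> Hom R (F x) (F y)" and ns: "\<not> split_mono R (F x) (F y) f"
    and fac: "\<And>Z g h. Z \<in> Obj R \<Longrightarrow> g \<in> Hom R (F x) Z \<Longrightarrow> h \<in> Hom R Z (F y) \<Longrightarrow> Comp R (F x) Z (F y) h g = f \<Longrightarrow>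
      split_mono R (F x) Z g \<or> split_epi R Z (F y) h"
    using irr unfolding irreducible_morphism_def by blast+
  obtain c where c: "f = smul c (idm x y)" using F_Hom(1)[OF x f] by blast
  have fnz: "f \<noteq> 0"
  proof
    assume f0: "f = 0"
    have zi: "Zero R (F x) (F x) \<in> Hom R (F x) (F x :: (nat, 'k) rep)" "Zero R (F x) (F y) \<in> Hom R (F x) (F y :: (nat, 'k) rep)"
      by (rule R.zero_in[OF F_Obj F_Obj])+
    \<comment> \<open>The zero map is excluded by its factorization into two zero maps, neither of
      which splits.\<close>
    have "Comp R (F x) (F x) (F y) (Zero R (F x) (F y)) (Zero R (F x) (F x)) = f"
      using R.comp_zero_left[OF F_Obj F_Obj F_Obj zi(1)] f0 by simp
    from fac[OF F_Obj zi this] show False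
    proof
      assume "split_mono R (F x) (F x) (Zero R (F x) (F x) :: (nat, 'k) rep_mor)"
      then show False unfolding split_mono_def
        using R.comp_zero_right[OF F_Obj F_Obj F_Obj] F_ide_nonzero[OF x(1)] by metis
    next
      assume "split_epi R (F x) (F y) (Zero R (F x) (F y) :: (nat, 'k) rep_mor)"
      then show False unfolding split_epi_def
        using R.comp_zero_left[OF F_Obj F_Obj F_Obj] F_ide_nonzero[OF x(2)] by metis
    qed
  qed
  then have l: "linked x y" using F_Hom(2)[OF x f] by blast
  have c0: "c \<noteq> 0" using fnz c by (auto simp: fun_ext)
  have xy: "x \<noteq> y"
  proof
    assume e: "x = y"
    have ii: "Ide R (F x) \<in> Hom R (F x) (F x :: (nat, 'k) rep)" by (rule R.ide_in[OF F_Obj])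
    have "f = Scl R (F x) (F x) c (Ide R (F x))" unfolding F_ide[OF x(1)] using c e by simp
    then have "Comp R (F x) (F x) (F x) (Scl R (F x) (F x) (inverse c) (Ide R (F x))) f = Ide R (F x)"
      using R.comp_scl_left[OF F_Obj F_Obj F_Obj R.scl_in[OF F_Obj F_Obj ii] ii, of "inverse c" c]
        R.comp_ide_left[OF F_Obj F_Obj R.scl_in[OF F_Obj F_Obj ii], of c] R.scl_scl[OF F_Obj F_Obj ii, of "inverse c" c]
        R.scl_one[OF F_Obj F_Obj ii] c0 by (metis left_inverse)
    then show False using ns R.scl_in[OF F_Obj F_Obj ii, of "inverse c"] e unfolding split_mono_def by metis
  qed
  have "(x, y) \<in> P"
  proof (rule ccontr)
    assume np: "(x, y) \<notin> P"
    obtain z where z: "(x, z) \<in> P" "linked z y" using first_pivot[OF x l xy] .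
    have zS: "z \<in> S" and zy: "z \<noteq> y" using z np by (auto simp: P_iff)
    have sl: "sle x z" "sle z y" and xz: "x \<noteq> z" using P_sle[OF z(1)] linked_sle[OF z(2)] by auto
    have g: "smul 1 (idm x z) \<in> Hom R (F x) (F z :: (nat, 'k) rep)" by (rule scaled_identity_Hom[OF x(1) zS sl(1)])
    have h: "smul c (idm z y) \<in> Hom R (F z) (F y)" by (rule scaled_identity_Hom[OF zS x(2) sl(2)])
    have "supp x \<inter> supp z \<inter> (supp z \<inter> supp y) = supp x \<inter> supp y" using supp_between[OF sl] by auto
    then have "Comp R (F x) (F z) (F y) (smul c (idm z y)) (smul 1 (idm x z)) = f"
      unfolding rep_sel(3) scaled_identity_comp c by simp
    from fac[OF F_Obj g h this] show False using no_split(1)[OF x(1) zS xz g] no_split(2)[OF zS x(2) zy h] by blast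
  qed
  then show ?thesis using c c0 by blast
qed

text \<open>\<open>F\<close> takes a middle term that is not a segment to the zero representation, so that meshes with one
  middle term need no separate treatment.\<close>

lemma mesh_supp:
  assumes t: "t \<in> S" "x \<in> S" "x = (s (fst t), s (snd t))"
  defines "y1 \<equiv> (s (fst t), snd t)" and "y2 \<equiv> (fst t, s (snd t))"
  shows "supp y1 \<union> supp y2 = supp t \<union> supp x" "supp y1 \<inter> supp y2 = supp t \<inter> supp x"
    "sle t y1" "sle t y2" "sle y1 x" "sle y2 x" "t \<noteq> y1" "t \<noteq> y2" "y1 \<noteq> x" "y2 \<noteq> x"
    "y1 \<notin> S \<Longrightarrow> supp y1 = {}" "y2 \<notin> S \<Longrightarrow> supp y2 = {}"
proof -
  obtain i j where ij: "t = (i, j)" by (cases t)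
  have b: "i < j" "j \<le> n + 2" "s i < s j" "s j \<le> n + 2" using t ij by (auto simp: S_iff)
  \<comment> \<open>If \<open>s j < i\<close>, then \<open>i\<close> lies strictly between
    \<open>s j\<close> and \<open>j\<close> and is lower, so \<open>s i > i\<close>, against
    \<open>s i < s j\<close>. The second bound is its mirror image.\<close>
  have 1: "i \<le> s j"
  proof (rule ccontr)
    assume n1: "\<not> i \<le> s j"
    then have "j \<in> up \<or> j = n + 2" using s_up[of j] vertex_cases(1)[of j] b by auto
    then have "i \<in> low" using s_down[of j] n1 b by auto
    then show False using s_up[of i] n1 b by auto
  qed
  have 2: "s i \<le> j"
  proof (rule ccontr)
    assume n1: "\<not> s i \<le> j"
    then have "i = 0 \<or> i \<in> low" using s_down[of i] vertex_cases(1)[of i] b by auto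
    then have "j \<in> up" using s_up[of i] n1 b by auto
    then show False using s_down[of j] n1 b by auto
  qed
  show "supp y1 \<union> supp y2 = supp t \<union> supp x" "supp y1 \<inter> supp y2 = supp t \<inter> supp x"
    "y1 \<notin> S \<Longrightarrow> supp y1 = {}" "y2 \<notin> S \<Longrightarrow> supp y2 = {}"
    using b 1 2 by (auto simp: supp_def y1_def y2_def t(3) ij S_iff)
  have "lle i (s i)" "rle j (s j)" "s i \<noteq> i" "s j \<noteq> j" using lle_s[of i] rle_s[of j] s_ne[of i] s_ne[of j] b by auto
  then show "sle t y1" "sle t y2" "sle y1 x" "sle y2 x" "t \<noteq> y1" "t \<noteq> y2" "y1 \<noteq> x" "y2 \<noteq> x"
    by (auto simp: sle_def y1_def y2_def t(3) ij)
qed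

lemma F_Hom_backwards_zero:
  fixes f :: "(nat, 'k::field) rep_mor"
  assumes "f \<in> Hom R (F x) (F y)" "x \<in> S \<or> supp x = {}" "y \<in> S \<or> supp y = {}" "sle y x" "x \<noteq> y"
  shows "f = Zero R (F x) (F y)"
proof (cases "x \<in> S \<and> y \<in> S")
  case True
  have "\<not> linked x y" using sle_antisym[of x y] linked_sle[of x y] assms by blast
  then show ?thesis using F_Hom(2)[OF _ _ assms(1)] True by simp
next
  case False
  show ?thesis
  proof (rule rep_hom_eqI[OF assms(1) R.zero_in[OF F_Obj F_Obj]])
    fix v and z :: "nat \<Rightarrow> 'k" assume v: "v \<in> verts Q" and z: "z \<in> space_at (F x) v"
    then show "f v z = Zero R (F x) (F y) v z"
      using lm_in[OF rep_lm[OF assms(1) v] z] lm_zero[OF rep_lm[OF assms(1) v]] False assms(2,3) by (auto simp: F_space)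
  qed
qed

text \<open>The union and intersection formulas of \<open>mesh_supp\<close> give exactness at each
  vertex, and a splitting would need maps against the order. On an interval summand, a map out of
  \<open>F t\<close> factors through a first pivot of \<open>t\<close>, that is, through one of the
  middle terms; dually for maps into \<open>F x\<close>.\<close>

lemma mesh_almost_split:
  assumes t: "t \<in> S" "x \<in> S" "x = (s (fst t), s (snd t))"
  shows "\<exists>E\<in>Obj R. \<exists>f g. almost_split_sequence R (F t) E (F x :: (nat, 'k::field) rep) f g"
proof -
  define y1 where "y1 = (s (fst t), snd t)"
  define y2 where "y2 = (fst t, s (snd t))"
  note ms = mesh_supp[OF t, folded y1_def y2_def]
  note sh = mesh_shape(1,2)[OF t, folded y1_def y2_def]
  have bd: "snd y1 \<le> n + 2" "snd y2 \<le> n + 2" using t by (auto simp: y1_def y2_def S_iff)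
  obtain E i1 i2 p1 p2 where E: "representation Q E" and B: "is_biproduct R (F y1) (F y2) E i1 i2 p1 (p2 :: (nat, 'k) rep_mor)"
    using biproduct[OF F_rep F_rep, of y1 y2] by blast
  have EO: "E \<in> Obj R" using E by simp
  have i1: "i1 \<in> Hom R (F y1) E" and i2: "i2 \<in> Hom R (F y2) E" and p1: "p1 \<in> Hom R E (F y1)" and p2: "p2 \<in> Hom R E (F y2)"
    and b11: "Comp R (F y1) E (F y1) p1 i1 = Ide R (F y1)" and b22: "Comp R (F y2) E (F y2) p2 i2 = Ide R (F y2)"
    and b12: "Comp R (F y1) E (F y2) p2 i1 = Zero R (F y1) (F y2)" and b21: "Comp R (F y2) E (F y1) p1 i2 = Zero R (F y2) (F y1)"
    and bs: "Add R E E (Comp R E (F y1) E i1 p1) (Comp R E (F y2) E i2 p2) = Ide R E"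
    using B unfolding is_biproduct_def by auto
  note [simp] = F_Obj EO i1 i2 p1 p2
  define A1 where "A1 = (idm t y1 :: (nat, 'k) rep_mor)"
  define A2 where "A2 = (idm t y2 :: (nat, 'k) rep_mor)"
  define C1 where "C1 = (idm y1 x :: (nat, 'k) rep_mor)"
  define C2 where "C2 = (idm y2 x :: (nat, 'k) rep_mor)"
  have A1 [simp]: "A1 \<in> Hom R (F t) (F y1)" and A2 [simp]: "A2 \<in> Hom R (F t) (F y2)"
    and C1 [simp]: "C1 \<in> Hom R (F y1) (F x)" and C2 [simp]: "C2 \<in> Hom R (F y2) (F x)"
    unfolding A1_def A2_def C1_def C2_def by (rule identity_on_Hom; use ms bd in blast)+
  define f where "f = Add R (F t) E (Comp R (F t) (F y1) E i1 A1) (Comp R (F t) (F y2) E i2 A2)"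
  \<comment> \<open>The minus sign makes the two ways around the mesh cancel, since both are the
    identity on the common support.\<close>
  define g where "g = Add R E (F x) (Comp R E (F y1) (F x) C1 p1) (Scl R E (F x) (- 1) (Comp R E (F y2) (F x) C2 p2))"
  have f [simp]: "f \<in> Hom R (F t) E" unfolding f_def by (intro R.add_in R.comp_in) (simp_all del: rep_sel)
  have g [simp]: "g \<in> Hom R E (F x)" unfolding g_def by (intro R.add_in R.comp_in R.scl_in) (simp_all del: rep_sel)
  have p1f: "Comp R (F t) E (F y1) p1 f = A1"
    unfolding f_def using R.comp_assoc[of "F t" "F y1" E "F y1" A1 i1 p1, symmetric] R.comp_assoc[of "F t" "F y2" E "F y1" A2 i2 p1, symmetric] b11 b21
    by (simp add: R.comp_add_right del: rep_sel)
  have p2f: "Comp R (F t) E (F y2) p2 f = A2"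
    unfolding f_def using R.comp_assoc[of "F t" "F y1" E "F y2" A1 i1 p2, symmetric] R.comp_assoc[of "F t" "F y2" E "F y2" A2 i2 p2, symmetric] b22 b12
    by (simp add: R.comp_add_right del: rep_sel)
  have gi1: "Comp R (F y1) E (F x) g i1 = C1"
    unfolding g_def using b11 b12 by (simp add: R.comp_add_left R.comp_assoc del: rep_sel)
  have gi2: "Comp R (F y2) E (F x) g i2 = Scl R (F y2) (F x) (- 1) C2"
    unfolding g_def using b22 b21 by (simp add: R.comp_add_left R.comp_assoc del: rep_sel)
  have ev: "p1 v (f v z) = A1 v z" "p2 v (f v z) = A2 v z" "g v (i1 v a) = C1 v a" "g v (i2 v b) = vscale (- 1) (C2 v b)" for v z a b
    using fun_cong[OF p1f, of v] fun_cong[OF p2f, of v] fun_cong[OF gi1, of v] fun_cong[OF gi2, of v]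
    by (auto simp: fun_eq_iff)
  have fe: "f v z = i1 v (A1 v z) + i2 v (A2 v z)" for v z
    unfolding f_def by (simp add: fun_ext plus_fun_def)
  have ge: "g v e = C1 v (p1 v e) + vscale (- 1) (C2 v (p2 v e))" for v e
    unfolding g_def by (simp add: fun_ext plus_fun_def)
  have ee: "i1 v (p1 v e) + i2 v (p2 v e) = e" if "v \<in> verts Q" "e \<in> space_at E v" for v e
    using fun_cong[OF fun_cong[OF bs, of v], of e] that by (simp add: plus_fun_def)
  have A1v: "A1 v z = (if v \<in> supp t \<and> v \<in> supp y1 \<and> z \<in> line then z else 0)"
    and A2v: "A2 v z = (if v \<in> supp t \<and> v \<in> supp y2 \<and> z \<in> line then z else 0)"
    and C1v: "C1 v z = (if v \<in> supp y1 \<and> v \<in> supp x \<and> z \<in> line then z else 0)"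
    and C2v: "C2 v z = (if v \<in> supp y2 \<and> v \<in> supp x \<and> z \<in> line then z else 0)" for v z
    by (auto simp: A1_def A2_def C1_def C2_def identity_on_def)
  have un: "v \<in> supp t \<or> v \<in> supp x \<longleftrightarrow> v \<in> supp y1 \<or> v \<in> supp y2" "v \<in> supp t \<and> v \<in> supp x \<longleftrightarrow> v \<in> supp y1 \<and> v \<in> supp y2" for v
    using ms(1,2) by blast+
  have inj: "inj_on (f v) (space_at (F t) v)" if "v \<in> verts Q" for v
  proof (rule inj_onI)
    fix z z' assume z: "z \<in> space_at (F t) v" "z' \<in> space_at (F t) v" "f v z = f v z'"
    then have "A1 v z = A1 v z'" "A2 v z = A2 v z'" using ev(1,2)[of v z] ev(1,2)[of v z'] by simp_all
    then show "z = z'" using z(1,2) un[of v] by (auto simp: F_space A1v A2v split: if_splits)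
  qed
  have im: "f v ` space_at (F t) v = {e \<in> space_at E v. g v e = 0}" if v: "v \<in> verts Q" for v
  proof (intro subset_antisym subsetI)
    fix e assume "e \<in> f v ` space_at (F t) v"
    then obtain z where z: "z \<in> space_at (F t) v" "e = f v z" by blast
    have "g v e = C1 v (A1 v z) + vscale (- 1) (C2 v (A2 v z))" using z ge ev by simp
    also have "\<dots> = 0" using z(1) un[of v] by (auto simp: A1v A2v C1v C2v F_space)
    finally show "e \<in> {e \<in> space_at E v. g v e = 0}" using z lm_in[OF rep_lm[OF f v] z(1)] by simp
  next
    fix e assume "e \<in> {e \<in> space_at E v. g v e = 0}"
    then have e: "e \<in> space_at E v" "C1 v (p1 v e) = C2 v (p2 v e)" using ge[of v e] by auto
    define a where "a = p1 v e"
    define b where "b = p2 v e"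
    have ab: "a \<in> space_at (F y1) v" "b \<in> space_at (F y2) v"
      using lm_in[OF rep_lm[OF p1 v] e(1)] lm_in[OF rep_lm[OF p2 v] e(1)] by (simp_all add: a_def b_def)
    have c: "C1 v a = C2 v b" using e(2) by (simp add: a_def b_def)
    \<comment> \<open>The preimage is whichever component is supported at \<open>v\<close>; where
      both are, the kernel condition makes them agree. Outside the support of \<open>t\<close> it is
      0.\<close>
    have "\<exists>z\<in>space_at (F t) v. A1 v z = a \<and> A2 v z = b"
    proof (cases "v \<in> supp y1")
      case True
      then show ?thesis using ab c un[of v]
        by (intro bexI[of _ "if v \<in> supp t then a else 0"]) (auto simp: F_space A1v A2v C1v C2v split: if_splits)
    next
      case False
      then show ?thesis using ab c un[of v]
        by (intro bexI[of _ "if v \<in> supp t then b else 0"]) (auto simp: F_space A1v A2v C1v C2v split: if_splits)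
    qed
    then obtain z where z: "z \<in> space_at (F t) v" "A1 v z = a" "A2 v z = b" by blast
    then have "f v z = e" using fe[of v z] ee[OF v e(1)] by (simp add: a_def b_def)
    then show "e \<in> f v ` space_at (F t) v" using z by blast
  qed
  have surj: "g v ` space_at E v = space_at (F x) v" if v: "v \<in> verts Q" for v
  proof (intro subset_antisym subsetI)
    fix y :: "nat \<Rightarrow> 'k" assume "y \<in> g v ` space_at E v" then show "y \<in> space_at (F x) v" using lm_in[OF rep_lm[OF g v]] by auto
  next
    fix y :: "nat \<Rightarrow> 'k" assume y: "y \<in> space_at (F x) v"
    show "y \<in> g v ` space_at E v"
    \<comment> \<open>Vectors are lifted through the first middle term where possible, otherwise
      through the second, with a sign to compensate the one in \<open>g\<close>.\<close>
    proof (cases "v \<in> supp y1")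
      case True
      then have "i1 v y \<in> space_at E v" using lm_in[OF rep_lm[OF i1 v], of y] y by (auto simp: F_space split: if_splits)
      moreover have "g v (i1 v y) = y" using ev(3)[of v y] True y by (auto simp: C1v F_space split: if_splits)
      ultimately show ?thesis by (metis imageI)
    next
      case False
      have y': "vscale (- 1) y \<in> space_at (F y2) v"
        using y False un[of v] by (auto simp: F_space seq.subspace_neg[OF subspace_line] split: if_splits)
      then have "i2 v (vscale (- 1) y) \<in> space_at E v" using lm_in[OF rep_lm[OF i2 v]] by blast
      moreover have "g v (i2 v (vscale (- 1) y)) = y"
        using ev(4)[of v "vscale (- 1) y"] y y' False un[of v] by (auto simp: C2v F_space split: if_splits)
      ultimately show ?thesis by (metis imageI)
    qed
  qed
  have ex: "short_exact R (F t) E (F x) f g"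
    unfolding short_exact_def
    using kernelI[OF F_rep E F_rep f g inj im] cokernelI[OF F_rep E F_rep f g surj] im by auto
  have y1S: "y1 \<in> S \<or> supp y1 = {}" and y2S: "y2 \<in> S \<or> supp y2 = {}" using ms(11,12) by blast+
  have nsm: "\<not> split_mono R (F t) E f"
  proof
    \<comment> \<open>A retraction is made up of maps from the middle terms back to
      \<open>F t\<close>, all of which vanish.\<close>
    assume "split_mono R (F t) E f"
    then obtain u where u [simp]: "u \<in> Hom R E (F t)" and uf: "Comp R (F t) E (F t) u f = Ide R (F t)"
      unfolding split_mono_def by blast
    have "Comp R (F y1) E (F t) u i1 = Zero R (F y1) (F t)"
      by (rule F_Hom_backwards_zero[OF R.comp_in y1S]) (use t(1) ms in \<open>simp_all del: rep_sel\<close>)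
    moreover have "Comp R (F y2) E (F t) u i2 = Zero R (F y2) (F t)"
      by (rule F_Hom_backwards_zero[OF R.comp_in y2S]) (use t(1) ms in \<open>simp_all del: rep_sel\<close>)
    ultimately have "Comp R (F t) E (F t) u f = Zero R (F t) (F t)"
      unfolding f_def using R.comp_assoc[of "F t" "F y1" E "F t" A1 i1 u, symmetric] R.comp_assoc[of "F t" "F y2" E "F t" A2 i2 u, symmetric]
      by (simp add: R.comp_add_right del: rep_sel)
    then show False using uf F_ide_nonzero[OF t(1)] by metis
  qed
  have nse: "\<not> split_epi R E (F x) g"
  proof
    assume "split_epi R E (F x) g"
    then obtain u where u [simp]: "u \<in> Hom R (F x) E" and gu: "Comp R (F x) E (F x) g u = Ide R (F x)"
      unfolding split_epi_def by blast
    have "Comp R (F x) E (F y1) p1 u = Zero R (F x) (F y1)"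
      by (rule F_Hom_backwards_zero[OF R.comp_in _ y1S]) (use t(2) ms in \<open>simp_all del: rep_sel\<close>)
    moreover have "Comp R (F x) E (F y2) p2 u = Zero R (F x) (F y2)"
      by (rule F_Hom_backwards_zero[OF R.comp_in _ y2S]) (use t(2) ms in \<open>simp_all del: rep_sel\<close>)
    ultimately have "Comp R (F x) E (F x) g u = Zero R (F x) (F x)"
      unfolding g_def by (simp add: R.comp_add_left R.comp_assoc del: rep_sel)
    then show False using gu F_ide_nonzero[OF t(2)] by metis
  qed
  have left: "\<exists>u\<in>Hom R E W. Comp R (F t) E W u f = h"
    if W: "W \<in> Obj R" and h: "h \<in> Hom R (F t) W" and ns: "\<not> split_mono R (F t) W h" for W h
  proof -
    obtain zs \<iota> \<pi> where zs: "zs \<in> lists S" and D: "is_dsum R (map F zs) W \<iota> \<pi>"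
      using decomposition[of W] W by auto
    have mO: "map F zs \<in> lists (Obj R)" by (auto simp: in_lists_conv_set)
    show ?thesis
    proof (rule R.dsum_factor_left[OF EO F_Obj W mO D f h])
      fix k assume "k < length (map F zs)"
      then have k: "k < length zs" by simp
      then have z: "zs ! k \<in> S" and \<pi>: "\<pi> k \<in> Hom R W (F (zs ! k))" using zs is_dsumD(2)[OF D, of k] by (auto simp: in_lists_conv_set)
      define z where "z = zs ! k"
      note z = z[folded z_def] and \<pi> = \<pi>[folded z_def]
      define a where "a = Comp R (F t) W (F z) (\<pi> k) h"
      have a: "a \<in> Hom R (F t) (F z)" unfolding a_def by (rule R.comp_in[OF F_Obj W F_Obj h \<pi>])
      have "\<exists>u\<in>Hom R E (F z). Comp R (F t) E (F z) u f = a"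
      proof (cases "a = 0")
        case True
        then show ?thesis using R.comp_zero_left[OF F_Obj EO F_Obj f, of z] R.zero_in[OF EO F_Obj, of z]
          by (intro bexI[of _ "Zero R E (F z)"]) (simp_all only: rep_sel(5))
      next
        case False
        then have l: "linked t z" using F_Hom(2)[OF t(1) z a] by blast
        obtain c where c: "a = smul c (idm t z)" using F_Hom(1)[OF t(1) z a] by blast
        \<comment> \<open>If \<open>z\<close> were \<open>t\<close>, the component would be a
          nonzero multiple of the identity, and rescaling \<open>\<pi> k\<close> would split
          \<open>h\<close>.\<close>
        have "t \<noteq> z"
        proof
          assume e: "t = z"
          have c0: "c \<noteq> 0" using False c by (auto simp: fun_ext)
          have "Comp R (F t) W (F t) (Scl R W (F t) (inverse c) (\<pi> k)) h = Scl R (F t) (F t) (inverse c) a"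
            unfolding a_def e by (rule R.comp_scl_left[OF F_Obj W F_Obj _ \<pi>]) (use h e in simp)
          also have "\<dots> = Ide R (F t)" unfolding F_ide[OF t(1)] using c c0 e by simp
          finally have "split_mono R (F t) W h"
            unfolding split_mono_def using R.scl_in[OF W F_Obj \<pi>] e by metis
          then show False using ns by blast
        qed
        then obtain y where y: "(t, y) \<in> P" "linked y z" using first_pivot[OF t(1) z l] by blast
        then have yS: "y \<in> S" and yy: "y = y1 \<or> y = y2" using sh(2)[of y] by auto
        have sl: "sle t y" "sle y z" using P_sle[OF y(1)] linked_sle[OF y(2)] by auto
        have q: "smul c (idm y z) \<in> Hom R (F y) (F z)" by (rule scaled_identity_Hom[OF yS z sl(2)])
        have comp: "Comp R (F t) (F y) (F z) (smul c (idm y z)) (idm t y) = a"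
        proof -
          have "supp t \<inter> supp y \<inter> (supp y \<inter> supp z) = supp t \<inter> supp z" using supp_between[OF sl] by auto
          then show ?thesis using scaled_identity_comp[of c "supp y \<inter> supp z" 1 "supp t \<inter> supp y"] c by simp
        qed
        from yy show ?thesis
        proof
          assume e: "y = y1"
          have "Comp R (F t) E (F z) (Comp R E (F y1) (F z) (smul c (idm y1 z)) p1) f = a"
            using R.comp_assoc[OF F_Obj EO F_Obj F_Obj f p1 q[unfolded e]] p1f comp[unfolded e] by (simp add: A1_def del: rep_sel)
          then show ?thesis using R.comp_in[OF EO F_Obj F_Obj p1 q[unfolded e]] by blast
        next
          assume e: "y = y2"
          have "Comp R (F t) E (F z) (Comp R E (F y2) (F z) (smul c (idm y2 z)) p2) f = a"
            using R.comp_assoc[OF F_Obj EO F_Obj F_Obj f p2 q[unfolded e]] p2f comp[unfolded e] by (simp add: A2_def del: rep_sel)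
          then show ?thesis using R.comp_in[OF EO F_Obj F_Obj p2 q[unfolded e]] by blast
        qed
      qed
      then show "\<exists>u\<in>Hom R E (map F zs ! k). Comp R (F t) E (map F zs ! k) u f = Comp R (F t) W (map F zs ! k) (\<pi> k) h"
        using k unfolding a_def z_def by simp
    qed
  qed
  have right: "\<exists>u\<in>Hom R W E. Comp R W E (F x) g u = h"
    if W: "W \<in> Obj R" and h: "h \<in> Hom R W (F x)" and ns: "\<not> split_epi R W (F x) h" for W h
  proof -
    obtain zs \<iota> \<pi> where zs: "zs \<in> lists S" and D: "is_dsum R (map F zs) W \<iota> \<pi>"
      using decomposition[of W] W by auto
    have mO: "map F zs \<in> lists (Obj R)" by (auto simp: in_lists_conv_set)
    show ?thesis
    proof (rule R.dsum_factor_right[OF EO F_Obj W mO D g h])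
      fix k assume "k < length (map F zs)"
      then have k: "k < length zs" by simp
      then have z: "zs ! k \<in> S" and \<iota>: "\<iota> k \<in> Hom R (F (zs ! k)) W" using zs is_dsumD(1)[OF D, of k] by (auto simp: in_lists_conv_set)
      define z where "z = zs ! k"
      note z = z[folded z_def] and \<iota> = \<iota>[folded z_def]
      define a where "a = Comp R (F z) W (F x) h (\<iota> k)"
      have a: "a \<in> Hom R (F z) (F x)" unfolding a_def by (rule R.comp_in[OF F_Obj W F_Obj \<iota> h])
      have "\<exists>u\<in>Hom R (F z) E. Comp R (F z) E (F x) g u = a"
      proof (cases "a = 0")
        case True
        then show ?thesis using R.comp_zero_right[OF F_Obj EO F_Obj g, of z] R.zero_in[OF F_Obj EO, of z]
          by (intro bexI[of _ "Zero R (F z) E"]) (simp_all only: rep_sel(5))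
      next
        case False
        then have l: "linked z x" using F_Hom(2)[OF z t(2) a] by blast
        obtain c where c: "a = smul c (idm z x)" using F_Hom(1)[OF z t(2) a] by blast
        have "z \<noteq> x"
        proof
          assume e: "z = x"
          have c0: "c \<noteq> 0" using False c by (auto simp: fun_ext)
          have "Comp R (F x) W (F x) h (Scl R (F x) W (inverse c) (\<iota> k)) = Scl R (F x) (F x) (inverse c) a"
            unfolding a_def e by (rule R.comp_scl_right[OF F_Obj W F_Obj _ h]) (use \<iota> e in simp)
          also have "\<dots> = Ide R (F x)" unfolding F_ide[OF t(2)] using c c0 e by simp
          finally have "split_epi R W (F x) h"
            unfolding split_epi_def using R.scl_in[OF F_Obj W \<iota>] e by metis
          then show False using ns by blast
        qed
        then obtain y where y: "(y, x) \<in> P" "linked z y" using last_pivot[OF z t(2) l] by blast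
        then have yS: "y \<in> S" and yy: "y = y1 \<or> y = y2" using sh(1)[of y] by auto
        have sl: "sle z y" "sle y x" using P_sle[OF y(1)] linked_sle[OF y(2)] by auto
        have q: "smul d (idm z y) \<in> Hom R (F z) (F y)" for d by (rule scaled_identity_Hom[OF z yS sl(1)])
        have comp: "(\<lambda>v. idm y x v \<circ> smul d (idm z y) v) = smul d (idm z x)" for d :: 'k
        proof -
          have "supp z \<inter> supp y \<inter> (supp y \<inter> supp x) = supp z \<inter> supp x" using supp_between[OF sl] by auto
          then show ?thesis using scaled_identity_comp[of 1 "supp y \<inter> supp x" d "supp z \<inter> supp y"] by simp
        qed
        from yy show ?thesis
        proof
          assume e: "y = y1"
          have "Comp R (F z) E (F x) g (Comp R (F z) (F y1) E i1 (smul c (idm z y1))) = Comp R (F z) (F y1) (F x) C1 (smul c (idm z y1))"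
            using R.comp_assoc[OF F_Obj F_Obj EO F_Obj q[unfolded e] i1 g] gi1 by (simp del: rep_sel)
          also have "\<dots> = a" using comp[of c, unfolded e] c by (simp add: C1_def)
          finally show ?thesis using R.comp_in[OF F_Obj F_Obj EO q[unfolded e] i1] by blast
        next
          assume e: "y = y2"
          \<comment> \<open>The coefficient \<open>- c\<close> compensates the sign of
            \<open>g\<close> on the second middle term.\<close>
          have "Comp R (F z) E (F x) g (Comp R (F z) (F y2) E i2 (smul (- c) (idm z y2)))
             = Comp R (F z) (F y2) (F x) (Scl R (F y2) (F x) (- 1) C2) (smul (- c) (idm z y2))"
            unfolding gi2[symmetric] by (rule R.comp_assoc[OF F_Obj F_Obj EO F_Obj q[unfolded e] i2 g, symmetric])
          also have "\<dots> = Scl R (F z) (F x) (- 1) (Comp R (F z) (F y2) (F x) C2 (smul (- c) (idm z y2)))"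
            by (rule R.comp_scl_left[OF F_Obj F_Obj F_Obj q[unfolded e] C2])
          also have "\<dots> = a" using comp[of "- c", unfolded e] c by (simp add: C2_def)
          finally show ?thesis using R.comp_in[OF F_Obj F_Obj EO q[unfolded e] i2] by blast
        qed
      qed
      then show "\<exists>u\<in>Hom R (map F zs ! k) E. Comp R (map F zs ! k) E (F x) g u = Comp R (map F zs ! k) W (F x) h (\<iota> k)"
        using k unfolding a_def z_def by simp
    qed
  qed
  have "almost_split_sequence R (F t) E (F x) f g"
    unfolding almost_split_sequence_def using ex nsm nse left right by blast
  then show ?thesis using EO by blast
qed

text \<open>The right-hand map of the almost split sequence is an epimorphism onto
  \<open>F x\<close> that does not split.\<close>

lemma mesh_end_not_projective:
  assumes t: "t \<in> S" "x \<in> S" "x = (s (fst t), s (snd t))"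
  shows "\<not> projective_object R (F x :: (nat, 'k::field) rep)"
proof
  assume pr: "projective_object R (F x :: (nat, 'k) rep)"
  obtain E f g where E: "E \<in> Obj R" and A: "almost_split_sequence R (F t) E (F x :: (nat, 'k) rep) f g"
    using mesh_almost_split[OF t] by blast
  then have "is_cokernel R (F t) E (F x) f g" "\<not> split_epi R E (F x) g"
    unfolding almost_split_sequence_def short_exact_def by auto
  then show False
    using pr R.cokernel_epi[OF F_Obj E F_Obj] E F_Obj R.ide_in[OF F_Obj] unfolding projective_object_def split_epi_def by metis
qed

text \<open>The description by \<open>THE\<close> is unambiguous: left-hand terms of two almost
  split sequences are isomorphic by \<open>almost_split_unique\<close>, hence equal by
  \<open>F_iso\<close>.\<close>

lemma translate_some:
  assumes t: "t \<in> S" "x \<in> S" "x = (s (fst t), s (snd t))"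
  shows "AR_translate R (ind_objects n) (F x) = Some (F t :: (nat, 'k::field) rep)"
proof -
  obtain E f g where E: "E \<in> Obj R" and A: "almost_split_sequence R (F t) E (F x :: (nat, 'k) rep) f g"
    using mesh_almost_split[OF t] by blast
  have "(THE X. X \<in> ind_objects n \<and> (\<exists>e\<in>Obj R. \<exists>f g. almost_split_sequence R X e (F x) f g)) = (F t :: (nat, 'k) rep)"
  proof (rule the_equality)
    show "F t \<in> ind_objects n \<and> (\<exists>e\<in>Obj R. \<exists>f g. almost_split_sequence R (F t) e (F x :: (nat, 'k) rep) f g)"
      using F_in_ind[OF t(1)] E A by blast
    fix X :: "(nat, 'k) rep" assume "X \<in> ind_objects n \<and> (\<exists>e\<in>Obj R. \<exists>f g. almost_split_sequence R X e (F x) f g)"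
    then obtain u e' f' g' where u: "u \<in> S" "X = F u" and e': "e' \<in> Obj R" and B: "almost_split_sequence R X e' (F x) f' g'"
      unfolding F_image[symmetric] by blast
    have "isomorphic_in R (F u) (F t :: (nat, 'k) rep)"
      by (rule R.almost_split_unique[OF F_Obj e' F_Obj F_Obj E B[unfolded u] A F_End[OF u(1)] F_End[OF t(1)]])
    then show "X = F t" using F_iso[OF u(1) t(1)] u(2) by blast
  qed
  then show ?thesis unfolding AR_translate_def using mesh_end_not_projective[OF t, where 'k = 'k] by simp
qed

text \<open>A missing translate means \<open>r j \<le> r i\<close>. The neighbours then show that
  the arrows within the interval point left before a vertex \<open>v\<close> and right after it, and
  that none leaves the interval. This is the support of the projective at \<open>v\<close>.\<close>

lemma untranslated_shape:
  assumes x: "x \<in> S" and none: "R_segment n Q x = None"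
  obtains v where "v \<in> supp x" "\<And>m. fst x < m \<Longrightarrow> m < v \<Longrightarrow> m \<in> low" "\<And>m. v \<le> m \<Longrightarrow> m < snd x \<Longrightarrow> m \<in> up"
    "fst x \<notin> low" "snd x \<notin> up"
proof -
  obtain i j where ij: "x = (i, j)" by (cases x)
  have b: "i < j" "j \<le> n + 2" using x ij by (auto simp: S_iff)
  have le: "r j \<le> r i" using none by (simp add: R_segment_def ij split: if_splits)
  have jn: "j \<notin> up"
  proof
    assume ju: "j \<in> up"
    then have rj: "j < r j" using r_up[of j] by auto
    have "r i \<le> j"
    proof (rule ccontr)
      assume n1: "\<not> r i \<le> j"
      then have "i = 0 \<or> i \<in> up" using r_down[of i] vertex_cases(2)[of i] b by auto
      then have "j \<in> low" using r_up[of i] n1 b by auto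
      then show False using ju disj by blast
    qed
    then show False using rj le by simp
  qed
  then have "j \<in> low \<or> j = n + 2" using vertex_cases(1)[of j] b by auto
  from r_down[OF this] have rj: "r j < j" "r j = 0 \<or> r j \<in> low" "\<And>m. r j < m \<Longrightarrow> m < j \<Longrightarrow> m \<in> up"
    by blast+
  have inl: "i \<notin> low"
  proof
    assume il: "i \<in> low"
    then have "r i < i" using r_down[of i] by auto
    moreover have "i \<le> r j" using rj(3)[of i] il disj[of i] b by (metis leI)
    ultimately show False using le by simp
  qed
  then have "i = 0 \<or> i \<in> up" using vertex_cases(2)[of i] b by auto
  from r_up[OF this] have ri: "i < r i" "\<And>m. i < m \<Longrightarrow> m < r i \<Longrightarrow> m \<in> low" by blast+
  show ?thesis
  \<comment> \<open>\<open>max i (r j)\<close> is the last lower vertex strictly between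
    \<open>i\<close> and \<open>j\<close>, or \<open>i\<close> if there is none; the source
    \<open>v\<close> is the next vertex.\<close>
  proof (rule that[of "max i (r j) + 1"])
    show "max i (r j) + 1 \<in> supp x" using b rj(1) by (auto simp: supp_def ij)
    fix m
    { assume "fst x < m" "m < max i (r j) + 1"
      then have m: "i < m" "m \<le> r j" by (auto simp: ij)
      then show "m \<in> low" using ri(2)[of m] rj(2) le by (cases "m = r j") auto }
    { assume "max i (r j) + 1 \<le> m" "m < snd x"
      then show "m \<in> up" using rj(3)[of m] by (auto simp: ij) }
  qed (use inl jn in \<open>auto simp: ij\<close>)
qed

text \<open>The interval is generated by its vector at \<open>v\<close>, so a lift is obtained from
  a preimage \<open>x0\<close> of the image of that vector, transported outwards along the arrows.
  The family is compatible because no arrow leaves the support.\<close>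

lemma untranslated_projective:
  assumes x: "x \<in> S" and none: "R_segment n Q x = None"
  shows "projective_object R (F x :: (nat, 'k::field) rep)"
  unfolding projective_object_def
proof (intro conjI ballI impI F_Obj allI)
  fix X Y :: "(nat, 'k) rep" and e h
  assume "X \<in> Obj R" "Y \<in> Obj R" and e: "is_epi R X Y e" and h: "h \<in> Hom R (F x) Y"
  then have X: "representation Q X" and Y: "representation Q Y" by auto
  have eH: "e \<in> Hom R X Y" using e unfolding is_epi_def by blast
  obtain v where v: "v \<in> supp x" and lo: "\<And>m. fst x < m \<Longrightarrow> m < v \<Longrightarrow> m \<in> low"
    and hi: "\<And>m. v \<le> m \<Longrightarrow> m < snd x \<Longrightarrow> m \<in> up" and fx: "fst x \<notin> low" and sx: "snd x \<notin> up"
    by (rule untranslated_shape[OF x none]) blast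
  have supp: "m \<in> supp x \<longleftrightarrow> fst x < m \<and> m \<le> snd x" for m by (auto simp: supp_def)
  have vQ: "m \<in> verts Q" if "m \<in> supp x" for m using supp_verts[OF x that] by simp
  have "h v unit0 \<in> space_at Y v" using lm_in[OF rep_lm[OF h vQ[OF v]], of unit0] v by (simp add: F_space)
  then obtain x0 where x0: "x0 \<in> space_at X v" "e v x0 = h v unit0"
    using epi_surj[OF X Y e vQ[OF v]] by (metis imageE)
  \<comment> \<open>\<open>wu d\<close> and \<open>wd d\<close> are the transports of
    \<open>x0\<close> over \<open>d\<close> arrows to the right and to the left.\<close>
  define wu where "wu = rec_nat x0 (\<lambda>d y. map_at X (v + d, Suc (v + d)) y)"
  define wd where "wd = rec_nat x0 (\<lambda>d y. map_at X (v - d, v - d - 1) y)"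
  define w where "w m = (if v \<le> m then wu (m - v) else wd (v - m))" for m
  have wv: "w v = x0" by (simp add: w_def wu_def)
  have wup: "w (Suc m) = map_at X (m, Suc m) (w m)" if "v \<le> m" for m
    using that by (simp add: w_def wu_def Suc_diff_le)
  have wdown: "w m = map_at X (Suc m, m) (w (Suc m))" if "m < v" for m
  proof -
    have d: "v - m = Suc (v - Suc m)" using that by simp
    have "w m = wd (Suc (v - Suc m))" using that d by (simp add: w_def)
    also have "\<dots> = map_at X (v - (v - Suc m), v - (v - Suc m) - 1) (wd (v - Suc m))" by (simp add: wd_def)
    also have "v - (v - Suc m) = Suc m" using that by simp
    also have "wd (v - Suc m) = w (Suc m)" using that by (cases "Suc m = v") (auto simp: w_def wd_def wu_def)
    finally show ?thesis by simp
  qed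
  have w: "w m \<in> space_at X m \<and> e m (w m) = h m unit0" if "m \<in> supp x" for m
  proof (cases "v \<le> m")
    case True
    then show ?thesis using that
    proof (induction m rule: dec_induct)
      case base
      then show ?case using x0 wv by simp
    next
      case (step m)
      then have m: "m \<in> supp x" "m < snd x" using v by (auto simp: supp)
      have ab: "(m, Suc m) \<in> arrs Q" using hi[of m] step m by (simp add: arr_iff)
      have IH: "w m \<in> space_at X m" "e m (w m) = h m unit0" using step m by auto
      have "h (Suc m) unit0 = map_at Y (m, Suc m) (h m unit0)"
        using rep_nat[OF h ab, of unit0] m step.prems by (simp add: F_space F_map)
      then show ?case using wup[of m] step IH lm_in[OF rep_map[OF X ab] IH(1)] rep_nat[OF eH ab IH(1)] by simp
    qed
  next
    case False
    then have "m \<le> v" by simp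
    then show ?thesis using that
    proof (induction m rule: inc_induct)
      case base
      then show ?case using x0 wv by simp
    next
      case (step m)
      then have m: "Suc m \<in> supp x" "fst x < m" using v by (auto simp: supp)
      have ab: "(Suc m, m) \<in> arrs Q" using lo[of m] step m by (simp add: arr_iff)
      have IH: "w (Suc m) \<in> space_at X (Suc m)" "e (Suc m) (w (Suc m)) = h (Suc m) unit0" using step m by auto
      have "h m unit0 = map_at Y (Suc m, m) (h (Suc m) unit0)"
        using rep_nat[OF h ab, of unit0] m step.prems by (simp add: F_space F_map)
      then show ?case using wdown[of m] step IH lm_in[OF rep_map[OF X ab] IH(1)] rep_nat[OF eH ab IH(1)] by simp
    qed
  qed
  define l where "l = (\<lambda>m z. if m \<in> supp x \<and> z \<in> line then vscale (z 0) (w m) else (0 :: nat \<Rightarrow> 'k))"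
  have l: "l \<in> Hom R (F x) X"
    unfolding l_def
  proof (rule family_Hom[OF X x])
    fix a b assume ab: "(a, b) \<in> arrs Q" and a: "a \<in> supp x"
    show "map_at X (a, b) (w a) = (if b \<in> supp x then w b else 0)"
      using ab unfolding arr_iff
    proof
      assume u: "b = a + 1 \<and> a \<in> up"
      then have "b \<in> supp x" using a sx by (cases "a = snd x") (auto simp: supp)
      moreover have "v \<le> a" using lo[of a] a u disj[of a] by (metis leI supp)
      ultimately show ?thesis using wup[of a] u by simp
    next
      assume u: "a = b + 1 \<and> b \<in> low"
      then have "b \<in> supp x" using a fx by (cases "b = fst x") (auto simp: supp)
      moreover have "b < v" using hi[of b] a u disj[of b] by (auto simp: supp not_le[symmetric])
      ultimately show ?thesis using wdown[of b] u by simp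
    qed
  qed (use w in blast)
  have "Comp R (F x) X Y e l = h"
  proof (rule rep_hom_eqI[OF R.comp_in[OF F_Obj _ _ l eH] h])
    fix m and z :: "nat \<Rightarrow> 'k" assume m: "m \<in> verts Q" and z: "z \<in> space_at (F x) m"
    show "Comp R (F x) X Y e l m z = h m z"
    proof (cases "m \<in> supp x")
      case True
      then have zl: "z \<in> line" using z by (simp add: F_space)
      then have z': "z = vscale (z 0) unit0" by (simp flip: line_iff)
      have "e m (vscale (z 0) (w m)) = vscale (z 0) (h m unit0)" using lm_scl[OF rep_lm[OF eH m]] w[OF True] by simp
      also have "\<dots> = h m (vscale (z 0) unit0)" using lm_scl[OF rep_lm[OF h m], of unit0 "z 0"] True by (simp add: F_space)
      finally show ?thesis using True zl z' by (simp add: l_def)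
    next
      case False
      then show ?thesis using z lm_zero[OF rep_lm[OF h m]] lm_zero[OF rep_lm[OF eH m]] by (simp add: F_space l_def)
    qed
  qed (use X Y in auto)
  then show "\<exists>l\<in>Hom R (F x) X. Comp R (F x) X Y e l = h" using l by blast
qed

lemma translate_eq:
  assumes x: "x \<in> S"
  shows "map_option F (R_segment n Q x) = AR_translate R (ind_objects n :: (nat, 'k::field) rep set) (F x)"
proof (cases "R_segment n Q x")
  case None
  then show ?thesis using untranslated_projective[OF x None, where 'k = 'k] by (simp add: AR_translate_def)
next
  case (Some t)
  then have "t \<in> S" "x = (s (fst t), s (snd t))" using R_segment_iff[OF x] by auto
  then show ?thesis using translate_some[OF _ x, of t, where 'k = 'k] Some by simp
qed

lemma F_bij: "bij_betw F S (ind_objects n :: (nat, 'k::field) rep set)"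
  using F_inj F_image by (simp add: bij_betw_def)

lemma AR_quiver_iso:
  "translation_quiver_iso \<Gamma> (AR_quiver R (ind_objects n :: (nat, 'k::field) rep set)) F"
proof (rule translation_quiver_transport[OF polygon_translation_quiver])
  let ?A = "AR_quiver R (ind_objects n :: (nat, 'k) rep set)"
  show "bij_betw F (verts \<Gamma>) (verts ?A)" using F_bij by (simp add: AR_quiver_def)
  show "arrs ?A \<subseteq> verts ?A \<times> verts ?A" by (auto simp: AR_quiver_def)
  fix x assume "x \<in> verts \<Gamma>" then have x: "x \<in> S" by simp
  then show "transl ?A (F x) = map_option F (transl \<Gamma> x)" by (simp add: AR_quiver_def translate_eq[OF x])
  fix y assume "y \<in> verts \<Gamma>" then have y: "y \<in> S" by simp
  have "(x, y) \<in> P \<longleftrightarrow> (\<exists>f. irreducible_morphism R (F x) (F y :: (nat, 'k) rep) f)"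
  proof
    assume "(x, y) \<in> P"
    then have "irreducible_morphism R (F x) (F y) (smul 1 (idm x y) :: (nat, 'k) rep_mor)" by (rule pivot_irreducible) simp
    then show "\<exists>f. irreducible_morphism R (F x) (F y :: (nat, 'k) rep) f" by blast
  next
    assume "\<exists>f. irreducible_morphism R (F x) (F y :: (nat, 'k) rep) f"
    then show "(x, y) \<in> P" by (elim exE) (rule irreducible_pivot[OF x y, THEN conjunct1])
  qed
  then show "(x, y) \<in> arrs \<Gamma> \<longleftrightarrow> (F x, F y) \<in> arrs ?A"
    by (simp add: AR_quiver_def F_in_ind[OF x] F_in_ind[OF y])
qed

text \<open>A nonzero factor does not change the class, so the class attached to a pivot is
  independent of \<open>c\<close>.\<close>

lemma scalar_class_idm:
  "c \<noteq> 0 \<Longrightarrow> scalar_class R X Y (smul c \<phi>) = {smul a \<phi> | a. a \<noteq> (0::'k::field)}"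
proof -
  assume c: "c \<noteq> 0"
  have "\<exists>b. b \<noteq> 0 \<and> smul a \<phi> = smul (b * c) \<phi>" if "a \<noteq> 0" for a
    using that c by (intro exI[of _ "a / c"]) simp
  then show ?thesis unfolding scalar_class_def rep_sel using c by (auto simp: mult_eq_0_iff)
qed

section \<open>Classes of irreducible morphisms, and the extension to the additive hull\<close>

context
  fixes c :: "nat \<times> nat \<Rightarrow> nat \<times> nat \<Rightarrow> 'k::field" and Fm
  assumes hook: "hook_functor n Q c Fm"
begin

text \<open>Irreducible maps between two given intervals are nonzero multiples of one canonical map,
  so each pivot accounts for exactly one class.\<close>

lemma irreducible_classes_bij:
  "bij_betw (\<lambda>(x, y). (F x, F y, scalar_class R (F x) (F y) (Fm x y (mesh_arrow \<Gamma> x y)))) P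
    (irreducible_classes R (ind_objects n))"
proof -
  have cl: "scalar_class R (F x) (F y) (Fm x y (mesh_arrow \<Gamma> x y)) = {smul a (idm x y) | a. a \<noteq> 0}" if "(x, y) \<in> P" for x y
    unfolding hook_arrow[OF hook that] by (rule scalar_class_idm[OF c_nonzero[OF hook that]])
  show ?thesis
  proof (rule bij_betw_imageI[OF inj_onI equalityI[OF image_subsetI subsetI]])
    fix p q assume pq: "p \<in> P" "q \<in> P" and e: "(case p of (x, y) \<Rightarrow> (F x :: (nat, 'k) rep, F y :: (nat, 'k) rep, scalar_class R (F x) (F y) (Fm x y (mesh_arrow \<Gamma> x y))))
       = (case q of (x, y) \<Rightarrow> (F x, F y, scalar_class R (F x) (F y) (Fm x y (mesh_arrow \<Gamma> x y))))"
    obtain x y u v where xy: "p = (x, y)" "q = (u, v)" by (cases p; cases q)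
    have "x \<in> S" "y \<in> S" "u \<in> S" "v \<in> S" using pq xy by (auto simp: P_iff)
    moreover have "F x = (F u :: (nat, 'k) rep)" "F y = (F v :: (nat, 'k) rep)" using e xy by auto
    ultimately show "p = q" using F_inj[where 'k = 'k] xy by (auto dest: inj_onD)
  next
    fix p assume p: "p \<in> P"
    obtain x y where xy: "p = (x, y)" by (cases p)
    have S: "x \<in> S" "y \<in> S" and pP: "(x, y) \<in> P" using p xy by (auto simp: P_iff)
    have "irreducible_morphism R (F x) (F y) (Fm x y (mesh_arrow \<Gamma> x y))"
      unfolding hook_arrow[OF hook pP] by (rule pivot_irreducible[OF pP c_nonzero[OF hook pP]])
    then show "(case p of (x, y) \<Rightarrow> (F x, F y, scalar_class R (F x) (F y) (Fm x y (mesh_arrow \<Gamma> x y)))) \<in> irreducible_classes R (ind_objects n)"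
      unfolding irreducible_classes_def xy prod.case using F_in_ind[OF S(1)] F_in_ind[OF S(2)] by blast
  next
    fix q :: "(nat, 'k) rep \<times> (nat, 'k) rep \<times> (nat, 'k) rep_mor set" assume "q \<in> irreducible_classes R (ind_objects n)"
    then obtain x y f where x: "x \<in> S" "y \<in> S" and irr: "irreducible_morphism R (F x) (F y) f"
      and q: "q = (F x, F y, scalar_class R (F x) (F y) f)"
      unfolding irreducible_classes_def F_image[symmetric] by blast
    obtain d where p: "(x, y) \<in> P" and d: "d \<noteq> 0" "f = smul d (idm x y)" using irreducible_pivot[OF x irr] by blast
    have "q = (F x, F y, {smul a (idm x y) | a. a \<noteq> 0})" unfolding q d(2) by (simp only: scalar_class_idm[OF d(1)])
    then show "q \<in> (\<lambda>(x, y). (F x, F y, scalar_class R (F x) (F y) (Fm x y (mesh_arrow \<Gamma> x y)))) ` P"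
      using p cl[OF p] by (intro image_eqI[of _ _ "(x, y)"]) simp_all
  qed
qed

text \<open>The target is enlarged from the intervals to all representations, where direct sums
  exist.\<close>

lemma hook_linfun_rep: "linfun PolC R F Fm"
proof -
  have L: "linear_functor PolC IndC F Fm" using hook by (simp add: hook_functor_def)
  have O: "\<forall>x\<in>Obj (PolC :: ('k, _, _) lcat). F x \<in> Obj R" by simp
  have "is_functor PolC R F Fm"
    using L R.cat O unfolding linear_functor_def is_functor_def ind_sel by blast
  then show ?thesis
    using L R.linear unfolding linfun_def linear_functor_def ind_sel by blast
qed

lemma hull_extension_exists: "\<exists>Go Gm. extends_to_hull PolC R F Fm Go Gm"
proof -
  interpret L: linfun PolC R F Fm by (rule hook_linfun_rep)
  show ?thesis
    by (rule L.extension_to_hull_exists, rule R.dsum_exists[OF zero_rep]) (use R_abelian in \<open>auto simp: abelian_category_def\<close>)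
qed

lemma hull_extension:
  assumes E: "extends_to_hull PolC R F Fm Go Gm"
  shows "equivalence_of_categories (additive_hull PolC) R Go Gm" "exact_functor (additive_hull PolC) R Go Gm"
proof -
  interpret L: linfun PolC R F Fm by (rule hook_linfun_rep)
  have ff: "fully_faithful PolC R F Fm"
    using hook_fully_faithful[OF hook] unfolding fully_faithful_def ind_sel .
  have dec: "\<exists>xs \<iota> \<pi>. xs \<in> lists (Obj (PolC :: ('k, _, _) lcat)) \<and> is_dsum R (map F xs) X \<iota> \<pi>"
    if "X \<in> Obj R" for X :: "(nat, 'k) rep"
    using decomposition[of X] that by (simp add: PolC_Obj[OF hook])
  interpret G: linequiv "additive_hull PolC" R Go Gm by (rule L.hull_extension_linequiv[OF ff E dec])
  show "equivalence_of_categories (additive_hull PolC) R Go Gm" by (rule G.equivalence)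
  show "exact_functor (additive_hull PolC) R Go Gm" by (rule G.exact[OF R_abelian])
qed

end

end

theorem theorem4p6:
  fixes n :: nat and Q :: "nat quiver"
  assumes "dynkin_A (n + 2) Q"
  shows
    "indecomposable_representatives (rep_category Q)
        (ind_objects n :: (nat, 'k::alg_closed_field) rep set) \<and>
     (\<exists>(c :: nat \<times> nat \<Rightarrow> nat \<times> nat \<Rightarrow> 'k) Fm.
        (\<forall>x y. c x y \<in> {1, - 1}) \<and> hook_functor n Q c Fm) \<and>
     (\<forall>(c :: nat \<times> nat \<Rightarrow> nat \<times> nat \<Rightarrow> 'k) Fm. hook_functor n Q c Fm \<longrightarrow>
        equivalence_of_categories (polygon_category n Q) (ind_category n Q) F_obj Fm \<and>
        translation_quiver_iso (polygon_quiver n Q)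
          (AR_quiver (rep_category Q) (ind_objects n :: (nat, 'k) rep set)) F_obj \<and>
        bij_betw F_obj (segments n) (ind_objects n :: (nat, 'k) rep set) \<and>
        bij_betw
          (\<lambda>(x, y). (F_obj x, F_obj y, scalar_class (rep_category Q) (F_obj x) (F_obj y)
                       (Fm x y (mesh_arrow (polygon_quiver n Q) x y))))
          (pivots n Q) (irreducible_classes (rep_category Q) (ind_objects n)) \<and>
        (\<forall>x\<in>segments n. map_option F_obj (R_segment n Q x) =
           AR_translate (rep_category Q) (ind_objects n :: (nat, 'k) rep set) (F_obj x)) \<and>
        (\<exists>Go Gm. extends_to_hull (polygon_category n Q) (rep_category Q) F_obj Fm Go Gm) \<and>
        (\<forall>Go Gm. extends_to_hull (polygon_category n Q) (rep_category Q) F_obj Fm Go Gm \<longrightarrow>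
           equivalence_of_categories (additive_hull (polygon_category n Q)) (rep_category Q) Go Gm \<and>
           exact_functor (additive_hull (polygon_category n Q)) (rep_category Q) Go Gm))"
proof -
  interpret dynkin n Q by unfold_locales (rule assms)
  show ?thesis
    using representatives hook_functor_exists hook_equivalence AR_quiver_iso F_bij irreducible_classes_bij
      translate_eq hull_extension_exists hull_extension
    by (intro conjI allI impI ballI) blast+
qed

end
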